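(* Let $\mathcal A$ be an arc collection on a marked surface $(S,M)$ that splits the surface and satisfies [NMD]. Let $\nu\in\ker(d)\subset \mathrm{CC}^\bullet(\mathrm{Gtl}_{\mathcal A})$ be a Hochschild cocycle of the gentle $A_\infty$-algebra $(\mathrm{Gtl}_{\mathcal A},\mu)$ with $\nu^0=0$ and $\nu^1=0$. Then the class of $\nu$ in $\mathrm{HH}^\bullet(\mathrm{Gtl}_{\mathcal A})$ is zero.
   Context: **Arc collections and gentle algebras.** A marked surface $(S,M)$ is a compact connected oriented surface $S$ without boundary, with a finite subset $M\subset S$ of marked points; $|M|\ge 3$ if $S$ is a sphere and $|M|\ge1$ otherwise. An arc collection $\mathcal A$ is a finite set of oriented curves $a:[0,1]\to S$ with $a^{-1}(M)=\{0,1\}$ that do not intersect themselves or each other internally. It splits the surface if the complement of the arcs is a disjoint union of discs, called faces; each face is a polygon bounded by arcs. [NMD]: no single arc or pair of arcs bounds a face (all faces are $n$-gons with $n\ge3$). The quiver $Q_{\mathcal A}$ has the arcs as vertices and one arrow ("angle arrow") $\alpha$ for each corner of a face: the internal anticlockwise angle, from arc $t(\alpha)$ to arc $h(\alpha)$, around the marked point $m(\alpha)$. Its $\mathbb Z_2$-degree $|\alpha|$ is $0$ if both arcs have the same direction at the marked point, $1$ otherwise. Paths are written right to left ($\alpha\beta$ is a path if $t(\alpha)=h(\beta)$). $\mathrm{Gtl}_{\mathcal A}=\mathbb CQ_{\mathcal A}/\langle\alpha\beta\mid\alpha,\beta\text{ arrows that are consecutive angles in a face}\rangle$. $\Bbbk\cong\mathbb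 C^{\mathcal A}$ is the span of the vertex idempotents $1_a$. Nonzero paths of positive length are called angles (angle paths). **Gentle $A_\infty$-structure $\mu$.** Tree-gons are sequences of angles up to cyclic permutation: (i) if $\alpha_1,\dots,\alpha_k$ are the consecutive angle arrows of a face with $h(\alpha_i)=t(\alpha_{i+1})$ then $(\alpha_k,\dots,\alpha_1)$ is a tree-gon; (ii) if $(\alpha_k,\dots,\alpha_1)$, $(\beta_l,\dots,\beta_1)$ are tree-gons with $\alpha_1\beta_l\neq0$ and $\beta_1\alpha_k\ne0$ in $\mathrm{Gtl}_{\mathcal A}$, then $(\beta_1\alpha_k,\alpha_{k-1},\dots,\alpha_2,\alpha_1\beta_l,\beta_{l-1},\dots,\beta_2)$ is a tree-gon. Put $\mu^0=\mu^1=0$, $\mu^2(a,b)=(-1)^{|b|}ab$, and for $k\ge3$ $\mu^k=\sum_\psi\mu_\psi$ over tree-gons $\psi=(\alpha_k,\dots,\alpha_1)$ of length $k$ (indices mod $k$), where $\mu_\psi(\beta\alpha_{i+k-1},\alpha_{i+k-2},\dots,\alpha_i)=\beta$ and $\mu_\psi(\alpha_{i+k-1},\dots,\alpha_{i+1},\alpha_i\gamma)=(-1)^{|\gamma|}\gamma$ for all $i$ and all (possibly trivial) paths $\beta,\gamma$ with $\beta\alpha_{i+k-1}\ne0$, resp. $\alpha_i\gamma\neq0$; all other values on sequences of angles or idempotents are zero. **Hochschild complex.** For $A=\mathrm{Gtl}_{\mathcal A}$: $\mathrm{CC}^\bullet(A)=\mathrm{Hom}_{\Bbbk}(\bigoplus_{i\ge0}A[1]^{\otimes_{\Bbbk}i},A[1])$,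 $\mathbb Z_2$-graded. An element $\nu$ of degree $\|\nu\|=j$ is a collection of $n$-ary products $\nu^n$ ($n\ge0$, the $n$-th component) of degree $1+j-n$. With $\|x\|=|x|-1$, the bracket is $[\kappa,\nu](a_r,\dots,a_1)=\sum_{0\le i\le j\le r}(-1)^{(\|a_1\|+\dots+\|a_i\|)\|\nu\|}\kappa(a_r,\dots,a_{j+1},\nu(a_j,\dots,a_{i+1}),a_i,\dots,a_1)-(-1)^{\|\nu\|\|\kappa\|}\sum_{0\le i\le j\le r}(-1)^{(\|a_1\|+\dots+\|a_i\|)\|\kappa\|}\nu(a_r,\dots,a_{j+1},\kappa(a_j,\dots,a_{i+1}),a_i,\dots,a_1)$, the differential is $d=[\mu,-]$, and $\mathrm{HH}^\bullet(A)$ is its cohomology. *)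

theory Defs
  imports "HOL-Complex_Analysis.Complex_Analysis" "HOL-Library.Poly_Mapping"
begin

section \<open>Marked surfaces and arc collections\<close>

text \<open>
  An injective continuous map between plane open sets preserves the orientation iff it sends
  small anticlockwise circles to curves winding once anticlockwise around the image of the centre.
\<close>

definition orientation_preserving_on :: "complex set \<Rightarrow> (complex \<Rightarrow> complex) \<Rightarrow> bool" where
  "orientation_preserving_on U f \<longleftrightarrow>
     (\<forall>z r. 0 < r \<and> cball z r \<subseteq> U \<longrightarrow> winding_number (f \<circ> circlepath z r) (f z) = 1)"

definition oriented_atlas ::
    "'s::t2_space set \<Rightarrow> ('s set \<times> ('s \<Rightarrow> complex)) set \<Rightarrow> bool" where
  "oriented_atlas S At \<longleftrightarrow>
     (\<forall>(U, \<phi>) \<in> At. openin (top_of_set S) U \<and> open (\<phi> ` U) \<and>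
        (\<exists>g. homeomorphism U (\<phi> ` U) \<phi> g)) \<and>
     S \<subseteq> (\<Union>(U, \<phi>) \<in> At. U) \<and>
     (\<forall>(U, \<phi>) \<in> At. \<forall>(V, \<psi>) \<in> At.
        orientation_preserving_on (\<phi> ` (U \<inter> V)) (\<psi> \<circ> inv_into U \<phi>))"

definition marked_surface ::
    "'s::t2_space set \<Rightarrow> ('s set \<times> ('s \<Rightarrow> complex)) set \<Rightarrow> 's set \<Rightarrow> bool" where
  "marked_surface S At M \<longleftrightarrow>
     compact S \<and> connected S \<and> S \<noteq> {} \<and> oriented_atlas S At \<and>
     finite M \<and> M \<subseteq> S \<and> 1 \<le> card M \<and>
     (S homeomorphic sphere (0 :: real ^ 3) 1 \<longrightarrow> 3 \<le> card M)"

text \<open>Simple paths may be closed, so arcs are allowed to be loops based at a marked point.\<close>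

definition arc_collection :: "'s::t2_space set \<Rightarrow> 's set \<Rightarrow> (real \<Rightarrow> 's) set \<Rightarrow> bool" where
  "arc_collection S M A \<longleftrightarrow>
     finite A \<and>
     (\<forall>a\<in>A. simple_path a \<and> path_image a \<subseteq> S \<and> {t \<in> {0..1}. a t \<in> M} = {0, 1}) \<and>
     (\<forall>a\<in>A. \<forall>b\<in>A. a \<noteq> b \<longrightarrow> a ` {0<..<1} \<inter> b ` {0<..<1} = {})"

definition faces :: "'s::t2_space set \<Rightarrow> (real \<Rightarrow> 's) set \<Rightarrow> 's set set" where
  "faces S A = components (S - (\<Union>a\<in>A. path_image a))"

text \<open>
  A face is presented as a polygon by a map from the closed unit disc, whose boundary circle is
  subdivided by the \<open>n\<close>-th roots of unity into \<open>n\<close> edges, numbered anticlockwise: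
  edge \<open>i\<close> runs from the \<open>i\<close>-th to the \<open>(i+1)\<close>-th root of unity.  The map is an orientation
  preserving homeomorphism from the open disc to the face and runs along an arc on every edge.
  In \<open>poly_side P i = (a, d)\<close> the flag \<open>d\<close> tells whether edge \<open>i\<close>, traversed anticlockwise, follows
  the direction of \<open>a\<close>.  Different edges may lie on the same arc and different corners may be
  the same marked point.
\<close>

record 's polygon =
  poly_sides :: nat
  poly_map :: "complex \<Rightarrow> 's"
  poly_side :: "nat \<Rightarrow> (real \<Rightarrow> 's) \<times> bool"

definition polygon_face ::
    "('s::t2_space set \<times> ('s \<Rightarrow> complex)) set \<Rightarrow> (real \<Rightarrow> 's) set \<Rightarrow> 's set \<Rightarrow> 's polygon \<Rightarrow> bool" where
  "polygon_face At A F P \<longleftrightarrow>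
     1 \<le> poly_sides P \<and>
     continuous_on (cball 0 1) (poly_map P) \<and>
     (\<exists>g. homeomorphism (ball 0 1) F (poly_map P) g) \<and>
     (\<forall>(U, \<psi>) \<in> At. orientation_preserving_on (ball 0 1 \<inter> poly_map P -` U) (\<psi> \<circ> poly_map P)) \<and>
     (\<forall>i < poly_sides P. case poly_side P i of (a, d) \<Rightarrow> a \<in> A \<and>
        (\<forall>t\<in>{0..1}. poly_map P (cis (2 * pi * (real i + t) / real (poly_sides P))) =
                     (if d then a t else reversepath a t)))"

text \<open>The family \<open>P\<close> picks a polygon for every face.\<close>

definition splits_surface ::
    "'s::t2_space set \<Rightarrow> ('s set \<times> ('s \<Rightarrow> complex)) set \<Rightarrow> (real \<Rightarrow> 's) set \<Rightarrow>
     ('s set \<Rightarrow> 's polygon) \<Rightarrow> bool" where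
  "splits_surface S At A P \<longleftrightarrow> (\<forall>F \<in> faces S A. polygon_face At A F (P F))"

definition NMD :: "'s::t2_space set \<Rightarrow> (real \<Rightarrow> 's) set \<Rightarrow> ('s set \<Rightarrow> 's polygon) \<Rightarrow> bool" where
  "NMD S A P \<longleftrightarrow> (\<forall>F \<in> faces S A. 3 \<le> poly_sides (P F))"


section \<open>Gentle algebras\<close>

text \<open>
  \<open>q_face_words\<close> contains, for every face, the list \<open>[\<alpha>\<^sub>k, \<dots>, \<alpha>\<^sub>1]\<close> of its consecutive
  angle arrows, with \<open>h(\<alpha>\<^sub>i) = t(\<alpha>\<^sub>i\<^sub>+\<^sub>1)\<close> for indices modulo \<open>k\<close>.  All lists of arrows or paths
  are written from right to left, as in the notation \<open>\<alpha>\<beta>\<close> for \<open>\<beta>\<close> followed by \<open>\<alpha>\<close>.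
\<close>

record ('v, 'e) angle_quiver =
  q_verts :: "'v set"
  q_arrows :: "'e set"
  q_tail :: "'e \<Rightarrow> 'v"
  q_head :: "'e \<Rightarrow> 'v"
  q_deg :: "'e \<Rightarrow> int"
  q_face_words :: "'e list set"

text \<open>
  The arrow \<open>(F, i)\<close> is the angle of the face \<open>F\<close> at the \<open>i\<close>-th root of unity.  Inside the disc,
  turning anticlockwise around this corner leads from edge \<open>i\<close> to edge \<open>i - 1\<close>.
  At this corner edge \<open>i\<close> starts and edge \<open>i - 1\<close> ends, so that the two arcs have the same direction
  there (both outgoing or both incoming) iff exactly one of the two edges follows its arc.
\<close>

definition prev_side :: "'s polygon \<Rightarrow> nat \<Rightarrow> (real \<Rightarrow> 's) \<times> bool" where
  "prev_side P i = poly_side P ((i + poly_sides P - 1) mod poly_sides P)"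

definition surface_quiver ::
    "'s::t2_space set \<Rightarrow> (real \<Rightarrow> 's) set \<Rightarrow> ('s set \<Rightarrow> 's polygon) \<Rightarrow>
     (real \<Rightarrow> 's, 's set \<times> nat) angle_quiver" where
  "surface_quiver S A P =
    \<lparr> q_verts = A,
      q_arrows = {(F, i). F \<in> faces S A \<and> i < poly_sides (P F)},
      q_tail = (\<lambda>(F, i). fst (poly_side (P F) i)),
      q_head = (\<lambda>(F, i). fst (prev_side (P F) i)),
      q_deg = (\<lambda>(F, i). if snd (poly_side (P F) i) \<noteq> snd (prev_side (P F) i) then 0 else 1),
      q_face_words = {map (Pair F) [0..<poly_sides (P F)] | F. F \<in> faces S A} \<rparr>"

text \<open>\<open>\<alpha>\<close> comes directly after \<open>\<beta>\<close> in a face, i.e. \<open>\<alpha>\<beta>\<close> is one of the relations.\<close>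

definition consecutive :: "('v, 'e) angle_quiver \<Rightarrow> 'e \<Rightarrow> 'e \<Rightarrow> bool" where
  "consecutive Q \<alpha> \<beta> \<longleftrightarrow>
     (\<exists>w \<in> q_face_words Q. \<exists>i < length w. \<alpha> = w ! i \<and> \<beta> = w ! (Suc i mod length w))"

text \<open>
  A path is a pair of its source and its list of arrows; \<open>(a, [])\<close> is the idempotent of \<open>a\<close>.
  The nonzero paths are those which do not contain a relation.
\<close>

type_synonym ('v, 'e) qpath = "'v \<times> 'e list"

definition q_paths :: "('v, 'e) angle_quiver \<Rightarrow> ('v, 'e) qpath set" where
  "q_paths Q = {(v, as). v \<in> q_verts Q \<and> set as \<subseteq> q_arrows Q \<and>
     (as \<noteq> [] \<longrightarrow> q_tail Q (last as) = v) \<and>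
     successively (\<lambda>\<alpha> \<beta>. q_tail Q \<alpha> = q_head Q \<beta>) as}"

definition nz_paths :: "('v, 'e) angle_quiver \<Rightarrow> ('v, 'e) qpath set" where
  "nz_paths Q = {p \<in> q_paths Q. successively (\<lambda>\<alpha> \<beta>. \<not> consecutive Q \<alpha> \<beta>) (snd p)}"

definition path_head :: "('v, 'e) angle_quiver \<Rightarrow> ('v, 'e) qpath \<Rightarrow> 'v" where
  "path_head Q p = (if snd p = [] then fst p else q_head Q (hd (snd p)))"

definition path_deg :: "('v, 'e) angle_quiver \<Rightarrow> ('v, 'e) qpath \<Rightarrow> int" where
  "path_deg Q p = (\<Sum>\<alpha>\<leftarrow>snd p. q_deg Q \<alpha>)"

definition path_comp :: "('v, 'e) qpath \<Rightarrow> ('v, 'e) qpath \<Rightarrow> ('v, 'e) qpath" where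
  "path_comp p q = (fst q, snd p @ snd q)"

definition comp_nz :: "('v, 'e) angle_quiver \<Rightarrow> ('v, 'e) qpath \<Rightarrow> ('v, 'e) qpath \<Rightarrow> bool" where
  "comp_nz Q p q \<longleftrightarrow> p \<in> nz_paths Q \<and> q \<in> nz_paths Q \<and> fst p = path_head Q q \<and>
     path_comp p q \<in> nz_paths Q"

type_synonym ('v, 'e) qvec = "('v, 'e) qpath \<Rightarrow>\<^sub>0 complex"

definition smul :: "complex \<Rightarrow> ('p \<Rightarrow>\<^sub>0 complex) \<Rightarrow> ('p \<Rightarrow>\<^sub>0 complex)" where
  "smul c x = Poly_Mapping.map (\<lambda>y. c * y) x"

definition bvec :: "'p \<Rightarrow> ('p \<Rightarrow>\<^sub>0 complex)" where
  "bvec p = Poly_Mapping.single p 1"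

text \<open>
  The ideal of relations is generated by paths, so every element of the quotient of the path
  algebra by it has a unique representative supported on nonzero paths.  The gentle algebra is
  the space of these representatives, with the induced product \<open>gmul\<close>; the lemmas on \<open>Gtl_proj\<close>
  below identify it with the quotient.
\<close>

definition Gtl :: "('v, 'e) angle_quiver \<Rightarrow> ('v, 'e) qvec set" where
  "Gtl Q = {x. Poly_Mapping.keys x \<subseteq> nz_paths Q}"

text \<open>The span of the vertex idempotents.\<close>

definition Gtl0 :: "('v, 'e) angle_quiver \<Rightarrow> ('v, 'e) qvec set" where
  "Gtl0 Q = {x. Poly_Mapping.keys x \<subseteq> {(v, []) | v. v \<in> q_verts Q}}"

definition path_mul :: "('v, 'e) angle_quiver \<Rightarrow> ('v, 'e) qpath \<Rightarrow> ('v, 'e) qpath \<Rightarrow> ('v, 'e) qvec" where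
  "path_mul Q p q = (if comp_nz Q p q then bvec (path_comp p q) else 0)"

definition gmul :: "('v, 'e) angle_quiver \<Rightarrow> ('v, 'e) qvec \<Rightarrow> ('v, 'e) qvec \<Rightarrow> ('v, 'e) qvec" where
  "gmul Q x y = (\<Sum>p \<in> Poly_Mapping.keys x. \<Sum>q \<in> Poly_Mapping.keys y.
     smul (Poly_Mapping.lookup x p * Poly_Mapping.lookup y q) (path_mul Q p q))"


subsection \<open>The gentle algebra as a quotient of the path algebra\<close>

definition path_algebra :: "('v, 'e) angle_quiver \<Rightarrow> ('v, 'e) qvec set" where
  "path_algebra Q = {x. Poly_Mapping.keys x \<subseteq> q_paths Q}"

definition pa_mul :: "('v, 'e) angle_quiver \<Rightarrow> ('v, 'e) qvec \<Rightarrow> ('v, 'e) qvec \<Rightarrow> ('v, 'e) qvec" where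
  "pa_mul Q x y = (\<Sum>p \<in> Poly_Mapping.keys x. \<Sum>q \<in> Poly_Mapping.keys y.
     smul (Poly_Mapping.lookup x p * Poly_Mapping.lookup y q)
       (if fst p = path_head Q q then bvec (path_comp p q) else 0))"

inductive_set rel_ideal :: "('v, 'e) angle_quiver \<Rightarrow> ('v, 'e) qvec set" for Q where
  zero: "0 \<in> rel_ideal Q"
| rel: "\<lbrakk>(v, [\<alpha>, \<beta>]) \<in> q_paths Q; consecutive Q \<alpha> \<beta>\<rbrakk> \<Longrightarrow> bvec (v, [\<alpha>, \<beta>]) \<in> rel_ideal Q"
| add: "\<lbrakk>x \<in> rel_ideal Q; y \<in> rel_ideal Q\<rbrakk> \<Longrightarrow> x + y \<in> rel_ideal Q"
| scale: "x \<in> rel_ideal Q \<Longrightarrow> smul c x \<in> rel_ideal Q"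
| left: "\<lbrakk>x \<in> rel_ideal Q; z \<in> path_algebra Q\<rbrakk> \<Longrightarrow> pa_mul Q z x \<in> rel_ideal Q"
| right: "\<lbrakk>x \<in> rel_ideal Q; z \<in> path_algebra Q\<rbrakk> \<Longrightarrow> pa_mul Q x z \<in> rel_ideal Q"

definition Gtl_proj :: "('v, 'e) angle_quiver \<Rightarrow> ('v, 'e) qvec \<Rightarrow> ('v, 'e) qvec" where
  "Gtl_proj Q x = (\<Sum>p \<in> Poly_Mapping.keys x \<inter> nz_paths Q.
     Poly_Mapping.single p (Poly_Mapping.lookup x p))"

lemma lookup_smul [simp]: "Poly_Mapping.lookup (smul c x) p = c * Poly_Mapping.lookup x p"
  by (simp add: smul_def Poly_Mapping.map.rep_eq when_def)

lemma smul_zero [simp]: "smul c 0 = 0"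
  by (rule poly_mapping_eqI) simp

lemma lookup_Gtl_proj [simp]:
  "Poly_Mapping.lookup (Gtl_proj Q x) p = (if p \<in> nz_paths Q then Poly_Mapping.lookup x p else 0)"
proof -
  have "Poly_Mapping.lookup (Gtl_proj Q x) p =
      (\<Sum>q \<in> Poly_Mapping.keys x \<inter> nz_paths Q. if q = p then Poly_Mapping.lookup x q else 0)"
    unfolding Gtl_proj_def by (simp add: lookup_sum lookup_single when_def)
  also have "\<dots> = (if p \<in> nz_paths Q then Poly_Mapping.lookup x p else 0)"
    by (auto simp: sum.delta in_keys_iff)
  finally show ?thesis .
qed

lemma Gtl_proj_add: "Gtl_proj Q (x + y) = Gtl_proj Q x + Gtl_proj Q y"
  by (rule poly_mapping_eqI) (simp add: lookup_add)

lemma Gtl_proj_smul: "Gtl_proj Q (smul c x) = smul c (Gtl_proj Q x)"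
  by (rule poly_mapping_eqI) simp

lemma Gtl_proj_zero [simp]: "Gtl_proj Q 0 = 0"
  by (rule poly_mapping_eqI) simp

lemma Gtl_proj_sum: "Gtl_proj Q (\<Sum>i\<in>I. f i) = (\<Sum>i\<in>I. Gtl_proj Q (f i))"
  by (induction I rule: infinite_finite_induct) (simp_all add: Gtl_proj_add)

lemma keys_Gtl_proj: "Poly_Mapping.keys (Gtl_proj Q x) = Poly_Mapping.keys x \<inter> nz_paths Q"
  by (auto simp: in_keys_iff split: if_splits)

lemma Gtl_proj_in_Gtl: "Gtl_proj Q x \<in> Gtl Q"
  by (simp add: Gtl_def keys_Gtl_proj)

lemma Gtl_proj_id: "x \<in> Gtl Q \<Longrightarrow> Gtl_proj Q x = x"
  by (rule poly_mapping_eqI) (auto simp: Gtl_def in_keys_iff)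

lemma Gtl_subset_path_algebra: "Gtl Q \<subseteq> path_algebra Q"
  by (auto simp: Gtl_def path_algebra_def nz_paths_def)

lemma path_comp_nz_imp:
  assumes "p \<in> q_paths Q" "q \<in> q_paths Q" "path_comp p q \<in> nz_paths Q"
  shows "p \<in> nz_paths Q \<and> q \<in> nz_paths Q"
  using assms by (auto simp: nz_paths_def path_comp_def successively_append_iff)

lemma path_comp_in_q_paths:
  assumes "p \<in> q_paths Q" "q \<in> q_paths Q" "fst p = path_head Q q"
  shows "path_comp p q \<in> q_paths Q"
  using assms by (auto simp: q_paths_def path_comp_def path_head_def successively_append_iff
      split: if_splits)

lemma Gtl_proj_bvec: "Gtl_proj Q (bvec p) = (if p \<in> nz_paths Q then bvec p else 0)"
  by (rule poly_mapping_eqI) (auto simp: bvec_def lookup_single when_def)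

lemma Gtl_proj_mul:
  assumes "x \<in> path_algebra Q" "y \<in> path_algebra Q"
  shows "Gtl_proj Q (pa_mul Q x y) = gmul Q (Gtl_proj Q x) (Gtl_proj Q y)"
proof -
  let ?X = "Poly_Mapping.keys x" and ?Y = "Poly_Mapping.keys y" and ?N = "nz_paths Q"
  let ?c = "\<lambda>p q. Poly_Mapping.lookup x p * Poly_Mapping.lookup y q"
  have X: "?X \<subseteq> q_paths Q" and Y: "?Y \<subseteq> q_paths Q"
    using assms by (auto simp: path_algebra_def)
  have *: "Gtl_proj Q (if fst p = path_head Q q then bvec (path_comp p q) else 0) = path_mul Q p q"
    if "p \<in> ?X" "q \<in> ?Y" for p q
    using path_comp_nz_imp[of p Q q] that X Y
    by (auto simp: path_mul_def comp_nz_def Gtl_proj_bvec)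
  have "Gtl_proj Q (pa_mul Q x y) = (\<Sum>p\<in>?X. \<Sum>q\<in>?Y. smul (?c p q) (path_mul Q p q))"
    unfolding pa_mul_def by (simp add: Gtl_proj_sum Gtl_proj_smul * cong: sum.cong)
  also have "\<dots> = (\<Sum>p\<in>?X. \<Sum>q\<in>?Y \<inter> ?N. smul (?c p q) (path_mul Q p q))"
    by (intro sum.cong refl sum.mono_neutral_right) (auto simp: path_mul_def comp_nz_def)
  also have "\<dots> = (\<Sum>p\<in>?X \<inter> ?N. \<Sum>q\<in>?Y \<inter> ?N. smul (?c p q) (path_mul Q p q))"
    by (intro sum.mono_neutral_right) (auto simp: path_mul_def comp_nz_def intro!: sum.neutral)
  also have "\<dots> = gmul Q (Gtl_proj Q x) (Gtl_proj Q y)"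
    unfolding gmul_def keys_Gtl_proj by (intro sum.cong refl) auto
  finally show ?thesis .
qed

lemma keys_smul_subset: "Poly_Mapping.keys (smul c x) \<subseteq> Poly_Mapping.keys x"
  by (auto simp: in_keys_iff)

lemma path_algebra_smul: "x \<in> path_algebra Q \<Longrightarrow> smul c x \<in> path_algebra Q"
  using keys_smul_subset[of c x] by (auto simp: path_algebra_def)

lemma path_algebra_add: "x \<in> path_algebra Q \<Longrightarrow> y \<in> path_algebra Q \<Longrightarrow> x + y \<in> path_algebra Q"
  using keys_add[of x y] by (auto simp: path_algebra_def)

lemma path_algebra_sum:
  "(\<And>i. i \<in> I \<Longrightarrow> f i \<in> path_algebra Q) \<Longrightarrow> (\<Sum>i\<in>I. f i) \<in> path_algebra Q"
proof (induction I rule: infinite_finite_induct)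
  case (insert i I)
  then show ?case by (simp add: path_algebra_add)
qed (simp_all add: path_algebra_def)

lemma path_algebra_bvec: "bvec p \<in> path_algebra Q \<longleftrightarrow> p \<in> q_paths Q"
  by (simp add: path_algebra_def bvec_def)

lemma path_algebra_mul:
  assumes "x \<in> path_algebra Q" "y \<in> path_algebra Q"
  shows "pa_mul Q x y \<in> path_algebra Q"
  unfolding pa_mul_def
proof (intro path_algebra_sum path_algebra_smul)
  fix p q assume "p \<in> Poly_Mapping.keys x" "q \<in> Poly_Mapping.keys y"
  then have "p \<in> q_paths Q" "q \<in> q_paths Q"
    using assms by (auto simp: path_algebra_def)
  then show "(if fst p = path_head Q q then bvec (path_comp p q) else 0) \<in> path_algebra Q"
    using path_comp_in_q_paths[of p Q q] by (auto simp: path_algebra_bvec) (simp add: path_algebra_def)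
qed

lemma pa_mul_bvec:
  "pa_mul Q (bvec p) (bvec q) = (if fst p = path_head Q q then bvec (path_comp p q) else 0)"
  by (rule poly_mapping_eqI) (simp add: pa_mul_def bvec_def)

lemma zero_path_in_rel_ideal:
  assumes wf: "q_head Q ` q_arrows Q \<subseteq> q_verts Q" "q_tail Q ` q_arrows Q \<subseteq> q_verts Q"
    and p: "p \<in> q_paths Q" "p \<notin> nz_paths Q"
  shows "bvec p \<in> rel_ideal Q"
proof -
  obtain v as where p_eq: "p = (v, as)" by (cases p)
  have "\<not> successively (\<lambda>\<alpha> \<beta>. \<not> consecutive Q \<alpha> \<beta>) as"
    using p by (auto simp: nz_paths_def p_eq)
  then obtain i where i: "Suc i < length as" "consecutive Q (as ! i) (as ! Suc i)"
    by (auto simp: successively_conv_nth)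
  define us \<alpha> \<beta> vs where "us = take i as" and "\<alpha> = as ! i" and "\<beta> = as ! Suc i"
    and "vs = drop (Suc (Suc i)) as"
  have as: "as = us @ [\<alpha>, \<beta>] @ vs"
    using i unfolding us_def \<alpha>_def \<beta>_def vs_def
    by (metis Cons_nth_drop_Suc Suc_lessD append_Cons append_Nil append_take_drop_id)
  define r q l where "r = (q_tail Q \<beta>, [\<alpha>, \<beta>])" and "q = (v, vs)" and "l = (q_head Q \<alpha>, us)"
  have paths: "r \<in> q_paths Q" "q \<in> q_paths Q" "l \<in> q_paths Q"
    using p(1) wf unfolding r_def q_def l_def p_eq as
    by (auto simp: q_paths_def successively_append_iff successively_Cons split: if_splits)
  have heads: "fst r = path_head Q q" "fst l = path_head Q (path_comp r q)"
    using p(1) unfolding r_def q_def l_def p_eq as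
    by (auto simp: q_paths_def path_head_def path_comp_def successively_append_iff successively_Cons
        split: if_splits)
  have "bvec r \<in> rel_ideal Q"
    using paths(1) i(2) unfolding r_def \<alpha>_def \<beta>_def by (intro rel_ideal.rel) auto
  then have "pa_mul Q (bvec r) (bvec q) \<in> rel_ideal Q"
    using paths by (intro rel_ideal.right) (simp_all add: path_algebra_bvec)
  then have "bvec (path_comp r q) \<in> rel_ideal Q"
    using heads by (simp add: pa_mul_bvec)
  then have "pa_mul Q (bvec l) (bvec (path_comp r q)) \<in> rel_ideal Q"
    using paths by (intro rel_ideal.left) (simp_all add: path_algebra_bvec)
  then have "bvec (path_comp l (path_comp r q)) \<in> rel_ideal Q"
    using heads by (simp add: pa_mul_bvec)
  then show ?thesis
    by (simp add: path_comp_def p_eq as r_def q_def l_def)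
qed

lemma Gtl_proj_kernel:
  assumes wf: "q_head Q ` q_arrows Q \<subseteq> q_verts Q" "q_tail Q ` q_arrows Q \<subseteq> q_verts Q"
  shows "rel_ideal Q = {x \<in> path_algebra Q. Gtl_proj Q x = 0}"
proof (intro equalityI subsetI)
  fix x assume "x \<in> rel_ideal Q"
  then have "x \<in> path_algebra Q \<and> Gtl_proj Q x = 0"
  proof induction
    case zero
    then show ?case by (simp add: path_algebra_def)
  next
    case (rel v \<alpha> \<beta>)
    then show ?case by (auto simp: path_algebra_bvec Gtl_proj_bvec nz_paths_def)
  next
    case (add x y)
    then show ?case by (simp add: path_algebra_add Gtl_proj_add)
  next
    case (scale x c)
    then show ?case by (simp add: path_algebra_smul Gtl_proj_smul)
  next
    case (left x z)
    then show ?case by (simp add: path_algebra_mul Gtl_proj_mul) (simp add: gmul_def)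
  next
    case (right x z)
    then show ?case by (simp add: path_algebra_mul Gtl_proj_mul) (simp add: gmul_def)
  qed
  then show "x \<in> {x \<in> path_algebra Q. Gtl_proj Q x = 0}" by simp
next
  fix x assume "x \<in> {x \<in> path_algebra Q. Gtl_proj Q x = 0}"
  then have keys: "Poly_Mapping.keys x \<subseteq> q_paths Q" and "Gtl_proj Q x = 0"
    by (auto simp: path_algebra_def)
  then have nz: "Poly_Mapping.keys x \<inter> nz_paths Q = {}"
    using keys_Gtl_proj[of Q x] by simp
  have *: "(\<Sum>p\<in>K. smul (Poly_Mapping.lookup x p) (bvec p)) \<in> rel_ideal Q"
    if "finite K" "K \<subseteq> Poly_Mapping.keys x" for K
    using that
  proof (induction K)
    case empty
    then show ?case by (simp add: rel_ideal.zero)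
  next
    case (insert p K)
    then have "bvec p \<in> rel_ideal Q"
      using keys nz by (intro zero_path_in_rel_ideal[OF wf]) auto
    with insert show ?case by (simp add: rel_ideal.add rel_ideal.scale)
  qed
  have "(\<Sum>p\<in>Poly_Mapping.keys x. smul (Poly_Mapping.lookup x p) (bvec p)) = x"
    by (rule poly_mapping_eqI)
      (simp add: lookup_sum bvec_def lookup_single when_def if_distrib sum.delta in_keys_iff
        cong: if_cong)
  then show "x \<in> rel_ideal Q"
    using *[OF finite_keys order_refl] by simp
qed


section \<open>Tree-gons and the gentle A-infinity structure\<close>

definition sg :: "int \<Rightarrow> complex" where
  "sg m = (if even m then 1 else - 1)"

definition arrow_path :: "('v, 'e) angle_quiver \<Rightarrow> 'e \<Rightarrow> ('v, 'e) qpath" where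
  "arrow_path Q \<alpha> = (q_tail Q \<alpha>, [\<alpha>])"

inductive treegon_word :: "('v, 'e) angle_quiver \<Rightarrow> ('v, 'e) qpath list \<Rightarrow> bool" for Q where
  face: "w \<in> q_face_words Q \<Longrightarrow> treegon_word Q (map (arrow_path Q) w)"
| cyclic: "treegon_word Q (x # xs) \<Longrightarrow> treegon_word Q (xs @ [x])"
| glue: "\<lbrakk>treegon_word Q (ak # as @ [a1]); treegon_word Q (bl # bs @ [b1]);
    comp_nz Q a1 bl; comp_nz Q b1 ak\<rbrakk>
   \<Longrightarrow> treegon_word Q (path_comp b1 ak # as @ path_comp a1 bl # bs)"

text \<open>A tree-gon is the set of all rotations of such a word.\<close>

definition treegons :: "('v, 'e) angle_quiver \<Rightarrow> ('v, 'e) qpath list set set" where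
  "treegons Q = {{rotate i w | i. True} | w. treegon_word Q w}"

inductive mu_value ::
    "('v, 'e) angle_quiver \<Rightarrow> ('v, 'e) qpath list set \<Rightarrow> ('v, 'e) qpath list \<Rightarrow> ('v, 'e) qvec \<Rightarrow> bool"
    for Q \<psi> where
  left: "\<lbrakk>\<alpha> # as \<in> \<psi>; comp_nz Q \<beta> \<alpha>\<rbrakk> \<Longrightarrow> mu_value Q \<psi> (path_comp \<beta> \<alpha> # as) (bvec \<beta>)"
| right: "\<lbrakk>as @ [\<alpha>] \<in> \<psi>; comp_nz Q \<alpha> \<gamma>\<rbrakk>
    \<Longrightarrow> mu_value Q \<psi> (as @ [path_comp \<alpha> \<gamma>]) (smul (sg (path_deg Q \<gamma>)) (bvec \<gamma>))"

text \<open>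
  At most one value is prescribed (in particular both rules give the same one for
  trivial \<open>\<beta>\<close> and \<open>\<gamma>\<close>); the sum makes it zero if there is none.
\<close>

definition mu_treegon ::
    "('v, 'e) angle_quiver \<Rightarrow> ('v, 'e) qpath list set \<Rightarrow> ('v, 'e) qpath list \<Rightarrow> ('v, 'e) qvec" where
  "mu_treegon Q \<psi> ps = (\<Sum>y \<in> {y. mu_value Q \<psi> ps y}. y)"

text \<open>
  Only finitely many tree-gons contribute to the value at a given sequence, and these have
  the length of the sequence.
\<close>

definition mu_basis :: "('v, 'e) angle_quiver \<Rightarrow> ('v, 'e) qpath list \<Rightarrow> ('v, 'e) qvec" where
  "mu_basis Q ps =
     (if length ps < 2 then 0
      else if length ps = 2 then smul (sg (path_deg Q (ps ! 1))) (path_mul Q (ps ! 0) (ps ! 1))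
      else (\<Sum>\<psi> \<in> {\<psi> \<in> treegons Q. mu_treegon Q \<psi> ps \<noteq> 0}. mu_treegon Q \<psi> ps))"


section \<open>The Hochschild complex\<close>

text \<open>
  A cochain is the family of its \<open>n\<close>-ary products, as one function on argument lists
  \<open>[a\<^sub>n, \<dots>, a\<^sub>1]\<close>, extended by zero outside the algebra.  Maps of \<open>\<k>\<close>-bimodules out of tensor
  powers over \<open>\<k>\<close> are multilinear maps that are balanced over \<open>\<k>\<close> between neighbouring arguments
  and compatible with the outer actions; for \<open>n = 0\<close> they are elements commuting with \<open>\<k>\<close>.
\<close>

type_synonym ('v, 'e) cochain = "('v, 'e) qvec list \<Rightarrow> ('v, 'e) qvec"

definition CC :: "('v, 'e) angle_quiver \<Rightarrow> ('v, 'e) cochain set" where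
  "CC Q = {\<nu>.
     (\<forall>xs. \<not> set xs \<subseteq> Gtl Q \<longrightarrow> \<nu> xs = 0) \<and>
     (\<forall>xs. set xs \<subseteq> Gtl Q \<longrightarrow> \<nu> xs \<in> Gtl Q) \<and>
     (\<forall>us vs x y. set us \<subseteq> Gtl Q \<and> set vs \<subseteq> Gtl Q \<and> x \<in> Gtl Q \<and> y \<in> Gtl Q \<longrightarrow>
        \<nu> (us @ (x + y) # vs) = \<nu> (us @ x # vs) + \<nu> (us @ y # vs)) \<and>
     (\<forall>us vs c x. set us \<subseteq> Gtl Q \<and> set vs \<subseteq> Gtl Q \<and> x \<in> Gtl Q \<longrightarrow>
        \<nu> (us @ smul c x # vs) = smul c (\<nu> (us @ x # vs))) \<and>
     (\<forall>us vs x y. \<forall>e \<in> Gtl0 Q. set us \<subseteq> Gtl Q \<and> set vs \<subseteq> Gtl Q \<and> x \<in> Gtl Q \<and> y \<in> Gtl Q \<longrightarrow>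
        \<nu> (us @ gmul Q x e # y # vs) = \<nu> (us @ x # gmul Q e y # vs)) \<and>
     (\<forall>xs x. \<forall>e \<in> Gtl0 Q. set xs \<subseteq> Gtl Q \<and> x \<in> Gtl Q \<longrightarrow>
        \<nu> (gmul Q e x # xs) = gmul Q e (\<nu> (x # xs)) \<and>
        \<nu> (xs @ [gmul Q x e]) = gmul Q (\<nu> (xs @ [x])) e) \<and>
     (\<forall>e \<in> Gtl0 Q. gmul Q e (\<nu> []) = gmul Q (\<nu> []) e)}"

text \<open>The multilinear extension of a map defined on sequences of basis elements.\<close>

definition mlin :: "('p list \<Rightarrow> ('p \<Rightarrow>\<^sub>0 complex)) \<Rightarrow> ('p \<Rightarrow>\<^sub>0 complex) list \<Rightarrow> ('p \<Rightarrow>\<^sub>0 complex)" where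
  "mlin f xs = (\<Sum>ps \<in> listset (map Poly_Mapping.keys xs).
     smul (\<Prod>i<length xs. Poly_Mapping.lookup (xs ! i) (ps ! i)) (f ps))"

definition mu :: "('v, 'e) angle_quiver \<Rightarrow> ('v, 'e) cochain" where
  "mu Q xs = (if set xs \<subseteq> Gtl Q then mlin (mu_basis Q) xs else 0)"

text \<open>
  The component of degree \<open>j\<close> modulo 2 of a cochain: its \<open>n\<close>-ary product shifts the
  degree by \<open>1 + j - n\<close>.  Cochains need not be homogeneous.
\<close>

definition degree_part ::
    "('v, 'e) angle_quiver \<Rightarrow> int \<Rightarrow> ('v, 'e) qvec \<Rightarrow> ('v, 'e) qvec" where
  "degree_part Q m x = (\<Sum>q \<in> {q \<in> Poly_Mapping.keys x. even (path_deg Q q - m)}.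
     Poly_Mapping.single q (Poly_Mapping.lookup x q))"

definition hom_part :: "('v, 'e) angle_quiver \<Rightarrow> int \<Rightarrow> ('v, 'e) cochain \<Rightarrow> ('v, 'e) cochain" where
  "hom_part Q j \<nu> xs = (if set xs \<subseteq> Gtl Q
     then mlin (\<lambda>ps. degree_part Q ((\<Sum>p\<leftarrow>ps. path_deg Q p) + 1 + j - int (length ps))
                       (\<nu> (map bvec ps))) xs
     else 0)"

text \<open>
  For homogeneous \<open>\<nu>\<close> of degree \<open>j\<close>, the sum of the terms
  \<open>\<kappa>(a\<^sub>r, \<dots>, \<nu>(a\<^sub>l, \<dots>, a\<^sub>i\<^sub>+\<^sub>1), a\<^sub>i, \<dots>, a\<^sub>1)\<close> over \<open>0 \<le> i \<le> l \<le> r\<close>, with signs; the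
  list \<open>ps\<close> is \<open>[a\<^sub>r, \<dots>, a\<^sub>1]\<close>.
\<close>

definition insertion ::
    "('v, 'e) angle_quiver \<Rightarrow> ('v, 'e) cochain \<Rightarrow> int \<Rightarrow> ('v, 'e) cochain \<Rightarrow>
     ('v, 'e) qpath list \<Rightarrow> ('v, 'e) qvec" where
  "insertion Q \<kappa> j \<nu> ps = (let r = length ps; as = map bvec ps in
     \<Sum>l\<le>r. \<Sum>i\<le>l.
       smul (sg ((\<Sum>p\<leftarrow>drop (r - i) ps. path_deg Q p - 1) * j))
         (\<kappa> (take (r - l) as @ \<nu> (take (l - i) (drop (r - l) as)) # drop (r - i) as)))"

definition hom_bracket ::
    "('v, 'e) angle_quiver \<Rightarrow> int \<Rightarrow> ('v, 'e) cochain \<Rightarrow> int \<Rightarrow> ('v, 'e) cochain \<Rightarrow>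
     ('v, 'e) qpath list \<Rightarrow> ('v, 'e) qvec" where
  "hom_bracket Q k \<kappa> j \<nu> ps =
     insertion Q \<kappa> j \<nu> ps - smul (sg (j * k)) (insertion Q \<nu> k \<kappa> ps)"

definition bracket ::
    "('v, 'e) angle_quiver \<Rightarrow> ('v, 'e) cochain \<Rightarrow> ('v, 'e) cochain \<Rightarrow> ('v, 'e) cochain" where
  "bracket Q \<kappa> \<nu> xs = (if set xs \<subseteq> Gtl Q
     then (\<Sum>k \<in> {0, 1}. \<Sum>j \<in> {0, 1}.
             mlin (hom_bracket Q k (hom_part Q k \<kappa>) j (hom_part Q j \<nu>)) xs)
     else 0)"

definition hoch_diff :: "('v, 'e) angle_quiver \<Rightarrow> ('v, 'e) cochain \<Rightarrow> ('v, 'e) cochain" where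
  "hoch_diff Q = bracket Q (mu Q)"

definition HH_class :: "('v, 'e) angle_quiver \<Rightarrow> ('v, 'e) cochain \<Rightarrow> ('v, 'e) cochain set" where
  "HH_class Q \<nu> = {\<lambda>xs. \<nu> xs + hoch_diff Q \<epsilon> xs | \<epsilon>. \<epsilon> \<in> CC Q}"

end

theory Submission
 imports Defs
begin

text \<open>
 Tree-gons only see the arrows of the quiver, the cyclic order of the corners of each face, and the
 fact that an arc lies on at most two sides of the faces (\<open>at_most_two_sides\<close>): near the midpoint of
 an arc every side contributes a half-disc of its polygon, and three such half-discs would contain a
 drawing of the graph \<open>K\<^sub>3\<^sub>,\<^sub>3\<close> in the plane.  Hence every arrow has at most one non-zero successor
 and at most one non-zero predecessor, and everything else is combinatorics of words of paths.

 The relation \<open>[\<mu>, \<mu>] = 0\<close> (\<open>mm_mm\<close>) gives \<open>d d = 0\<close>.  Its terms cancel in pairs, because a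
 tree-gon with a split entry \<open>c @ d\<close> can be cut along the arc between \<open>c\<close> and \<open>d\<close>, in exactly one way
 (\<open>tg_cut\<close>, \<open>cut_sum\<close>): merging two neighbours before applying a tree-gon cancels against applying one
 tree-gon inside another.  What remains at the two ends of a sequence cancels by \<open>four_term\<close>.

 A bimodule cochain is a family of coefficients \<open>\<nu>(w; q)\<close>, indexed by sequences \<open>w\<close> of composable
 non-zero paths and parallel non-zero paths \<open>q\<close>.  The index pairs are matched with each other.  The
 first place of \<open>w\<close> at which a product can be undone or formed (a longer path can be split off its first
 arrow, a single arrow can be merged into its successor, a run of idempotents can be shortened or
 lengthened by one) matches \<open>w\<close> with a sequence whose length differs by one, as for the bar resolution of
 a quadratic monomial algebra.  No such place exists only if \<open>w\<close> walks along a face, one corner after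
 the other.  Then a corner is added to or removed from the front of \<open>w\<close> and \<open>q\<close> alike; this fails
 exactly for closed walks with idempotent value \<open>q\<close>, whose partner comes from the higher products:
 a closed walk is matched with the walk that is shorter by one turn less one corner and takes the value
 of a corner.  Without the higher products these walks would give non-trivial classes.

 The source of a matched pair is the shorter sequence, and the differential is triangular along the
 matching (\<open>dif_match\<close>): if \<open>\<eta>\<close> vanishes on all targets and on all sequences below \<open>w\<close>, then the
 coefficient of \<open>d \<eta>\<close> at the partner of \<open>(w; q)\<close> is a non-zero multiple of \<open>\<eta>(w; q)\<close>.  Every target
 of length at least two has a source (\<open>matched\<close>).  Therefore a cochain \<open>\<epsilon>\<close> with \<open>d \<epsilon> = \<nu>\<close> on all
 targets can be constructed by recursion.  If \<open>\<nu>\<close> is closed and has no components of length zero and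
 one, the difference \<open>\<nu> - d \<epsilon>\<close> is closed and vanishes on all targets, and triangularity shows by
 induction that it vanishes on all sources too (\<open>basis_acyclic\<close>).
\<close>

section \<open>Linear maps, coderivations and their commutators\<close>

abbreviation keys :: "('a \<Rightarrow>\<^sub>0 'b::zero) \<Rightarrow> 'a set" where "keys \<equiv> Poly_Mapping.keys"
abbreviation lookup :: "('a \<Rightarrow>\<^sub>0 'b::zero) \<Rightarrow> 'a \<Rightarrow> 'b" where "lookup \<equiv> Poly_Mapping.lookup"

lemma sg_mult: "sg a * sg b = sg (a + b)"
 by (auto simp: sg_def)

lemma sg_cong: "even (a - b) \<Longrightarrow> sg a = sg b"
 by (auto simp: sg_def)

lemma sg_simps [simp]: "sg 0 = 1" "sg 1 = -1" "sg (- a) = sg a" "sg (2 * a) = 1" "sg (a * 2) = 1" "sg (- 1) = - 1"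
 by (auto simp: sg_def)

lemma sg_neq_0 [simp]: "sg a \<noteq> 0" by (simp add: sg_def)

lemma sg_self: "sg a * sg a = 1" by (simp add: sg_def)

lemma sg_add1: "sg (a + 1) = - sg a" "sg (1 + a) = - sg a" "sg (a - 1) = - sg a" "sg (1 - a) = - sg a"
 by (auto simp: sg_def)

lemma smul_add_right: "smul c (x + y) = smul c x + smul c y"
 by (rule poly_mapping_eqI) (simp add: lookup_add algebra_simps)
lemma smul_diff_right: "smul c (x - y) = smul c x - smul c y"
 by (rule poly_mapping_eqI) (simp add: lookup_minus algebra_simps)
lemma smul_add_left: "smul (a + b) x = smul a x + smul b x"
 by (rule poly_mapping_eqI) (simp add: lookup_add algebra_simps)
lemma smul_smul [simp]: "smul a (smul b x) = smul (a * b) x"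
 by (rule poly_mapping_eqI) (simp add: algebra_simps)
lemma smul_1 [simp]: "smul 1 x = x"
 by (rule poly_mapping_eqI) simp
lemma smul_0_left [simp]: "smul 0 x = 0"
 by (rule poly_mapping_eqI) simp
lemma smul_minus_left: "smul (- c) x = - smul c x"
 by (rule poly_mapping_eqI) simp
lemma smul_sum_right: "smul c (\<Sum>i\<in>I. f i) = (\<Sum>i\<in>I. smul c (f i))"
 by (induction I rule: infinite_finite_induct) (simp_all add: smul_add_right)
lemma smul_eq_0 [simp]: "smul c x = 0 \<longleftrightarrow> c = 0 \<or> x = 0"
proof
 assume "smul c x = 0"
 then have "c * lookup x p = 0" for p by (metis lookup_smul lookup_zero)
 then show "c = 0 \<or> x = 0" by (auto intro: poly_mapping_eqI)
qed auto

lemma lookup_bvec: "lookup (bvec p) q = (if p = q then 1 else 0)"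
 by (simp add: bvec_def lookup_single when_def)
lemma keys_bvec [simp]: "keys (bvec p) = {p}"
 by (simp add: bvec_def)

text \<open>
 The linear extension of a map given on a basis.
\<close>

definition lin :: "('p \<Rightarrow> ('q \<Rightarrow>\<^sub>0 complex)) \<Rightarrow> ('p \<Rightarrow>\<^sub>0 complex) \<Rightarrow> ('q \<Rightarrow>\<^sub>0 complex)" where
 "lin f x = (\<Sum>p\<in>keys x. smul (lookup x p) (f p))"

lemma lin_superset: "finite K \<Longrightarrow> keys x \<subseteq> K \<Longrightarrow> lin f x = (\<Sum>p\<in>K. smul (lookup x p) (f p))"
 unfolding lin_def by (rule sum.mono_neutral_left) (auto simp: in_keys_iff)

lemma lin_0 [simp]: "lin f 0 = 0" by (simp add: lin_def)
lemma lin_bvec [simp]: "lin f (bvec p) = f p" by (simp add: lin_def lookup_bvec)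
lemma lin_add: "lin f (x + y) = lin f x + lin f y"
proof -
 let ?K = "keys x \<union> keys y"
 have "lin f (x + y) = (\<Sum>p\<in>?K. smul (lookup (x + y) p) (f p))"
  by (rule lin_superset) (use keys_add[of x y] in auto)
 also have "\<dots> = lin f x + lin f y"
  by (simp add: lin_superset[of ?K] lookup_add smul_add_left sum.distrib)
 finally show ?thesis .
qed
lemma lin_smul: "lin f (smul c x) = smul c (lin f x)"
proof -
 have "lin f (smul c x) = (\<Sum>p\<in>keys x. smul (lookup (smul c x) p) (f p))"
  by (rule lin_superset) (auto simp: in_keys_iff)
 then show ?thesis by (simp add: lin_def smul_sum_right)
qed
lemma lin_minus: "lin f (- x) = - lin f x"
 using lin_smul[of f "-1" x] by (simp add: smul_minus_left)
lemma lin_diff: "lin f (x - y) = lin f x - lin f y"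
 using lin_add[of f x "- y"] by (simp add: lin_minus)
lemma lin_sum: "lin f (\<Sum>i\<in>I. x i) = (\<Sum>i\<in>I. lin f (x i))"
 by (induction I rule: infinite_finite_induct) (simp_all add: lin_add)
lemma lin_cong: "(\<And>p. p \<in> keys x \<Longrightarrow> f p = g p) \<Longrightarrow> lin f x = lin g x"
 by (simp add: lin_def)
lemma lin_lin: "lin f (lin g x) = lin (\<lambda>p. lin f (g p)) x"
 by (simp add: lin_def[of g] lin_def[of "\<lambda>p. lin f (g p)"] lin_sum lin_smul)
lemma lin_fun_add: "lin (\<lambda>p. f p + g p) x = lin f x + lin g x"
 by (simp add: lin_def smul_add_right sum.distrib)
lemma lin_fun_diff: "lin (\<lambda>p. f p - g p) x = lin f x - lin g x"
 by (simp add: lin_def smul_diff_right sum_subtractf)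
lemma lin_fun_smul: "lin (\<lambda>p. smul c (f p)) x = smul c (lin f x)"
 by (simp add: lin_def smul_sum_right mult.commute)
lemma lin_fun_sum: "lin (\<lambda>p. \<Sum>i\<in>I. f i p) x = (\<Sum>i\<in>I. lin (f i) x)"
 by (simp add: lin_def smul_sum_right) (rule sum.swap)
lemma lin_fun_0 [simp]: "lin (\<lambda>p. 0) x = 0"
 by (simp add: lin_def)
lemma lin_id [simp]: "lin bvec x = x"
proof (rule poly_mapping_eqI)
 fix p
 have "lookup (lin bvec x) p = (\<Sum>q\<in>keys x. if q = p then lookup x q else 0)"
  by (simp add: lin_def lookup_sum lookup_bvec if_distrib cong: if_cong)
 also have "\<dots> = lookup x p" by (simp add: in_keys_iff)
 finally show "lookup (lin bvec x) p = lookup x p" .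
qed
lemma lookup_lin: "lookup (lin f x) q = (\<Sum>p\<in>keys x. lookup x p * lookup (f p) q)"
 by (simp add: lin_def lookup_sum)
lemma keys_lin: "keys (lin f x) \<subseteq> (\<Union>p\<in>keys x. keys (f p))"
proof
 fix q assume "q \<in> keys (lin f x)"
 then have "(\<Sum>p\<in>keys x. lookup x p * lookup (f p) q) \<noteq> 0" by (simp add: in_keys_iff lookup_lin)
 then obtain p where "p \<in> keys x" "lookup (f p) q \<noteq> 0" by (metis (no_types, lifting) mult_eq_0_iff sum.neutral)
 then show "q \<in> (\<Union>p\<in>keys x. keys (f p))" by (auto simp: in_keys_iff)
qed
lemma keys_linD: "q \<in> keys (lin f x) \<Longrightarrow> \<exists>p\<in>keys x. q \<in> keys (f p)"
 using keys_lin[of f x] by blast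
lemma lin_swap: "lin (\<lambda>p. lin (\<lambda>q. h p q) y) x = lin (\<lambda>q. lin (\<lambda>p. h p q) x) y"
 by (simp add: lin_def smul_sum_right mult.commute) (rule sum.swap)

definition fsplits :: "'p list \<Rightarrow> ('p list \<times> 'p list) set" where
 "fsplits ws = {(X, R). ws = X @ R \<and> X \<noteq> []}"

definition splits :: "'p list \<Rightarrow> ('p list \<times> 'p list \<times> 'p list) set" where
 "splits ws = {(L, X, R). ws = L @ X @ R \<and> X \<noteq> []}"

definition asplits :: "'p list \<Rightarrow> ('p list \<times> 'p list) set" where
 "asplits ws = {(X, R). ws = X @ R}"

lemma finite_asplits [simp]: "finite (asplits ws)"
proof (induction ws)
 case (Cons p ws)
 have "asplits (p # ws) = insert ([], p # ws) ((\<lambda>(X, R). (p # X, R)) ` asplits ws)"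
  by (auto simp: asplits_def Cons_eq_append_conv image_iff)
 with Cons show ?case by simp
qed (simp add: asplits_def)

lemma finite_fsplits [simp]: "finite (fsplits ws)"
 by (rule finite_subset[OF _ finite_asplits[of ws]]) (auto simp: fsplits_def asplits_def)

lemma fsplits_Nil [simp]: "fsplits [] = {}" by (auto simp: fsplits_def)

lemma splits_Nil [simp]: "splits [] = {}" by (auto simp: splits_def)

lemma splits_Cons: "splits (p # ws) = Pair [] ` fsplits (p # ws) \<union> (\<lambda>(L, X, R). (p # L, X, R)) ` splits ws"
 by (auto simp: splits_def fsplits_def image_iff Cons_eq_append_conv)

lemma finite_splits [simp]: "finite (splits ws)"
 by (induction ws) (auto simp: splits_Cons)

lemma sum_splits_Cons:
 "(\<Sum>(L, X, R)\<in>splits (p # ws). F L X R) = (\<Sum>(X, R)\<in>fsplits (p # ws). F [] X R) + (\<Sum>(L, X, R)\<in>splits ws. F (p # L) X R)"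
proof -
 let ?c = "\<lambda>(L, X, R). (p # L, X, R)" and ?F = "\<lambda>(L, X, R). F L X R"
 have inj: "inj_on ?c (splits ws)" "inj_on (Pair []) (fsplits (p # ws))"
  by (auto simp: inj_on_def)
 have "sum ?F (splits (p # ws)) = sum ?F (Pair [] ` fsplits (p # ws)) + sum ?F (?c ` splits ws)"
  unfolding splits_Cons by (rule sum.union_disjoint) auto
 also have "\<dots> = sum (?F \<circ> Pair []) (fsplits (p # ws)) + sum (?F \<circ> ?c) (splits ws)"
  by (simp only: sum.reindex[OF inj(1)] sum.reindex[OF inj(2)])
 finally show ?thesis by (simp add: case_prod_unfold o_def)
qed

definition pairs :: "'p list \<Rightarrow> ('p list \<times> 'p \<times> 'p \<times> 'p list) set" where
 "pairs ws = {(A, c, d, B). ws = A @ c # d # B}"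

lemma finite_pairs [simp]: "finite (pairs ws)"
proof -
 have "pairs ws \<subseteq> (\<lambda>(A, B). (A, hd B, hd (tl B), tl (tl B))) ` asplits ws"
  by (force simp: pairs_def asplits_def image_iff)
 then show ?thesis by (rule finite_subset) simp
qed

lemma sum_splits_outer2:
 assumes F: "\<And>L X R. length L + length R \<noteq> 1 \<Longrightarrow> F L X R = 0" and ws: "2 \<le> length ws"
 shows "(\<Sum>(L, X, R)\<in>splits ws. F L X R) = F [hd ws] (tl ws) [] + (F [] (butlast ws) [last ws] :: 'a :: comm_monoid_add)"
proof -
 let ?a = "([hd ws], tl ws, [])" and ?b = "([], butlast ws, [last ws])"
 have "?a \<in> splits ws" "?b \<in> splits ws"
  using ws by (cases ws; auto simp: splits_def)+
 moreover have "t = ?a \<or> t = ?b" if t: "t \<in> splits ws" "length (fst t) + length (snd (snd t)) = 1" for t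
 proof -
  obtain L X R where e: "t = (L, X, R)" "ws = L @ X @ R" "X \<noteq> []" "length L + length R = 1" using t by (cases t) (auto simp: splits_def)
  then consider l where "L = [l]" "R = []" | r where "L = []" "R = [r]"
   by (cases L; cases R; auto)
  then show ?thesis using e by cases auto
 qed
 ultimately have "(\<Sum>(L, X, R)\<in>splits ws. F L X R) = (\<Sum>(L, X, R)\<in>{?a, ?b}. F L X R)"
 proof (intro sum.mono_neutral_right ballI, goal_cases)
  case (3 t)
  then have "length (fst t) + length (snd (snd t)) \<noteq> 1" by blast
  then show ?case using F by (cases t) auto
 qed auto
 then show ?thesis by simp
qed

lemma sum_splits_inner2:
 assumes F: "\<And>L X R. length X \<noteq> 2 \<Longrightarrow> F L X R = (0 :: 'a :: comm_monoid_add)"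
 shows "(\<Sum>(L, X, R)\<in>splits ws. F L X R) = (\<Sum>(A, c, d, B)\<in>pairs ws. F A [c, d] B)"
proof -
 have F': "F L X R \<noteq> 0 \<Longrightarrow> length X = 2" for L X R using F by blast
 have "(\<Sum>(L, X, R)\<in>splits ws. F L X R) = (\<Sum>(L, X, R)\<in>{(L, X, R). (L, X, R) \<in> splits ws \<and> length X = 2}. F L X R)"
  by (rule sum.mono_neutral_right) (auto dest: F')
 also have "\<dots> = (\<Sum>(A, c, d, B)\<in>pairs ws. F A [c, d] B)"
  by (rule sum.reindex_bij_witness[of _ "\<lambda>(A, c, d, B). (A, [c, d], B)" "\<lambda>(L, X, R). (L, hd X, hd (tl X), R)"])
   (auto simp: splits_def pairs_def length_Suc_conv numeral_2_eq_2)
 finally show ?thesis .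
qed

locale graded_basis =
 fixes dg :: "'p \<Rightarrow> int"
begin

definition wdeg :: "'p list \<Rightarrow> int" where "wdeg ws = (\<Sum>p\<leftarrow>ws. dg p)"

lemma wdeg_simps [simp]: "wdeg [] = 0" "wdeg (p # ws) = dg p + wdeg ws" "wdeg (u @ v) = wdeg u + wdeg v"
 by (simp_all add: wdeg_def)

definition homog :: "int \<Rightarrow> ('p list \<Rightarrow> ('p \<Rightarrow>\<^sub>0 complex)) \<Rightarrow> bool" where
 "homog j f \<longleftrightarrow> (\<forall>ws. \<forall>x\<in>keys (f ws). even (dg x - wdeg ws - j))"

text \<open>
 The coderivation of the tensor coalgebra that extends \<open>f\<close>, of parity \<open>j\<close>; the sign moves \<open>f\<close> past the
 entries on its right.  Insertions of an empty sequence are left out, so \<open>f []\<close> plays the role of zero.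
\<close>

definition hat :: "int \<Rightarrow> ('p list \<Rightarrow> ('p \<Rightarrow>\<^sub>0 complex)) \<Rightarrow> 'p list \<Rightarrow> ('p list \<Rightarrow>\<^sub>0 complex)" where
 "hat j f ws = (\<Sum>(L, X, R)\<in>splits ws. smul (sg (wdeg R * j)) (lin (\<lambda>x. bvec (L @ x # R)) (f X)))"

text \<open>
 The insertions that use an initial segment; the others leave the first entry alone and are
 collected in \<open>rest\<close>.  This allows inductions over the sequence.
\<close>

definition front :: "int \<Rightarrow> ('p list \<Rightarrow> ('p \<Rightarrow>\<^sub>0 complex)) \<Rightarrow> 'p list \<Rightarrow> ('p list \<Rightarrow>\<^sub>0 complex)" where
 "front j f ws = (\<Sum>(X, R)\<in>fsplits ws. smul (sg (wdeg R * j)) (lin (\<lambda>x. bvec (x # R)) (f X)))"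

lemma keys_hat: "w \<in> keys (hat j f ws) \<Longrightarrow> \<exists>L X R x. ws = L @ X @ R \<and> X \<noteq> [] \<and> x \<in> keys (f X) \<and> w = L @ x # R"
proof -
 assume w: "w \<in> keys (hat j f ws)"
 have "lookup (hat j f ws) w = (\<Sum>(L, X, R)\<in>splits ws. sg (wdeg R * j) * lookup (lin (\<lambda>x. bvec (L @ x # R)) (f X)) w)"
  by (simp add: hat_def lookup_sum case_prod_unfold)
 moreover have "lookup (hat j f ws) w \<noteq> 0" using w by (simp add: in_keys_iff)
 ultimately obtain t where t: "t \<in> splits ws" "(case t of (L, X, R) \<Rightarrow> sg (wdeg R * j) * lookup (lin (\<lambda>x. bvec (L @ x # R)) (f X)) w) \<noteq> 0"
  using sum.not_neutral_contains_not_neutral by (metis (no_types, lifting))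
 then obtain L X R where e: "ws = L @ X @ R" "X \<noteq> []" "w \<in> keys (lin (\<lambda>x. bvec (L @ x # R)) (f X))"
  by (cases t) (auto simp: splits_def in_keys_iff)
 from e(3) keys_lin[of "\<lambda>x. bvec (L @ x # R)" "f X"] obtain x where "x \<in> keys (f X)" "w = L @ x # R" by auto
 then show ?thesis using e by blast
qed

abbreviation cons :: "'p \<Rightarrow> ('p list \<Rightarrow>\<^sub>0 complex) \<Rightarrow> ('p list \<Rightarrow>\<^sub>0 complex)" where
 "cons p \<equiv> lin (\<lambda>w. bvec (p # w))"

definition rest :: "int \<Rightarrow> ('p list \<Rightarrow> ('p \<Rightarrow>\<^sub>0 complex)) \<Rightarrow> 'p list \<Rightarrow> ('p list \<Rightarrow>\<^sub>0 complex)" where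
 "rest j f ws = (case ws of [] \<Rightarrow> 0 | p # w \<Rightarrow> cons p (hat j f w))"

lemma rest_simps [simp]: "rest j f [] = 0" "rest j f (p # w) = cons p (hat j f w)"
 by (simp_all add: rest_def)

lemma hat_Nil [simp]: "hat j f [] = 0" by (simp add: hat_def)

lemma hat_front_rest: "hat j f ws = front j f ws + rest j f ws"
proof (cases ws)
 case (Cons p w)
 show ?thesis unfolding Cons hat_def front_def sum_splits_Cons
  by (simp add: hat_def lin_sum lin_smul lin_lin case_prod_beta)
qed (simp add: front_def)

text \<open>The insertions of \<open>f\<close> after those of \<open>g\<close>, split according to whether the arguments of \<open>f\<close> contain the value of \<open>g\<close>.\<close>

text \<open>
 A value of \<open>g\<close> either lies among the arguments of the later \<open>f\<close> at the front, or to the right of all of them;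
 in the second case \<open>f\<close> and \<open>g\<close> can be interchanged at the price of a sign.
\<close>

lemma lin_front_hat:
 assumes g: "homog j' g"
 shows "lin (front j f) (hat j' g ws) =
  (\<Sum>(Z, R)\<in>fsplits ws. smul (sg (wdeg R * (j + j'))) (lin (\<lambda>x. bvec (x # R)) (lin f (hat j' g Z)))) +
  smul (sg (j * j')) (\<Sum>(Y, Q)\<in>fsplits ws. smul (sg (wdeg Q * j)) (lin (\<lambda>y. cons y (hat j' g Q)) (f Y)))"
proof -
 define T where "T Y L X R = smul (sg (j * j') * sg (wdeg R * j') * sg (wdeg (L @ X @ R) * j))
   (lin (\<lambda>x. lin (\<lambda>y. bvec (y # L @ x # R)) (f Y)) (g X))" for Y L X R
 define U where "U L X R1 R2 = smul (sg (wdeg R1 * j') * sg (wdeg R2 * (j + j')))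
   (lin (\<lambda>x. lin (\<lambda>y. bvec (y # R2)) (f (L @ x # R1))) (g X))" for L X R1 R2
 have front_mid: "front j f (L @ x # R) =
   (\<Sum>(Y, L')\<in>fsplits L. smul (sg (wdeg (L' @ x # R) * j)) (lin (\<lambda>y. bvec (y # L' @ x # R)) (f Y))) +
   (\<Sum>(R1, R2)\<in>asplits R. smul (sg (wdeg R2 * j)) (lin (\<lambda>y. bvec (y # R2)) (f (L @ x # R1))))" for L x R
 proof -
  have "fsplits (L @ x # R) = (\<lambda>(Y, L'). (Y, L' @ x # R)) ` fsplits L \<union> (\<lambda>(R1, R2). (L @ x # R1, R2)) ` asplits R"
   by (auto simp: fsplits_def asplits_def image_iff append_eq_append_conv2 Cons_eq_append_conv)
  moreover have "(\<lambda>(Y, L'). (Y, L' @ x # R)) ` fsplits L \<inter> (\<lambda>(R1, R2). (L @ x # R1, R2)) ` asplits R = {}"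
   by (auto simp: fsplits_def asplits_def)
  moreover have "inj_on (\<lambda>(Y, L'). (Y, L' @ x # R)) (fsplits L)" "inj_on (\<lambda>(R1, R2). (L @ x # R1, R2)) (asplits R)"
   by (auto simp: inj_on_def)
  ultimately show ?thesis unfolding front_def
   by (simp add: sum.union_disjoint sum.reindex case_prod_unfold o_def)
 qed
 have inner: "smul (sg (wdeg R * j')) (lin (\<lambda>x. front j f (L @ x # R)) (g X)) =
   (\<Sum>(Y, L')\<in>fsplits L. T Y L' X R) + (\<Sum>(R1, R2)\<in>asplits R. U L X R1 R2)" for L X R
 proof -
  have "lin (\<lambda>x. smul (sg (wdeg (L' @ x # R) * j)) (lin (\<lambda>y. bvec (y # L' @ x # R)) (f Y))) (g X) =
   smul (sg (j * j') * sg (wdeg (L' @ X @ R) * j)) (lin (\<lambda>x. lin (\<lambda>y. bvec (y # L' @ x # R)) (f Y)) (g X))" for L' Y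
  proof (rule trans[OF lin_cong lin_fun_smul])
   fix x assume "x \<in> keys (g X)"
   then have "even (dg x - wdeg X - j')" using g by (auto simp: homog_def)
   then have "sg (wdeg (L' @ x # R) * j) = sg (j * j') * sg (wdeg (L' @ X @ R) * j)"
    unfolding sg_mult by (intro sg_cong) (auto simp: algebra_simps)
   then show "smul (sg (wdeg (L' @ x # R) * j)) (lin (\<lambda>y. bvec (y # L' @ x # R)) (f Y)) =
    smul (sg (j * j') * sg (wdeg (L' @ X @ R) * j)) (lin (\<lambda>y. bvec (y # L' @ x # R)) (f Y))" by simp
  qed
  then show ?thesis
   unfolding front_mid lin_fun_add lin_fun_sum case_prod_beta smul_add_right smul_sum_right T_def U_def
   by (auto intro!: arg_cong2[where f = "(+)"] sum.cong simp: lin_fun_smul asplits_def sg_mult algebra_simps)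
 qed
 have "lin (front j f) (hat j' g ws) = (\<Sum>(L, X, R)\<in>splits ws. smul (sg (wdeg R * j')) (lin (\<lambda>x. front j f (L @ x # R)) (g X)))"
  unfolding hat_def lin_sum case_prod_beta lin_smul lin_lin lin_bvec ..
 also have "\<dots> = (\<Sum>(L, X, R)\<in>splits ws. \<Sum>(Y, L')\<in>fsplits L. T Y L' X R) + (\<Sum>(L, X, R)\<in>splits ws. \<Sum>(R1, R2)\<in>asplits R. U L X R1 R2)"
  unfolding inner case_prod_beta sum.distrib ..
 also have "(\<Sum>(L, X, R)\<in>splits ws. \<Sum>(Y, L')\<in>fsplits L. T Y L' X R) = (\<Sum>(Y, Q)\<in>fsplits ws. \<Sum>(L', X, R)\<in>splits Q. T Y L' X R)"
  unfolding case_prod_beta sum.Sigma[OF finite_splits ballI[OF finite_fsplits]] sum.Sigma[OF finite_fsplits ballI[OF finite_splits]]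
  by (rule sum.reindex_bij_witness[of _ "\<lambda>((Y, Q), (L', X, R)). ((Y @ L', X, R), (Y, L'))" "\<lambda>((L, X, R), (Y, L')). ((Y, L' @ X @ R), (L', X, R))"])
   (auto simp: splits_def fsplits_def)
 also have "\<dots> = smul (sg (j * j')) (\<Sum>(Y, Q)\<in>fsplits ws. smul (sg (wdeg Q * j)) (lin (\<lambda>y. cons y (hat j' g Q)) (f Y)))"
  unfolding smul_sum_right case_prod_beta hat_def lin_sum lin_smul lin_lin lin_fun_sum lin_fun_smul lin_bvec T_def smul_smul
  by (intro sum.cong refl) (auto simp: splits_def algebra_simps lin_swap[where x = "f _"] split: prod.splits)
 also have "(\<Sum>(L, X, R)\<in>splits ws. \<Sum>(R1, R2)\<in>asplits R. U L X R1 R2) = (\<Sum>(Z, R2)\<in>fsplits ws. \<Sum>(L, X, R1)\<in>splits Z. U L X R1 R2)"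
  unfolding case_prod_beta sum.Sigma[OF finite_splits ballI[OF finite_asplits]] sum.Sigma[OF finite_fsplits ballI[OF finite_splits]]
  by (rule sum.reindex_bij_witness[of _ "\<lambda>((Z, R2), (L, X, R1)). ((L, X, R1 @ R2), (R1, R2))" "\<lambda>((L, X, R), (R1, R2)). ((L @ X @ R1, R2), (L, X, R1))"])
   (auto simp: splits_def fsplits_def asplits_def)
 also have "\<dots> = (\<Sum>(Z, R)\<in>fsplits ws. smul (sg (wdeg R * (j + j'))) (lin (\<lambda>x. bvec (x # R)) (lin f (hat j' g Z))))"
  unfolding case_prod_beta hat_def lin_sum lin_smul lin_lin lin_bvec smul_sum_right U_def smul_smul
  by (simp add: mult.commute)
 finally show ?thesis by (simp only: add.commute)
qed

text \<open>
 The corestriction of the commutator of \<open>hat 1 m\<close> and \<open>hat j f\<close>; for \<open>m = \<mu>\<close> it is the Hochschild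
 differential of a cochain of parity \<open>j\<close>.
\<close>

definition dif :: "('p list \<Rightarrow> ('p \<Rightarrow>\<^sub>0 complex)) \<Rightarrow> int \<Rightarrow> ('p list \<Rightarrow> ('p \<Rightarrow>\<^sub>0 complex)) \<Rightarrow> 'p list \<Rightarrow> ('p \<Rightarrow>\<^sub>0 complex)" where
 "dif m j f ws = lin m (hat j f ws) - smul (sg j) (lin f (hat 1 m ws))"

lemma lin_rest_front:
 "lin (rest j' g) (front j f ws) = (\<Sum>(Y, Q)\<in>fsplits ws. smul (sg (wdeg Q * j)) (lin (\<lambda>y. cons y (hat j' g Q)) (f Y)))"
 unfolding front_def lin_sum case_prod_beta lin_smul lin_lin lin_bvec rest_simps ..

lemma lin_rest_cons: "lin (rest j' g) (cons p v) = cons p (lin (hat j' g) v)"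
 by (simp add: lin_lin)

text \<open>
 Coderivations are closed under commutators, because insertions at disjoint places cancel.  Splitting
 off the insertions at the front turns this into an induction over the sequence.
\<close>

theorem coderivation_commutator:
 assumes m: "homog 1 m" and f: "homog j f"
 shows "lin (hat 1 m) (hat j f ws) - smul (sg j) (lin (hat j f) (hat 1 m ws)) = hat (j + 1) (dif m j f) ws"
proof (induction ws)
 case (Cons p ws)
 let ?ws = "p # ws"
 let ?A = "\<lambda>j' g j f. (\<Sum>(Y, Q)\<in>fsplits ?ws. smul (sg (wdeg Q * j)) (lin (\<lambda>y. cons y (hat j' g Q)) (f Y)))"
 let ?B = "\<lambda>j f j' g. (\<Sum>(Z, R)\<in>fsplits ?ws. smul (sg (wdeg R * (j + j'))) (lin (\<lambda>x. bvec (x # R)) (lin f (hat j' g Z))))"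
 have *: "lin (hat j f) (hat j' g ?ws) = ?B j f j' g + smul (sg (j * j')) (?A j' g j f) + ?A j f j' g + cons p (lin (hat j f) (hat j' g ws))"
  if "homog j' g" for j j' :: int and f g
 proof -
  have "lin (hat j f) (hat j' g ?ws) = lin (front j f) (hat j' g ?ws) + lin (rest j f) (front j' g ?ws + rest j' g ?ws)"
   unfolding hat_front_rest[of j f, abs_def] lin_fun_add by (simp add: hat_front_rest[of j' g])
  then show ?thesis
   unfolding lin_front_hat[OF that] lin_add lin_rest_front rest_simps lin_rest_cons by (simp add: algebra_simps)
 qed
 have B: "?B 1 m j f - smul (sg j) (?B j f 1 m) = front (j + 1) (dif m j f) ?ws"
  unfolding front_def dif_def[abs_def] smul_sum_right case_prod_beta sum_subtractf[symmetric]
  by (intro sum.cong refl) (simp add: lin_diff lin_smul smul_diff_right algebra_simps)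
 have "lin (hat 1 m) (hat j f ?ws) - smul (sg j) (lin (hat j f) (hat 1 m ?ws)) =
   (?B 1 m j f - smul (sg j) (?B j f 1 m)) + cons p (lin (hat 1 m) (hat j f ws) - smul (sg j) (lin (hat j f) (hat 1 m ws)))"
  unfolding *[OF m] *[OF f] by (simp add: lin_diff lin_smul smul_add_right sg_self algebra_simps)
 then show ?case unfolding B Cons.IH by (simp add: hat_front_rest[of "j + 1"])
qed simp

lemma homog_dif:
 assumes m: "homog 1 m" and f: "homog j f"
 shows "homog (j + 1) (dif m i f)"
 unfolding homog_def
proof (intro allI ballI)
 fix ws x assume x: "x \<in> keys (dif m i f ws)"
 have "keys (dif m i f ws) \<subseteq> keys (lin m (hat i f ws)) \<union> keys (smul (sg i) (lin f (hat 1 m ws)))"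
  unfolding dif_def by (rule keys_diff)
 moreover have "keys (smul (sg i) (lin f (hat 1 m ws))) \<subseteq> keys (lin f (hat 1 m ws))" by (rule keys_smul_subset)
 ultimately have "x \<in> keys (lin m (hat i f ws)) \<or> x \<in> keys (lin f (hat 1 m ws))" using x by blast
 then show "even (dg x - wdeg ws - (j + 1))"
 proof
  assume "x \<in> keys (lin m (hat i f ws))"
  from keys_linD[OF this] obtain w where w: "w \<in> keys (hat i f ws)" "x \<in> keys (m w)" by blast
  obtain L X R y where y: "ws = L @ X @ R" "y \<in> keys (f X)" "w = L @ y # R" using keys_hat[OF w(1)] by blast
  have "even (dg x - wdeg w - 1)" using m w(2) unfolding homog_def by simp
  moreover have "even (dg y - wdeg X - j)" using f y(2) unfolding homog_def by simp
  ultimately have "even ((dg x - wdeg w - 1) + (dg y - wdeg X - j))" by simp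
  then show ?thesis using y by (simp add: algebra_simps)
 next
  assume "x \<in> keys (lin f (hat 1 m ws))"
  from keys_linD[OF this] obtain w where w: "w \<in> keys (hat 1 m ws)" "x \<in> keys (f w)" by blast
  obtain L X R y where y: "ws = L @ X @ R" "y \<in> keys (m X)" "w = L @ y # R" using keys_hat[OF w(1)] by blast
  have "even (dg x - wdeg w - j)" using f w(2) unfolding homog_def by simp
  moreover have "even (dg y - wdeg X - 1)" using m y(2) unfolding homog_def by simp
  ultimately have "even ((dg x - wdeg w - j) + (dg y - wdeg X - 1))" by simp
  then show ?thesis using y by (simp add: algebra_simps)
 qed
qed

lemma hat_eq_0: "(\<And>ws. f ws = 0) \<Longrightarrow> hat j f ws = 0"
 by (simp add: hat_def case_prod_beta)

text \<open>
 By \<open>coderivation_commutator\<close> the coderivation of \<open>m\<close> has square zero, so this is the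
 Jacobi identity for the commutator with it.
\<close>

theorem dif_dif:
 assumes m: "homog 1 m" and mm: "\<And>ws. lin m (hat 1 m ws) = 0" and f: "homog j f"
 shows "dif m (j + 1) (dif m j f) ws = 0"
proof -
 have 0: "lin m (lin (hat 1 m) v) = 0" for v
  by (simp add: lin_lin mm)
 have "lin (hat 1 m) (hat 1 m ws) + lin (hat 1 m) (hat 1 m ws) = hat (1 + 1) (dif m 1 m) ws" for ws
  using coderivation_commutator[OF m m, of ws] by (simp add: smul_minus_left)
 also have "\<dots> ws = 0" for ws by (rule hat_eq_0) (simp add: dif_def mm)
 finally have "smul 2 (lin (hat 1 m) (hat 1 m ws)) = 0" for ws
  using smul_add_left[of 1 1 "lin (hat 1 m) (hat 1 m ws)"] by simp
 then have hh: "lin (hat 1 m) (hat 1 m ws) = 0" for ws by simp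
 have "lin m (hat (j + 1) (dif m j f) ws) = - smul (sg j) (lin m (lin (hat j f) (hat 1 m ws)))"
  unfolding coderivation_commutator[OF m f, symmetric] by (simp add: lin_diff lin_smul 0)
 moreover have "lin (dif m j f) (hat 1 m ws) = lin m (lin (hat j f) (hat 1 m ws)) - smul (sg j) (lin f (lin (hat 1 m) (hat 1 m ws)))"
  unfolding dif_def[abs_def] lin_fun_diff lin_fun_smul by (simp add: lin_lin)
 ultimately show ?thesis by (simp add: dif_def[of m "j + 1"] hh sg_add1 smul_minus_left)
qed

end

section \<open>Three half-discs along an arc in the plane\<close>

text \<open>
 The inside and the outside of a closed set are open and cover its complement.
\<close>

lemma connected_inside_or_disjoint:
 fixes C :: "complex set"
 assumes "connected K" "K \<inter> C = {}" "closed C" "K \<inter> inside C \<noteq> {}"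
 shows "K \<subseteq> inside C"
proof (rule ccontr)
 assume "\<not> K \<subseteq> inside C"
 then have "K \<inter> outside C \<noteq> {}" using assms(2) inside_Un_outside[of C] by blast
 moreover have "K \<subseteq> inside C \<union> outside C" using assms(2) by auto
 moreover have "inside C \<inter> outside C \<inter> K = {}" by simp
 ultimately show False
  using connectedD[OF assms(1) open_inside[OF assms(3)] open_outside[OF assms(3)]] assms(4) by blast
qed

lemma closure_inside_subset:
 fixes C :: "complex set"
 assumes "closed C" "K \<subseteq> inside C" "x \<in> closure K" "x \<notin> C"
 shows "x \<in> inside C"
proof -
 have "closed (C \<union> inside C)"
  unfolding union_with_inside using open_outside[OF assms(1)] by (simp add: closed_def)
 then have "closure K \<subseteq> C \<union> inside C" using assms(2) by (intro closure_minimal) auto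
 then show ?thesis using assms(3,4) by blast
qed

definition theta_curve :: "(real \<Rightarrow> complex) \<Rightarrow> (real \<Rightarrow> complex) \<Rightarrow> (real \<Rightarrow> complex) \<Rightarrow> complex \<Rightarrow> complex \<Rightarrow> bool" where
 "theta_curve c1 c2 c3 u v \<longleftrightarrow> u \<noteq> v \<and> (\<forall>c\<in>{c1, c2, c3}. arc c \<and> pathstart c = u \<and> pathfinish c = v) \<and>
   path_image c1 \<inter> path_image c2 = {u, v} \<and> path_image c1 \<inter> path_image c3 = {u, v} \<and> path_image c2 \<inter> path_image c3 = {u, v}"

text \<open>
 The third arc cuts the inside of the closed curve formed by the first two into two pieces, each of which
 is bounded by the third and only one of the others.  A connected set that avoids the curve and reaches the
 third arc lies in one of the pieces, and the closure of a piece does not meet the arc opposite to it.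
\<close>

lemma theta_inside:
 assumes th: "theta_curve c1 c2 c3 u v"
  and ins: "path_image c3 \<inter> inside (path_image c1 \<union> path_image c2) \<noteq> {}"
  and K: "connected K" "K \<inter> (path_image c1 \<union> path_image c2 \<union> path_image c3) = {}"
  and x1: "x1 \<in> closure K" "x1 \<in> path_image c1 - {u, v}"
  and x2: "x2 \<in> closure K" "x2 \<in> path_image c2 - {u, v}"
  and x3: "x3 \<in> closure K" "x3 \<in> path_image c3 - {u, v}"
 shows False
proof -
 let ?C = "\<lambda>c c'. path_image c \<union> path_image c'"
 have uv: "u \<noteq> v" and c: "arc c1" "arc c2" "arc c3" "pathstart c1 = u" "pathfinish c1 = v" "pathstart c2 = u" "pathfinish c2 = v"
   "pathstart c3 = u" "pathfinish c3 = v"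
  and I: "path_image c1 \<inter> path_image c2 = {u, v}" "path_image c1 \<inter> path_image c3 = {u, v}" "path_image c2 \<inter> path_image c3 = {u, v}"
  using th by (auto simp: theta_curve_def)
 have cl: "closed (?C c c')" if "arc c" "arc c'" for c c' :: "real \<Rightarrow> complex"
  using that by (intro closed_Un closed_arc_image)
 obtain s: "inside (?C c1 c3) \<inter> inside (?C c2 c3) = {}"
  "inside (?C c1 c3) \<union> inside (?C c2 c3) \<union> (path_image c3 - {u, v}) = inside (?C c1 c2)"
  using split_inside_simple_closed_curve[OF arc_imp_simple_path[OF c(1)] c(4,5) arc_imp_simple_path[OF c(2)] c(6,7)
   arc_imp_simple_path[OF c(3)] c(8,9) uv I ins] by metis
 have "x3 \<in> inside (?C c1 c2)" using s(2) x3(2) by blast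
 then have "K \<inter> inside (?C c1 c2) \<noteq> {}"
  using open_Int_closure_eq_empty[OF open_inside[OF cl[OF c(1,2)]], of K] x3(1) by blast
 then have "K \<subseteq> inside (?C c1 c2)" using connected_inside_or_disjoint[OF K(1) _ cl[OF c(1,2)]] K(2) by blast
 then have sub: "K \<subseteq> inside (?C c1 c3) \<union> inside (?C c2 c3)" using s(2) K(2) by blast
 have "K \<inter> inside (?C c1 c3) \<noteq> {} \<or> K \<inter> inside (?C c2 c3) \<noteq> {}" using sub x3(1) by (cases "K = {}") auto
 then have "K \<subseteq> inside (?C c1 c3) \<or> K \<subseteq> inside (?C c2 c3)"
  using connected_inside_or_disjoint[OF K(1) _ cl[OF c(1,3)]] connected_inside_or_disjoint[OF K(1) _ cl[OF c(2,3)]] K(2) by blast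
 then show False
 proof
  assume k: "K \<subseteq> inside (?C c1 c3)"
  have "x2 \<notin> ?C c1 c3" using x2(2) I by blast
  then have "x2 \<in> inside (?C c1 c3)" using closure_inside_subset[OF cl[OF c(1,3)] k x2(1)] by blast
  then have "x2 \<in> inside (?C c1 c2)" using s(2) by blast
  then show False using x2(2) inside_no_overlap[of "?C c1 c2"] by blast
 next
  assume k: "K \<subseteq> inside (?C c2 c3)"
  have "x1 \<notin> ?C c2 c3" using x1(2) I by blast
  then have "x1 \<in> inside (?C c2 c3)" using closure_inside_subset[OF cl[OF c(2,3)] k x1(1)] by blast
  then have "x1 \<in> inside (?C c1 c2)" using s(2) by blast
  then show False using x1(2) inside_no_overlap[of "?C c1 c2"] by blast
 qed
qed

lemma Jordan_two_arcs:
 fixes c1 c2 :: "real \<Rightarrow> complex"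
 assumes "arc c1" "arc c2" "pathstart c1 = u" "pathfinish c1 = v" "pathstart c2 = u" "pathfinish c2 = v"
  and "path_image c1 \<inter> path_image c2 = {u, v}"
 shows "inside (path_image c1 \<union> path_image c2) \<noteq> {}" "connected (inside (path_image c1 \<union> path_image c2))"
  "bounded (inside (path_image c1 \<union> path_image c2))" "connected (outside (path_image c1 \<union> path_image c2))"
proof -
 let ?c = "c1 +++ reversepath c2"
 have "simple_path ?c"
  by (rule simple_path_join_loop) (use assms in \<open>auto simp: arc_reversepath\<close>)
 moreover have "pathfinish ?c = pathstart ?c" using assms by simp
 moreover have "path_image ?c = path_image c1 \<union> path_image c2" using assms by (simp add: path_image_join)
 ultimately show "inside (path_image c1 \<union> path_image c2) \<noteq> {}" "connected (inside (path_image c1 \<union> path_image c2))"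
  "bounded (inside (path_image c1 \<union> path_image c2))" "connected (outside (path_image c1 \<union> path_image c2))"
  using Jordan_inside_outside[of ?c] by auto
qed

text \<open>
 The drawing of \<open>K\<^sub>3\<^sub>,\<^sub>3\<close> is excluded by \<open>theta_inside\<close> if the third arc runs inside the curve
 formed by the other two.  Otherwise the inversion \<open>z \<mapsto> 1 / (z - z0)\<close> at a point \<open>z0\<close> inside this
 curve interchanges its inside and its outside, and brings the third arc to the inside.
\<close>

lemma theta_no_triple:
 assumes th: "theta_curve c1 c2 c3 u v"
  and K: "connected K" "K \<inter> (path_image c1 \<union> path_image c2 \<union> path_image c3) = {}"
  and x1: "x1 \<in> closure K" "x1 \<in> path_image c1 - {u, v}"
  and x2: "x2 \<in> closure K" "x2 \<in> path_image c2 - {u, v}"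
  and x3: "x3 \<in> closure K" "x3 \<in> path_image c3 - {u, v}"
 shows False
proof (cases "path_image c3 \<inter> inside (path_image c1 \<union> path_image c2) = {}")
 case False
 then show False using theta_inside[OF th _ K x1 x2 x3] by blast
next
 case no: True
 let ?C = "path_image c1 \<union> path_image c2"
 have uv: "u \<noteq> v" and c: "arc c1" "arc c2" "arc c3" "pathstart c1 = u" "pathfinish c1 = v" "pathstart c2 = u" "pathfinish c2 = v"
   "pathstart c3 = u" "pathfinish c3 = v"
  and I: "path_image c1 \<inter> path_image c2 = {u, v}" "path_image c1 \<inter> path_image c3 = {u, v}" "path_image c2 \<inter> path_image c3 = {u, v}"
  using th by (auto simp: theta_curve_def)
 have cl: "closed ?C" using c by (intro closed_Un closed_arc_image)
 note J = Jordan_two_arcs[OF c(1,2,4-7) I(1)]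
 have oI: "open (inside ?C)" by (rule open_inside[OF cl])
 have x3C: "x3 \<notin> ?C" using x3(2) I by blast
 have KI: "K \<inter> inside ?C = {}"
 proof (rule ccontr)
  assume n: "K \<inter> inside ?C \<noteq> {}"
  have "K \<subseteq> inside ?C" by (rule connected_inside_or_disjoint[OF K(1) _ cl n]) (use K(2) in blast)
  from closure_inside_subset[OF cl this x3(1) x3C] show False using no x3(2) by blast
 qed
 obtain z0 where z0: "z0 \<in> inside ?C" using J(1) by blast
 define g where "g z = 1 / (z - z0)" for z
 have cg: "continuous_on S g" if "z0 \<notin> S" for S
  unfolding g_def using that by (intro continuous_intros) auto
 have ig: "inj_on g S" for S by (auto simp: inj_on_def g_def)
 have zC: "z0 \<notin> ?C" using z0 inside_no_overlap[of ?C] by blast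
 have zc: "z0 \<notin> path_image c1" "z0 \<notin> path_image c2" "z0 \<notin> path_image c3" using zC no z0 by auto
 have "closure K \<inter> inside ?C = {}" using open_Int_closure_eq_empty[OF oI, of K] KI by blast
 then have zK: "z0 \<notin> closure K" using z0 by blast
 have arcs: "arc (g \<circ> c)" if "arc c" "z0 \<notin> path_image c" for c
  using that unfolding arc_def
  by (auto intro!: path_continuous_image cg comp_inj_on ig)
 have pimg: "path_image (g \<circ> c) = g ` path_image c" for c by (rule path_image_compose)
 have th': "theta_curve (g \<circ> c1) (g \<circ> c2) (g \<circ> c3) (g u) (g v)"
  unfolding theta_curve_def
 proof (intro conjI)
  show "g u \<noteq> g v" using ig[of UNIV] uv by (auto simp: inj_on_def)
  show "\<forall>c\<in>{g \<circ> c1, g \<circ> c2, g \<circ> c3}. arc c \<and> pathstart c = g u \<and> pathfinish c = g v"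
   using arcs c zc by (auto simp: pathstart_compose pathfinish_compose)
  show "path_image (g \<circ> c1) \<inter> path_image (g \<circ> c2) = {g u, g v}"
   "path_image (g \<circ> c1) \<inter> path_image (g \<circ> c3) = {g u, g v}"
   "path_image (g \<circ> c2) \<inter> path_image (g \<circ> c3) = {g u, g v}"
   unfolding pimg image_Int[OF ig[of UNIV], symmetric] I by simp_all
 qed
 have arcs': "arc (g \<circ> c1)" "arc (g \<circ> c2)" "pathstart (g \<circ> c1) = g u" "pathfinish (g \<circ> c1) = g v" "pathstart (g \<circ> c2) = g u"
  "pathfinish (g \<circ> c2) = g v" "path_image (g \<circ> c1) \<inter> path_image (g \<circ> c2) = {g u, g v}"
  using th' by (auto simp: theta_curve_def)
 let ?C' = "path_image (g \<circ> c1) \<union> path_image (g \<circ> c2)"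
 have C': "?C' = g ` ?C" unfolding pimg by blast
 note J' = Jordan_two_arcs[OF arcs']
 have cl': "closed ?C'" using arcs' by (intro closed_Un closed_arc_image)
 have gC: "g z \<in> ?C' \<longleftrightarrow> z \<in> ?C" for z unfolding C' using ig[of UNIV] by (auto simp: inj_on_def)
 have in3: "g x3 \<in> inside ?C'"
 proof (rule ccontr)
  assume n: "g x3 \<notin> inside ?C'"
  have y: "g x3 \<in> outside ?C'" using n gC[of x3] x3C inside_Un_outside[of ?C'] by blast
  define B where "B = g ` (inside ?C - {z0})"
  have conB: "connected B" unfolding B_def
   by (intro connected_continuous_image cg connected_open_delete oI J) auto
  have BC: "B \<inter> ?C' = {}" using gC inside_no_overlap[of ?C] unfolding B_def by blast
  \<comment> \<open>Near \<open>z0\<close> the inversion is unbounded, so the inside goes to the outside.\<close>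
  have "\<not> bounded B"
  proof
   assume "bounded B"
   then obtain R where R: "R > 0" "\<forall>w\<in>B. norm w \<le> R" by (auto simp: bounded_pos)
   obtain e where e: "e > 0" "ball z0 e \<subseteq> inside ?C" using oI z0 open_contains_ball by blast
   define d where "d = min (e / 2) (1 / (2 * R))"
   have d: "d > 0" "d < e" "d \<le> 1 / (2 * R)" using e R by (auto simp: d_def min_def)
   have "z0 + of_real d \<in> ball z0 e" using d by (simp add: dist_norm)
   then have "g (z0 + of_real d) \<in> B" unfolding B_def using e d by auto
   then have "norm (g (z0 + of_real d)) \<le> R" using R by blast
   then have "1 / d \<le> R" using d by (simp add: g_def norm_divide)
   then have "1 \<le> R * d" using d by (simp add: field_simps)
   also have "R * d \<le> R * (1 / (2 * R))" using d R by (intro mult_left_mono) auto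
   also have "\<dots> = 1 / 2" using R by simp
   finally show False by simp
  qed
  then have "\<not> B \<subseteq> inside ?C'" using J'(3) bounded_subset by blast
  then obtain b where b: "b \<in> B" "b \<in> outside ?C'" using BC inside_Un_outside[of ?C'] by blast
  have b0: "b \<noteq> 0" using b unfolding B_def g_def by auto
  define W where "W = outside ?C' - {0}"
  have cW: "connected W" unfolding W_def
   by (intro connected_open_delete open_outside cl' J') auto
  define h where "h w = z0 + 1 / w" for w
  have hW: "connected (h ` W)"
   by (rule connected_continuous_image[OF _ cW]) (auto simp: h_def W_def intro!: continuous_intros)
  have gh: "g (h w) = w" if "w \<noteq> 0" for w using that by (simp add: g_def h_def)
  have hg: "h (g z) = z" for z by (simp add: g_def h_def)
  have hC: "h ` W \<inter> ?C = {}"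
  proof (rule ccontr)
   assume "h ` W \<inter> ?C \<noteq> {}"
   then obtain w where w: "w \<in> W" "h w \<in> ?C" by blast
   then have "w \<in> ?C'" using gC[of "h w"] gh[of w] by (simp add: W_def)
   then show False using w(1) outside_no_overlap[of ?C'] unfolding W_def by blast
  qed
  have "b \<in> W" using b b0 by (simp add: W_def)
  moreover have "h b \<in> inside ?C" using b hg unfolding B_def by auto
  ultimately have "h ` W \<inter> inside ?C \<noteq> {}" by blast
  from connected_inside_or_disjoint[OF hW hC cl this] have "h ` W \<subseteq> inside ?C" .
  moreover have "g x3 \<noteq> 0" using zc x3 unfolding g_def by auto
  then have "g x3 \<in> W" using y by (simp add: W_def)
  ultimately have "x3 \<in> inside ?C" using hg[of x3] by (metis image_subset_iff)
  then show False using no x3(2) by blast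
 qed
 have cK: "g ` closure K \<subseteq> closure (g ` K)"
  by (rule image_closure_subset) (auto intro!: cg zK closure_subset)
 have mem: "g x \<in> path_image (g \<circ> c) - {g u, g v}" if "x \<in> path_image c - {u, v}" for x c
  using that ig[of UNIV] unfolding pimg by (auto simp: inj_on_def)
 show False
 proof (rule theta_inside[OF th'])
  show "path_image (g \<circ> c3) \<inter> inside ?C' \<noteq> {}" using in3 mem[OF x3(2)] by blast
  show "connected (g ` K)" using K(1) zK closure_subset[of K] by (intro connected_continuous_image cg) auto
  show "g ` K \<inter> (?C' \<union> path_image (g \<circ> c3)) = {}"
   using K(2) ig[of UNIV] unfolding pimg by (auto simp: inj_on_def)
  show "g x1 \<in> closure (g ` K)" "g x2 \<in> closure (g ` K)" "g x3 \<in> closure (g ` K)" using cK x1 x2 x3 by auto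
  show "g x1 \<in> path_image (g \<circ> c1) - {g u, g v}" "g x2 \<in> path_image (g \<circ> c2) - {g u, g v}" "g x3 \<in> path_image (g \<circ> c3) - {g u, g v}"
   using mem x1 x2 x3 by auto
 qed
qed

lemma norm_open_segment_sphere:
 fixes a b :: complex
 assumes "norm a = 1" "norm b \<le> 1" "x \<in> open_segment a b" "norm b = 1 \<or> norm b < 1"
 shows "norm x < 1"
 using dist_decreases_open_segment[OF assms(3), of 0] assms by auto

text \<open>
 The maps \<open>\<psi> j\<close> glue three half-discs along a common piece of the boundary from \<open>u\<close> through \<open>p\<close> to \<open>v\<close>.
 The three chords from \<open>u\<close> to \<open>v\<close> form a theta curve.  The segments from \<open>p\<close> to the midpoints of
 the chords form a connected set that reaches each of the chords.  The condition on inner products says that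
 chord and radius are orthogonal, so that the segment meets its own chord only at the midpoint.
\<close>

lemma no_three_half_discs:
 fixes N :: "nat \<Rightarrow> complex set" and \<psi> :: "nat \<Rightarrow> complex \<Rightarrow> complex" and \<alpha> \<beta> c :: "nat \<Rightarrow> complex"
 assumes N: "\<And>j. j < 3 \<Longrightarrow> convex (N j) \<and> N j \<subseteq> cball 0 1 \<and> c j \<in> N j \<and> \<alpha> j \<in> N j \<and> \<beta> j \<in> N j"
  and sphere: "\<And>j. j < 3 \<Longrightarrow> norm (c j) = 1 \<and> norm (\<alpha> j) = 1 \<and> norm (\<beta> j) = 1"
  and chord: "\<And>j. j < 3 \<Longrightarrow> c j \<bullet> \<alpha> j = c j \<bullet> \<beta> j \<and> c j \<bullet> \<alpha> j < 1"
  and cont: "\<And>j. j < 3 \<Longrightarrow> continuous_on (N j) (\<psi> j) \<and> inj_on (\<psi> j) (N j \<inter> ball 0 1)"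
  and disj: "\<And>i j. i < 3 \<Longrightarrow> j < 3 \<Longrightarrow> i \<noteq> j \<Longrightarrow> \<psi> i ` (N i \<inter> ball 0 1) \<inter> \<psi> j ` (N j \<inter> ball 0 1) = {}"
  and ends: "\<And>j. j < 3 \<Longrightarrow> \<psi> j (\<alpha> j) = u \<and> \<psi> j (\<beta> j) = v \<and> \<psi> j (c j) = p \<and> \<psi> j ` (N j \<inter> ball 0 1) \<inter> {u, v, p} = {}"
  and uvp: "u \<noteq> v" "p \<noteq> u" "p \<noteq> v"
 shows False
proof -
 define D where "D j = \<psi> j ` (N j \<inter> ball 0 1)" for j
 define \<gamma> where "\<gamma> j = \<psi> j \<circ> linepath (\<alpha> j) (\<beta> j)" for j
 define m where "m j = midpoint (\<alpha> j) (\<beta> j)" for j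
 define K where "K j = \<psi> j ` insert (c j) (open_segment (c j) (m j))" for j
 have fact: "\<alpha> j \<noteq> \<beta> j \<and> open_segment (\<alpha> j) (\<beta> j) \<subseteq> N j \<inter> ball 0 1 \<and> closed_segment (\<alpha> j) (\<beta> j) \<subseteq> N j \<and>
   m j \<in> open_segment (\<alpha> j) (\<beta> j) \<and> m j \<noteq> c j \<and> open_segment (c j) (m j) \<subseteq> N j \<inter> ball 0 1 \<and> closed_segment (c j) (m j) \<subseteq> N j \<and>
   open_segment (c j) (m j) \<inter> closed_segment (\<alpha> j) (\<beta> j) = {}" if j: "j < 3" for j
 proof -
  have ab: "\<alpha> j \<noteq> \<beta> j" using ends[OF j] uvp by auto
  have cs: "closed_segment (\<alpha> j) (\<beta> j) \<subseteq> N j" using N[OF j] closed_segment_subset by blast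
  have "norm x < 1" if "x \<in> open_segment (\<alpha> j) (\<beta> j)" for x
   using norm_open_segment_sphere[OF _ _ that] sphere[OF j] by simp
  then have os: "open_segment (\<alpha> j) (\<beta> j) \<subseteq> N j \<inter> ball 0 1" using cs segment_open_subset_closed by fastforce
  have mo: "m j \<in> open_segment (\<alpha> j) (\<beta> j)" using ab by (simp add: m_def)
  then have mN: "m j \<in> N j" "norm (m j) < 1" using os by auto
  have mc: "m j \<noteq> c j" using mN(2) sphere[OF j] by auto
  have cs2: "closed_segment (c j) (m j) \<subseteq> N j" using N[OF j] mN closed_segment_subset by blast
  have "norm x < 1" if xo: "x \<in> open_segment (c j) (m j)" for x
  proof -
   obtain s where s: "0 < s" "s < 1" "x = (1 - s) *\<^sub>R c j + s *\<^sub>R m j" using xo by (auto simp: in_segment)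
   have "norm x \<le> norm ((1 - s) *\<^sub>R c j) + norm (s *\<^sub>R m j)" unfolding s(3) by (rule norm_triangle_ineq)
   also have "\<dots> = (1 - s) + s * norm (m j)" using s sphere[OF j] by simp
   also have "\<dots> < (1 - s) + s * 1" using s mN(2) by (intro add_strict_left_mono mult_strict_left_mono)
   finally show ?thesis by simp
  qed
  then have os2: "open_segment (c j) (m j) \<subseteq> N j \<inter> ball 0 1" using cs2 segment_open_subset_closed by fastforce
  define k where "k = c j \<bullet> \<alpha> j"
  have k: "c j \<bullet> x = k" if xc: "x \<in> closed_segment (\<alpha> j) (\<beta> j)" for x
  proof -
   obtain s where s: "x = (1 - s) *\<^sub>R \<alpha> j + s *\<^sub>R \<beta> j" using xc by (auto simp: in_segment)
   show ?thesis unfolding s using chord[OF j] by (simp add: inner_add_right k_def algebra_simps)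
  qed
  have "x \<notin> closed_segment (\<alpha> j) (\<beta> j)" if "x \<in> open_segment (c j) (m j)" for x
  proof
   assume x: "x \<in> closed_segment (\<alpha> j) (\<beta> j)"
   obtain s where s: "0 < s" "s < 1" "x = (1 - s) *\<^sub>R c j + s *\<^sub>R m j" using \<open>x \<in> open_segment (c j) (m j)\<close> by (auto simp: in_segment)
   have "c j \<bullet> m j = k" using k mo segment_open_subset_closed by blast
   moreover have "c j \<bullet> c j = 1" using sphere[OF j] by (simp add: dot_square_norm)
   ultimately have "k = (1 - s) + s * k" using k[OF x] unfolding s(3) by (simp add: inner_add_right)
   then have "(1 - s) * (1 - k) = 0" by (simp add: algebra_simps)
   then show False using s chord[OF j] by (simp add: k_def)
  qed
  then show ?thesis using ab cs os mo mc cs2 os2 by blast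
 qed
 have eDn: "u \<notin> D j" "v \<notin> D j" "p \<notin> D j" if "j < 3" for j using ends[OF that] unfolding D_def by auto
 have img: "path_image (\<gamma> j) = insert u (insert v (\<psi> j ` open_segment (\<alpha> j) (\<beta> j)))" if j: "j < 3" for j
 proof -
  have "closed_segment (\<alpha> j) (\<beta> j) = insert (\<alpha> j) (insert (\<beta> j) (open_segment (\<alpha> j) (\<beta> j)))"
   using closed_segment_eq_open[of "\<alpha> j" "\<beta> j"] by auto
  then show ?thesis unfolding \<gamma>_def path_image_compose path_image_linepath using ends[OF j] by auto
 qed
 have sub: "\<psi> j ` open_segment (\<alpha> j) (\<beta> j) \<subseteq> D j" "\<psi> j ` open_segment (c j) (m j) \<subseteq> D j" if j: "j < 3" for j
  using fact[OF j] unfolding D_def by blast+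
 have arcs: "arc (\<gamma> j) \<and> pathstart (\<gamma> j) = u \<and> pathfinish (\<gamma> j) = v" if j: "j < 3" for j
 proof -
  let ?S = "closed_segment (\<alpha> j) (\<beta> j)"
  have S: "?S = insert (\<alpha> j) (insert (\<beta> j) (open_segment (\<alpha> j) (\<beta> j)))"
   using closed_segment_eq_open[of "\<alpha> j" "\<beta> j"] by auto
  have "inj_on (\<psi> j) (open_segment (\<alpha> j) (\<beta> j))" using cont[OF j] fact[OF j] inj_on_subset by blast
  moreover have "u \<notin> \<psi> j ` open_segment (\<alpha> j) (\<beta> j)" "v \<notin> \<psi> j ` open_segment (\<alpha> j) (\<beta> j)" using eDn[OF j] sub[OF j] by blast+
  ultimately have inj: "inj_on (\<psi> j) ?S" unfolding S inj_on_insert using ends[OF j] uvp by auto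
  have "continuous_on ?S (\<psi> j)" using cont[OF j] fact[OF j] continuous_on_subset by blast
  then have "path (\<gamma> j)" unfolding \<gamma>_def by (intro path_continuous_image) auto
  moreover have "inj_on (\<gamma> j) {0..1}" unfolding \<gamma>_def
   by (intro comp_inj_on) (use fact[OF j] inj in \<open>auto simp: arc_linepath[unfolded arc_def] linepath_image_01\<close>)
  ultimately show ?thesis using ends[OF j] by (simp add: arc_def) (simp add: \<gamma>_def pathstart_compose pathfinish_compose)
 qed
 have int: "path_image (\<gamma> i) \<inter> path_image (\<gamma> j) = {u, v}" if "i < 3" "j < 3" "i \<noteq> j" for i j
  using disj[OF that] sub(1)[OF that(1)] sub(1)[OF that(2)] eDn[OF that(1)] eDn[OF that(2)]
  unfolding img[OF that(1)] img[OF that(2)] D_def[symmetric] by blast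
 have th: "theta_curve (\<gamma> 0) (\<gamma> 1) (\<gamma> 2) u v"
  unfolding theta_curve_def using uvp arcs[of 0] arcs[of 1] arcs[of 2] int[of 0 1] int[of 0 2] int[of 1 2] by simp
 have conK: "connected (K j)" if j: "j < 3" for j
 proof -
  have f: "m j \<noteq> c j" "closed_segment (c j) (m j) \<subseteq> N j" using fact[OF j] by auto
  have "connected (insert (c j) (open_segment (c j) (m j)))"
   by (rule connected_intermediate_closure[of "open_segment (c j) (m j)"])
    (use f segment_open_subset_closed[of "c j" "m j"] in \<open>auto intro: convex_connected convex_open_segment\<close>)
  moreover have "insert (c j) (open_segment (c j) (m j)) \<subseteq> N j"
   using f segment_open_subset_closed[of "c j" "m j"] N[OF j] by blast
  ultimately show ?thesis unfolding K_def using cont[OF j] by (intro connected_continuous_image) (auto intro: continuous_on_subset)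
 qed
 have pK: "p \<in> K j" if "j < 3" for j using ends[OF that] unfolding K_def by auto
 have Kint: "K i \<inter> path_image (\<gamma> j) = {}" if i: "i < 3" and j: "j < 3" for i j
 proof -
  have "p \<notin> path_image (\<gamma> j)" using uvp eDn(3)[OF j] sub(1)[OF j] unfolding img[OF j] by blast
  moreover have "\<psi> i ` open_segment (c i) (m i) \<inter> path_image (\<gamma> j) = {}"
  proof (cases "i = j")
   case False
   then show ?thesis using disj[OF i j] sub(1)[OF j] sub(2)[OF i] eDn[OF i] unfolding img[OF j] D_def[symmetric] by blast
  next
   case True
   have "x = y" if "\<psi> j x = \<psi> j y" "x \<in> open_segment (c j) (m j)" "y \<in> open_segment (\<alpha> j) (\<beta> j)" for x y
   proof -
    have "x \<in> N j \<inter> ball 0 1" "y \<in> N j \<inter> ball 0 1" using fact[OF j] that(2,3) by blast+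
    then show ?thesis using cont[OF j] that(1) by (auto dest: inj_onD)
   qed
   moreover have "open_segment (c j) (m j) \<inter> open_segment (\<alpha> j) (\<beta> j) = {}"
    using fact[OF j] segment_open_subset_closed[of "\<alpha> j" "\<beta> j"] by blast
   ultimately have "\<psi> j ` open_segment (c j) (m j) \<inter> \<psi> j ` open_segment (\<alpha> j) (\<beta> j) = {}" by blast
   then show ?thesis using True sub(2)[OF j] eDn[OF j] unfolding img[OF j] by blast
  qed
  ultimately show ?thesis unfolding K_def using ends[OF i] by auto
 qed
 let ?K = "K 0 \<union> K 1 \<union> K 2"
 have K: "connected ?K"
  by (intro connected_Un conK) (use pK[of 0] pK[of 1] pK[of 2] in auto)
 have d: "?K \<inter> (path_image (\<gamma> 0) \<union> path_image (\<gamma> 1) \<union> path_image (\<gamma> 2)) = {}"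
  using Kint[of 0 0] Kint[of 0 1] Kint[of 0 2] Kint[of 1 0] Kint[of 1 1] Kint[of 1 2] Kint[of 2 0] Kint[of 2 1] Kint[of 2 2] by auto
 have x: "\<psi> j (m j) \<in> closure (K j)" "\<psi> j (m j) \<in> path_image (\<gamma> j) - {u, v}" if j: "j < 3" for j
 proof -
  have f: "m j \<noteq> c j" "closed_segment (c j) (m j) \<subseteq> N j" "m j \<in> open_segment (\<alpha> j) (\<beta> j)" using fact[OF j] by auto
  have "\<psi> j ` closure (open_segment (c j) (m j)) \<subseteq> closure (\<psi> j ` open_segment (c j) (m j))"
  proof (rule image_closure_subset)
   show "continuous_on (closure (open_segment (c j) (m j))) (\<psi> j)" using f cont[OF j] by (auto intro: continuous_on_subset)
  qed (simp_all only: closed_closure closure_subset)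
  moreover have "m j \<in> closure (open_segment (c j) (m j))" using f by simp
  moreover have "closure (\<psi> j ` open_segment (c j) (m j)) \<subseteq> closure (K j)" unfolding K_def by (intro closure_mono) auto
  ultimately show "\<psi> j (m j) \<in> closure (K j)" by blast
  have "\<psi> j (m j) \<in> D j" using sub(1)[OF j] f(3) by blast
  then show "\<psi> j (m j) \<in> path_image (\<gamma> j) - {u, v}" using eDn[OF j] f(3) unfolding img[OF j] by blast
 qed
 have cl: "closure (K 0) \<subseteq> closure ?K" "closure (K 1) \<subseteq> closure ?K" "closure (K 2) \<subseteq> closure ?K"
  by (rule closure_mono; blast)+
 have j: "0 < (3 :: nat)" "1 < (3 :: nat)" "2 < (3 :: nat)" by simp_all
 show False
  by (rule theta_no_triple[OF th K d subsetD[OF cl(1) x(1)[OF j(1)]] x(2)[OF j(1)]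
     subsetD[OF cl(2) x(1)[OF j(2)]] x(2)[OF j(2)] subsetD[OF cl(3) x(1)[OF j(3)]] x(2)[OF j(3)]])
qed

section \<open>An arc lies on at most two sides of the faces\<close>

lemma inner_cis: "cis x \<bullet> cis y = cos (x - y)"
 by (simp add: inner_complex_def cos_diff)

lemma cis_edge_inj:
 assumes "cis (2 * pi * (real i + t) / real k) = cis (2 * pi * (real j + t) / real k)" "i < k" "j < k"
 shows "i = j"
proof -
 have k: "real k > 0" using assms by simp
 have "sin (2 * pi * (real i + t) / real k) = sin (2 * pi * (real j + t) / real k)"
  "cos (2 * pi * (real i + t) / real k) = cos (2 * pi * (real j + t) / real k)"
  using assms(1) by (simp_all add: complex_eq_iff)
 then obtain n :: int where "2 * pi * (real i + t) / real k = 2 * pi * (real j + t) / real k + 2 * pi * of_int n"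
  using sin_cos_eq_iff by metis
 then have "2 * pi * (real i + t) = 2 * pi * (real j + t + of_int n * real k)" using k by (simp add: field_simps)
 then have "real i = real j + of_int n * real k" by simp
 then have "real_of_int (int i) = real_of_int (int j + n * int k)" by simp
 then have n: "int i = int j + n * int k" by linarith
 have "n = 0"
 proof (rule ccontr)
  assume "n \<noteq> 0"
  then consider "n \<ge> 1" | "n \<le> - 1" by linarith
  then show False
  proof cases
   case 1
   then have "1 * int k \<le> n * int k" by (intro mult_right_mono) auto
   then show False using n assms by linarith
  next
   case 2
   then have "n * int k \<le> - 1 * int k" by (intro mult_right_mono) auto
   then show False using n assms by linarith
  qed
 qed
 then show ?thesis using n by simp
qed

text \<open>
 The choice of a radius that works for three given sides.
\<close>

lemma uniform_pos:
 fixes Pr :: "nat \<Rightarrow> real \<Rightarrow> bool"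
 assumes "\<And>j. j < 3 \<Longrightarrow> \<exists>e>0. Pr j e" and mono: "\<And>j e e'. Pr j e \<Longrightarrow> 0 < e' \<Longrightarrow> e' \<le> e \<Longrightarrow> Pr j e'"
 shows "\<exists>e>0. \<forall>j<3. Pr j e"
proof -
 obtain e0 e1 e2 where e: "e0 > 0" "Pr 0 e0" "e1 > 0" "Pr 1 e1" "e2 > 0" "Pr 2 e2"
  using assms(1)[of 0] assms(1)[of 1] assms(1)[of 2] by auto
 define e where "e = min e0 (min e1 e2)"
 have "e > 0" "e \<le> e0" "e \<le> e1" "e \<le> e2" using e by (auto simp: e_def)
 then have "Pr 0 e" "Pr 1 e" "Pr 2 e" using e mono by blast+
 moreover have "j = 0 \<or> j = 1 \<or> j = 2" if "j < 3" for j :: nat using that by linarith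
 ultimately show ?thesis using \<open>e > 0\<close> by blast
qed

lemma polygon_face_side:
 assumes "polygon_face At A F P" "i < poly_sides P" "poly_side P i = (a, d)"
 shows "a \<in> A" "\<forall>t\<in>{0..1}. poly_map P (cis (2 * pi * (real i + t) / real (poly_sides P))) = (if d then a t else reversepath a t)"
proof -
 have "\<forall>i < poly_sides P. case poly_side P i of (a, d) \<Rightarrow> a \<in> A \<and>
   (\<forall>t\<in>{0..1}. poly_map P (cis (2 * pi * (real i + t) / real (poly_sides P))) = (if d then a t else reversepath a t))"
  using assms(1) unfolding polygon_face_def by (elim conjE)
 from this[rule_format, OF assms(2)]
 show "a \<in> A" "\<forall>t\<in>{0..1}. poly_map P (cis (2 * pi * (real i + t) / real (poly_sides P))) = (if d then a t else reversepath a t)"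
  unfolding assms(3) by simp_all
qed

text \<open>
 In a chart around the midpoint of the arc, small half-discs at the midpoints of three sides on this arc would
 contradict \<open>no_three_half_discs\<close>: the map of a polygon is injective on the open disc, different faces are disjoint,
 and no face meets the arc.
\<close>

lemma at_most_two_sides:
 fixes S :: "'s::t2_space set" and F :: "nat \<Rightarrow> 's set" and n :: "nat \<Rightarrow> nat"
 assumes ms: "marked_surface S At M" and ac: "arc_collection S M A" and sp: "splits_surface S At A P"
  and side: "\<And>j. j < 3 \<Longrightarrow> F j \<in> faces S A \<and> n j < poly_sides (P (F j)) \<and> fst (poly_side (P (F j)) (n j)) = a"
  and dist: "\<And>i j. i < 3 \<Longrightarrow> j < 3 \<Longrightarrow> i \<noteq> j \<Longrightarrow> F i = F j \<Longrightarrow> n i \<noteq> n j"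
 shows False
proof -
 define f where "f j = poly_map (P (F j))" for j
 define k where "k j = poly_sides (P (F j))" for j
 define d where "d j = snd (poly_side (P (F j)) (n j))" for j
 define e where "e j t = cis (2 * pi * (real (n j) + t) / real (k j))" for j t
 have pf: "polygon_face At A (F j) (P (F j))" if "j < 3" for j using sp side[OF that] by (simp add: splits_surface_def)
 have nk: "n j < k j" if "j < 3" for j using side[OF that] by (simp add: k_def)
 have sd: "poly_side (P (F j)) (n j) = (a, d j)" if "j < 3" for j using side[OF that] by (simp add: d_def prod_eq_iff)
 have aA: "a \<in> A" using polygon_face_side(1)[OF pf[of 0] _ sd[of 0]] nk[of 0] by (simp add: k_def)
 have fe: "f j (e j t) = (if d j then a t else a (1 - t))" if j: "j < 3" and t: "0 \<le> t" "t \<le> 1" for j t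
  using polygon_face_side(2)[OF pf[OF j] _ sd[OF j]] nk[OF j] t by (simp add: f_def e_def k_def reversepath_def)
 have fc: "continuous_on (cball 0 1) (f j)" if "j < 3" for j using pf[OF that] by (simp add: polygon_face_def f_def)
 have fh: "f j ` ball 0 1 = F j \<and> inj_on (f j) (ball 0 1)" if j: "j < 3" for j
 proof -
  obtain g where g: "homeomorphism (ball 0 1) (F j) (f j) g" using pf[OF j] unfolding polygon_face_def f_def by blast
  then have "inj_on (f j) (ball 0 1)" unfolding homeomorphism_def by (metis inj_on_inverseI)
  then show ?thesis using g by (simp add: homeomorphism_def)
 qed
 have Fsub: "F j \<subseteq> S" "F j \<inter> path_image a = {}" if "j < 3" for j
  using side[OF that] aA in_components_subset[of "F j"] unfolding faces_def by blast+
 have Fdisj: "F i \<inter> F j = {}" if "i < 3" "j < 3" "F i \<noteq> F j" for i j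
  using side[OF that(1)] side[OF that(2)] that(3) components_nonoverlap unfolding faces_def by blast
 have clS: "closed S" using ms by (simp add: marked_surface_def compact_imp_closed)
 have fS: "f j ` cball 0 1 \<subseteq> S" if j: "j < 3" for j
 proof -
  have "f j ` closure (ball 0 1) \<subseteq> S"
   by (rule image_closure_subset) (use fc[OF j] fh[OF j] Fsub[OF j] clS in auto)
  then show ?thesis by simp
 qed
 have sa: "simple_path a" "path_image a \<subseteq> S" using ac aA by (auto simp: arc_collection_def)
 have ainj: "a x = a y \<Longrightarrow> 0 < x \<Longrightarrow> x < 1 \<Longrightarrow> 0 < y \<Longrightarrow> y < 1 \<Longrightarrow> x = y" for x y
  using sa(1) unfolding simple_path_def loop_free_def by (smt (verit) atLeastAtMost_iff)
 have apath: "a x \<in> path_image a" if "0 \<le> x" "x \<le> 1" for x using that by (auto simp: path_image_def)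
 define p where "p = a (1 / 2)"
 have "p \<in> S" using apath[of "1 / 2"] sa by (auto simp: p_def)
 moreover have at: "oriented_atlas S At" using ms by (simp add: marked_surface_def)
 ultimately obtain U \<phi> where U: "(U, \<phi>) \<in> At" "p \<in> U" unfolding oriented_atlas_def by blast
 then have "openin (top_of_set S) U" and "\<exists>g. homeomorphism U (\<phi> ` U) \<phi> g" using at unfolding oriented_atlas_def by blast+
 then obtain Op g where Op: "open Op" "U = S \<inter> Op" and g: "homeomorphism U (\<phi> ` U) \<phi> g" by (auto simp: openin_open)
 have \<phi>c: "continuous_on U \<phi>" and \<phi>i: "inj_on \<phi> U" using g unfolding homeomorphism_def by (auto intro: inj_on_inverseI)
 define c where "c j = e j (1 / 2)" for j
 have fcp: "f j (c j) = p" if "j < 3" for j using fe[OF that, of "1 / 2"] by (simp add: c_def p_def)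
 have ne: "norm (e j t) = 1" for j t by (simp add: e_def)
 have cdist: "c i \<noteq> c j" if "i < 3" "j < 3" "i \<noteq> j" "F i = F j" for i j
 proof
  assume "c i = c j"
  then have "n i = n j" using cis_edge_inj[of "n i" "1 / 2" "k i" "n j"] nk[OF that(1)] nk[OF that(2)] that(4)
   by (simp add: c_def e_def k_def)
  then show False using dist[OF that] by simp
 qed
 have "\<exists>\<delta>>0. \<forall>j<3. (\<forall>z\<in>cball 0 1. dist z (c j) < \<delta> \<longrightarrow> f j z \<in> U) \<and> (\<forall>i<3. i \<noteq> j \<and> F i = F j \<longrightarrow> 2 * \<delta> \<le> dist (c i) (c j))"
 proof (rule uniform_pos)
  fix j :: nat assume j: "j < 3"
  have "openin (top_of_set (cball 0 1)) (cball 0 1 \<inter> f j -` Op)"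
   by (rule continuous_openin_preimage_gen[OF fc[OF j] Op(1)])
  moreover have "c j \<in> cball 0 1 \<inter> f j -` Op" using fcp[OF j] U(2) Op(2) ne by (simp add: c_def)
  ultimately obtain e1 where e1: "e1 > 0" "\<forall>z\<in>cball 0 1. dist z (c j) < e1 \<longrightarrow> z \<in> cball 0 1 \<inter> f j -` Op"
   unfolding openin_euclidean_subtopology_iff by blast
  have "\<exists>e2>0. \<forall>i<3. i \<noteq> j \<and> F i = F j \<longrightarrow> 2 * e2 \<le> dist (c i) (c j)"
  proof (rule uniform_pos)
   fix i :: nat assume i: "i < 3"
   show "\<exists>e>0. i \<noteq> j \<and> F i = F j \<longrightarrow> 2 * e \<le> dist (c i) (c j)"
    using cdist[OF i j] by (cases "i \<noteq> j \<and> F i = F j") (auto intro: exI[of _ "dist (c i) (c j) / 2"] exI[of _ 1])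
  qed auto
  then obtain e2 where e2: "e2 > 0" "\<forall>i<3. i \<noteq> j \<and> F i = F j \<longrightarrow> 2 * e2 \<le> dist (c i) (c j)" by blast
  have "\<forall>z\<in>cball 0 1. dist z (c j) < e1 \<longrightarrow> f j z \<in> U" using e1(2) fS[OF j] Op(2) by blast
  then show "\<exists>\<delta>>0. (\<forall>z\<in>cball 0 1. dist z (c j) < \<delta> \<longrightarrow> f j z \<in> U) \<and> (\<forall>i<3. i \<noteq> j \<and> F i = F j \<longrightarrow> 2 * \<delta> \<le> dist (c i) (c j))"
   using e1(1) e2 by (intro exI[of _ "min e1 e2"]) fastforce
 qed fastforce
 then obtain \<delta> where \<delta>: "\<delta> > 0" "\<And>j z. j < 3 \<Longrightarrow> z \<in> cball 0 1 \<Longrightarrow> dist z (c j) < \<delta> \<Longrightarrow> f j z \<in> U"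
  "\<And>i j. i < 3 \<Longrightarrow> j < 3 \<Longrightarrow> i \<noteq> j \<Longrightarrow> F i = F j \<Longrightarrow> 2 * \<delta> \<le> dist (c i) (c j)" by blast
 have "\<exists>\<eta>>0. \<forall>j<3. \<eta> \<le> 1 / 4 \<and> (\<forall>t. \<bar>t - 1 / 2\<bar> \<le> \<eta> \<longrightarrow> dist (e j t) (c j) < \<delta>)"
 proof (rule uniform_pos)
  fix j :: nat assume "j < 3"
  then have "k j \<noteq> 0" using nk[of j] by simp
  then have "isCont (\<lambda>t. exp (\<i> * complex_of_real (2 * pi * (real (n j) + t) / real (k j)))) (1 / 2)"
   by (intro continuous_intros) auto
  then have "isCont (e j) (1 / 2)" unfolding e_def cis_conv_exp .
  then obtain s where s: "s > 0" "\<forall>t. dist t (1 / 2) < s \<longrightarrow> dist (e j t) (e j (1 / 2)) < \<delta>"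
   using \<delta>(1) unfolding continuous_at_eps_delta by blast
  then show "\<exists>\<eta>>0. \<eta> \<le> 1 / 4 \<and> (\<forall>t. \<bar>t - 1 / 2\<bar> \<le> \<eta> \<longrightarrow> dist (e j t) (c j) < \<delta>)"
   by (intro exI[of _ "min (1 / 4) (s / 2)"]) (auto simp: c_def dist_real_def)
 qed fastforce
 then obtain \<eta> where \<eta>: "\<eta> > 0" "\<eta> \<le> 1 / 4" "\<And>j t. j < 3 \<Longrightarrow> \<bar>t - 1 / 2\<bar> \<le> \<eta> \<Longrightarrow> dist (e j t) (c j) < \<delta>" by force
 \<comment> \<open>A side may run along the arc in either direction; \<open>\<alpha> j\<close> always lies over \<open>u\<close>.\<close>
 define \<alpha> where "\<alpha> j = e j (if d j then 1 / 2 - \<eta> else 1 / 2 + \<eta>)" for j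
 define \<beta> where "\<beta> j = e j (if d j then 1 / 2 + \<eta> else 1 / 2 - \<eta>)" for j
 define u where "u = a (1 / 2 - \<eta>)"
 define v where "v = a (1 / 2 + \<eta>)"
 have fab: "f j (\<alpha> j) = u" "f j (\<beta> j) = v" if "j < 3" for j
  using fe[OF that, of "1 / 2 - \<eta>"] fe[OF that, of "1 / 2 + \<eta>"] \<eta>(1,2) by (auto simp: \<alpha>_def \<beta>_def u_def v_def)
 have uvp: "u \<noteq> v" "p \<noteq> u" "p \<noteq> v"
  using ainj[of "1 / 2 - \<eta>" "1 / 2 + \<eta>"] ainj[of "1 / 2" "1 / 2 - \<eta>"] ainj[of "1 / 2" "1 / 2 + \<eta>"] \<eta>(1,2) by (auto simp: u_def v_def p_def)
 have uvpa: "{u, v, p} \<subseteq> path_image a" using apath \<eta>(1,2) by (auto simp: u_def v_def p_def)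
 define N where "N j = cball 0 1 \<inter> ball (c j) \<delta>" for j
 have N: "\<alpha> j \<in> N j \<and> \<beta> j \<in> N j \<and> c j \<in> N j" if j: "j < 3" for j
  using \<eta>(3)[OF j, of "1 / 2 - \<eta>"] \<eta>(3)[OF j, of "1 / 2 + \<eta>"] \<eta>(1) \<delta>(1) ne
  by (auto simp: N_def \<alpha>_def \<beta>_def c_def dist_commute)
 have fN: "f j ` N j \<subseteq> U" if j: "j < 3" for j using \<delta>(2)[OF j] by (auto simp: N_def dist_commute)
 have fB: "f j ` (N j \<inter> ball 0 1) \<subseteq> U" if j: "j < 3" for j by (rule subset_trans[OF image_mono fN[OF j]]) simp
 have UU: "{u, v, p} \<subseteq> U" using fN[of 0] N[of 0] fab[of 0] fcp[of 0] by auto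
 have disjf: "f i ` (N i \<inter> ball 0 1) \<inter> f j ` (N j \<inter> ball 0 1) = {}" if ij: "i < 3" "j < 3" "i \<noteq> j" for i j
 proof (cases "F i = F j")
  case False
  then show ?thesis using Fdisj[OF ij(1,2)] fh[OF ij(1)] fh[OF ij(2)] by blast
 next
  case True
  have "ball (c i) \<delta> \<inter> ball (c j) \<delta> = {}"
  proof (rule ccontr)
   assume "ball (c i) \<delta> \<inter> ball (c j) \<delta> \<noteq> {}"
   then obtain z where "dist (c i) z < \<delta>" "dist (c j) z < \<delta>" by auto
   then have "dist (c i) (c j) < 2 * \<delta>" using dist_triangle2[of "c i" "c j" z] by linarith
   then show False using \<delta>(3)[OF ij True] by linarith
  qed
  moreover have "f i = f j" using True by (simp add: f_def)
  moreover have "inj_on (f j) (ball 0 1)" using fh[OF ij(2)] by blast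
  ultimately show ?thesis unfolding N_def by (auto simp: inj_on_def)
 qed
 show False
 proof (rule no_three_half_discs[where N = N and \<psi> = "\<lambda>j. \<phi> \<circ> f j" and \<alpha> = \<alpha> and \<beta> = \<beta> and c = c and u = "\<phi> u" and v = "\<phi> v" and p = "\<phi> p"])
  fix j :: nat assume j: "j < 3"
  show "convex (N j) \<and> N j \<subseteq> cball 0 1 \<and> c j \<in> N j \<and> \<alpha> j \<in> N j \<and> \<beta> j \<in> N j"
   using N[OF j] by (auto simp: N_def intro: convex_Int)
  show "norm (c j) = 1 \<and> norm (\<alpha> j) = 1 \<and> norm (\<beta> j) = 1" using ne by (simp add: c_def \<alpha>_def \<beta>_def)
  show "c j \<bullet> \<alpha> j = c j \<bullet> \<beta> j \<and> c j \<bullet> \<alpha> j < 1"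
  proof -
   have kp: "real (k j) \<ge> 1" using nk[OF j] by simp
   let ?x = "2 * pi * \<eta> / real (k j)"
   have "2 * pi * (real (n j) + 1 / 2) / real (k j) - 2 * pi * (real (n j) + (1 / 2 - \<eta>)) / real (k j) = ?x"
    "2 * pi * (real (n j) + 1 / 2) / real (k j) - 2 * pi * (real (n j) + (1 / 2 + \<eta>)) / real (k j) = - ?x"
    using kp by (simp_all add: field_simps)
   then have "c j \<bullet> e j (1 / 2 - \<eta>) = cos ?x" "c j \<bullet> e j (1 / 2 + \<eta>) = cos ?x"
    unfolding c_def e_def inner_cis by (simp_all only: cos_minus)
   moreover have "0 < ?x" using \<eta>(1) kp by simp
   moreover have "?x \<le> pi"
   proof -
    have "2 * pi * \<eta> / real (k j) \<le> 2 * pi * \<eta> / 1" using kp \<eta>(1) by (intro divide_left_mono) auto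
    also have "\<dots> \<le> 2 * pi * (1 / 4) / 1" using \<eta>(2) by simp
    finally show ?thesis using pi_gt_zero by linarith
   qed
   then have "cos ?x < 1" using cos_monotone_0_pi[of 0 ?x] \<open>0 < ?x\<close> by simp
   ultimately show ?thesis by (simp add: \<alpha>_def \<beta>_def)
  qed
  show "continuous_on (N j) (\<phi> \<circ> f j) \<and> inj_on (\<phi> \<circ> f j) (N j \<inter> ball 0 1)"
  proof
   show "continuous_on (N j) (\<phi> \<circ> f j)"
   proof (rule continuous_on_compose)
    show "continuous_on (N j) (f j)" by (rule continuous_on_subset[OF fc[OF j]]) (simp add: N_def)
    show "continuous_on (f j ` N j) \<phi>" by (rule continuous_on_subset[OF \<phi>c fN[OF j]])
   qed
   show "inj_on (\<phi> \<circ> f j) (N j \<inter> ball 0 1)"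
   proof (rule comp_inj_on)
    show "inj_on (f j) (N j \<inter> ball 0 1)" by (rule inj_on_subset[OF conjunct2[OF fh[OF j]]]) simp
    show "inj_on \<phi> (f j ` (N j \<inter> ball 0 1))" by (rule inj_on_subset[OF \<phi>i fB[OF j]])
   qed
  qed
  have "f j ` (N j \<inter> ball 0 1) \<inter> {u, v, p} = {}" using fh[OF j] Fsub(2)[OF j] uvpa by blast
  then have "\<phi> ` (f j ` (N j \<inter> ball 0 1)) \<inter> \<phi> ` {u, v, p} = {}"
   unfolding inj_on_image_Int[OF \<phi>i fB[OF j] UU, symmetric] by (simp only: image_empty)
  then show "(\<phi> \<circ> f j) (\<alpha> j) = \<phi> u \<and> (\<phi> \<circ> f j) (\<beta> j) = \<phi> v \<and> (\<phi> \<circ> f j) (c j) = \<phi> p \<and>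
    (\<phi> \<circ> f j) ` (N j \<inter> ball 0 1) \<inter> {\<phi> u, \<phi> v, \<phi> p} = {}"
   using fab[OF j] fcp[OF j] by (simp add: image_comp)
 next
  fix i j :: nat assume ij: "i < 3" "j < 3" "i \<noteq> j"
  have "\<phi> ` (f i ` (N i \<inter> ball 0 1)) \<inter> \<phi> ` (f j ` (N j \<inter> ball 0 1)) = {}"
   unfolding inj_on_image_Int[OF \<phi>i fB[OF ij(1)] fB[OF ij(2)], symmetric] disjf[OF ij] by (rule image_empty)
  then show "(\<phi> \<circ> f i) ` (N i \<inter> ball 0 1) \<inter> (\<phi> \<circ> f j) ` (N j \<inter> ball 0 1) = {}" by (simp add: image_comp)
 next
  show "\<phi> u \<noteq> \<phi> v" "\<phi> p \<noteq> \<phi> u" "\<phi> p \<noteq> \<phi> v" using uvp UU \<phi>i by (auto simp: inj_on_def)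
 qed
qed

section \<open>Tree-gons as words\<close>

lemma append_Cons_eq_append_ConsD:
 assumes "A @ x # B = C @ y # D"
 shows "(\<exists>E. C = A @ x # E \<and> B = E @ y # D) \<or> (A = C \<and> x = y \<and> B = D) \<or> (\<exists>E. A = C @ y # E \<and> D = E @ x # B)"
 using assms by (auto simp: append_eq_append_conv2 Cons_eq_append_conv append_eq_Cons_conv)

text \<open>
 The elements of \<open>Ar\<close> are the corners of faces; \<open>nx x\<close> is the next corner of the same face in the order in
 which words are written, and \<open>per x\<close> is the number of corners of that face.  The relation \<open>cmp a b\<close> says that \<open>b\<close>
 followed by \<open>a\<close> is a path, and this path is zero iff \<open>b = nx a\<close>.  The last two assumptions are the gentle condition.
\<close>

locale face_structure =
 fixes Ar :: "'e set" and nx pv :: "'e \<Rightarrow> 'e" and per :: "'e \<Rightarrow> nat" and cmp :: "'e \<Rightarrow> 'e \<Rightarrow> bool"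
 assumes nx_in [simp]: "x \<in> Ar \<Longrightarrow> nx x \<in> Ar"
  and pv_in [simp]: "x \<in> Ar \<Longrightarrow> pv x \<in> Ar"
  and pv_nx [simp]: "x \<in> Ar \<Longrightarrow> pv (nx x) = x"
  and nx_pv [simp]: "x \<in> Ar \<Longrightarrow> nx (pv x) = x"
  and per_ge: "x \<in> Ar \<Longrightarrow> 3 \<le> per x"
  and per_nx [simp]: "x \<in> Ar \<Longrightarrow> per (nx x) = per x"
  and funpow_nx_eq: "x \<in> Ar \<Longrightarrow> (nx ^^ i) x = x \<longleftrightarrow> per x dvd i"
  and cmp_in: "cmp a b \<Longrightarrow> a \<in> Ar \<and> b \<in> Ar"
  and cmp_nx [simp]: "x \<in> Ar \<Longrightarrow> cmp x (nx x)"
  and cmp_square: "\<lbrakk>cmp a b; cmp a' b; cmp a' b'\<rbrakk> \<Longrightarrow> cmp a b'"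
  and gentle_right: "\<lbrakk>cmp a b; b \<noteq> nx a; cmp a b'; b' \<noteq> nx a\<rbrakk> \<Longrightarrow> b = b'"
  and gentle_left: "\<lbrakk>cmp a b; b \<noteq> nx a; cmp a' b; b \<noteq> nx a'\<rbrakk> \<Longrightarrow> a = a'"
begin

text \<open>
 The product \<open>a b\<close> of two arrows is a path and non-zero.
\<close>

definition nzc :: "'e \<Rightarrow> 'e \<Rightarrow> bool" where
 "nzc a b \<longleftrightarrow> cmp a b \<and> b \<noteq> nx a"

lemma nzc_in: "nzc a b \<Longrightarrow> a \<in> Ar \<and> b \<in> Ar"
 using cmp_in nzc_def by blast

lemma nzc_right_unique: "nzc a b \<Longrightarrow> nzc a b' \<Longrightarrow> b = b'"
 using gentle_right unfolding nzc_def by blast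

lemma nzc_left_unique: "nzc a b \<Longrightarrow> nzc a' b \<Longrightarrow> a = a'"
 using gentle_left unfolding nzc_def by blast

lemma nx_inj: "x \<in> Ar \<Longrightarrow> y \<in> Ar \<Longrightarrow> nx x = nx y \<Longrightarrow> x = y"
 by (metis pv_nx)

lemma funpow_nx_in [simp]: "x \<in> Ar \<Longrightarrow> (nx ^^ i) x \<in> Ar"
 by (induction i) auto

lemma per_pv [simp]: "x \<in> Ar \<Longrightarrow> per (pv x) = per x"
 by (metis nx_pv per_nx pv_in)

text \<open>The corners of the face of \<open>x\<close>, starting with \<open>x\<close>.\<close>

text \<open>
 The corners of the face of \<open>x\<close>, starting with \<open>x\<close> and ending with \<open>pv x\<close>.
\<close>

definition fw :: "'e \<Rightarrow> 'e list" where
 "fw x = map (\<lambda>i. (nx ^^ i) x) [0..<per x]"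

definition mid :: "'e \<Rightarrow> 'e list" where
 "mid x = map (\<lambda>i. (nx ^^ i) x) [1..<per x - 1]"

abbreviation sing :: "'e list \<Rightarrow> 'e list list" where
 "sing \<equiv> map (\<lambda>y. [y])"

lemma funpow_per: "x \<in> Ar \<Longrightarrow> (nx ^^ per x) x = x"
 by (simp add: funpow_nx_eq)

lemma funpow_pred_per: "x \<in> Ar \<Longrightarrow> (nx ^^ (per x - 1)) x = pv x"
proof -
 assume x: "x \<in> Ar"
 then have "per x = Suc (per x - 1)" using per_ge[OF x] by simp
 then have "nx ((nx ^^ (per x - 1)) x) = x" using funpow_per[OF x] by (metis funpow.simps(2) o_apply)
 then show ?thesis using x pv_nx[of "(nx ^^ (per x - 1)) x"] by simp
qed

lemma per_Suc_Suc: "x \<in> Ar \<Longrightarrow> \<exists>n. per x = Suc (Suc n) \<and> n \<noteq> 0"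
 by (rule exI[of _ "per x - 2"]) (use per_ge[of x] in linarith)

lemma mid_eq: "per x = Suc (Suc n) \<Longrightarrow> mid x = map (\<lambda>i. (nx ^^ Suc i) x) [0..<n]"
proof -
 assume "per x = Suc (Suc n)"
 then have "per x - 1 = Suc n" by simp
 then show ?thesis
  unfolding mid_def One_nat_def by (simp only: map_Suc_upt[symmetric] map_map o_def)
qed

lemma fw_eq: "x \<in> Ar \<Longrightarrow> fw x = x # mid x @ [pv x]"
proof -
 assume x: "x \<in> Ar"
 obtain n where n: "per x = Suc (Suc n)" using per_Suc_Suc[OF x] by blast
 have l: "(nx ^^ Suc n) x = pv x" using funpow_pred_per[OF x] unfolding n diff_Suc_1 .
 have "fw x = map (\<lambda>i. (nx ^^ i) x) (0 # map Suc [0..<Suc n])"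
  unfolding fw_def n map_Suc_upt by (simp only: upt_conv_Cons zero_less_Suc)
 also have "\<dots> = x # map (\<lambda>i. (nx ^^ Suc i) x) [0..<Suc n]"
  by (simp only: list.map map_map o_def funpow_0)
 also have "\<dots> = x # mid x @ [pv x]"
  unfolding mid_eq[OF n] upt_Suc_append[OF le0] map_append list.map l ..
 finally show ?thesis .
qed

lemma fw_nx: "x \<in> Ar \<Longrightarrow> fw (nx x) = mid x @ [pv x, x]"
proof -
 assume x: "x \<in> Ar"
 obtain n where n: "per x = Suc (Suc n)" using per_Suc_Suc[OF x] by blast
 have l: "(nx ^^ Suc n) x = pv x" using funpow_pred_per[OF x] unfolding n diff_Suc_1 .
 have l': "(nx ^^ Suc (Suc n)) x = x" using funpow_per[OF x] unfolding n .
 have "fw (nx x) = map (\<lambda>i. (nx ^^ Suc i) x) [0..<Suc (Suc n)]"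
  unfolding fw_def per_nx[OF x] n by (simp only: funpow_Suc_right o_apply)
 also have "\<dots> = mid x @ [pv x, x]"
  unfolding mid_eq[OF n] upt_Suc_append[OF le0] map_append list.map l l' append_assoc append.simps ..
 finally show ?thesis .
qed

lemma mid_ne: "x \<in> Ar \<Longrightarrow> mid x \<noteq> []"
proof -
 assume "x \<in> Ar"
 with per_Suc_Suc show ?thesis using mid_eq by fastforce
qed

lemma length_fw [simp]: "length (fw x) = per x"
 by (simp add: fw_def)

lemma set_fw: "x \<in> Ar \<Longrightarrow> set (fw x) \<subseteq> Ar"
 by (auto simp: fw_def)

lemma fw_ne [simp]: "x \<in> Ar \<Longrightarrow> fw x \<noteq> []"
 by (simp add: fw_eq)

text \<open>
 Lists of paths that are tree-gons, each path given by its list of arrows.  It suffices to glue single faces (ears)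
 to a tree-gon, at a place between two neighbouring entries that become longer; this
 permits inductions that add one face at a time.
\<close>

inductive tg :: "'e list list \<Rightarrow> bool" where
 face: "x \<in> Ar \<Longrightarrow> tg (sing (fw x))"
| ear: "\<lbrakk>tg (L @ [b, c] @ R); nzc (last b) x; nzc (pv x) (hd c)\<rbrakk>
  \<Longrightarrow> tg (L @ [b @ [x]] @ sing (mid x) @ [pv x # c] @ R)"

lemma tg_ne: "tg w \<Longrightarrow> [] \<notin> set w"
 by (induction rule: tg.induct) auto

lemma tg_length: "tg w \<Longrightarrow> 3 \<le> length w"
 by (induction rule: tg.induct) (auto simp: per_ge)

lemma tg_ear': "tg (L @ [b, c] @ R) \<Longrightarrow> b' = b @ [x] \<Longrightarrow> c' = pv x # c \<Longrightarrow>
  nzc (last b) x \<Longrightarrow> nzc (pv x) (hd c) \<Longrightarrow> w = L @ [b'] @ sing (mid x) @ [c'] @ R \<Longrightarrow> tg w"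
 using ear by auto

text \<open>
 By induction on the tree-gon that is glued in: its faces can be glued one after the other.
\<close>

lemma tg_glue:
 assumes "tg (L @ [b, c] @ R)" "tg (u1 # U @ [u2])" "nzc (last b) (hd u1)" "nzc (last u2) (hd c)"
 shows "tg (L @ [b @ u1] @ U @ [u2 @ c] @ R)"
proof -
 have "tg (L @ [b @ u1] @ U @ [u2 @ c] @ R)"
  if "tg v" "v = u1 # U @ [u2]" "nzc (last b) (hd u1)" "nzc (last u2) (hd c)" for v u1 U u2
  using that
 proof (induction arbitrary: u1 U u2 rule: tg.induct)
  case (face x)
  then have "u1 = [x]" "U = sing (mid x)" "u2 = [pv x]" by (auto simp: fw_eq)
  with face assms(1) show ?case using ear by auto
 next
  case (ear L' b' c' R' x)
  have ne: "b' \<noteq> []" "c' \<noteq> []" using tg_ne[OF ear.hyps(1)] by auto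
  consider "L' = []" "R' = []" | l L'' where "L' = l # L''" "R' = []"
   | R'' r where "L' = []" "R' = R'' @ [r]" | l L'' R'' r where "L' = l # L''" "R' = R'' @ [r]"
   by (metis neq_Nil_conv rev_exhaust)
  then show ?case
  proof cases
   case 1
   with ear have e: "u1 = b' @ [x]" "U = sing (mid x)" "u2 = pv x # c'" by auto
   have "tg (L @ [b @ b'] @ [] @ [c' @ c] @ R)"
    using ear.IH[of b' "[]" c'] ear.prems e 1 ne by (auto simp: hd_append)
   then have "tg (L @ [b @ b', c' @ c] @ R)" by simp
   from tg_ear'[OF this refl refl] show ?thesis using ear.hyps e ne by (auto simp: hd_append)
  next
   case 2
   with ear have e: "u1 = l" "U = L'' @ [b' @ [x]] @ sing (mid x)" "u2 = pv x # c'" by auto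
   have "tg (L @ [b @ l] @ (L'' @ [b']) @ [c' @ c] @ R)"
    using ear.IH[of l "L'' @ [b']" c'] ear.prems e 2 ne by (auto simp: hd_append)
   then have "tg ((L @ [b @ l] @ L'') @ [b', c' @ c] @ R)" by simp
   from tg_ear'[OF this refl refl] show ?thesis using ear.hyps e ne by (auto simp: hd_append)
  next
   case 3
   with ear have e: "u1 = b' @ [x]" "U = sing (mid x) @ [pv x # c'] @ R''" "u2 = r" by auto
   have "tg (L @ [b @ b'] @ (c' # R'') @ [r @ c] @ R)"
    using ear.IH[of b' "c' # R''" r] ear.prems e 3 ne by (auto simp: hd_append)
   then have "tg (L @ [b @ b', c'] @ R'' @ [r @ c] @ R)" by simp
   from tg_ear'[OF this refl refl] show ?thesis using ear.hyps e ne by (auto simp: hd_append)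
  next
   case 4
   with ear have e: "u1 = l" "U = L'' @ [b' @ [x]] @ sing (mid x) @ [pv x # c'] @ R''" "u2 = r" by auto
   have "tg (L @ [b @ l] @ (L'' @ b' # c' # R'') @ [r @ c] @ R)"
    using ear.IH[of l "L'' @ b' # c' # R''" r] ear.prems e 4 ne by (auto simp: hd_append)
   then have "tg ((L @ [b @ l] @ L'') @ [b', c'] @ R'' @ [r @ c] @ R)" by simp
   from tg_ear'[OF this refl refl] show ?thesis using ear.hyps e ne by (auto simp: hd_append)
  qed
 qed
 from this[OF assms(2) refl assms(3,4)] show ?thesis .
qed

text \<open>
 Only an ear at the place between the last and the first entry needs an argument: it amounts to gluing
 the old tree-gon to the new face, which is possible by \<open>tg_glue\<close>.
\<close>

lemma tg_rotate: "tg (z # w) \<Longrightarrow> tg (w @ [z])"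
proof -
 have "tg (w @ [z])" if "tg v" "v = z # w" for v z w
  using that
 proof (induction arbitrary: z w rule: tg.induct)
  case (face x)
  then have "w @ [z] = sing (mid x @ [pv x, x])" by (auto simp: fw_eq)
  then have "w @ [z] = sing (fw (nx x))" using face by (simp only: fw_nx)
  then show ?case using tg.face[of "nx x"] face by simp
 next
  case (ear L b c R x)
  show ?case
  proof (cases L)
   case Nil
   with ear have e: "z = b @ [x]" "w = sing (mid x) @ [pv x # c] @ R" by auto
   have x: "x \<in> Ar" using ear nzc_in by blast
   have ne: "b \<noteq> []" "c \<noteq> []" using tg_ne[OF ear.hyps(1)] by auto
   have 1: "tg (c # R @ [b])" using ear.IH[of b "c # R"] Nil by simp
   have 2: "tg (sing (mid x) @ [[pv x], [x]] @ [])" using tg.face[of "nx x"] x by (simp add: fw_nx)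
   show ?thesis using tg_glue[OF 2 1] ear e by simp
  next
   case (Cons l L')
   with ear have e: "z = l" "w = L' @ [b @ [x]] @ sing (mid x) @ [pv x # c] @ R" by auto
   have "tg (L' @ [b, c] @ (R @ [l]))" using ear.IH[of l "L' @ [b,c] @ R"] Cons by simp
   from tg.ear[OF this] show ?thesis using ear e by simp
  qed
 qed
 then show "tg (z # w) \<Longrightarrow> ?thesis" by simp
qed

lemma tg_rotate_append: "tg (u @ v) \<Longrightarrow> tg (v @ u)"
proof (induction u arbitrary: v)
 case (Cons a u)
 from tg_rotate[of a "u @ v"] Cons.prems Cons.IH[of "v @ [a]"] show ?case by simp
qed simp

lemma tg_adj: "tg w \<Longrightarrow> successively (\<lambda>a b. hd b = nx (last a)) w \<and> hd (hd w) = nx (last (last w))"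
proof (induction rule: tg.induct)
 case (face x)
 have "successively (\<lambda>a b. hd b = nx (last a)) (sing (fw x))"
  by (auto simp: successively_conv_nth fw_def)
 then show ?case using face by (simp add: fw_eq)
next
 case (ear L b c R x)
 have ne: "b \<noteq> []" "c \<noteq> []" using tg_ne[OF ear.hyps(1)] by auto
 have x: "x \<in> Ar" using ear nzc_in by blast
 have "successively (\<lambda>a b. hd b = nx (last a)) (sing (fw x))"
  by (auto simp: successively_conv_nth fw_def)
 then have s: "successively (\<lambda>a b. hd b = nx (last a)) ([x] # sing (mid x) @ [[pv x]])" using x by (simp add: fw_eq)
 obtain m ms where m: "mid x = m # ms" using mid_ne[OF x] by (cases "mid x") auto
 show ?case using ear.IH s ne m
  by (cases L; cases R; auto simp: successively_append_iff successively_Cons hd_append last_append split: if_splits)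
qed

lemma tg_nzl: "tg w \<Longrightarrow> a \<in> set w \<Longrightarrow> set a \<subseteq> Ar \<and> successively nzc a"
proof (induction arbitrary: a rule: tg.induct)
 case (face x)
 then show ?case using set_fw[of x] by auto
next
 case (ear L b c R x)
 have ne: "b \<noteq> []" "c \<noteq> []" using tg_ne[OF ear.hyps(1)] by auto
 have x: "x \<in> Ar" using ear nzc_in by blast
 then have "set (mid x) \<subseteq> Ar" using set_fw[of x] by (simp add: fw_eq)
 then show ?case using ear.prems ear.IH[of b] ear.IH[of c] ear.IH[of a] ear.hyps ne x
  by (auto simp: successively_append_iff successively_Cons)
qed

lemma in_singD: "a \<in> set (sing xs) \<Longrightarrow> length a = 1" by auto

text \<open>
 The corners of a face in succession leave no room for another face: a tree-gon
 that begins like a face stops where the face closes up.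
\<close>

lemma face_start:
 "tg w \<Longrightarrow> w = sing (x # mid x) @ [pv x # y] @ C \<Longrightarrow> x \<in> Ar \<Longrightarrow> y = [] \<and> C = []"
proof (induction arbitrary: y C rule: tg.induct)
 case (face x')
 then have "x' = x" by (simp add: fw_eq)
 with face show ?case by (simp add: fw_eq)
next
 case (ear L b c R x')
 have ne: "b \<noteq> []" "c \<noteq> []" using tg_ne[OF ear.hyps(1)] by auto
 have "L @ (b @ [x']) # (sing (mid x') @ (pv x' # c) # R) = sing (x # mid x) @ (pv x # y) # C"
  using ear.prems by simp
 from append_Cons_eq_append_ConsD[OF this] show ?case
 proof (elim disjE exE conjE)
  fix E assume "sing (x # mid x) = L @ (b @ [x']) # E"
  then have "b @ [x'] \<in> set (sing (x # mid x))" by simp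
  from in_singD[OF this] ne show ?thesis by simp
 next
  assume e: "L = sing (x # mid x)" "b @ [x'] = pv x # y"
  with ne obtain y' where "b = pv x # y'" by (cases b) auto
  with ear.IH[of y' "c # R"] ear.prems e show ?thesis by simp
 next
  fix E assume "L = sing (x # mid x) @ (pv x # y) # E"
  with ear.IH[of y "E @ [b,c] @ R"] ear.prems show ?thesis by simp
 qed
qed

lemma face_end:
 "tg w \<Longrightarrow> w = C @ [y @ [x]] @ sing (mid x @ [pv x]) \<Longrightarrow> x \<in> Ar \<Longrightarrow> y = [] \<and> C = []"
proof (induction arbitrary: y C rule: tg.induct)
 case (face x')
 then have "sing (x' # mid x') @ [[pv x']] = (C @ [y @ [x]] @ sing (mid x)) @ [[pv x]]" by (simp add: fw_eq)
 then have "pv x' = pv x" by (simp only: append1_eq_conv list.inject)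
 then have "x' = x" using face by (metis nx_pv)
 with face have "C @ [y @ [x]] = [[x]]" by (simp add: fw_eq)
 then show ?case by (simp add: append_eq_Cons_conv)
next
 case (ear L b c R x')
 have ne: "b \<noteq> []" "c \<noteq> []" using tg_ne[OF ear.hyps(1)] by auto
 have "(L @ [b @ [x']] @ sing (mid x')) @ (pv x' # c) # R = C @ (y @ [x]) # sing (mid x @ [pv x])"
  using ear.prems by simp
 from append_Cons_eq_append_ConsD[OF this] show ?case
 proof (elim disjE exE conjE)
  fix E assume "R = E @ (y @ [x]) # sing (mid x @ [pv x])"
  with ear.IH[of "L @ [b,c] @ E" y] ear.prems show ?thesis by simp
 next
  assume e: "R = sing (mid x @ [pv x])" "pv x' # c = y @ [x]"
  with ne obtain y' where "c = y' @ [x]" by (cases y) auto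
  with ear.IH[of "L @ [b]" y'] ear.prems e show ?thesis by simp
 next
  fix E assume "sing (mid x @ [pv x]) = E @ (pv x' # c) # R"
  then have "pv x' # c \<in> set (sing (mid x @ [pv x]))" by simp
  from in_singD[OF this] ne show ?thesis by simp
 qed
qed

text \<open>
 Ears at different places do not interfere, so any ear of a tree-gon may be taken to be the one that is
 glued last.
\<close>

lemma tg_ear_cut:
 "tg w \<Longrightarrow> w = L @ [b @ [x]] @ sing (mid x) @ [pv x # c] @ R \<Longrightarrow> b \<noteq> [] \<Longrightarrow> c \<noteq> [] \<Longrightarrow> x \<in> Ar
  \<Longrightarrow> tg (L @ [b, c] @ R)"
proof (induction arbitrary: L b x c R rule: tg.induct)
 case (face x')
 then have "b @ [x] \<in> set (sing (fw x'))" by simp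
 from in_singD[OF this] face show ?case by simp
next
 case (ear L' b' c' R' x')
 have ne: "b' \<noteq> []" "c' \<noteq> []" using tg_ne[OF ear.hyps(1)] by auto
 let ?Z = "sing (mid x) @ (pv x # c) # R" and ?Z' = "sing (mid x') @ (pv x' # c') # R'"
 have "L @ (b @ [x]) # ?Z = L' @ (b' @ [x']) # ?Z'" using ear.prems by simp
 from append_Cons_eq_append_ConsD[OF this] show ?case
 proof (elim disjE exE conjE)
  fix E assume L': "L' = L @ (b @ [x]) # E" and "?Z = E @ (b' @ [x']) # ?Z'"
  from append_Cons_eq_append_ConsD[OF this(2)] show ?thesis
  proof (elim disjE exE conjE)
   fix E2 assume e: "E = sing (mid x) @ (pv x # c) # E2" "R = E2 @ (b' @ [x']) # ?Z'"
   have "tg (L @ [b, c] @ (E2 @ [b', c'] @ R'))" using ear.IH[of L b x c] ear.prems e L' by simp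
   then have "tg ((L @ [b, c] @ E2) @ [b', c'] @ R')" by simp
   from tg.ear[OF this ear.hyps(2,3)] show ?thesis using e by simp
  next
   assume e: "sing (mid x) = E" "pv x # c = b' @ [x']" "R = ?Z'"
   then obtain c'' where c'': "c = c'' @ [x']" "b' = pv x # c''" using ne by (cases b') auto
   show ?thesis
   proof (cases "c'' = []")
    case True
    with ear.hyps(1) L' e c'' have "tg ((L @ [b @ [x]] @ sing (mid x @ [pv x])) @ (c' # R'))" by simp
    from tg_rotate_append[OF this] face_end[of _ "c' # R' @ L" b x] ear.prems show ?thesis by simp
   next
    case False
    have "tg (L @ [b, c''] @ (c' # R'))" using ear.IH[of L b x c'' "c' # R'"] ear.prems e L' c'' False by simp
    then have "tg ((L @ [b]) @ [c'', c'] @ R')" by simp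
    from tg.ear[OF this, of x'] show ?thesis using ear.hyps c'' e False by simp
   qed
  next
   fix E2 assume "sing (mid x) = E @ (b' @ [x']) # E2"
   then have "b' @ [x'] \<in> set (sing (mid x))" by simp
   from in_singD[OF this] ne show ?thesis by simp
  qed
 next
  assume "L = L'" "b @ [x] = b' @ [x']" "?Z = ?Z'"
  with ear.hyps show ?thesis by simp
 next
  fix E assume L: "L = L' @ (b' @ [x']) # E" and "?Z' = E @ (b @ [x]) # ?Z"
  from append_Cons_eq_append_ConsD[OF this(2)] show ?thesis
  proof (elim disjE exE conjE)
   fix E2 assume e: "E = sing (mid x') @ (pv x' # c') # E2" "R' = E2 @ (b @ [x]) # ?Z"
   have "tg ((L' @ [b', c'] @ E2) @ [b, c] @ R)" using ear.IH[of "L' @ [b', c'] @ E2" b x c R] ear.prems e by simp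
   then have "tg (L' @ [b', c'] @ (E2 @ [b, c] @ R))" by simp
   from tg.ear[OF this ear.hyps(2,3)] show ?thesis using e L by simp
  next
   assume e: "sing (mid x') = E" "pv x' # c' = b @ [x]" "R' = ?Z"
   then obtain c'' where c'': "c' = c'' @ [x]" "b = pv x' # c''" using ear.prems by (cases b) auto
   show ?thesis
   proof (cases "c'' = []")
    case True
    with ear.hyps(1) L e c'' have "tg ((L' @ [b']) @ (sing (x # mid x) @ [pv x # c] @ R))" by simp
    from tg_rotate_append[OF this] face_start[of _ x c "R @ L' @ [b']"] ear.prems show ?thesis by simp
   next
    case False
    have "tg ((L' @ [b']) @ [c'', c] @ R)"
     using ear.IH[of "L' @ [b']" c'' x c R] ear.prems e c'' False by simp
    then have "tg (L' @ [b', c''] @ (c # R))" by simp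
    from tg.ear[OF this, of x'] show ?thesis using ear.hyps c'' e False L by simp
   qed
  next
   fix E2 assume "sing (mid x') = E @ (b @ [x]) # E2"
   then have "b @ [x] \<in> set (sing (mid x'))" by simp
   from in_singD[OF this] ear.prems show ?thesis by simp
  qed
 qed
qed

text \<open>
 A tree-gon is determined by the way in which it starts: the walk around its boundary cannot go on after
 the boundary has closed up.
\<close>

lemma tg_prefix_free: "tg u \<Longrightarrow> u = B @ [z] \<Longrightarrow> tg (B @ [z @ y] @ C) \<Longrightarrow> y = [] \<and> C = []"
proof (induction arbitrary: B z y C rule: tg.induct)
 case (face x)
 then have "B = sing (x # mid x)" "z = [pv x]" by (simp_all add: fw_eq)
 with face face_start[of _ x y C] show ?case by simp
next
 case (ear L b c R x)
 have ne: "b \<noteq> []" "c \<noteq> []" using tg_ne[OF ear.hyps(1)] by auto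
 have x: "x \<in> Ar" using ear nzc_in by blast
 show ?case
 proof (cases R rule: rev_cases)
  case Nil
  with ear.prems have e: "B = L @ [b @ [x]] @ sing (mid x)" "z = pv x # c" by simp_all
  have "tg (L @ [b, c @ y] @ C)" using tg_ear_cut[OF ear.prems(2), of L b x "c @ y" C] e ne x by simp
  then show ?thesis using ear.IH[of "L @ [b]" c y C] Nil by simp
 next
  case (snoc R' r)
  with ear.prems have e: "B = L @ [b @ [x]] @ sing (mid x) @ [pv x # c] @ R'" "z = r" by simp_all
  have "tg (L @ [b, c] @ (R' @ [r @ y] @ C))"
   using tg_ear_cut[OF ear.prems(2), of L b x c "R' @ [r @ y] @ C"] e ne x by simp
  then show ?thesis using ear.IH[of "L @ [b, c] @ R'" r y C] snoc by simp
 qed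
qed

lemma tg_suffix_free: "tg u \<Longrightarrow> u = z # B \<Longrightarrow> tg (C @ [y @ z] @ B) \<Longrightarrow> y = [] \<and> C = []"
proof (induction arbitrary: B z y C rule: tg.induct)
 case (face x)
 then have "B = sing (mid x @ [pv x])" "z = [x]" by (simp_all add: fw_eq)
 with face face_end[of _ C y x] show ?case by simp
next
 case (ear L b c R x)
 have ne: "b \<noteq> []" "c \<noteq> []" using tg_ne[OF ear.hyps(1)] by auto
 have x: "x \<in> Ar" using ear nzc_in by blast
 show ?case
 proof (cases L)
  case Nil
  with ear.prems have e: "B = sing (mid x) @ [pv x # c] @ R" "z = b @ [x]" by simp_all
  have "tg (C @ [y @ b, c] @ R)" using tg_ear_cut[OF ear.prems(2), of C "y @ b" x c R] e ne x by simp
  then show ?thesis using ear.IH[of b "c # R" C y] Nil by simp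
 next
  case (Cons l L')
  with ear.prems have e: "B = L' @ [b @ [x]] @ sing (mid x) @ [pv x # c] @ R" "z = l" by simp_all
  have "tg ((C @ [y @ l] @ L') @ [b, c] @ R)"
   using tg_ear_cut[OF ear.prems(2), of "C @ [y @ l] @ L'" b x c R] e ne x by simp
  then show ?thesis using ear.IH[of l "L' @ [b, c] @ R" C y] Cons by simp
 qed
qed

end

section \<open>Cutting tree-gons\<close>

context face_structure begin

lemma nzc_swap: "\<lbrakk>nzc b a; a = nx c; d = nx b; c \<in> Ar\<rbrakk> \<Longrightarrow> nzc c d"
 unfolding nzc_def using cmp_square[of c a b d] cmp_in by (metis cmp_nx)

text \<open>
 The entry \<open>c @ d\<close> of a tree-gon is split and the tree-gon is cut along the arc between \<open>c\<close> and \<open>d\<close>.  The cut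
 runs through the polygon to an entry \<open>b @ a\<close>, here on the left of \<open>c @ d\<close>, and splits it into \<open>b\<close> and \<open>a\<close>.
\<close>

definition left_cut :: "'e list list \<Rightarrow> 'e list \<Rightarrow> 'e list \<Rightarrow> 'e list list \<Rightarrow> 'e list list \<Rightarrow> 'e list \<Rightarrow> 'e list \<Rightarrow> 'e list list \<Rightarrow> bool" where
 "left_cut A c d B A1 b a A2 \<longleftrightarrow> A = A1 @ (b @ a) # A2 \<and> b \<noteq> [] \<and> a \<noteq> [] \<and> tg (a # A2 @ [c]) \<and> tg (A1 @ b # d # B)"

definition right_cut :: "'e list list \<Rightarrow> 'e list \<Rightarrow> 'e list \<Rightarrow> 'e list list \<Rightarrow> 'e list list \<Rightarrow> 'e list \<Rightarrow> 'e list \<Rightarrow> 'e list list \<Rightarrow> bool" where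
 "right_cut A c d B B1 b a B2 \<longleftrightarrow> B = B1 @ (b @ a) # B2 \<and> b \<noteq> [] \<and> a \<noteq> [] \<and> tg (d # B1 @ [b]) \<and> tg (A @ c # a # B2)"

text \<open>
 If the arc between \<open>c\<close> and \<open>d\<close> is a side of the ear that was glued last, the ear tells where the cut ends;
 otherwise the cut is inherited from the tree-gon before this gluing.
\<close>

lemma tg_cut:
 "tg w \<Longrightarrow> w = A @ (c @ d) # B \<Longrightarrow> c \<noteq> [] \<Longrightarrow> d \<noteq> [] \<Longrightarrow>
  (\<exists>A1 b a A2. left_cut A c d B A1 b a A2) \<or> (\<exists>B1 b a B2. right_cut A c d B B1 b a B2)"
proof (induction arbitrary: A c d B rule: tg.induct)
 case (face x)
 then have "c @ d \<in> set (sing (fw x))" by simp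
 from in_singD[OF this] face show ?case by (cases c; cases d) auto
next
 case (ear L b c' R x A c d B)
 let ?e = c'
 have ne: "b \<noteq> []" "?e \<noteq> []" using tg_ne[OF ear.hyps(1)] by auto
 have x: "x \<in> Ar" using ear nzc_in by blast
 have fc: "tg ([x] # sing (mid x) @ [[pv x]])" using tg.face[OF x] x by (simp add: fw_eq)
 note nz = ear.hyps(2,3)
 let ?E = "[b @ [x]] @ sing (mid x) @ [pv x # ?e]"
 have earI: "tg v \<Longrightarrow> v = L' @ [b'', e''] @ R' \<Longrightarrow> last b'' = last b \<Longrightarrow> hd e'' = hd ?e \<Longrightarrow>
   tg (L' @ (b'' @ [x]) # sing (mid x) @ (pv x # e'') # R')" for v L' b'' e'' R'
  using tg.ear[of L' b'' e'' R' x] nz by simp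
 have "L @ (b @ [x]) # (sing (mid x) @ (pv x # ?e) # R) = A @ (c @ d) # B" using ear.prems by simp
 from append_Cons_eq_append_ConsD[OF this] show ?case
 proof (elim disjE exE conjE)
  fix E assume A: "A = L @ (b @ [x]) # E" and "sing (mid x) @ (pv x # ?e) # R = E @ (c @ d) # B"
  from append_Cons_eq_append_ConsD[OF this(2)] show ?thesis
  proof (elim disjE exE conjE)
   fix E2 assume e: "E = sing (mid x) @ (pv x # ?e) # E2" "R = E2 @ (c @ d) # B"
   from ear.IH[of "L @ [b, ?e] @ E2" c d B] ear.prems e
   have "(\<exists>A1 b' a A2. left_cut (L @ [b, ?e] @ E2) c d B A1 b' a A2) \<or> (\<exists>B1 b' a B2. right_cut (L @ [b, ?e] @ E2) c d B B1 b' a B2)"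
    by simp
   then show ?thesis
   proof (elim disjE exE)
    fix A1 b' a A2 assume "left_cut (L @ [b, ?e] @ E2) c d B A1 b' a A2"
    then have l: "A1 @ (b' @ a) # A2 = L @ b # (?e # E2)" "b' \<noteq> []" "a \<noteq> []" "tg (a # A2 @ [c])" "tg (A1 @ b' # d # B)"
     by (auto simp: left_cut_def)
    from append_Cons_eq_append_ConsD[OF l(1)] show ?thesis
    proof (elim disjE exE conjE)
     fix F assume f: "L = A1 @ (b' @ a) # F" "A2 = F @ b # ?e # E2"
     have "left_cut A c d B A1 b' a (F @ ?E @ E2)"
      unfolding left_cut_def using l f e A earI[OF l(4), of "a # F" b ?e "E2 @ [c]"] by simp
     then show ?thesis by blast
    next
     assume f: "A1 = L" "b' @ a = b" "A2 = ?e # E2"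
     have "left_cut A c d B A1 b' (a @ [x]) (sing (mid x) @ (pv x # ?e) # E2)"
      unfolding left_cut_def using l f e A earI[OF l(4), of "[]" a ?e "E2 @ [c]"] by auto
     then show ?thesis by blast
    next
     fix F assume f: "A1 = L @ b # F" "?e # E2 = F @ (b' @ a) # A2"
     show ?thesis
     proof (cases F)
      case Nil
      with f l have "left_cut A c d B (L @ [b @ [x]] @ sing (mid x)) (pv x # b') a A2"
       unfolding left_cut_def using e A earI[OF l(5), of L b b' "d # B"] by (auto simp: hd_append)
      then show ?thesis by blast
     next
      case (Cons f' F')
      with f l have "left_cut A c d B (L @ ?E @ F') b' a A2"
       unfolding left_cut_def using e A earI[OF l(5), of L b ?e "F' @ b' # d # B"] by auto
      then show ?thesis by blast
     qed
    qed
   next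
    fix B1 b' a B2 assume "right_cut (L @ [b, ?e] @ E2) c d B B1 b' a B2"
    then have l: "B = B1 @ (b' @ a) # B2" "b' \<noteq> []" "a \<noteq> []" "tg (d # B1 @ [b'])" "tg (L @ [b, ?e] @ E2 @ c # a # B2)"
     by (auto simp: right_cut_def)
    then have "right_cut A c d B B1 b' a B2"
     unfolding right_cut_def using e A earI[OF l(5), of L b ?e "E2 @ c # a # B2"] by auto
    then show ?thesis by blast
   qed
  next
   assume e: "sing (mid x) = E" "pv x # ?e = c @ d" "R = B"
   show ?thesis
   proof (cases "tl c = []")
    case True
    then have "c = [pv x]" "d = ?e" using e ear.prems by (cases c; auto)+
    then have "left_cut A c d B L b [x] E"
     unfolding left_cut_def using fc ear.hyps(1) e ne A by auto
    then show ?thesis by blast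
   next
    case False
    then obtain c2 where c2: "c = pv x # c2" "?e = c2 @ d" "c2 \<noteq> []" using e ear.prems by (cases c) auto
    from ear.IH[of "L @ [b]" c2 d R] c2 ear.prems
    have "(\<exists>A1 b' a A2. left_cut (L @ [b]) c2 d R A1 b' a A2) \<or> (\<exists>B1 b' a B2. right_cut (L @ [b]) c2 d R B1 b' a B2)"
     by simp
    then show ?thesis
    proof (elim disjE exE)
     fix A1 b' a A2 assume "left_cut (L @ [b]) c2 d R A1 b' a A2"
     then have l: "A1 @ (b' @ a) # A2 = L @ b # []" "b' \<noteq> []" "a \<noteq> []" "tg (a # A2 @ [c2])" "tg (A1 @ b' # d # R)"
      by (auto simp: left_cut_def)
     show ?thesis
     proof (cases A2 rule: rev_cases)
      case Nil
      with l have "A1 = L" "b' @ a = b" by auto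
      then have "left_cut A c d B L b' (a @ [x]) E"
       unfolding left_cut_def using l e A c2 Nil earI[OF l(4), of "[]" a c2 "[]"] by auto
      then show ?thesis by blast
     next
      case (snoc F f')
      with l(1) have "(A1 @ (b' @ a) # F) @ [f'] = L @ [b]" by simp
      then have "f' = b" "L = A1 @ (b' @ a) # F" by (simp_all only: append1_eq_conv)
      then have "left_cut A c d B A1 b' a (F @ (b @ [x]) # E)"
       unfolding left_cut_def using l e A c2 snoc earI[OF l(4), of "a # F" b c2 "[]"] by auto
      then show ?thesis by blast
     qed
    next
     fix B1 b' a B2 assume "right_cut (L @ [b]) c2 d R B1 b' a B2"
     then have l: "B = B1 @ (b' @ a) # B2" "b' \<noteq> []" "a \<noteq> []" "tg (d # B1 @ [b'])" "tg (L @ [b] @ c2 # a # B2)"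
      using e by (auto simp: right_cut_def)
     then have "right_cut A c d B B1 b' a B2"
      unfolding right_cut_def using e A c2 earI[OF l(5), of L b c2 "a # B2"] by auto
     then show ?thesis by blast
    qed
   qed
  next
   fix E2 assume "sing (mid x) = E @ (c @ d) # E2"
   then have "c @ d \<in> set (sing (mid x))" by simp
   from in_singD[OF this] ear.prems show ?thesis by (cases c; cases d) auto
  qed
 next
  assume e: "L = A" "b @ [x] = c @ d" "sing (mid x) @ (pv x # ?e) # R = B"
  show ?thesis
  proof (cases d rule: rev_cases)
   case Nil with ear.prems show ?thesis by simp
  next
   case (snoc d' x')
   with e have d': "x' = x" "b = c @ d'" by auto
   show ?thesis
   proof (cases "d' = []")
    case True
    then have "right_cut A c d B (sing (mid x)) [pv x] ?e R"
     unfolding right_cut_def using fc ear.hyps(1) e ne d' snoc by auto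
    then show ?thesis by blast
   next
    case False
    from ear.IH[of L c d' "?e # R"] d' ear.prems False
    have "(\<exists>A1 b' a A2. left_cut L c d' (?e # R) A1 b' a A2) \<or> (\<exists>B1 b' a B2. right_cut L c d' (?e # R) B1 b' a B2)"
     by simp
    then show ?thesis
    proof (elim disjE exE)
     fix A1 b' a A2 assume "left_cut L c d' (?e # R) A1 b' a A2"
     then have l: "L = A1 @ (b' @ a) # A2" "b' \<noteq> []" "a \<noteq> []" "tg (a # A2 @ [c])" "tg (A1 @ b' # d' # ?e # R)"
      by (auto simp: left_cut_def)
     then have "left_cut A c d B A1 b' a A2"
      unfolding left_cut_def using e d' snoc False earI[OF l(5), of "A1 @ [b']" d' ?e "R"] by auto
     then show ?thesis by blast
    next
     fix B1 b' a B2 assume "right_cut L c d' (?e # R) B1 b' a B2"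
     then have l: "?e # R = B1 @ (b' @ a) # B2" "b' \<noteq> []" "a \<noteq> []" "tg (d' # B1 @ [b'])" "tg (L @ c # a # B2)"
      by (auto simp: right_cut_def)
     show ?thesis
     proof (cases B1)
      case Nil
      with l have "?e = b' @ a" "R = B2" by auto
      then have "right_cut A c d B (sing (mid x)) (pv x # b') a B2"
       unfolding right_cut_def using l e d' snoc False Nil earI[OF l(4), of "[]" d' b' "[]"] by auto
      then show ?thesis by blast
     next
      case (Cons f F)
      with l have "f = ?e" "R = F @ (b' @ a) # B2" by auto
      then have "right_cut A c d B (sing (mid x) @ (pv x # ?e) # F) b' a B2"
       unfolding right_cut_def using l e d' snoc False Cons earI[OF l(4), of "[]" d' ?e "F @ [b']"] by auto
      then show ?thesis by blast
     qed
    qed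
   qed
  qed
 next
  fix E assume L: "L = A @ (c @ d) # E" and B: "B = E @ (b @ [x]) # sing (mid x) @ (pv x # ?e) # R"
  from ear.IH[of A c d "E @ [b, ?e] @ R"] ear.prems L
  have "(\<exists>A1 b' a A2. left_cut A c d (E @ [b, ?e] @ R) A1 b' a A2) \<or> (\<exists>B1 b' a B2. right_cut A c d (E @ [b, ?e] @ R) B1 b' a B2)"
   by simp
  then show ?thesis
  proof (elim disjE exE)
   fix A1 b' a A2 assume "left_cut A c d (E @ [b, ?e] @ R) A1 b' a A2"
   then have l: "A = A1 @ (b' @ a) # A2" "b' \<noteq> []" "a \<noteq> []" "tg (a # A2 @ [c])" "tg (A1 @ b' # d # E @ [b, ?e] @ R)"
    by (auto simp: left_cut_def)
   then have "left_cut A c d B A1 b' a A2"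
    unfolding left_cut_def using B earI[OF l(5), of "A1 @ b' # d # E" b ?e R] by auto
   then show ?thesis by blast
  next
   fix B1 b' a B2 assume "right_cut A c d (E @ [b, ?e] @ R) B1 b' a B2"
   then have l: "B1 @ (b' @ a) # B2 = E @ b # (?e # R)" "b' \<noteq> []" "a \<noteq> []" "tg (d # B1 @ [b'])" "tg (A @ c # a # B2)"
    by (auto simp: right_cut_def)
   from append_Cons_eq_append_ConsD[OF l(1)] show ?thesis
   proof (elim disjE exE conjE)
    fix F assume f: "E = B1 @ (b' @ a) # F" "B2 = F @ b # ?e # R"
    have "right_cut A c d B B1 b' a (F @ ?E @ R)"
     unfolding right_cut_def using l f B earI[OF l(5), of "A @ c # a # F" b ?e R] by auto
    then show ?thesis by blast
   next
    assume f: "B1 = E" "b' @ a = b" "B2 = ?e # R"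
    have "right_cut A c d B B1 b' (a @ [x]) (sing (mid x) @ (pv x # ?e) # R)"
     unfolding right_cut_def using l f B earI[OF l(5), of "A @ [c]" a ?e R] by auto
    then show ?thesis by blast
   next
    fix F assume f: "B1 = E @ b # F" "?e # R = F @ (b' @ a) # B2"
    show ?thesis
    proof (cases F)
     case Nil
     with f l have "right_cut A c d B (E @ [b @ [x]] @ sing (mid x)) (pv x # b') a B2"
      unfolding right_cut_def using B earI[OF l(4), of "d # E" b b' "[]"] by auto
     then show ?thesis by blast
    next
     case (Cons f' F')
     with f l have "right_cut A c d B (E @ ?E @ F') b' a B2"
      unfolding right_cut_def using B earI[OF l(4), of "d # E" b ?e "F' @ [b']"] by auto
     then show ?thesis by blast
    qed
   qed
  qed
 qed
qed

lemma left_cut_glue: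
 assumes "left_cut A c d B A1 b a A2" "nzc (last b) (hd a)"
 shows "nzc (last c) (hd d)" "tg (A @ (c @ d) # B)"
proof -
 have l: "A = A1 @ (b @ a) # A2" "b \<noteq> []" "a \<noteq> []" "tg (a # A2 @ [c])" "tg (A1 @ b # d # B)"
  using assms by (auto simp: left_cut_def)
 have c: "c \<noteq> []" using tg_ne[OF l(4)] by auto
 have "set c \<subseteq> Ar" using tg_nzl[OF l(4), of c] by auto
 then have "last c \<in> Ar" using c by auto
 moreover have "hd a = nx (last c)" using tg_adj[OF l(4)] by simp
 moreover have "hd d = nx (last b)" using tg_adj[OF l(5)] by (auto simp: successively_append_iff)
 ultimately show 1: "nzc (last c) (hd d)" using nzc_swap assms(2) by metis
 show "tg (A @ (c @ d) # B)" using tg_glue[of A1 b d B a A2 c] l assms(2) 1 by simp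
qed

lemma right_cut_glue:
 assumes "right_cut A c d B B1 b a B2" "nzc (last b) (hd a)"
 shows "nzc (last c) (hd d)" "tg (A @ (c @ d) # B)"
proof -
 have l: "B = B1 @ (b @ a) # B2" "b \<noteq> []" "a \<noteq> []" "tg (d # B1 @ [b])" "tg (A @ c # a # B2)"
  using assms by (auto simp: right_cut_def)
 have c: "c \<noteq> []" using tg_ne[OF l(5)] by auto
 have "set c \<subseteq> Ar" using tg_nzl[OF l(5), of c] by auto
 then have "last c \<in> Ar" using c by auto
 moreover have "hd d = nx (last b)" using tg_adj[OF l(4)] by simp
 moreover have "hd a = nx (last c)" using tg_adj[OF l(5)] by (auto simp: successively_append_iff)
 ultimately show 1: "nzc (last c) (hd d)" using nzc_swap assms(2) by metis
 show "tg (A @ (c @ d) # B)" using tg_glue[of A c a B2 d B1 b] l assms(2) 1 by simp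
qed

end

section \<open>The products defined by tree-gons\<close>

lemma suffix_total:
 assumes "\<And>a a' b. r a b \<Longrightarrow> r a' b \<Longrightarrow> a = a'"
 shows "successively r u \<Longrightarrow> successively r v \<Longrightarrow> u \<noteq> [] \<Longrightarrow> v \<noteq> [] \<Longrightarrow> last u = last v
  \<Longrightarrow> (\<exists>y. u = y @ v) \<or> (\<exists>y. v = y @ u \<and> y \<noteq> [])"
proof (induction u arbitrary: v rule: rev_induct)
 case (snoc x u)
 from snoc.prems obtain v' where v: "v = v' @ [x]" by (metis append_butlast_last_id last_snoc)
 show ?case
 proof (cases "u = [] \<or> v' = []")
  case True then show ?thesis using v by auto
 next
  case False
  with snoc.prems v have "r (last u) x" "r (last v') x" "successively r u" "successively r v'"
   by (auto simp: successively_append_iff)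
  with snoc.IH[of v'] False assms v show ?thesis by auto
 qed
qed simp

lemma prefix_total:
 assumes "\<And>a b b'. r a b \<Longrightarrow> r a b' \<Longrightarrow> b = b'"
 shows "successively r u \<Longrightarrow> successively r v \<Longrightarrow> u \<noteq> [] \<Longrightarrow> v \<noteq> [] \<Longrightarrow> hd u = hd v
  \<Longrightarrow> (\<exists>y. u = v @ y) \<or> (\<exists>y. v = u @ y \<and> y \<noteq> [])"
proof (induction u arbitrary: v)
 case (Cons x u)
 from Cons.prems obtain v' where v: "v = x # v'" by (cases v) auto
 show ?case
 proof (cases "u = [] \<or> v' = []")
  case True then show ?thesis using v by auto
 next
  case False
  with Cons.prems v have "r x (hd u)" "r x (hd v')" "successively r u" "successively r v'"
   by (auto simp: successively_Cons)
  with Cons.IH[of v'] False assms v show ?thesis by auto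
 qed
qed simp

text \<open>
 The condition on the parity of the degrees around a face is what makes the products below odd.
\<close>

locale graded_face_structure = face_structure Ar nx pv per cmp
 for Ar :: "'e set" and nx pv :: "'e \<Rightarrow> 'e" and per :: "'e \<Rightarrow> nat" and cmp :: "'e \<Rightarrow> 'e \<Rightarrow> bool" +
 fixes adeg :: "'e \<Rightarrow> int"
 assumes face_parity: "x \<in> Ar \<Longrightarrow> even ((\<Sum>y\<leftarrow>fw x. adeg y) - int (per x))"
begin

definition ldeg :: "'e list \<Rightarrow> int" where "ldeg a = (\<Sum>y\<leftarrow>a. adeg y)"

lemma ldeg_simps [simp]: "ldeg [] = 0" "ldeg (x # a) = adeg x + ldeg a" "ldeg (a @ b) = ldeg a + ldeg b"
 by (simp_all add: ldeg_def)

sublocale graded_basis "\<lambda>a. ldeg a - 1" .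

definition nzl :: "'e list \<Rightarrow> bool" where
 "nzl a \<longleftrightarrow> set a \<subseteq> Ar \<and> successively nzc a"

lemma nzl_append: "nzl (a @ b) \<longleftrightarrow> nzl a \<and> nzl b \<and> (a = [] \<or> b = [] \<or> nzc (last a) (hd b))"
 by (auto simp: nzl_def successively_append_iff)

lemma nzl_Nil [simp]: "nzl []" by (simp add: nzl_def)

lemma nzl_suffix_total:
 "nzl u \<Longrightarrow> nzl v \<Longrightarrow> u \<noteq> [] \<Longrightarrow> v \<noteq> [] \<Longrightarrow> last u = last v \<Longrightarrow> (\<exists>y. u = y @ v) \<or> (\<exists>y. v = y @ u \<and> y \<noteq> [])"
 using suffix_total[of nzc u v] nzc_left_unique by (auto simp: nzl_def)

lemma nzl_prefix_total:
 "nzl u \<Longrightarrow> nzl v \<Longrightarrow> u \<noteq> [] \<Longrightarrow> v \<noteq> [] \<Longrightarrow> hd u = hd v \<Longrightarrow> (\<exists>y. u = v @ y) \<or> (\<exists>y. v = u @ y \<and> y \<noteq> [])"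
 using prefix_total[of nzc u v] nzc_right_unique by (auto simp: nzl_def)

lemma tg_entry: "tg w \<Longrightarrow> a \<in> set w \<Longrightarrow> nzl a \<and> a \<noteq> []"
 using tg_nzl[of w a] tg_ne[of w] by (auto simp: nzl_def)

lemma wdeg_sing: "wdeg (sing xs) = (\<Sum>y\<leftarrow>xs. adeg y) - int (length xs)"
 by (induction xs) auto

lemma tg_parity: "tg w \<Longrightarrow> even (wdeg w)"
proof (induction rule: tg.induct)
 case (face x)
 then show ?case using face_parity by (simp add: wdeg_sing)
next
 case (ear L b c R x)
 then have x: "x \<in> Ar" using nzc_in by blast
 have "even (wdeg (sing (fw x)))" using face_parity[OF x] by (simp add: wdeg_sing)
 then show ?case using ear.IH x by (auto simp: fw_eq algebra_simps)
qed

text \<open>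
 The values of the product on \<open>w\<close>: the surplus on the left of the first entry or on the right of the last entry
 over a tree-gon.  An empty surplus is counted in \<open>inL\<close> only, because both rules then prescribe the same value.
\<close>

definition inL :: "'e list list \<Rightarrow> 'e list set" where
 "inL w = {x. \<exists>z zs. w = (x @ z) # zs \<and> tg (z # zs)}"

definition inR :: "'e list list \<Rightarrow> 'e list set" where
 "inR w = {x. x \<noteq> [] \<and> (\<exists>z zs. w = zs @ [z @ x] \<and> tg (zs @ [z]))}"

lemma finite_inL [simp]: "finite (inL w)"
proof -
 have "inL w \<subseteq> fst ` asplits (hd w)" by (force simp: inL_def asplits_def image_iff)
 then show ?thesis by (rule finite_subset) simp
qed

lemma finite_inR [simp]: "finite (inR w)"
proof -
 have "inR w \<subseteq> snd ` asplits (last w)" by (force simp: inR_def asplits_def image_iff)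
 then show ?thesis by (rule finite_subset) simp
qed

text \<open>
 The sum of all products of length at least three on a list of paths; the product of length two is \<open>m2\<close>.
\<close>

definition mT :: "'e list list \<Rightarrow> ('e list \<Rightarrow>\<^sub>0 complex)" where
 "mT w = (\<Sum>x\<in>inL w. bvec x) + (\<Sum>x\<in>inR w. smul (sg (ldeg x)) (bvec x))"

definition m2 :: "'e list list \<Rightarrow> ('e list \<Rightarrow>\<^sub>0 complex)" where
 "m2 w = (case w of [a, b] \<Rightarrow> if nzl (a @ b) then smul (sg (ldeg b)) (bvec (a @ b)) else 0 | _ \<Rightarrow> 0)"

text \<open>
 The ways of applying a product with value \<open>x\<close> inside \<open>ws\<close>, with surplus on the left (\<open>CLs\<close>) or right
 (\<open>CRs\<close>), such that the remaining word satisfies \<open>P\<close>.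
\<close>

definition CLs where "CLs P ws = {(L, X, R, x). ws = L @ X @ R \<and> X \<noteq> [] \<and> x \<in> inL X \<and> P (L @ x # R)}"
definition CRs where "CRs P ws = {(L, X, R, x). ws = L @ X @ R \<and> X \<noteq> [] \<and> x \<in> inR X \<and> P (L @ x # R)}"

lemma CLs_Sigma: "CLs P ws = (\<lambda>((L, X, R), x). (L, X, R, x)) ` (SIGMA (L, X, R):splits ws. {x\<in>inL X. P (L @ x # R)})"
 by (force simp: CLs_def splits_def image_iff)

lemma CRs_Sigma: "CRs P ws = (\<lambda>((L, X, R), x). (L, X, R, x)) ` (SIGMA (L, X, R):splits ws. {x\<in>inR X. P (L @ x # R)})"
 by (force simp: CRs_def splits_def image_iff)

lemma finite_CLs [simp]: "finite (CLs P ws)"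
 unfolding CLs_Sigma by (intro finite_imageI finite_SigmaI finite_splits) auto

lemma finite_CRs [simp]: "finite (CRs P ws)"
 unfolding CRs_Sigma by (intro finite_imageI finite_SigmaI finite_splits) auto

lemma sum_CLs: "(\<Sum>(L, X, R, x)\<in>CLs P ws. F L X R x) = (\<Sum>(L, X, R)\<in>splits ws. \<Sum>x\<in>inL X. if P (L @ x # R) then F L X R x else (0 :: complex))"
proof -
 have i: "inj_on (\<lambda>((L, X, R), x). (L, X, R, x)) (SIGMA (L, X, R):splits ws. {x\<in>inL X. P (L @ x # R)})"
  by (auto simp: inj_on_def)
 show ?thesis unfolding CLs_Sigma sum.reindex[OF i]
  by (subst sum.inter_filter[symmetric] | simp add: case_prod_unfold sum.Sigma o_def)+
qed

lemma sum_CRs: "(\<Sum>(L, X, R, x)\<in>CRs P ws. F L X R x) = (\<Sum>(L, X, R)\<in>splits ws. \<Sum>x\<in>inR X. if P (L @ x # R) then F L X R x else (0 :: complex))"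
proof -
 have i: "inj_on (\<lambda>((L, X, R), x). (L, X, R, x)) (SIGMA (L, X, R):splits ws. {x\<in>inR X. P (L @ x # R)})"
  by (auto simp: inj_on_def)
 show ?thesis unfolding CRs_Sigma sum.reindex[OF i]
  by (subst sum.inter_filter[symmetric] | simp add: case_prod_unfold sum.Sigma o_def)+
qed

text \<open>
 The lists on which the relations between tree-gons are non-trivial; lists with an idempotent are treated separately.
\<close>

definition word :: "'e list list \<Rightarrow> bool" where
 "word ws \<longleftrightarrow> (\<forall>a\<in>set ws. a \<noteq> [] \<and> nzl a) \<and> successively (\<lambda>a b. cmp (last a) (hd b)) ws"

lemma inL_D: "x \<in> inL X \<Longrightarrow> \<exists>a A2 c. X = (x @ a) # A2 @ [c] \<and> tg (a # A2 @ [c]) \<and> a \<noteq> []"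
proof -
 assume "x \<in> inL X"
 then obtain z zs where z: "X = (x @ z) # zs" "tg (z # zs)" by (auto simp: inL_def)
 with tg_length[OF z(2)] tg_entry[OF z(2), of z] show ?thesis by (cases zs rule: rev_cases) auto
qed

lemma inR_D: "x \<in> inR X \<Longrightarrow> \<exists>d B1 b. X = d # B1 @ [b @ x] \<and> tg (d # B1 @ [b]) \<and> b \<noteq> [] \<and> x \<noteq> []"
proof -
 assume "x \<in> inR X"
 then obtain z zs where z: "X = zs @ [z @ x]" "tg (zs @ [z])" "x \<noteq> []" by (auto simp: inR_def)
 with tg_length[OF z(2)] tg_entry[OF z(2), of z] show ?thesis by (cases zs) auto
qed

text \<open>Merging two neighbouring entries against removing a polygon from the inside of the word.\<close>

text \<open>
 If merging the neighbours \<open>c\<close> and \<open>d\<close> produces a tree-gon (up to surplus), then cutting it between \<open>c\<close> and \<open>d\<close>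
 shows two nested tree-gons in the word itself, and conversely.  The hypotheses say that \<open>P\<close>, which
 describes the outer tree-gon, behaves well under cutting and gluing and that no word admits both a left and a right cut; \<open>ins\<close> excludes the cuts that run through the surplus.
\<close>

lemma cut_sum:
 assumes ws: "word ws"
  and ex: "\<And>A c d B. ws = A @ c # d # B \<Longrightarrow> P (A @ (c @ d) # B) \<Longrightarrow> ins A c d B \<Longrightarrow>
   (\<exists>A1 b a A2. A = A1 @ (b @ a) # A2 \<and> a \<noteq> [] \<and> tg (a # A2 @ [c]) \<and> P (A1 @ b # d # B)) \<or>
   (\<exists>B1 b a B2. B = B1 @ (b @ a) # B2 \<and> a \<noteq> [] \<and> tg (d # B1 @ [b]) \<and> P (A @ c # a # B2))"
  and left: "\<And>A1 b a A2 c d B. ws = A1 @ (b @ a) # A2 @ c # d # B \<Longrightarrow> a \<noteq> [] \<Longrightarrow> tg (a # A2 @ [c]) \<Longrightarrow> P (A1 @ b # d # B)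
   \<Longrightarrow> P (A1 @ (b @ a) # A2 @ (c @ d) # B) \<and> ins (A1 @ (b @ a) # A2) c d B"
  and right: "\<And>A c d B1 b a B2. ws = A @ c # d # B1 @ (b @ a) # B2 \<Longrightarrow> a \<noteq> [] \<Longrightarrow> tg (d # B1 @ [b]) \<Longrightarrow> P (A @ c # a # B2)
   \<Longrightarrow> P (A @ (c @ d) # B1 @ (b @ a) # B2) \<and> ins A c d (B1 @ (b @ a) # B2)"
  and excl: "\<And>A1 b a A2 c d B1 b' a' B2. P (A1 @ b # d # B1 @ (b' @ a') # B2) \<Longrightarrow> a' \<noteq> [] \<Longrightarrow> tg (d # B1 @ [b'])
   \<Longrightarrow> P (A1 @ (b @ a) # A2 @ c # a' # B2) \<Longrightarrow> False"
 shows "(\<Sum>(A, c, d, B)\<in>{(A, c, d, B)\<in>pairs ws. P (A @ (c @ d) # B) \<and> ins A c d B}. sg (wdeg (d # B))) =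
  (\<Sum>(L, X, R, x)\<in>{(L, X, R, x)\<in>CLs P ws. R \<noteq> []}. sg (wdeg R)) +
  (\<Sum>(L, X, R, x)\<in>{(L, X, R, x)\<in>CRs P ws. L \<noteq> []}. sg (wdeg R) * sg (ldeg x))"
proof -
 let ?M = "{(A, c, d, B)\<in>pairs ws. P (A @ (c @ d) # B) \<and> ins A c d B}"
 let ?C = "{(L, X, R, x)\<in>CLs P ws. R \<noteq> []}" and ?D = "{(L, X, R, x)\<in>CRs P ws. L \<noteq> []}"
 define h where "h = (\<lambda>(L, X, R, x :: 'e list). (L @ butlast X, last X :: 'e list, hd R :: 'e list, tl R))"
 define k where "k = (\<lambda>(L, X, R, x :: 'e list). (butlast L, last L :: 'e list, hd X :: 'e list, tl X @ R))"
 let ?f = "\<lambda>(A :: 'e list list, c :: 'e list, d, B). sg (wdeg (d # B))"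
 have C: "\<exists>A1 b a A2 c d B. t = (A1, (b @ a) # A2 @ [c], d # B, b) \<and> ws = A1 @ (b @ a) # A2 @ c # d # B \<and> a \<noteq> [] \<and>
   tg (a # A2 @ [c]) \<and> P (A1 @ b # d # B) \<and> h t = (A1 @ (b @ a) # A2, c, d, B)" if tC: "t \<in> ?C" for t
 proof -
  obtain L X R x where t: "t = (L, X, R, x)" "ws = L @ X @ R" "x \<in> inL X" "P (L @ x # R)" "R \<noteq> []"
   using tC by (cases t) (auto simp: CLs_def)
  from inL_D[OF t(3)] obtain a A2 c where "X = (x @ a) # A2 @ [c]" "tg (a # A2 @ [c])" "a \<noteq> []" by blast
  then show ?thesis using t by (cases R) (auto simp: h_def butlast_append)
 qed
 have D: "\<exists>A c d B1 b a B2. t = (A @ [c], d # B1 @ [b @ a], B2, a) \<and> ws = A @ c # d # B1 @ (b @ a) # B2 \<and> a \<noteq> [] \<and>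
   tg (d # B1 @ [b]) \<and> P (A @ c # a # B2) \<and> k t = (A, c, d, B1 @ (b @ a) # B2)" if tD: "t \<in> ?D" for t
 proof -
  obtain L X R x where t: "t = (L, X, R, x)" "ws = L @ X @ R" "x \<in> inR X" "P (L @ x # R)" "L \<noteq> []"
   using tD by (cases t) (auto simp: CRs_def)
  from inR_D[OF t(3)] obtain d B1 b where "X = d # B1 @ [b @ x]" "tg (d # B1 @ [b])" "x \<noteq> []" by blast
  then show ?thesis using t by (cases L rule: rev_cases) (auto simp: k_def)
 qed
 have injh: "inj_on h ?C"
 proof (rule inj_onI)
  fix s t assume st: "s \<in> ?C" "t \<in> ?C" "h s = h t"
  from C[OF st(1)] obtain A1 b a A2 c d B where s: "s = (A1, (b @ a) # A2 @ [c], d # B, b)" "tg (a # A2 @ [c])" "a \<noteq> []"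
   "h s = (A1 @ (b @ a) # A2, c, d, B)" by blast
  from C[OF st(2)] obtain A1' b' a' A2' c' d' B' where t: "t = (A1', (b' @ a') # A2' @ [c'], d' # B', b')" "tg (a' # A2' @ [c'])" "a' \<noteq> []"
   "h t = (A1' @ (b' @ a') # A2', c', d', B')" by blast
  from s t st(3) have
   e: "s = (A1, (b @ a) # A2 @ [c], d # B, b)" "t = (A1', (b' @ a') # A2' @ [c], d # B, b')"
   "A1 @ (b @ a) # A2 = A1' @ (b' @ a') # A2'" "tg (a # A2 @ [c])" "tg (a' # A2' @ [c])" "a \<noteq> []" "a' \<noteq> []"
   by simp_all
  from append_Cons_eq_append_ConsD[OF e(3)] show "s = t"
  proof (elim disjE exE conjE)
   fix E assume "A1' = A1 @ (b @ a) # E" "A2 = E @ (b' @ a') # A2'"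
   with e tg_suffix_free[OF e(5) refl, of "a # E" b'] show ?thesis by simp
  next
   assume f: "A1 = A1'" "b @ a = b' @ a'" "A2 = A2'"
   from this(2) obtain us where "(b = b' @ us \<and> a' = us @ a) \<or> (b' = b @ us \<and> a = us @ a')"
    by (auto simp: append_eq_append_conv2)
   with e f tg_suffix_free[OF e(5) refl, of "[]" us] tg_suffix_free[OF e(4) refl, of "[]" us] show ?thesis by auto
  next
   fix E assume "A1 = A1' @ (b' @ a') # E" "A2' = E @ (b @ a) # A2"
   with e tg_suffix_free[OF e(4) refl, of "a' # E" b] show ?thesis by simp
  qed
 qed
 have injk: "inj_on k ?D"
 proof (rule inj_onI)
  fix s t assume st: "s \<in> ?D" "t \<in> ?D" "k s = k t"
  from D[OF st(1)] obtain A c d B1 b a B2 where s: "s = (A @ [c], d # B1 @ [b @ a], B2, a)" "tg (d # B1 @ [b])" "a \<noteq> []"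
   "k s = (A, c, d, B1 @ (b @ a) # B2)" by blast
  from D[OF st(2)] obtain A' c' d' B1' b' a' B2' where t: "t = (A' @ [c'], d' # B1' @ [b' @ a'], B2', a')" "tg (d' # B1' @ [b'])" "a' \<noteq> []"
   "k t = (A', c', d', B1' @ (b' @ a') # B2')" by blast
  from s t st(3) have
   e: "s = (A @ [c], d # B1 @ [b @ a], B2, a)" "t = (A @ [c], d # B1' @ [b' @ a'], B2', a')"
   "B1 @ (b @ a) # B2 = B1' @ (b' @ a') # B2'" "tg (d # B1 @ [b])" "tg (d # B1' @ [b'])" "a \<noteq> []" "a' \<noteq> []"
   by simp_all
  from append_Cons_eq_append_ConsD[OF e(3)] show "s = t"
  proof (elim disjE exE conjE)
   fix E assume "B1' = B1 @ (b @ a) # E"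
   with e tg_prefix_free[OF e(4), of "d # B1" b a "E @ [b']"] show ?thesis by simp
  next
   assume f: "B1 = B1'" "b @ a = b' @ a'" "B2 = B2'"
   from this(2) obtain us where "(b = b' @ us \<and> a' = us @ a) \<or> (b' = b @ us \<and> a = us @ a')"
    by (auto simp: append_eq_append_conv2)
   with e f tg_prefix_free[OF e(5), of "d # B1'" b' us "[]"] tg_prefix_free[OF e(4), of "d # B1" b us "[]"] show ?thesis by auto
  next
   fix E assume "B1 = B1' @ (b' @ a') # E"
   with e tg_prefix_free[OF e(5), of "d # B1'" b' a' "E @ [b]"] show ?thesis by simp
  qed
 qed
 have M: "?M = h ` ?C \<union> k ` ?D"
 proof (intro equalityI subsetI)
  fix t assume "t \<in> ?M"
  then obtain A c d B where t: "t = (A, c, d, B)" "ws = A @ c # d # B" "P (A @ (c @ d) # B)" "ins A c d B"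
   by (cases t) (auto simp: pairs_def)
  from ex[OF t(2-4)] show "t \<in> h ` ?C \<union> k ` ?D"
  proof (elim disjE exE conjE)
   fix A1 b a A2 assume l: "A = A1 @ (b @ a) # A2" "a \<noteq> []" "tg (a # A2 @ [c])" "P (A1 @ b # d # B)"
   then have "(A1, (b @ a) # A2 @ [c], d # B, b) \<in> ?C" using t by (auto simp: CLs_def inL_def)
   then have "h (A1, (b @ a) # A2 @ [c], d # B, b) \<in> h ` ?C" by (rule imageI)
   then show ?thesis using t l by (simp add: h_def butlast_append)
  next
   fix B1 b a B2 assume l: "B = B1 @ (b @ a) # B2" "a \<noteq> []" "tg (d # B1 @ [b])" "P (A @ c # a # B2)"
   then have "\<exists>z zs. d # B1 @ [b @ a] = zs @ [z @ a] \<and> tg (zs @ [z])"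
    by (intro exI[of _ b] exI[of _ "d # B1"]) auto
   then have "(A @ [c], d # B1 @ [b @ a], B2, a) \<in> ?D" using t l by (auto simp: CRs_def inR_def)
   then have "k (A @ [c], d # B1 @ [b @ a], B2, a) \<in> k ` ?D" by (rule imageI)
   then show ?thesis using t l by (simp add: k_def)
  qed
 next
  fix t assume "t \<in> h ` ?C \<union> k ` ?D"
  then show "t \<in> ?M"
  proof
   assume "t \<in> h ` ?C"
   then obtain s where "s \<in> ?C" "t = h s" by blast
   with C[of s] left show ?thesis by (fastforce simp: pairs_def)
  next
   assume "t \<in> k ` ?D"
   then obtain s where "s \<in> ?D" "t = k s" by blast
   with D[of s] right show ?thesis by (fastforce simp: pairs_def)
  qed
 qed
 have disj: "h ` ?C \<inter> k ` ?D = {}"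
 proof -
  have False if s: "s \<in> ?C" and t: "t \<in> ?D" and e: "h s = k t" for s t
  proof -
   obtain A1 b a A2 c d B where 1: "a \<noteq> []" "tg (a # A2 @ [c])" "P (A1 @ b # d # B)" "h s = (A1 @ (b @ a) # A2, c, d, B)"
    using C[OF s] by blast
   obtain A c' d' B1 b' a' B2 where 2: "a' \<noteq> []" "tg (d' # B1 @ [b'])" "P (A @ c' # a' # B2)" "k t = (A, c', d', B1 @ (b' @ a') # B2)"
    using D[OF t] by blast
   have "A = A1 @ (b @ a) # A2" "c' = c" "d' = d" "B = B1 @ (b' @ a') # B2" using e 1(4) 2(4) by simp_all
   with excl[of A1 b d B1 b' a' B2 a A2 c] 1 2 show False by simp
  qed
  then show ?thesis by blast
 qed
 have fin: "finite ?C" "finite ?D"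
  by (rule finite_subset[OF _ finite_CLs[of P ws]], force) (rule finite_subset[OF _ finite_CRs[of P ws]], force)
 have "sum ?f ?M = sum (?f \<circ> h) ?C + sum (?f \<circ> k) ?D"
  unfolding M by (subst sum.union_disjoint) (use fin disj in \<open>auto simp: sum.reindex[OF injh] sum.reindex[OF injk]\<close>)
 also have "sum (?f \<circ> h) ?C = (\<Sum>(L, X, R, x)\<in>?C. sg (wdeg R))"
  by (rule sum.cong[OF refl]) (auto simp: h_def wdeg_def neq_Nil_conv)
 also have "sum (?f \<circ> k) ?D = (\<Sum>(L, X, R, x)\<in>?D. sg (wdeg R) * sg (ldeg x))"
 proof (rule sum.cong[OF refl])
  fix t assume "t \<in> ?D"
  from D[OF this] obtain A c d B1 b a B2 where e: "t = (A @ [c], d # B1 @ [b @ a], B2, a)" "tg (d # B1 @ [b])"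
   "k t = (A, c, d, B1 @ (b @ a) # B2)" by blast
  have "sg (wdeg (d # B1 @ (b @ a) # B2)) = sg (wdeg B2) * sg (ldeg a)"
   unfolding sg_mult by (rule sg_cong) (use tg_parity[OF e(2)] in \<open>simp add: algebra_simps\<close>)
  then show "(?f \<circ> k) t = (case t of (L, X, R, x) \<Rightarrow> sg (wdeg R) * sg (ldeg x))" using e by simp
 qed
 finally show ?thesis .
qed

lemma excl_tg: "tg (A @ b # d # B1 @ (b' @ a') # B2) \<Longrightarrow> a' \<noteq> [] \<Longrightarrow> tg (d # B1 @ [b']) \<Longrightarrow> False"
proof -
 assume l: "tg (A @ b # d # B1 @ (b' @ a') # B2)" "a' \<noteq> []" "tg (d # B1 @ [b'])"
 have "tg ((d # B1) @ [b' @ a'] @ (B2 @ A @ [b]))"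
  using tg_rotate_append[of "A @ [b]" "d # B1 @ (b' @ a') # B2"] l by simp
 from tg_prefix_free[OF l(3) _ this] l show False by simp
qed

lemma word_entry: "word (A @ a # B) \<Longrightarrow> a \<noteq> [] \<and> nzl a"
 by (auto simp: word_def)

lemma word_junction: "word (A @ (b @ a) # B) \<Longrightarrow> b \<noteq> [] \<Longrightarrow> a \<noteq> [] \<Longrightarrow> nzc (last b) (hd a)"
 using word_entry[of A "b @ a" B] by (auto simp: nzl_append)

lemma left_cutI: "A = A1 @ (b @ a) # A2 \<Longrightarrow> b \<noteq> [] \<Longrightarrow> a \<noteq> [] \<Longrightarrow> tg (a # A2 @ [c]) \<Longrightarrow> tg (A1 @ b # d # B) \<Longrightarrow> nzc (last b) (hd a)
  \<Longrightarrow> tg (A @ (c @ d) # B)"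
 using left_cut_glue(2)[of A c d B A1 b a A2] by (simp add: left_cut_def)

lemma right_cutI: "B = B1 @ (b @ a) # B2 \<Longrightarrow> b \<noteq> [] \<Longrightarrow> a \<noteq> [] \<Longrightarrow> tg (d # B1 @ [b]) \<Longrightarrow> tg (A @ c # a # B2) \<Longrightarrow> nzc (last b) (hd a)
  \<Longrightarrow> tg (A @ (c @ d) # B)"
 using right_cut_glue(2)[of A c d B B1 b a B2] by (simp add: right_cut_def)

lemma in_inL: "q \<in> inL (a # w) \<longleftrightarrow> (\<exists>z. a = q @ z \<and> tg (z # w))"
 by (auto simp: inL_def)

lemma in_inR: "q \<in> inR (w @ [a]) \<longleftrightarrow> q \<noteq> [] \<and> (\<exists>z. a = z @ q \<and> tg (w @ [z]))"
 by (auto simp: inR_def)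

lemma cut_sum_L:
 assumes ws: "word ws"
 shows "(\<Sum>(A, c, d, B)\<in>{(A, c, d, B)\<in>pairs ws. q \<in> inL (A @ (c @ d) # B) \<and> \<not> (A = [] \<and> (\<exists>y. q = c @ y))}. sg (wdeg (d # B))) =
  (\<Sum>(L, X, R, x)\<in>{(L, X, R, x)\<in>CLs (\<lambda>w. q \<in> inL w) ws. R \<noteq> []}. sg (wdeg R)) +
  (\<Sum>(L, X, R, x)\<in>{(L, X, R, x)\<in>CRs (\<lambda>w. q \<in> inL w) ws. L \<noteq> []}. sg (wdeg R) * sg (ldeg x))"
proof (rule cut_sum[OF ws, where P = "\<lambda>w. q \<in> inL w" and ins = "\<lambda>A c d B. \<not> (A = [] \<and> (\<exists>y. q = c @ y))"])
 fix A c d B assume w: "ws = A @ c # d # B" and q: "q \<in> inL (A @ (c @ d) # B)" and ins: "\<not> (A = [] \<and> (\<exists>y. q = c @ y))"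
 have ne: "c \<noteq> []" "d \<noteq> []" using word_entry[of A c "d # B"] word_entry[of "A @ [c]" d B] ws w by auto
 let ?G = "(\<exists>A1 b a A2. A = A1 @ (b @ a) # A2 \<and> a \<noteq> [] \<and> tg (a # A2 @ [c]) \<and> q \<in> inL (A1 @ b # d # B)) \<or>
   (\<exists>B1 b a B2. B = B1 @ (b @ a) # B2 \<and> a \<noteq> [] \<and> tg (d # B1 @ [b]) \<and> q \<in> inL (A @ c # a # B2))"
 show ?G
 proof (cases A)
  case Nil
  with q obtain z where z: "c @ d = q @ z" "tg (z # B)" by (auto simp: in_inL)
  from z(1) ins Nil obtain c' where c': "c = q @ c'" "z = c' @ d" "c' \<noteq> []"
   by (auto simp: append_eq_append_conv2)
  from tg_cut[OF z(2), of "[]" c' d B] c' ne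
  obtain B1 b a B2 where "right_cut [] c' d B B1 b a B2" by (auto simp: left_cut_def)
  then have "B = B1 @ (b @ a) # B2 \<and> a \<noteq> [] \<and> tg (d # B1 @ [b]) \<and> q \<in> inL (A @ c # a # B2)"
   using Nil c' by (auto simp: right_cut_def in_inL)
  then show ?thesis by blast
 next
  case (Cons f A')
  with q obtain z where z: "f = q @ z" "tg (z # A' @ (c @ d) # B)" by (auto simp: in_inL)
  from tg_cut[OF z(2), of "z # A'" c d B] ne
  show ?thesis
  proof (simp, elim disjE exE)
   fix A1 b a A2 assume "left_cut (z # A') c d B A1 b a A2"
   then have l: "z # A' = A1 @ (b @ a) # A2" "a \<noteq> []" "tg (a # A2 @ [c])" "tg (A1 @ b # d # B)" by (auto simp: left_cut_def)
   show ?thesis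
   proof (cases A1)
    case Nil
    with l Cons z have "A = [] @ ((q @ b) @ a) # A2 \<and> a \<noteq> [] \<and> tg (a # A2 @ [c]) \<and> q \<in> inL ([] @ (q @ b) # d # B)"
     by (auto simp: in_inL)
    then show ?thesis by blast
   next
    case (Cons y A1')
    with l \<open>A = f # A'\<close> z have "A = ((q @ z) # A1') @ (b @ a) # A2 \<and> a \<noteq> [] \<and> tg (a # A2 @ [c]) \<and> q \<in> inL (((q @ z) # A1') @ b # d # B)"
     by (auto simp: in_inL)
    then show ?thesis by blast
   qed
  next
   fix B1 b a B2 assume "right_cut (z # A') c d B B1 b a B2"
   then have "B = B1 @ (b @ a) # B2 \<and> a \<noteq> [] \<and> tg (d # B1 @ [b]) \<and> q \<in> inL (A @ c # a # B2)"
    using Cons z by (auto simp: right_cut_def in_inL)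
   then show ?thesis by blast
  qed
 qed
next
 fix A1 b a A2 c d B
 assume w: "ws = A1 @ (b @ a) # A2 @ c # d # B" and l: "a \<noteq> []" "tg (a # A2 @ [c])" "q \<in> inL (A1 @ b # d # B)"
 have "q \<in> inL (A1 @ (b @ a) # A2 @ (c @ d) # B)"
 proof (cases A1)
  case Nil
  with l obtain z where z: "b = q @ z" "tg (z # d # B)" by (auto simp: in_inL)
  have zne: "z \<noteq> []" using tg_ne[OF z(2)] by auto
  have "nzc (last z) (hd a)" using word_junction[of A1 b a "A2 @ c # d # B"] w ws z zne l by simp
  then have "tg (((z @ a) # A2) @ (c @ d) # B)"
   using left_cutI[of "(z @ a) # A2" "[]" z a A2 c d B] zne z l by simp
  then show ?thesis using Nil z by (simp add: in_inL)
 next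
  case (Cons f A1')
  with l obtain z where z: "f = q @ z" "tg (z # A1' @ b # d # B)" by (auto simp: in_inL)
  have bne: "b \<noteq> []" using tg_ne[OF z(2)] by auto
  have "nzc (last b) (hd a)" using word_junction[of A1 b a "A2 @ c # d # B"] w ws bne l by simp
  then have "tg ((z # A1' @ (b @ a) # A2) @ (c @ d) # B)"
   using left_cutI[of "z # A1' @ (b @ a) # A2" "z # A1'" b a A2 c d B] bne z l by simp
  then show ?thesis using Cons z by (simp add: in_inL)
 qed
 then show "q \<in> inL (A1 @ (b @ a) # A2 @ (c @ d) # B) \<and> \<not> (A1 @ (b @ a) # A2 = [] \<and> (\<exists>y. q = c @ y))" by simp
next
 fix A c d B1 b a B2
 assume w: "ws = A @ c # d # B1 @ (b @ a) # B2" and l: "a \<noteq> []" "tg (d # B1 @ [b])" "q \<in> inL (A @ c # a # B2)"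
 have bne: "b \<noteq> []" using tg_ne[OF l(2)] by auto
 have nz: "nzc (last b) (hd a)" using word_junction[of "A @ c # d # B1" b a B2] w ws bne l by simp
 show "q \<in> inL (A @ (c @ d) # B1 @ (b @ a) # B2) \<and> \<not> (A = [] \<and> (\<exists>y. q = c @ y))"
 proof (cases A)
  case Nil
  with l obtain z where z: "c = q @ z" "tg (z # a # B2)" by (auto simp: in_inL)
  have zne: "z \<noteq> []" using tg_ne[OF z(2)] by auto
  have "tg ([] @ (z @ d) # B1 @ (b @ a) # B2)"
   using right_cutI[of _ B1 b a B2 d "[]" z] bne z l nz by simp
  then show ?thesis using Nil z zne by (simp add: in_inL)
 next
  case (Cons f A')
  with l obtain z where z: "f = q @ z" "tg (z # A' @ c # a # B2)" by (auto simp: in_inL)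
  have "tg ((z # A') @ (c @ d) # B1 @ (b @ a) # B2)"
   using right_cutI[of _ B1 b a B2 d "z # A'" c] bne z l nz by simp
  then show ?thesis using Cons z by (simp add: in_inL)
 qed
next
 fix A1 b a A2 c d B1 b' a' B2
 assume l: "q \<in> inL (A1 @ b # d # B1 @ (b' @ a') # B2)" "a' \<noteq> []" "tg (d # B1 @ [b'])"
 show False
 proof (cases A1)
  case Nil
  with l obtain z where z: "tg (z # d # B1 @ (b' @ a') # B2)" by (auto simp: in_inL)
  then show ?thesis using excl_tg[of "[]" z d B1 b' a' B2] l by simp
 next
  case (Cons f A')
  with l obtain z where z: "tg (z # A' @ b # d # B1 @ (b' @ a') # B2)" by (auto simp: in_inL)
  then show ?thesis using excl_tg[of "z # A'" b d B1 b' a' B2] l by simp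
 qed
qed

lemma cut_sum_R:
 assumes ws: "word ws"
 shows "(\<Sum>(A, c, d, B)\<in>{(A, c, d, B)\<in>pairs ws. q \<in> inR (A @ (c @ d) # B) \<and> \<not> (B = [] \<and> (\<exists>y. q = y @ d))}. sg (wdeg (d # B))) =
  (\<Sum>(L, X, R, x)\<in>{(L, X, R, x)\<in>CLs (\<lambda>w. q \<in> inR w) ws. R \<noteq> []}. sg (wdeg R)) +
  (\<Sum>(L, X, R, x)\<in>{(L, X, R, x)\<in>CRs (\<lambda>w. q \<in> inR w) ws. L \<noteq> []}. sg (wdeg R) * sg (ldeg x))"
proof (rule cut_sum[OF ws, where P = "\<lambda>w. q \<in> inR w" and ins = "\<lambda>A c d B. \<not> (B = [] \<and> (\<exists>y. q = y @ d))"])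
 fix A c d B assume w: "ws = A @ c # d # B" and q: "q \<in> inR (A @ (c @ d) # B)" and ins: "\<not> (B = [] \<and> (\<exists>y. q = y @ d))"
 have ne: "c \<noteq> []" "d \<noteq> []" using word_entry[of A c "d # B"] word_entry[of "A @ [c]" d B] ws w by auto
 let ?G = "(\<exists>A1 b a A2. A = A1 @ (b @ a) # A2 \<and> a \<noteq> [] \<and> tg (a # A2 @ [c]) \<and> q \<in> inR (A1 @ b # d # B)) \<or>
   (\<exists>B1 b a B2. B = B1 @ (b @ a) # B2 \<and> a \<noteq> [] \<and> tg (d # B1 @ [b]) \<and> q \<in> inR (A @ c # a # B2))"
 show ?G
 proof (cases B rule: rev_cases)
  case Nil
  with q obtain z where z: "c @ d = z @ q" "tg (A @ [z])" "q \<noteq> []" by (auto simp: in_inR)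
  from z(1) ins Nil obtain d' where d': "d = d' @ q" "z = c @ d'" "d' \<noteq> []"
   by (auto simp: append_eq_append_conv2)
  from tg_cut[OF z(2), of A c d' "[]"] d' ne
  obtain A1 b a A2 where "left_cut A c d' [] A1 b a A2" by (auto simp: right_cut_def)
  then have "A = A1 @ (b @ a) # A2 \<and> a \<noteq> [] \<and> tg (a # A2 @ [c]) \<and> q \<in> inR (A1 @ b # d # B)"
   using Nil d' z in_inR[of q "A1 @ [b]" d] by (auto simp: left_cut_def)
  then show ?thesis by blast
 next
  case (snoc B' f)
  with q in_inR[of q "A @ (c @ d) # B'" f] obtain z where z: "f = z @ q" "tg (A @ (c @ d) # B' @ [z])" "q \<noteq> []" by auto
  from tg_cut[OF z(2), of A c d "B' @ [z]"] ne
  show ?thesis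
  proof (simp, elim disjE exE)
   fix A1 b a A2 assume "left_cut A c d (B' @ [z]) A1 b a A2"
   then have "A = A1 @ (b @ a) # A2 \<and> a \<noteq> [] \<and> tg (a # A2 @ [c]) \<and> q \<in> inR (A1 @ b # d # B)"
    using snoc z in_inR[of q "A1 @ b # d # B'" f] by (auto simp: left_cut_def)
   then show ?thesis by blast
  next
   fix B1 b a B2 assume "right_cut A c d (B' @ [z]) B1 b a B2"
   then have l: "B' @ [z] = B1 @ (b @ a) # B2" "a \<noteq> []" "tg (d # B1 @ [b])" "tg (A @ c # a # B2)" by (auto simp: right_cut_def)
   show ?thesis
   proof (cases B2 rule: rev_cases)
    case Nil
    with l snoc z in_inR[of q "A @ [c]" "a @ q"]
    have "B = B1 @ (b @ (a @ q)) # [] \<and> a @ q \<noteq> [] \<and> tg (d # B1 @ [b]) \<and> q \<in> inR (A @ c # (a @ q) # [])" by auto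
    then show ?thesis by blast
   next
    case (snoc B2' y)
    with l(1) have "B' @ [z] = (B1 @ (b @ a) # B2') @ [y]" by simp
    then have "y = z" "B' = B1 @ (b @ a) # B2'" by (simp_all only: append1_eq_conv)
    with l \<open>B = B' @ [f]\<close> z snoc in_inR[of q "A @ c # a # B2'" f]
    have "B = B1 @ (b @ a) # (B2' @ [f]) \<and> a \<noteq> [] \<and> tg (d # B1 @ [b]) \<and> q \<in> inR (A @ c # a # B2' @ [f])" by auto
    then show ?thesis by blast
   qed
  qed
 qed
next
 fix A1 b a A2 c d B
 assume w: "ws = A1 @ (b @ a) # A2 @ c # d # B" and l: "a \<noteq> []" "tg (a # A2 @ [c])" "q \<in> inR (A1 @ b # d # B)"
 show "q \<in> inR (A1 @ (b @ a) # A2 @ (c @ d) # B) \<and> \<not> (B = [] \<and> (\<exists>y. q = y @ d))"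
 proof (cases B rule: rev_cases)
  case Nil
  with l in_inR[of q "A1 @ [b]" d] obtain z where z: "d = z @ q" "tg (A1 @ b # z # [])" "q \<noteq> []" by auto
  have ne: "z \<noteq> []" "b \<noteq> []" using tg_ne[OF z(2)] by auto
  have "nzc (last b) (hd a)" using word_junction[of A1 b a "A2 @ c # d # B"] w ws ne l by simp
  then have "tg ((A1 @ (b @ a) # A2) @ (c @ z) # [])"
   using left_cutI[of "A1 @ (b @ a) # A2" A1 b a A2 c z "[]"] ne z l by simp
  then show ?thesis using Nil z ne in_inR[of q "A1 @ (b @ a) # A2" "c @ d"] by simp
 next
  case (snoc B' f)
  with l in_inR[of q "A1 @ b # d # B'" f] obtain z where z: "f = z @ q" "tg (A1 @ b # d # B' @ [z])" "q \<noteq> []" by auto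
  have ne: "b \<noteq> []" using tg_ne[OF z(2)] by auto
  have "nzc (last b) (hd a)" using word_junction[of A1 b a "A2 @ c # d # B"] w ws ne l by simp
  then have "tg ((A1 @ (b @ a) # A2) @ (c @ d) # B' @ [z])"
   using left_cutI[of "A1 @ (b @ a) # A2" A1 b a A2 c d "B' @ [z]"] ne z l by simp
  then show ?thesis using snoc z ne in_inR[of q "A1 @ (b @ a) # A2 @ (c @ d) # B'" f] by simp
 qed
next
 fix A c d B1 b a B2
 assume w: "ws = A @ c # d # B1 @ (b @ a) # B2" and l: "a \<noteq> []" "tg (d # B1 @ [b])" "q \<in> inR (A @ c # a # B2)"
 have bne: "b \<noteq> []" using tg_ne[OF l(2)] by auto
 have nz: "z \<noteq> [] \<Longrightarrow> a = z @ z' \<Longrightarrow> nzc (last b) (hd z)" for z z' using word_junction[of "A @ c # d # B1" b a B2] w ws bne l by simp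
 have "q \<in> inR (A @ (c @ d) # B1 @ (b @ a) # B2)"
 proof (cases B2 rule: rev_cases)
  case Nil
  with l in_inR[of q "A @ [c]" a] obtain z where z: "a = z @ q" "tg (A @ c # z # [])" "q \<noteq> []" by auto
  have zne: "z \<noteq> []" using tg_ne[OF z(2)] by auto
  have "tg (A @ (c @ d) # B1 @ (b @ z) # [])"
   using right_cutI[of _ B1 b z "[]" d A c] bne zne z l nz by simp
  then show ?thesis using Nil z zne in_inR[of q "A @ (c @ d) # B1" "b @ a"] by simp
 next
  case (snoc B' f)
  with l in_inR[of q "A @ c # a # B'" f] obtain z where z: "f = z @ q" "tg (A @ c # a # B' @ [z])" "q \<noteq> []" by auto
  have "tg (A @ (c @ d) # B1 @ (b @ a) # B' @ [z])"
   using right_cutI[of _ B1 b a "B' @ [z]" d A c] bne z l nz[of a "[]"] by simp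
  then show ?thesis using snoc z in_inR[of q "A @ (c @ d) # B1 @ (b @ a) # B'" f] by simp
 qed
 then show "q \<in> inR (A @ (c @ d) # B1 @ (b @ a) # B2) \<and> \<not> (B1 @ (b @ a) # B2 = [] \<and> (\<exists>y. q = y @ d))" by simp
next
 fix A1 b a A2 c d B1 b' a' B2
 assume l: "q \<in> inR (A1 @ b # d # B1 @ (b' @ a') # B2)" "a' \<noteq> []" "tg (d # B1 @ [b'])" "q \<in> inR (A1 @ (b @ a) # A2 @ c # a' # B2)"
 show False
 proof (cases B2 rule: rev_cases)
  case Nil
  with l(4) in_inR[of q "A1 @ (b @ a) # A2 @ [c]" a'] obtain z2
   where z: "a' = z2 @ q" "tg (A1 @ (b @ a) # A2 @ [c, z2])" by auto
  have "z2 \<noteq> []" using tg_ne[OF z(2)] by auto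
  moreover have "tg (A1 @ b # d # B1 @ [b' @ z2])"
   using l(1) in_inR[of q "A1 @ b # d # B1" "b' @ a'"] z Nil by auto
  ultimately show ?thesis using excl_tg[of A1 b d B1 b' z2 "[]"] l(3) by simp
 next
  case (snoc B' f)
  with l in_inR[of q "A1 @ b # d # B1 @ (b' @ a') # B'" f] obtain z where "tg (A1 @ b # d # B1 @ (b' @ a') # B' @ [z])" by auto
  then show ?thesis using excl_tg[of A1 b d B1 b' a' "B' @ [z]"] l by simp
 qed
qed

text \<open>
 The terms that are not matched by cutting, because the surplus passes from one product to the other at an end of
 the word.  In \<open>X1\<close> and \<open>X2\<close> a product of length two comes first or last in the word; in \<open>CL\<close> and \<open>CR\<close> two
 tree-gons stand next to each other and share the entry that contains \<open>x\<close>.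
\<close>

definition X1 where "X1 ws q \<longleftrightarrow> (\<exists>p bl z x. ws = p # bl @ [z @ x] \<and> q = p @ x \<and> tg (bl @ [z]) \<and> hd (hd bl) = nx (last p))"
definition X2 where "X2 ws q \<longleftrightarrow> (\<exists>y z bl p. ws = (y @ z) # bl @ [p] \<and> q = y @ p \<and> tg (z # bl) \<and> hd p = nx (last (last bl)))"
definition CL where "CL ws q \<longleftrightarrow> (\<exists>z L x a A. ws = (q @ z) # L @ (x @ a) # A \<and> tg (z # L @ [x]) \<and> tg (a # A))"
definition CR where "CR ws q \<longleftrightarrow> (\<exists>B b x R z. ws = B @ (b @ x) # R @ [z @ q] \<and> tg (B @ [b]) \<and> tg (x # R @ [z]))"

lemma tg_adj_mid: "tg (A @ a # b # B) \<Longrightarrow> hd b = nx (last a)"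
 using tg_adj[of "A @ a # b # B"] by (auto simp: successively_append_iff)

lemma tg_adj_last: "tg (A @ [b]) \<Longrightarrow> A \<noteq> [] \<Longrightarrow> hd b = nx (last (last A))"
 using tg_adj_mid[of "butlast A" "last A" b "[]"] by (metis append_Cons append_Nil append_assoc append_butlast_last_id)

lemma tg_adj_first: "tg (a # B) \<Longrightarrow> B \<noteq> [] \<Longrightarrow> hd (hd B) = nx (last a)"
 using tg_adj_mid[of "[]" a "hd B" "tl B"] by simp

lemma tg_adj_wrap: "tg (a # A @ [b]) \<Longrightarrow> hd a = nx (last b)"
 using tg_adj[of "a # A @ [b]"] by simp

lemma tg_wrapI: "tg (A @ a # b # B) \<Longrightarrow> tg (b # B @ A @ [a])"
 using tg_rotate_append[of "A @ [a]" "b # B"] by simp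

lemma last_in: "nzl a \<Longrightarrow> a \<noteq> [] \<Longrightarrow> last a \<in> Ar"
 by (auto simp: nzl_def)

lemma tg_rotate_last: "tg (A @ [a]) \<Longrightarrow> tg (a # A)"
 using tg_rotate_append[of A "[a]"] by simp

lemma X1_imp:
 assumes ws: "word ws" and X: "X1 ws q" shows "X2 ws q \<or> CR ws q"
proof -
 obtain p bl z x where x: "ws = p # bl @ [z @ x]" "q = p @ x" "tg (bl @ [z])" "hd (hd bl) = nx (last p)"
  using X by (auto simp: X1_def)
 obtain e bl' where bl: "bl = e # bl'" using tg_length[OF x(3)] by (cases bl) auto
 have p: "nzl p" "p \<noteq> []" using word_entry[of "[]" p] ws x(1) by auto
 have z: "nzl z" "z \<noteq> []" using tg_entry[OF x(3), of z] by auto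
 have e: "hd e = nx (last z)" using tg_adj_wrap[of e bl' z] x(3) bl by simp
 then have "last p = last z" using nx_inj[OF last_in[OF p] last_in[OF z]] x(4) bl by simp
 with nzl_suffix_total[OF p(1) z(1) p(2) z(2)] consider d where "p = d @ z" | d where "z = d @ p" "d \<noteq> []" by blast
 then show ?thesis
 proof cases
  case 1
  have "tg (z # bl)" using tg_rotate_last[OF x(3)] .
  moreover have "hd (z @ x) = nx (last (last bl))"
   using tg_adj_last[OF x(3)] bl z(2) by simp
  ultimately have "X2 ws q" unfolding X2_def using x 1 by (intro exI[of _ d] exI[of _ z] exI[of _ bl] exI[of _ "z @ x"]) simp
  then show ?thesis ..
 next
  case 2
  with x(3) have "tg (bl @ (d @ p) # [])" by simp
  from tg_cut[OF this refl 2(2) p(2)] obtain A1 b a A2 where "left_cut bl d p [] A1 b a A2" by (auto simp: right_cut_def)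
  then have l: "bl = A1 @ (b @ a) # A2" "tg (a # A2 @ [d])" "tg (A1 @ b # [p])" by (auto simp: left_cut_def)
  have "tg ((p # A1) @ [b])" using tg_wrapI[OF l(3)] by simp
  then have "CR ws q" unfolding CR_def
   using x 2 l by (intro exI[of _ "p # A1"] exI[of _ b] exI[of _ a] exI[of _ A2] exI[of _ d]) simp
  then show ?thesis ..
 qed
qed

lemma X2_imp:
 assumes ws: "word ws" and X: "X2 ws q" shows "X1 ws q \<or> CL ws q"
proof -
 obtain y z bl p where x: "ws = (y @ z) # bl @ [p]" "q = y @ p" "tg (z # bl)" "hd p = nx (last (last bl))"
  using X by (auto simp: X2_def)
 obtain e bl' where bl: "bl = bl' @ [e]" using tg_length[OF x(3)] by (cases bl rule: rev_cases) auto
 have p: "nzl p" "p \<noteq> []" using word_entry[of "(y @ z) # bl" p "[]"] ws x(1) by auto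
 have z: "nzl z" "z \<noteq> []" using tg_entry[OF x(3), of z] by auto
 have e: "hd z = nx (last e)" using tg_adj_wrap[of z bl' e] x(3) bl by simp
 then have "hd p = hd z" using x(4) bl by simp
 with nzl_prefix_total[OF p(1) z(1) p(2) z(2)] consider d where "p = z @ d" | d where "z = p @ d" "d \<noteq> []" by blast
 then show ?thesis
 proof cases
  case 1
  have "tg (bl @ [z])" using tg_rotate[OF x(3)] .
  moreover have "hd (hd bl) = nx (last (y @ z))"
   using tg_adj_first[OF x(3)] bl z(2) by simp
  ultimately have "X1 ws q" unfolding X1_def
   using x 1 by (intro exI[of _ "y @ z"] exI[of _ bl] exI[of _ z] exI[of _ d]) simp
  then show ?thesis ..
 next
  case 2
  with x(3) have "tg ([] @ (p @ d) # bl)" by simp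
  from tg_cut[OF this refl p(2) 2(2)] obtain B1 b a B2 where "right_cut [] p d bl B1 b a B2" by (auto simp: left_cut_def)
  then have l: "bl = B1 @ (b @ a) # B2" "tg (d # B1 @ [b])" "tg (p # a # B2)" by (auto simp: right_cut_def)
  have "tg (a # B2 @ [p])" using tg_rotate[OF l(3)] by simp
  then have "CL ws q" unfolding CL_def
   using x 2 l by (intro exI[of _ d] exI[of _ B1] exI[of _ b] exI[of _ a] exI[of _ "B2 @ [p]"]) simp
  then show ?thesis ..
 qed
qed

lemma CL_imp:
 assumes ws: "word ws" and C: "CL ws q" shows "X2 ws q \<or> CR ws q"
proof -
 obtain z L x a A where c: "ws = (q @ z) # L @ (x @ a) # A" "tg (z # L @ [x])" "tg (a # A)"
  using C by (auto simp: CL_def)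
 obtain A' e where A: "A = A' @ [e]" using tg_length[OF c(3)] by (cases A rule: rev_cases) auto
 have A': "A' \<noteq> []" using tg_length[OF c(3)] A by auto
 have x: "nzl x" "x \<noteq> []" using tg_entry[OF c(2), of x] by auto
 have z: "nzl z" "z \<noteq> []" using tg_entry[OF c(2), of z] by auto
 have a: "nzl a" "a \<noteq> []" using tg_entry[OF c(3), of a] by auto
 have e: "nzl e" "e \<noteq> []" using tg_entry[OF c(3), of e] A by auto
 have xa: "nzc (last x) (hd a)" using word_junction[of "(q @ z) # L" x a A] ws c x a by simp
 have hz: "hd z = nx (last x)" using tg_adj_wrap[OF c(2)] .
 have ha: "hd a = nx (last e)" using tg_adj_wrap[of a A' e] c A by simp
 have ez: "nzc (last e) (hd z)" using nzc_swap[OF xa ha hz last_in[OF e]] .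
 have base: "tg (L @ [x, z] @ [])" using tg_rotate[OF c(2)] by simp
 show ?thesis
 proof (cases "q = []")
  case True
  then have "CR ws q" unfolding CR_def using c A
   by (intro exI[of _ "z # L"] exI[of _ x] exI[of _ a] exI[of _ A'] exI[of _ e]) simp
  then show ?thesis ..
 next
  case False
  have "nzl q" "nzc (last q) (hd z)" using word_entry[of "[]" "q @ z"] ws c False z by (auto simp: nzl_append)
  then have "last q = last e" using ez nzc_left_unique by blast
  with nzl_suffix_total[OF \<open>nzl q\<close> e(1) False e(2)]
  consider y where "q = y @ e" | d where "e = d @ q" "d \<noteq> []" by blast
  then show ?thesis
  proof cases
   case 1
   have "tg (L @ [x @ a] @ A' @ [e @ z] @ [])" using tg_glue[OF base, of a A' e] c A xa ez by simp
   then have "tg ((e @ z) # L @ (x @ a) # A')" using tg_rotate_append[of "L @ [x @ a] @ A'" "[e @ z]"] by simp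
   moreover have "hd e = nx (last (last A'))" using tg_adj_last[of "a # A'" e] c A A' by simp
   ultimately have "X2 ws q" unfolding X2_def using c A A' 1
    by (intro exI[of _ y] exI[of _ "e @ z"] exI[of _ "L @ (x @ a) # A'"] exI[of _ e]) simp
   then show ?thesis ..
  next
   case 2
   have "tg ((a # A') @ (d @ q) # [])" using c A 2 by simp
   from tg_cut[OF this refl 2(2) False] obtain A1 b a' A2 where "left_cut (a # A') d q [] A1 b a' A2" by (auto simp: right_cut_def)
   then have l: "a # A' = A1 @ (b @ a') # A2" "tg (a' # A2 @ [d])" "tg (A1 @ b # [q])" by (auto simp: left_cut_def)
   obtain A1' where A1: "A1 = a # A1'" using tg_length[OF l(3)] l(1) by (cases A1) auto
   have "tg (a # (A1' @ [b]) @ [q])" using l(3) A1 by simp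
   from tg_glue[OF base this xa] have "tg ((L @ [x @ a] @ A1' @ [b]) @ [q @ z])"
    using \<open>nzc (last q) (hd z)\<close> by simp
   from tg_rotate_last[OF this] have "tg (((q @ z) # L @ (x @ a) # A1') @ [b])" by simp
   then have "CR ws q" unfolding CR_def using c A 2 l A1
    by (intro exI[of _ "(q @ z) # L @ (x @ a) # A1'"] exI[of _ b] exI[of _ a'] exI[of _ A2] exI[of _ d]) simp
   then show ?thesis ..
  qed
 qed
qed

lemma CR_imp:
 assumes ws: "word ws" and C: "CR ws q" shows "X1 ws q \<or> CL ws q"
proof -
 obtain B b x R z where c: "ws = B @ (b @ x) # R @ [z @ q]" "tg (B @ [b])" "tg (x # R @ [z])"
  using C by (auto simp: CR_def)
 obtain e B' where B: "B = e # B'" using tg_length[OF c(2)] by (cases B) auto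
 have B': "B' \<noteq> []" using tg_length[OF c(2)] B by auto
 have x: "nzl x" "x \<noteq> []" using tg_entry[OF c(3), of x] by auto
 have z: "nzl z" "z \<noteq> []" using tg_entry[OF c(3), of z] by auto
 have b: "nzl b" "b \<noteq> []" using tg_entry[OF c(2), of b] by auto
 have e: "nzl e" "e \<noteq> []" using tg_entry[OF c(2), of e] B by auto
 have bx: "nzc (last b) (hd x)" using word_junction[of B b x] ws c x b by simp
 have hx: "hd x = nx (last z)" using tg_adj_wrap[OF c(3)] .
 have he: "hd e = nx (last b)" using tg_adj_wrap[of e B' b] c B by simp
 have ze: "nzc (last z) (hd e)" using nzc_swap[OF bx hx he last_in[OF z]] .
 show ?thesis
 proof (cases "q = []")
  case True
  then have "CL ws q" unfolding CL_def using c B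
   by (intro exI[of _ e] exI[of _ B'] exI[of _ b] exI[of _ x] exI[of _ "R @ [z]"]) simp
  then show ?thesis ..
 next
  case False
  have "nzl q" "nzc (last z) (hd q)"
   using word_entry[of "B @ (b @ x) # R" "z @ q" "[]"] ws c False z by (auto simp: nzl_append)
  then have "hd q = hd e" using ze nzc_right_unique by blast
  with nzl_prefix_total[OF \<open>nzl q\<close> e(1) False e(2)]
  consider y where "q = e @ y" | d where "e = q @ d" "d \<noteq> []" by blast
  then show ?thesis
  proof cases
   case 1
   have "tg (B' @ [b, e] @ [])" using tg_rotate[of e "B' @ [b]"] c B by simp
   from tg_glue[OF this c(3) bx ze] have "tg ((B' @ (b @ x) # R) @ [z @ e])" by simp
   moreover have "hd (hd (B' @ (b @ x) # R)) = nx (last e)"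
    using tg_adj_first[of e "B' @ [b]"] c B B' by simp
   ultimately have "X1 ws q" unfolding X1_def using c B 1
    by (intro exI[of _ e] exI[of _ "B' @ (b @ x) # R"] exI[of _ "z @ e"] exI[of _ y]) simp
   then show ?thesis ..
  next
   case 2
   have "tg ([] @ (q @ d) # (B' @ [b]))" using c B 2 by simp
   from tg_cut[OF this refl False 2(2)] obtain B1 b' a' B2 where "right_cut [] q d (B' @ [b]) B1 b' a' B2" by (auto simp: left_cut_def)
   then have l: "B' @ [b] = B1 @ (b' @ a') # B2" "tg (d # B1 @ [b'])" "tg (q # a' # B2)" by (auto simp: right_cut_def)
   have "B2 \<noteq> []" using tg_length[OF l(3)] by auto
   then obtain B2' f where "B2 = B2' @ [f]" by (cases B2 rule: rev_cases) auto
   with l(1) have "B' @ [b] = (B1 @ (b' @ a') # B2') @ [f]" by simp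
   then have B2: "B2 = B2' @ [b]" "B' = B1 @ (b' @ a') # B2'" using \<open>B2 = B2' @ [f]\<close> by (simp_all only: append1_eq_conv)
   have "tg ((a' # B2') @ [b, q] @ [])" using tg_rotate[OF l(3)] B2 by simp
   from tg_glue[OF this c(3) bx] have "tg (a' # B2' @ (b @ x) # R @ [z @ q])" using \<open>nzc (last z) (hd q)\<close> by simp
   then have "CL ws q" unfolding CL_def using c B 2 l B2
    by (intro exI[of _ d] exI[of _ B1] exI[of _ b'] exI[of _ a'] exI[of _ "B2' @ (b @ x) # R @ [z @ q]"]) simp
   then show ?thesis ..
  qed
 qed
qed

lemma X1_CL_exclusive: "X1 ws q \<Longrightarrow> CL ws q \<Longrightarrow> False"
proof -
 assume "X1 ws q" "CL ws q"
 then obtain p x z r where "hd ws = p" "q = p @ x" "hd ws = q @ z" "tg (z # r)" by (fastforce simp: X1_def CL_def)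
 with tg_ne[OF this(4)] show False by auto
qed

lemma X2_CR_exclusive: "X2 ws q \<Longrightarrow> CR ws q \<Longrightarrow> False"
proof -
 assume a: "X2 ws q" "CR ws q"
 then obtain p y where 1: "last ws = p" "q = y @ p" by (fastforce simp: X2_def)
 obtain z r where "last ws = z @ q" "tg (r @ [z])" using a(2) unfolding CR_def by (metis append_Cons append_assoc last_snoc)
 with tg_ne[OF this(2)] 1 show False by auto
qed

text \<open>
 The conditions \<open>X1\<close> and \<open>CL\<close> exclude each other, as do \<open>X2\<close> and \<open>CR\<close>.  Going around a tree-gon shows that each side implies
 the other.
\<close>

lemma four_term:
 "word ws \<Longrightarrow> of_bool (X1 ws q) + of_bool (CL ws q) = (of_bool (X2 ws q) + of_bool (CR ws q) :: complex)"
 using X1_imp[of ws q] X2_imp[of ws q] CL_imp[of ws q] CR_imp[of ws q] X1_CL_exclusive[of ws q] X2_CR_exclusive[of ws q]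
 by auto

lemma sum_CL:
 "(\<Sum>(L, X, R, x)\<in>{(L, X, R, x)\<in>CLs (\<lambda>w. q \<in> inL w) ws. R = []}. sg (wdeg R)) = of_bool (CL ws q)"
proof -
 let ?C = "{(L, X, R, x)\<in>CLs (\<lambda>w. q \<in> inL w) ws. R = []}"
 have C: "\<exists>L x a A. t = (L, (x @ a) # A, [], x) \<and> ws = L @ (x @ a) # A \<and> tg (a # A) \<and> q \<in> inL (L @ [x])" if t: "t \<in> ?C" for t
  using t by (cases t) (auto simp: CLs_def inL_def[of "_ :: 'e list list"])
 have uniq: "s = t" if s: "s \<in> ?C" and t: "t \<in> ?C" for s t
 proof -
  obtain L x a A where 1: "s = (L, (x @ a) # A, [], x)" "ws = L @ (x @ a) # A" "tg (a # A)" using C[OF s] by blast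
  obtain L' x' a' A' where 2: "t = (L', (x' @ a') # A', [], x')" "ws = L' @ (x' @ a') # A'" "tg (a' # A')" using C[OF t] by blast
  have ne: "a \<noteq> []" "a' \<noteq> []" using tg_ne[OF 1(3)] tg_ne[OF 2(3)] by auto
  have "L @ (x @ a) # A = L' @ (x' @ a') # A'" using 1 2 by simp
  from append_Cons_eq_append_ConsD[OF this] show "s = t"
  proof (elim disjE exE conjE)
   fix E assume "A = E @ (x' @ a') # A'"
   with 1 2 ne tg_suffix_free[OF 2(3) refl, of "a # E" x'] show ?thesis by simp
  next
   assume f: "L = L'" "x @ a = x' @ a'" "A = A'"
   from this(2) obtain us where "(x = x' @ us \<and> a' = us @ a) \<or> (x' = x @ us \<and> a = us @ a')"
    by (auto simp: append_eq_append_conv2)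
   with 1 2 f tg_suffix_free[OF 2(3) refl, of "[]" us] tg_suffix_free[OF 1(3) refl, of "[]" us] show ?thesis by auto
  next
   fix E assume "A' = E @ (x @ a) # A"
   with 1 2 ne tg_suffix_free[OF 1(3) refl, of "a' # E" x] show ?thesis by simp
  qed
 qed
 have iff: "?C \<noteq> {} \<longleftrightarrow> CL ws q"
 proof
  assume "?C \<noteq> {}"
  then obtain t where "t \<in> ?C" by blast
  from C[OF this] obtain L x a A where 1: "ws = L @ (x @ a) # A" "tg (a # A)" "q \<in> inL (L @ [x])" by blast
  show "CL ws q"
  proof (cases L)
   case Nil
   with 1(3) obtain z where "tg [z]" by (auto simp: in_inL)
   from tg_length[OF this] show ?thesis by simp
  next
   case (Cons f L')
   with 1(3) obtain z where "f = q @ z" "tg (z # L' @ [x])" by (auto simp: in_inL)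
   then show ?thesis unfolding CL_def using 1 Cons
    by (intro exI[of _ z] exI[of _ L'] exI[of _ x] exI[of _ a] exI[of _ A]) simp
  qed
 next
  assume "CL ws q"
  then obtain z L x a A where c: "ws = (q @ z) # L @ (x @ a) # A" "tg (z # L @ [x])" "tg (a # A)" by (auto simp: CL_def)
  then have "((q @ z) # L, (x @ a) # A, [], x) \<in> ?C" by (auto simp: CLs_def in_inL)
  then show "?C \<noteq> {}" by blast
 qed
 show ?thesis
 proof (cases "?C = {}")
  case True
  then show ?thesis using iff by (simp only: sum.empty) simp
 next
  case False
  then obtain t where "t \<in> ?C" by blast
  then have "?C = {t}" using uniq by blast
  moreover obtain L X x where "t = (L, X, [], x)" using C[OF \<open>t \<in> ?C\<close>] by blast
  ultimately show ?thesis using iff False by simp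
 qed
qed

lemma sum_CR:
 fixes P :: "'e list list \<Rightarrow> bool"
 assumes P: "\<And>x R. P (x # R) \<Longrightarrow> \<exists>R' z. R = R' @ [z @ q] \<and> tg (x # R' @ [z])"
  "\<And>x R' z. tg (x # R' @ [z]) \<Longrightarrow> P (x # R' @ [z @ q])"
 shows "(\<Sum>(L, X, R, x)\<in>{(L, X, R, x)\<in>CRs P ws. L = []}. sg (wdeg R) * sg (ldeg x)) = - of_bool (CR ws q) * sg (ldeg q)"
proof -
 let ?C = "{(L, X, R, x)\<in>CRs P ws. L = []}"
 have C: "\<exists>B b x R z. t = ([], B @ [b @ x], R @ [z @ q], x) \<and> ws = B @ (b @ x) # R @ [z @ q] \<and> x \<noteq> [] \<and> tg (B @ [b]) \<and> tg (x # R @ [z])" if t: "t \<in> ?C" for t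
  using t P(1) by (cases t) (fastforce simp: CRs_def inR_def[of "_ :: 'e list list"])
 have uniq: "s = t" if s: "s \<in> ?C" and t: "t \<in> ?C" for s t
 proof -
  obtain B b x R z where 1: "s = ([], B @ [b @ x], R @ [z @ q], x)" "ws = B @ (b @ x) # R @ [z @ q]" "x \<noteq> []" "tg (B @ [b])" using C[OF s] by blast
  obtain B' b' x' R' z' where 2: "t = ([], B' @ [b' @ x'], R' @ [z' @ q], x')" "ws = B' @ (b' @ x') # R' @ [z' @ q]" "x' \<noteq> []" "tg (B' @ [b'])" using C[OF t] by blast
  have "B @ (b @ x) # (R @ [z @ q]) = B' @ (b' @ x') # (R' @ [z' @ q])" using 1 2 by simp
  from append_Cons_eq_append_ConsD[OF this] show "s = t"
  proof (elim disjE exE conjE)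
   fix E assume "B' = B @ (b @ x) # E"
   with 1 2 tg_prefix_free[OF 1(4) refl, of x "E @ [b']"] show ?thesis by simp
  next
   assume f: "B = B'" "b @ x = b' @ x'" "R @ [z @ q] = R' @ [z' @ q]"
   from this(2) obtain us where "(b = b' @ us \<and> x' = us @ x) \<or> (b' = b @ us \<and> x = us @ x')"
    by (auto simp: append_eq_append_conv2)
   with 1 2 f tg_prefix_free[OF 1(4) refl, of us "[]"] tg_prefix_free[OF 2(4) refl, of us "[]"] show ?thesis by auto
  next
   fix E assume "B = B' @ (b' @ x') # E"
   with 1 2 tg_prefix_free[OF 2(4) refl, of x' "E @ [b]"] show ?thesis by simp
  qed
 qed
 have iff: "?C \<noteq> {} \<longleftrightarrow> CR ws q"
 proof
  assume "?C \<noteq> {}"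
  then obtain t where "t \<in> ?C" by blast
  from C[OF this] show "CR ws q" unfolding CR_def by blast
 next
  assume "CR ws q"
  then obtain B b x R z where c: "ws = B @ (b @ x) # R @ [z @ q]" "tg (B @ [b])" "tg (x # R @ [z])" by (auto simp: CR_def)
  have "x \<noteq> []" using tg_ne[OF c(3)] by auto
  then have "([], B @ [b @ x], R @ [z @ q], x) \<in> ?C" using c P(2)[OF c(3)] by (auto simp: CRs_def in_inR)
  then show "?C \<noteq> {}" by blast
 qed
 show ?thesis
 proof (cases "?C = {}")
  case True
  then show ?thesis using iff by (simp only: sum.empty) simp
 next
  case False
  then obtain t where "t \<in> ?C" by blast
  then have "?C = {t}" using uniq by blast
  moreover obtain B b x R z where t: "t = ([], B @ [b @ x], R @ [z @ q], x)" "tg (x # R @ [z])" using C[OF \<open>t \<in> ?C\<close>] by blast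
  moreover have "sg (wdeg (R @ [z @ q])) * sg (ldeg x) = sg (ldeg q + 1)"
   unfolding sg_mult by (rule sg_cong) (use tg_parity[OF t(2)] in \<open>simp add: algebra_simps\<close>)
  ultimately show ?thesis using iff False by (simp add: sg_add1 del: wdeg_simps)
 qed
qed

text \<open>
 Two adjacent tree-gons with a common entry whose middle part \<open>q\<close> is the surplus: either of them can be applied first,
 with opposite signs.
\<close>

lemma sum_both_sides:
 assumes q: "q \<noteq> []"
 shows "(\<Sum>(L, X, R, x)\<in>{(L, X, R, x)\<in>CRs (\<lambda>w. q \<in> inL w) ws. L = []}. sg (wdeg R) * sg (ldeg x)) =
  - sg (ldeg q) * (\<Sum>(L, X, R, x)\<in>{(L, X, R, x)\<in>CLs (\<lambda>w. q \<in> inR w) ws. R = []}. sg (wdeg R))"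
proof -
 let ?C = "{(L, X, R, x)\<in>CLs (\<lambda>w. q \<in> inR w) ws. R = []}" and ?D = "{(L, X, R, x)\<in>CRs (\<lambda>w. q \<in> inL w) ws. L = []}"
 define V where "V = {(L :: 'e list list, z, a, A). ws = L @ (z @ q @ a) # A \<and> tg (L @ [z]) \<and> tg (a # A)}"
 define h where "h = (\<lambda>(L :: 'e list list, z, a, A). (L, (z @ q @ a) # A, [] :: 'e list list, z @ q))"
 define k where "k = (\<lambda>(L, z, a, A). ([] :: 'e list list, L @ [z @ q @ a], A :: 'e list list, q @ a))"
 have C: "?C = h ` V"
 proof (intro equalityI subsetI)
  fix t assume "t \<in> ?C"
  then obtain L X x where t: "t = (L, X, [], x)" "ws = L @ X" "x \<in> inL X" "q \<in> inR (L @ [x])" by (cases t) (auto simp: CLs_def)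
  then obtain a A z where "X = (x @ a) # A" "tg (a # A)" "x = z @ q" "tg (L @ [z])" by (auto simp: inL_def in_inR)
  then have "(L, z, a, A) \<in> V" "t = h (L, z, a, A)" using t by (auto simp: V_def h_def)
  then show "t \<in> h ` V" by blast
 next
  fix t assume "t \<in> h ` V"
  then show "t \<in> ?C" using q by (auto simp: V_def h_def CLs_def in_inL in_inR)
 qed
 have D: "?D = k ` V"
 proof (intro equalityI subsetI)
  fix t assume "t \<in> ?D"
  then obtain X R x where t: "t = ([], X, R, x)" "ws = X @ R" "x \<in> inR X" "q \<in> inL (x # R)" by (cases t) (auto simp: CRs_def)
  then obtain a L z where "X = L @ [z @ x]" "tg (L @ [z])" "x = q @ a" "tg (a # R)" by (auto simp: inR_def in_inL)
  then have "(L, z, a, R) \<in> V" "t = k (L, z, a, R)" using t by (auto simp: V_def k_def)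
  then show "t \<in> k ` V" by blast
 next
  fix t assume "t \<in> k ` V"
  then show "t \<in> ?D" using q by (auto simp: V_def k_def CRs_def in_inL in_inR)
 qed
 have inj: "inj_on h V" "inj_on k V" by (auto simp: inj_on_def h_def k_def)
 show ?thesis unfolding C D sum.reindex[OF inj(1)] sum.reindex[OF inj(2)] sum_distrib_left
 proof (rule sum.cong[OF refl])
  fix t assume "t \<in> V"
  then obtain L z a A where t: "t = (L, z, a, A)" "tg (a # A)" by (auto simp: V_def)
  have "sg (wdeg A) * sg (ldeg (q @ a)) = sg (ldeg q + 1)"
   unfolding sg_mult by (rule sg_cong) (use tg_parity[OF t(2)] in \<open>simp add: algebra_simps\<close>)
  then show "((\<lambda>(L, X, R, x). sg (wdeg R) * sg (ldeg x)) \<circ> k) t = - sg (ldeg q) * ((\<lambda>(L, X, R, x). sg (wdeg R)) \<circ> h) t"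
   using t by (simp add: h_def k_def sg_add1)
 qed
qed

end

section \<open>The A-infinity relations\<close>

context graded_face_structure begin

definition mm :: "'e list list \<Rightarrow> ('e list \<Rightarrow>\<^sub>0 complex)" where
 "mm w = mT w + m2 w"

lemma lookup_mT: "lookup (mT w) q = of_bool (q \<in> inL w) + of_bool (q \<in> inR w) * sg (ldeg q)"
proof -
 have "(\<Sum>x\<in>inL w. if x = q then 1 else (0::complex)) = of_bool (q \<in> inL w)"
  "(\<Sum>x\<in>inR w. if x = q then sg (ldeg x) else 0) = of_bool (q \<in> inR w) * sg (ldeg q)"
  by auto
 then show ?thesis
  by (simp add: mT_def lookup_add lookup_sum lookup_bvec if_distrib[of "\<lambda>x. _ * x"] cong: if_cong)
qed

lemma lin_mT: "lin g (mT X) = (\<Sum>x\<in>inL X. g x) + (\<Sum>x\<in>inR X. smul (sg (ldeg x)) (g x))"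
 by (simp add: mT_def lin_add lin_sum lin_smul)

lemma sum_filter_split: "finite S \<Longrightarrow> sum f S = sum f {t\<in>S. Q t} + sum f {t\<in>S. \<not> Q t}"
 by (subst sum.union_disjoint[symmetric]) (auto intro: sum.cong)

lemma TT:
 "lookup (\<Sum>(L, X, R)\<in>splits ws. smul (sg (wdeg R)) (lin (\<lambda>x. mT (L @ x # R)) (mT X))) q =
  ((\<Sum>(L, X, R, x)\<in>CLs (\<lambda>w. q \<in> inL w) ws. sg (wdeg R)) + (\<Sum>(L, X, R, x)\<in>CRs (\<lambda>w. q \<in> inL w) ws. sg (wdeg R) * sg (ldeg x)))
  + sg (ldeg q) * ((\<Sum>(L, X, R, x)\<in>CLs (\<lambda>w. q \<in> inR w) ws. sg (wdeg R)) + (\<Sum>(L, X, R, x)\<in>CRs (\<lambda>w. q \<in> inR w) ws. sg (wdeg R) * sg (ldeg x)))"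
proof -
 have alg: "s * ((\<Sum>x\<in>I. a x + b x * t) + (\<Sum>x\<in>J. g x * (a x + b x * t))) =
   ((\<Sum>x\<in>I. a x * s) + (\<Sum>x\<in>J. a x * (s * g x))) + t * ((\<Sum>x\<in>I. b x * s) + (\<Sum>x\<in>J. b x * (s * g x)))"
  for s t :: complex and I J :: "'e list set" and a b g
  by (simp add: sum.distrib sum_distrib_left algebra_simps)
 have if_bool: "(if Q then c else 0) = of_bool Q * c" for Q and c :: complex by simp
 show ?thesis
  unfolding sum_CLs sum_CRs lookup_sum case_prod_beta lin_mT sum_distrib_left sum.distrib[symmetric] if_bool
  by (intro sum.cong refl)
   (simp only: lookup_smul lookup_add lookup_sum lookup_mT alg sum_distrib_left[symmetric])
qed

lemma m2_simps [simp]: "m2 [] = 0" "m2 [a] = 0" "m2 [a, b] = (if nzl (a @ b) then smul (sg (ldeg b)) (bvec (a @ b)) else 0)"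
 "m2 (a # b # c # w) = 0"
 by (simp_all add: m2_def)

lemma m2_length: "length w \<noteq> 2 \<Longrightarrow> m2 w = 0"
 by (auto simp: m2_def split: list.splits)

lemma assoc_terms: "(\<Sum>(L, X, R)\<in>splits ws. smul (sg (wdeg R)) (lin (\<lambda>x. m2 (L @ x # R)) (m2 X))) = 0"
proof (cases "length ws = 3")
 case False
 have "smul (sg (wdeg R)) (lin (\<lambda>x. m2 (L @ x # R)) (m2 X)) = 0" if "(L, X, R) \<in> splits ws" for L X R
 proof (cases "length X = 2")
  case True
  then have "m2 (L @ x # R) = 0" for x using that False by (intro m2_length) (auto simp: splits_def)
  then show ?thesis by (simp only: lin_fun_0 smul_zero)
 qed (simp add: m2_length)
 then show ?thesis by (auto intro: sum.neutral)
next
 case True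
 then obtain a b c where ws: "ws = [a, b, c]" by (auto simp: length_Suc_conv numeral_3_eq_3)
 have p: "pairs [a, b, c] = {([], a, b, [c]), ([a], b, c, [])}"
  by (auto simp: pairs_def Cons_eq_append_conv)
 have "(\<Sum>(L, X, R)\<in>splits ws. smul (sg (wdeg R)) (lin (\<lambda>x. m2 (L @ x # R)) (m2 X))) =
   (\<Sum>(A, c, d, B)\<in>pairs ws. smul (sg (wdeg B)) (lin (\<lambda>x. m2 (A @ x # B)) (m2 [c, d])))"
  by (rule sum_splits_inner2) (simp add: m2_length)
 also have "\<dots> = smul (sg (ldeg c - 1)) (lin (\<lambda>x. m2 [x, c]) (m2 [a, b])) + lin (\<lambda>x. m2 [a, x]) (m2 [b, c])"
  unfolding ws p by (simp del: m2_simps)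
 also have "\<dots> = 0"
 proof (cases "nzl (a @ b @ c)")
  case True
  then have "nzl (a @ b)" "nzl (b @ c)" by (cases "b = []"; auto simp: nzl_append)+
  moreover have "sg (ldeg c - 1) * (sg (ldeg b) * sg (ldeg c)) = - (sg (ldeg c) * sg (ldeg b + ldeg c))"
   by (auto simp: sg_def)
  ultimately show ?thesis using True by (simp add: lin_smul smul_minus_left)
 qed (simp add: lin_smul)
 finally show ?thesis .
qed

text \<open>
 Multiplying the first entry with the value of a product on the rest cancels against merging the first two
 entries if the merged entry continues the surplus; only \<open>X1\<close> is left over.
\<close>

lemma top_terms:
 assumes ws: "word (p # X)" and X: "X \<noteq> []"
 shows "lookup (lin (\<lambda>x. m2 [p, x]) (mT X)) q -
  (\<Sum>(A, c, d, B)\<in>{(A, c, d, B)\<in>pairs (p # X). nzl (c @ d) \<and> q \<in> inL (A @ (c @ d) # B) \<and> A = [] \<and> (\<exists>y. q = c @ y)}. sg (wdeg (d # B)))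
  = of_bool (X1 (p # X) q)"
proof -
 obtain d B where XdB: "X = d # B" using X by (cases X) auto
 have p: "p \<noteq> []" "nzl p" and d: "d \<noteq> []" "nzl d" using ws XdB by (auto simp: word_def)
 have cpd: "cmp (last p) (hd d)" using ws XdB by (auto simp: word_def)
 let ?S = "{(A, c, d, B)\<in>pairs (p # X). nzl (c @ d) \<and> q \<in> inL (A @ (c @ d) # B) \<and> A = [] \<and> (\<exists>y. q = c @ y)}"
 show ?thesis
 proof (cases "\<exists>x. q = p @ x")
  case False
  then have S: "?S = {}" by (auto simp: pairs_def)
  have "\<not> X1 (p # X) q" using False by (auto simp: X1_def)
  moreover have "lookup (m2 [p, x]) q = 0" for x using False by (auto simp: lookup_bvec)
  ultimately show ?thesis unfolding S by (simp add: lookup_lin del: m2_simps)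
 next
  case True
  then obtain x where q: "q = p @ x" by blast
  have S: "?S = (if nzl (p @ d) \<and> x \<in> inL X then {([], p, d, B)} else {})"
   using q XdB by (auto simp: pairs_def in_inL)
  have "lookup (m2 [p, y]) q = (if y = x then of_bool (nzl q) * sg (ldeg x) else 0)" for y
   using q by (auto simp: lookup_bvec)
  then have "lookup (lin (\<lambda>y. m2 [p, y]) (mT X)) q = of_bool (x \<in> inL X \<and> nzl q) * sg (ldeg x) + of_bool (x \<in> inR X \<and> nzl q)"
   by (simp add: lin_mT lookup_add lookup_sum if_distrib[of "\<lambda>x. _ * x"] sg_self cong: if_cong)
  moreover have "(\<Sum>(A, c, d, B)\<in>?S. sg (wdeg (d # B))) = of_bool (nzl (p @ d) \<and> x \<in> inL X) * sg (ldeg x)"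
  proof (cases "nzl (p @ d) \<and> x \<in> inL X")
   case True
   then obtain z where z: "d = x @ z" "tg (z # B)" using XdB by (auto simp: in_inL)
   have "sg (wdeg (d # B)) = sg (ldeg x)"
    by (rule sg_cong) (use tg_parity[OF z(2)] z(1) in \<open>simp add: algebra_simps\<close>)
   then show ?thesis unfolding S using True by simp
  qed (auto simp: S)
  moreover have "of_bool (x \<in> inL X \<and> nzl q) * sg (ldeg x) + of_bool (x \<in> inR X \<and> nzl q) - of_bool (nzl (p @ d) \<and> x \<in> inL X) * sg (ldeg x)
   = (of_bool (X1 (p # X) q) :: complex)"
  proof (cases "x = []")
   case True
   have "X1 (p # X) q \<longleftrightarrow> tg X \<and> hd d = nx (last p)"
   proof -
    have "X1 (p # X) q \<Longrightarrow> tg X \<and> hd d = nx (last p)"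
    proof -
     assume "X1 (p # X) q"
     then obtain bl z where b: "X = bl @ [z]" "tg (bl @ [z])" "hd (hd bl) = nx (last p)" using q True by (auto simp: X1_def)
     then show ?thesis using tg_length[OF b(2)] XdB by (cases bl) auto
    qed
    moreover have "X1 (p # X) q" if t: "tg X" "hd d = nx (last p)"
    proof -
     obtain bl z where b: "X = bl @ [z]" using XdB by (metis append_butlast_last_id list.distinct(1))
     then have "hd bl = d" using tg_length[OF t(1)] XdB by (cases bl) auto
     then show ?thesis unfolding X1_def using b t q True
      by (intro exI[of _ p] exI[of _ bl] exI[of _ z] exI[of _ "[]"]) simp
    qed
    ultimately show ?thesis by blast
   qed
   moreover have "nzl (p @ d) \<longleftrightarrow> hd d \<noteq> nx (last p)" using p d cpd by (auto simp: nzl_append nzc_def)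
   ultimately show ?thesis using True q p by (auto simp: inL_def inR_def XdB)
  next
   case False
   have 1: "nzl q \<Longrightarrow> x \<in> inL X \<Longrightarrow> nzl (p @ d)"
    using q d False by (auto simp: XdB in_inL nzl_append)
   have 2: "nzl (p @ d) \<Longrightarrow> x \<in> inL X \<Longrightarrow> nzl q"
    using q False by (auto simp: XdB in_inL nzl_append)
   have "X1 (p # X) q \<longleftrightarrow> x \<in> inR X \<and> nzl q"
   proof -
    have "nzl q \<longleftrightarrow> hd (hd bl) = nx (last p)" if X: "X = bl @ [z @ x]" and t: "tg (bl @ [z])" for bl z
    proof -
     have z: "z \<noteq> []" "nzl z" using tg_entry[OF t, of z] by auto
     obtain e bl' where bl: "bl = e # bl'" using tg_length[OF t] by (cases bl) auto
     have e: "hd e = nx (last z)" using tg_adj_wrap[of e bl' z] t bl by simp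
     have zx: "nzc (last z) (hd x)" "nzl x"
      using ws X False z by (auto simp: word_def nzl_append)
     have "hd (hd bl) = nx (last p) \<longleftrightarrow> last p = last z"
      using e bl nx_inj last_in z p by auto
     moreover have "nzl q \<longleftrightarrow> last p = last z"
      using q p zx False nzc_left_unique by (auto simp: nzl_append)
     ultimately show ?thesis by simp
    qed
    then show ?thesis using q False by (fastforce simp: X1_def inR_def)
   qed
   then show ?thesis using 1 2 by auto
  qed
  ultimately show ?thesis by (simp only:)
 qed
qed

text \<open>
 The mirror image of \<open>top_terms\<close>.
\<close>

lemma bottom_terms:
 assumes ws: "word (Y @ [p])" and Y: "Y \<noteq> []"
 shows "- sg (ldeg p) * lookup (lin (\<lambda>x. m2 [x, p]) (mT Y)) q
  - sg (ldeg q) * (\<Sum>(A, c, d, B)\<in>{(A, c, d, B)\<in>pairs (Y @ [p]). nzl (c @ d) \<and> q \<in> inR (A @ (c @ d) # B) \<and> B = [] \<and> (\<exists>y. q = y @ d)}. sg (wdeg (d # B)))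
  = - of_bool (X2 (Y @ [p]) q)"
proof -
 obtain A c where YAc: "Y = A @ [c]" using Y by (cases Y rule: rev_cases) auto
 have p: "p \<noteq> []" "nzl p" and c: "c \<noteq> []" "nzl c" using ws YAc by (auto simp: word_def)
 have cpd: "cmp (last c) (hd p)" using ws YAc by (auto simp: word_def successively_append_iff)
 let ?S = "{(A, c, d, B)\<in>pairs (Y @ [p]). nzl (c @ d) \<and> q \<in> inR (A @ (c @ d) # B) \<and> B = [] \<and> (\<exists>y. q = y @ d)}"
 have S0: "t \<in> ?S \<Longrightarrow> t = (A, c, p, [])" for t using YAc by (cases t) (auto simp: pairs_def)
 show ?thesis
 proof (cases "\<exists>x. q = x @ p")
  case False
  then have S: "?S = {}" using S0 by fastforce
  have "\<not> X2 (Y @ [p]) q" using False by (auto simp: X2_def)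
  moreover have "lookup (m2 [x, p]) q = 0" for x using False by (auto simp: lookup_bvec)
  ultimately show ?thesis unfolding S by (simp add: lookup_lin del: m2_simps)
 next
  case True
  then obtain y where q: "q = y @ p" by blast
  have S: "?S = (if nzl (c @ p) \<and> q \<in> inR (A @ [c @ p]) then {(A, c, p, [])} else {})"
   using q YAc S0 by (auto simp: pairs_def)
  have qR: "q \<in> inR (A @ [c @ p]) \<longleftrightarrow> (if y = [] then tg Y else y \<in> inR Y)"
   using q YAc p by (auto simp: in_inR)
  have "lookup (m2 [x, p]) q = (if x = y then of_bool (nzl q) * sg (ldeg p) else 0)" for x
   using q by (auto simp: lookup_bvec)
  then have l: "lookup (lin (\<lambda>x. m2 [x, p]) (mT Y)) q = of_bool (y \<in> inL Y \<and> nzl q) * sg (ldeg p) + of_bool (y \<in> inR Y \<and> nzl q) * sg (ldeg y) * sg (ldeg p)"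
   by (simp add: lin_mT lookup_add lookup_sum if_distrib[of "\<lambda>x. _ * x"] mult.assoc cong: if_cong)
  have s: "(\<Sum>(A, c, d, B)\<in>?S. sg (wdeg (d # B))) = of_bool (nzl (c @ p) \<and> q \<in> inR (A @ [c @ p])) * - sg (ldeg p)"
   unfolding S by (simp add: sg_add1)
  have main: "- of_bool (y \<in> inL Y \<and> nzl q) - of_bool (y \<in> inR Y \<and> nzl q) * sg (ldeg y) + of_bool (nzl (c @ p) \<and> q \<in> inR (A @ [c @ p])) * sg (ldeg y)
   = - (of_bool (X2 (Y @ [p]) q) :: complex)"
  proof (cases "y = []")
   case True
   have "X2 (Y @ [p]) q \<longleftrightarrow> tg Y \<and> hd p = nx (last c)"
   proof
    assume "X2 (Y @ [p]) q"
    then obtain y' z bl p' where b: "Y @ [p] = ((y' @ z) # bl) @ [p']" "q = y' @ p'" "tg (z # bl)" "hd p' = nx (last (last bl))"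
     by (auto simp: X2_def)
    then have "p' = p" "Y = (y' @ z) # bl" by (simp_all only: append1_eq_conv)
    moreover have "bl \<noteq> []" using tg_length[OF b(3)] by auto
    ultimately show "tg Y \<and> hd p = nx (last c)" using q True YAc b
     by (cases bl rule: rev_cases) auto
   next
    assume a: "tg Y \<and> hd p = nx (last c)"
    then obtain z bl where "A = z # bl" using tg_length[of Y] YAc by (cases A) auto
    then show "X2 (Y @ [p]) q" unfolding X2_def using a q True YAc
     by (intro exI[of _ "[]"] exI[of _ z] exI[of _ "bl @ [c]"] exI[of _ p]) simp
   qed
   moreover have "nzl (c @ p) \<longleftrightarrow> hd p \<noteq> nx (last c)" using p c cpd by (auto simp: nzl_append nzc_def)
   moreover have "y \<in> inL Y \<longleftrightarrow> tg Y" using True Y by (cases Y) (auto simp: in_inL)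
   moreover have "y \<notin> inR Y" using True by (simp add: inR_def)
   ultimately show ?thesis unfolding qR using True q p by auto
  next
   case False
   have 1: "nzl q \<Longrightarrow> y \<in> inR Y \<Longrightarrow> nzl (c @ p)"
    using q c False by (auto simp: YAc in_inR nzl_append)
   have 2: "nzl (c @ p) \<Longrightarrow> y \<in> inR Y \<Longrightarrow> nzl q"
    using q False p by (auto simp: YAc in_inR nzl_append)
   have "X2 (Y @ [p]) q \<longleftrightarrow> y \<in> inL Y \<and> nzl q"
   proof -
    have "nzl q \<longleftrightarrow> hd p = nx (last (last bl))" if X: "Y = (y @ z) # bl" and t: "tg (z # bl)" for bl z
    proof -
     have z: "z \<noteq> []" "nzl z" using tg_entry[OF t, of z] by auto
     obtain e bl' where bl: "bl = bl' @ [e]" using tg_length[OF t] by (cases bl rule: rev_cases) auto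
     have e: "hd z = nx (last e)" using tg_adj_wrap[of z bl' e] t bl by simp
     have zy: "nzc (last y) (hd z)" "nzl y"
      using ws X False z by (auto simp: word_def nzl_append)
     have "nzl q \<longleftrightarrow> hd p = hd z"
      using q p zy False nzc_right_unique by (auto simp: nzl_append)
     then show ?thesis using e bl by simp
    qed
    then show ?thesis using q False by (fastforce simp: X2_def inL_def)
   qed
   then show ?thesis unfolding qR using 1 2 False by auto
  qed
  have e: "ldeg q = ldeg y + ldeg p" using q by simp
  have e': "sg (ldeg p) * sg (ldeg p) = 1" "sg (ldeg y + ldeg p) * sg (ldeg p) = sg (ldeg y)" by (auto simp: sg_def)
  have alg: "- P * (u * P + v * Z * P) - PQ * (w * - P) = - u * (P * P) - v * Z * (P * P) + w * (PQ * P)" for u v w P PQ Z :: complex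
   by (simp add: algebra_simps)
  show ?thesis unfolding l s alg e e' using main by (simp only: mult_1_right)
 qed
qed

lemma mT_short: "length w < 3 \<Longrightarrow> mT w = 0"
proof -
 assume w: "length w < 3"
 then have "inL w = {}" "inR w = {}" by (auto simp: inL_def inR_def dest!: tg_length)
 then show ?thesis by (simp add: mT_def)
qed

lemma mT_unit: "[] \<in> set w \<Longrightarrow> mT w = 0"
proof -
 assume w: "[] \<in> set w"
 then have "inL w = {}" "inR w = {}" by (auto simp: inL_def inR_def dest!: tg_ne)
 then show ?thesis by (simp add: mT_def)
qed

lemma inside_nzl_L:
 assumes "word ws" "ws = A @ c # d # B" "q \<in> inL (A @ (c @ d) # B)" "\<not> (A = [] \<and> (\<exists>y. q = c @ y))"
 shows "nzl (c @ d)"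
proof (cases A)
 case Nil
 with assms(3) obtain z where z: "c @ d = q @ z" "tg (z # B)" by (auto simp: in_inL)
 from z(1) assms(4) Nil obtain c' where c': "c = q @ c'" "z = c' @ d" "c' \<noteq> []"
  by (auto simp: append_eq_append_conv2)
 have "nzl z" using tg_entry[OF z(2), of z] by simp
 then show ?thesis using c' assms(1,2) by (auto simp: nzl_append word_def)
next
 case (Cons f A')
 with assms(3) obtain z where "tg (z # A' @ (c @ d) # B)" by (auto simp: in_inL)
 from tg_entry[OF this, of "c @ d"] show ?thesis by simp
qed

lemma inside_nzl_R:
 assumes "word ws" "ws = A @ c # d # B" "q \<in> inR (A @ (c @ d) # B)" "\<not> (B = [] \<and> (\<exists>y. q = y @ d))"
 shows "nzl (c @ d)"
proof (cases B rule: rev_cases)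
 case Nil
 with assms(3) obtain z where z: "c @ d = z @ q" "tg (A @ [z])" by (auto simp: in_inR)
 from z(1) assms(4) Nil obtain d' where d': "d = d' @ q" "z = c @ d'" "d' \<noteq> []"
  by (auto simp: append_eq_append_conv2)
 have "nzl z" using tg_entry[OF z(2), of z] by simp
 then show ?thesis using d' assms(1,2) by (auto simp: nzl_append word_def)
next
 case (snoc B' f)
 with assms(3) in_inR[of q "A @ (c @ d) # B'" f] obtain z where "tg (A @ (c @ d) # B' @ [z])" by auto
 from tg_entry[OF this, of "c @ d"] show ?thesis by simp
qed

lemma merge_terms:
 assumes ws: "word ws"
 shows "lookup (\<Sum>(L, X, R)\<in>splits ws. smul (sg (wdeg R)) (lin (\<lambda>x. mT (L @ x # R)) (m2 X))) q =
  - (\<Sum>(A, c, d, B)\<in>{(A, c, d, B)\<in>pairs ws. q \<in> inL (A @ (c @ d) # B) \<and> \<not> (A = [] \<and> (\<exists>y. q = c @ y))}. sg (wdeg (d # B)))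
  - (\<Sum>(A, c, d, B)\<in>{(A, c, d, B)\<in>pairs ws. nzl (c @ d) \<and> q \<in> inL (A @ (c @ d) # B) \<and> A = [] \<and> (\<exists>y. q = c @ y)}. sg (wdeg (d # B)))
  - sg (ldeg q) * (\<Sum>(A, c, d, B)\<in>{(A, c, d, B)\<in>pairs ws. q \<in> inR (A @ (c @ d) # B) \<and> \<not> (B = [] \<and> (\<exists>y. q = y @ d))}. sg (wdeg (d # B)))
  - sg (ldeg q) * (\<Sum>(A, c, d, B)\<in>{(A, c, d, B)\<in>pairs ws. nzl (c @ d) \<and> q \<in> inR (A @ (c @ d) # B) \<and> B = [] \<and> (\<exists>y. q = y @ d)}. sg (wdeg (d # B)))"
proof -
 let ?f = "\<lambda>(A :: 'e list list, c :: 'e list, d, B). sg (wdeg (d # B))"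
 let ?L = "{(A, c, d, B)\<in>pairs ws. nzl (c @ d) \<and> q \<in> inL (A @ (c @ d) # B)}"
 let ?R = "{(A, c, d, B)\<in>pairs ws. nzl (c @ d) \<and> q \<in> inR (A @ (c @ d) # B)}"
 have fin: "finite ?L" "finite ?R" by (auto intro: finite_subset[OF _ finite_pairs[of ws]])
 have "lookup (\<Sum>(L, X, R)\<in>splits ws. smul (sg (wdeg R)) (lin (\<lambda>x. mT (L @ x # R)) (m2 X))) q =
   lookup (\<Sum>(A, c, d, B)\<in>pairs ws. smul (sg (wdeg B)) (lin (\<lambda>x. mT (A @ x # B)) (m2 [c, d]))) q"
  by (subst sum_splits_inner2) (simp_all add: m2_length)
 also have "\<dots> = (\<Sum>t\<in>pairs ws. (if t \<in> ?L then - ?f t else 0) + (if t \<in> ?R then - sg (ldeg q) * ?f t else 0))"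
  unfolding lookup_sum
 proof (rule sum.cong[OF refl])
  fix t assume t: "t \<in> pairs ws"
  obtain A c d B where e: "t = (A, c, d, B)" by (cases t)
  have s: "sg (wdeg B) * sg (ldeg d) = - sg (wdeg (d # B))" by (auto simp: sg_def)
  show "lookup (case t of (A, c, d, B) \<Rightarrow> smul (sg (wdeg B)) (lin (\<lambda>x. mT (A @ x # B)) (m2 [c, d]))) q =
   (if t \<in> ?L then - ?f t else 0) + (if t \<in> ?R then - sg (ldeg q) * ?f t else 0)"
  proof -
   have "lookup (smul (sg (wdeg B)) (lin (\<lambda>x. mT (A @ x # B)) (m2 [c, d]))) q =
    (if nzl (c @ d) then (sg (wdeg B) * sg (ldeg d)) * (of_bool (q \<in> inL (A @ (c @ d) # B)) + of_bool (q \<in> inR (A @ (c @ d) # B)) * sg (ldeg q)) else 0)"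
    by (simp only: m2_simps lookup_smul lookup_mT lin_smul lin_bvec lin_0 lookup_zero smul_smul if_distrib[of "lin _"] if_distrib[of "smul _"] if_distrib[of "\<lambda>z. lookup z q"] smul_zero)
   also have "\<dots> = (if t \<in> ?L then - sg (wdeg (d # B)) else 0) + (if t \<in> ?R then - sg (ldeg q) * sg (wdeg (d # B)) else 0)"
   proof -
    have "- a * (1 + b) = - a - b * a" "- a * (0 + b) = - b * a" for a b :: complex by (simp_all add: algebra_simps)
    then show ?thesis unfolding s using t e
     by (cases "nzl (c @ d)"; cases "q \<in> inL (A @ (c @ d) # B)"; cases "q \<in> inR (A @ (c @ d) # B)") (simp_all del: wdeg_simps)
   qed
   finally show ?thesis using e by (simp only: prod.case)
  qed
 qed
 also have "\<dots> = - sum ?f ?L - sg (ldeg q) * sum ?f ?R"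
 proof -
  have "(\<Sum>t\<in>pairs ws. if t \<in> S then g t else 0) = sum g S" if "S \<subseteq> pairs ws" for S and g :: "_ \<Rightarrow> complex"
   using that by (simp add: sum.inter_restrict[symmetric] Int_absorb1)
  moreover have "?L \<subseteq> pairs ws" "?R \<subseteq> pairs ws" by auto
  ultimately have "(\<Sum>t\<in>pairs ws. if t \<in> ?L then - ?f t else 0) = (\<Sum>t\<in>?L. - ?f t)"
   "(\<Sum>t\<in>pairs ws. if t \<in> ?R then - sg (ldeg q) * ?f t else 0) = (\<Sum>t\<in>?R. - sg (ldeg q) * ?f t)"
   by (simp_all only:)
  then show ?thesis unfolding sum.distrib by (simp only: sum_negf sum_distrib_left[symmetric]) simp
 qed
 also have "sum ?f ?L = sum ?f {t\<in>?L. \<not> (case t of (A, c, d, B) \<Rightarrow> A = [] \<and> (\<exists>y. q = c @ y))} + sum ?f {t\<in>?L. \<not> \<not> (case t of (A, c, d, B) \<Rightarrow> A = [] \<and> (\<exists>y. q = c @ y))}"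
  by (rule sum_filter_split[OF fin(1)])
 also have "sum ?f ?R = sum ?f {t\<in>?R. \<not> (case t of (A, c, d, B) \<Rightarrow> B = [] \<and> (\<exists>y. q = y @ d))} + sum ?f {t\<in>?R. \<not> \<not> (case t of (A, c, d, B) \<Rightarrow> B = [] \<and> (\<exists>y. q = y @ d))}"
  by (rule sum_filter_split[OF fin(2)])
 also have "{t\<in>?L. \<not> (case t of (A, c, d, B) \<Rightarrow> A = [] \<and> (\<exists>y. q = c @ y))} =
   {(A, c, d, B)\<in>pairs ws. q \<in> inL (A @ (c @ d) # B) \<and> \<not> (A = [] \<and> (\<exists>y. q = c @ y))}"
  using inside_nzl_L[OF ws] by (auto simp: pairs_def simp del: not_ex)
 also have "{t\<in>?R. \<not> (case t of (A, c, d, B) \<Rightarrow> B = [] \<and> (\<exists>y. q = y @ d))} =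
   {(A, c, d, B)\<in>pairs ws. q \<in> inR (A @ (c @ d) # B) \<and> \<not> (B = [] \<and> (\<exists>y. q = y @ d))}"
  using inside_nzl_R[OF ws] by (auto simp: pairs_def simp del: not_ex)
 also have "{t\<in>?L. \<not> \<not> (case t of (A, c, d, B) \<Rightarrow> A = [] \<and> (\<exists>y. q = c @ y))} =
   {(A, c, d, B)\<in>pairs ws. nzl (c @ d) \<and> q \<in> inL (A @ (c @ d) # B) \<and> A = [] \<and> (\<exists>y. q = c @ y)}" by auto
 also have "{t\<in>?R. \<not> \<not> (case t of (A, c, d, B) \<Rightarrow> B = [] \<and> (\<exists>y. q = y @ d))} =
   {(A, c, d, B)\<in>pairs ws. nzl (c @ d) \<and> q \<in> inR (A @ (c @ d) # B) \<and> B = [] \<and> (\<exists>y. q = y @ d)}" by auto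
 finally show ?thesis by (simp only: distrib_left diff_diff_add minus_add_distrib) simp
qed

lemma homog_mm: "homog 1 mm"
 unfolding homog_def
proof (intro allI ballI)
 fix w x assume x: "x \<in> keys (mm w)"
 have "keys (mm w) \<subseteq> keys (mT w) \<union> keys (m2 w)" unfolding mm_def by (rule keys_add)
 with x consider "x \<in> keys (mT w)" | "x \<in> keys (m2 w)" by blast
 then show "even (ldeg x - 1 - wdeg w - 1)"
 proof cases
  case 1
  then have "lookup (mT w) x \<noteq> 0" by (simp add: in_keys_iff)
  then have "x \<in> inL w \<or> x \<in> inR w" by (auto simp: lookup_mT)
  then show ?thesis
  proof
   assume "x \<in> inL w"
   then obtain z zs where "w = (x @ z) # zs" "tg (z # zs)" by (auto simp: inL_def)
   then show ?thesis using tg_parity[of "z # zs"] by (auto simp: algebra_simps)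
  next
   assume "x \<in> inR w"
   then obtain z zs where "w = zs @ [z @ x]" "tg (zs @ [z])" by (auto simp: inR_def)
   then show ?thesis using tg_parity[of "zs @ [z]"] by (auto simp: algebra_simps)
  qed
 next
  case 2
  then obtain a b where w: "w = [a, b]" using m2_length[of w] by (cases "length w = 2") (auto simp: length_Suc_conv numeral_2_eq_2)
  with 2 have "x = a @ b" by (auto simp: in_keys_iff lookup_bvec split: if_splits)
  then show ?thesis using w by simp
 qed
qed

text \<open>
 The terms with two products of length two cancel by associativity.
\<close>

lemma four_sums:
 "lin mm (hat 1 mm ws) =
  (\<Sum>(L, X, R)\<in>splits ws. smul (sg (wdeg R)) (lin (\<lambda>x. mT (L @ x # R)) (mT X))) +
  (\<Sum>(L, X, R)\<in>splits ws. smul (sg (wdeg R)) (lin (\<lambda>x. m2 (L @ x # R)) (mT X))) +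
  (\<Sum>(L, X, R)\<in>splits ws. smul (sg (wdeg R)) (lin (\<lambda>x. mT (L @ x # R)) (m2 X)))"
proof -
 have "lin mm (hat 1 mm ws) = (\<Sum>(L, X, R)\<in>splits ws. smul (sg (wdeg R)) (lin (\<lambda>x. mm (L @ x # R)) (mm X)))"
  unfolding hat_def lin_sum case_prod_beta lin_smul lin_lin lin_bvec by simp
 also have "\<dots> = (\<Sum>(L, X, R)\<in>splits ws. smul (sg (wdeg R)) (lin (\<lambda>x. mT (L @ x # R)) (mT X))) +
  (\<Sum>(L, X, R)\<in>splits ws. smul (sg (wdeg R)) (lin (\<lambda>x. m2 (L @ x # R)) (mT X))) +
  (\<Sum>(L, X, R)\<in>splits ws. smul (sg (wdeg R)) (lin (\<lambda>x. mT (L @ x # R)) (m2 X))) +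
  (\<Sum>(L, X, R)\<in>splits ws. smul (sg (wdeg R)) (lin (\<lambda>x. m2 (L @ x # R)) (m2 X)))"
  unfolding sum.distrib[symmetric] by (rule sum.cong[OF refl]) (simp add: mm_def lin_add lin_fun_add smul_add_right algebra_simps split: prod.splits)
 finally show ?thesis unfolding assoc_terms by simp
qed

lemma outer_product_terms:
 assumes "2 \<le> length ws"
 shows "(\<Sum>(L, X, R)\<in>splits ws. smul (sg (wdeg R)) (lin (\<lambda>x. m2 (L @ x # R)) (mT X))) =
  lin (\<lambda>x. m2 [hd ws, x]) (mT (tl ws)) + smul (- sg (ldeg (last ws))) (lin (\<lambda>x. m2 [x, last ws]) (mT (butlast ws)))"
proof -
 have "smul (sg (wdeg R)) (lin (\<lambda>x. m2 (L @ x # R)) (mT X)) = 0" if "length L + length R \<noteq> 1" for L X R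
 proof -
  have "m2 (L @ x # R) = 0" for x using that by (intro m2_length) simp
  then show ?thesis by simp
 qed
 from sum_splits_outer2[of "\<lambda>L X R. smul (sg (wdeg R)) (lin (\<lambda>x. m2 (L @ x # R)) (mT X))", OF this assms]
 show ?thesis by (simp add: sg_add1 del: m2_simps)
qed

lemma mm_mm_word:
 assumes ws: "word ws"
 shows "lin mm (hat 1 mm ws) = 0"
proof (cases "2 \<le> length ws")
 case False
 then have z: "mT X = 0 \<and> m2 X = 0" if "(L, X, R) \<in> splits ws" for L X R
  using that by (intro conjI mT_short m2_length) (auto simp: splits_def)
 have "(\<Sum>(L, X, R)\<in>splits ws. smul (sg (wdeg R)) (lin (g L R) (mT X))) = 0"
  "(\<Sum>(L, X, R)\<in>splits ws. smul (sg (wdeg R)) (lin (g L R) (m2 X))) = 0" for g :: "_ \<Rightarrow> _ \<Rightarrow> _ \<Rightarrow> ('e list \<Rightarrow>\<^sub>0 complex)"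
  by (rule sum.neutral, use z in auto)+
 then show ?thesis unfolding four_sums by simp
next
 case True
 obtain p X where pX: "ws = p # X" "X \<noteq> []" using True by (cases ws; cases "tl ws") auto
 obtain Y p' where Yp: "ws = Y @ [p']" "Y \<noteq> []" using True by (cases ws rule: rev_cases; cases "butlast ws") auto
 show ?thesis
 proof (rule poly_mapping_eqI)
  fix q
  let ?fl = "\<lambda>(L :: 'e list list, X :: 'e list list, R, x :: 'e list). sg (wdeg R)"
  let ?fr = "\<lambda>(L :: 'e list list, X :: 'e list list, R, x :: 'e list). sg (wdeg R) * sg (ldeg x)"
  let ?CL = "CLs (\<lambda>w. q \<in> inL w) ws" and ?CR = "CLs (\<lambda>w. q \<in> inR w) ws"
  let ?DL = "CRs (\<lambda>w. q \<in> inL w) ws" and ?DR = "CRs (\<lambda>w. q \<in> inR w) ws"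
  have split: "sum ?fl C = sum ?fl {(L, X, R, x)\<in>C. R \<noteq> []} + sum ?fl {(L, X, R, x)\<in>C. R = []}" if "finite C" for C
  proof -
   have "{t\<in>C. \<not> (case t of (L, X, R, x) \<Rightarrow> R = [])} = {(L, X, R, x)\<in>C. R \<noteq> []}"
    "{t\<in>C. (case t of (L, X, R, x) \<Rightarrow> R = [])} = {(L, X, R, x)\<in>C. R = []}" by auto
   with sum_filter_split[OF that, of ?fl "\<lambda>t. case t of (L, X, R, x) \<Rightarrow> R = []"] show ?thesis by simp
  qed
  have split': "sum ?fr C = sum ?fr {(L, X, R, x)\<in>C. L \<noteq> []} + sum ?fr {(L, X, R, x)\<in>C. L = []}" if "finite C" for C
  proof -
   have "{t\<in>C. \<not> (case t of (L, X, R, x) \<Rightarrow> L = [])} = {(L, X, R, x)\<in>C. L \<noteq> []}"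
    "{t\<in>C. (case t of (L, X, R, x) \<Rightarrow> L = [])} = {(L, X, R, x)\<in>C. L = []}" by auto
   with sum_filter_split[OF that, of ?fr "\<lambda>t. case t of (L, X, R, x) \<Rightarrow> L = []"] show ?thesis by simp
  qed
  define ca cb where "ca = sum ?fl {(L, X, R, x)\<in>?CR. R = []}" and "cb = sum ?fr {(L, X, R, x)\<in>?DL. L = []}"
  define cc where "cc = sum ?fr {(L, X, R, x)\<in>?DR. L = []}"
  have last: "sg (ldeg q) * ca + cb + sg (ldeg q) * cc = - of_bool (CR ws q)"
  proof (cases "q = []")
   case True
   have 0: "ca = 0" "cc = 0" using True by (auto simp: ca_def cc_def CLs_def CRs_def inR_def intro!: sum.neutral)
   have "\<exists>R' z. R = R' @ [z @ q] \<and> tg (x # R' @ [z])" if "q \<in> inL (x # R)" for x R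
    using that True tg_length[of "x # R"] by (cases R rule: rev_cases) (auto simp: in_inL)
   moreover have "q \<in> inL (x # R' @ [z @ q])" if "tg (x # R' @ [z])" for x R' z
    using that True by (simp add: in_inL)
   ultimately have "cb = - of_bool (CR ws q) * sg (ldeg q)"
    unfolding cb_def by (rule sum_CR)
   then show ?thesis using 0 True by simp
  next
   case False
   have "\<exists>R' z. R = R' @ [z @ q] \<and> tg (x # R' @ [z])" if i: "q \<in> inR (x # R)" for x R
   proof (cases R rule: rev_cases)
    case Nil
    then obtain z where "tg [z]" using i by (auto simp: inR_def)
    then show ?thesis using tg_length[of "[z]"] by simp
   next
    case (snoc R' f)
    then show ?thesis using i in_inR[of q "x # R'" f] by auto
   qed
   moreover have "q \<in> inR (x # R' @ [z @ q])" if "tg (x # R' @ [z])" for x R' z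
    using that False in_inR[of q "x # R'" "z @ q"] by simp
   ultimately have "cc = - of_bool (CR ws q) * sg (ldeg q)"
    unfolding cc_def by (rule sum_CR)
   moreover have "cb = - sg (ldeg q) * ca" unfolding cb_def ca_def by (rule sum_both_sides[OF False])
   moreover have "sg (ldeg q) * sg (ldeg q) = 1" by (rule sg_self)
   ultimately show ?thesis by (simp add: mult.left_commute)
  qed
  have t2: "lookup (lin (\<lambda>x. m2 [hd ws, x]) (mT (tl ws)) + smul (- sg (ldeg (last ws))) (lin (\<lambda>x. m2 [x, last ws]) (mT (butlast ws)))) q
   = lookup (lin (\<lambda>x. m2 [p, x]) (mT X)) q - sg (ldeg p') * lookup (lin (\<lambda>x. m2 [x, p']) (mT Y)) q"
  proof -
   have "hd ws = p" "tl ws = X" using pX(1) by simp_all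
   moreover have "last ws = p'" "butlast ws = Y" using Yp(1) by simp_all
   ultimately show ?thesis by (simp only: lookup_add lookup_smul) simp
  qed
  note top = top_terms[OF ws[unfolded pX(1)] pX(2), folded pX(1), of q]
  note bot = bottom_terms[OF ws[unfolded Yp(1)] Yp(2), folded Yp(1), of q]
  have "lookup (lin mm (hat 1 mm ws)) q = of_bool (X1 ws q) - of_bool (X2 ws q) + of_bool (CL ws q) - of_bool (CR ws q)"
   unfolding four_sums outer_product_terms[OF True] lookup_add[of "_ + _"] lookup_add[of "sum _ _"] TT merge_terms[OF ws] t2
    cut_sum_L[OF ws] cut_sum_R[OF ws] split[OF finite_CLs] split'[OF finite_CRs] sum_CL
    ca_def[symmetric] cb_def[symmetric] cc_def[symmetric]
   using top bot last by (simp only: algebra_simps) (simp add: algebra_simps)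
  then show "lookup (lin mm (hat 1 mm ws)) q = lookup 0 q"
   using four_term[OF ws, of q] by (simp add: algebra_simps)
 qed
qed

lemma mT_parity: "x \<in> keys (mT w) \<Longrightarrow> sg (ldeg x) = sg (wdeg w)"
proof -
 assume x: "x \<in> keys (mT w)"
 have "length w \<noteq> 2" using x mT_short[of w] by auto
 then have "x \<in> keys (mm w)" using x by (simp add: mm_def m2_length)
 then have "even (ldeg x - 1 - wdeg w - 1)" using homog_mm unfolding homog_def by blast
 then show ?thesis by (intro sg_cong) presburger
qed

lemma mT_keys_nzl: "x \<in> keys (mT w) \<Longrightarrow> \<forall>a\<in>set w. nzl a \<Longrightarrow> nzl x"
proof -
 assume x: "x \<in> keys (mT w)" and w: "\<forall>a\<in>set w. nzl a"
 then have "lookup (mT w) x \<noteq> 0" by (simp add: in_keys_iff)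
 then have "x \<in> inL w \<or> x \<in> inR w" by (auto simp: lookup_mT)
 then show ?thesis using w by (auto simp: inL_def inR_def nzl_append)
qed

text \<open>
 With an idempotent among the entries, higher products vanish unless the idempotent is first absorbed by a product of
 length two, which happens from both sides with opposite signs.
\<close>

lemma mm_mm_unit:
 assumes nz: "\<forall>a\<in>set ws. nzl a" and e: "[] \<in> set ws"
 shows "lin mm (hat 1 mm ws) = 0"
proof -
 have TT0: "(\<Sum>(L, X, R)\<in>splits ws. smul (sg (wdeg R)) (lin (\<lambda>x. mT (L @ x # R)) (mT X))) = 0"
 proof (rule sum.neutral, clarify)
  fix L X R assume "(L, X, R) \<in> splits ws"
  then have "[] \<in> set L \<union> set X \<union> set R" using e by (auto simp: splits_def)
  then consider "[] \<in> set X" | "[] \<in> set L \<union> set R" by blast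
  then show "smul (sg (wdeg R)) (lin (\<lambda>x. mT (L @ x # R)) (mT X)) = 0"
  proof cases
   case 1 then show ?thesis by (simp add: mT_unit)
  next
   case 2
   then have "mT (L @ x # R) = 0" for x by (intro mT_unit) auto
   then show ?thesis by simp
  qed
 qed
 define G where "G = (\<lambda>(A, c, d, B). smul (sg (wdeg B)) (lin (\<lambda>x. mT (A @ x # B)) (m2 [c, d])))"
 have G: "(\<Sum>(L, X, R)\<in>splits ws. smul (sg (wdeg R)) (lin (\<lambda>x. mT (L @ x # R)) (m2 X))) = sum G (pairs ws)"
  unfolding G_def by (rule sum_splits_inner2) (simp add: m2_length)
 have G0: "G (A, c, d, B) = 0" if "[] \<in> set (A @ (c @ d) # B)" for A c d B
  using mT_unit[OF that] by (simp add: G_def lin_smul)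
 obtain U W where ws: "ws = U @ [] # W" "[] \<notin> set U" using split_list_first[OF e] by blast
 have nzU: "\<forall>a\<in>set U. nzl a" and nzW: "\<forall>a\<in>set W. nzl a" using nz ws by auto
 show ?thesis
 proof (cases "2 \<le> length ws")
  case False
  then have m: "mT X = 0 \<and> m2 X = 0" if "(L, X, R) \<in> splits ws" for L X R
   using that by (intro conjI mT_short m2_length) (auto simp: splits_def)
  have "(\<Sum>(L, X, R)\<in>splits ws. smul (sg (wdeg R)) (lin (g L R) (mT X))) = 0"
   "(\<Sum>(L, X, R)\<in>splits ws. smul (sg (wdeg R)) (lin (g L R) (m2 X))) = 0" for g :: "_ \<Rightarrow> _ \<Rightarrow> _ \<Rightarrow> ('e list \<Rightarrow>\<^sub>0 complex)"
   by (rule sum.neutral, use m in auto)+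
  then show ?thesis unfolding four_sums by simp
 next
  case True
  note eq = four_sums[of ws, unfolded TT0 outer_product_terms[OF True] G]
  show ?thesis
  proof (cases "[] \<in> set W")
   case True
   have "[] \<in> set (tl ws)" using ws True by (cases U) auto
   moreover have "[] \<in> set (butlast ws)" using ws True by (cases W) (auto simp: butlast_append)
   moreover have "G t = 0" if tp: "t \<in> pairs ws" for t
   proof -
    obtain A c d B where t: "t = (A, c, d, B)" "A @ c # d # B = U @ [] # W" using tp ws by (cases t) (auto simp: pairs_def)
    have "[] \<in> set (A @ (c @ d) # B)"
    proof (rule ccontr)
     assume n: "[] \<notin> set (A @ (c @ d) # B)"
     have "length (filter (\<lambda>a. a = []) (A @ c # d # B)) = length (filter (\<lambda>a. a = []) (U @ [] # W))" using t by simp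
     moreover have "filter (\<lambda>a. a = []) A = []" "filter (\<lambda>a. a = []) B = []" using n by (auto simp: filter_empty_conv)
     moreover have "length (filter (\<lambda>a. a = []) W) > 0" using True by (simp add: filter_empty_conv)
     ultimately show False using n by (auto split: if_splits)
    qed
    then show ?thesis using t G0 by simp
   qed
   ultimately show ?thesis unfolding eq by (simp add: mT_unit)
  next
   case False
   have pr: "t = (U, [], hd W, tl W) \<and> W \<noteq> [] \<or> t = (butlast U, last U, [], W) \<and> U \<noteq> []" if tp: "t \<in> pairs ws" "G t \<noteq> 0" for t
   proof -
    obtain A c d B where t: "t = (A, c, d, B)" "A @ c # d # B = U @ [] # W" using tp(1) ws by (cases t) (auto simp: pairs_def)
    have n: "[] \<notin> set (A @ (c @ d) # B)" using tp(2) G0 t by blast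
    from append_Cons_eq_append_ConsD[OF t(2)] show ?thesis
    proof (elim disjE exE conjE)
     fix E assume E: "U = A @ c # E" "d # B = E @ [] # W"
     then have "E = []" using n by (cases E) auto
     then show ?thesis using E t by simp
    next
     assume "A = U" "c = []" "d # B = W"
     then show ?thesis using t by auto
    next
     fix E assume "A = U @ [] # E"
     then show ?thesis using n by simp
    qed
   qed
   have sums: "sum G (pairs ws) = sum G ((if W = [] then {} else {(U, [], hd W, tl W)}) \<union> (if U = [] then {} else {(butlast U, last U, [], W)}))"
   proof (rule sum.mono_neutral_right[OF finite_pairs], goal_cases)
    case 1
    have "(U, [], hd W, tl W) \<in> pairs ws" if "W \<noteq> []" using that ws by (simp add: pairs_def)
    moreover have "(butlast U, last U, [], W) \<in> pairs ws" if "U \<noteq> []"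
     using that ws by (simp add: pairs_def)
    ultimately show ?case by auto
   next
    case 2
    show ?case using pr by fastforce
   qed
   have g1: "G (U, [], hd W, tl W) = smul (- sg (wdeg W)) (mT (U @ W))" if "W \<noteq> []"
   proof -
    have s: "sg (wdeg (tl W)) * sg (ldeg (hd W)) = - sg (wdeg W)"
     using that by (cases W) (auto simp: sg_def)
    have "nzl (hd W)" using that nzW by simp
    then show ?thesis using that by (simp add: G_def lin_smul s)
   qed
   have g2: "G (butlast U, last U, [], W) = smul (sg (wdeg W)) (mT (U @ W))" if "U \<noteq> []"
   proof -
    have "butlast U @ last U # W = U @ W" using that by (metis append_Cons append_Nil append_assoc append_butlast_last_id)
    moreover have "m2 [last U, []] = bvec (last U)" using that nzU by simp
    ultimately show ?thesis by (simp only: G_def prod.case lin_bvec)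
   qed
   consider "U \<noteq> []" "W \<noteq> []" | "U = []" "W \<noteq> []" | "U \<noteq> []" "W = []" using True ws by fastforce
   then show ?thesis
   proof cases
    case 1
    have "[] \<in> set (tl ws)" using ws 1 by (cases U) auto
    moreover have "[] \<in> set (butlast ws)" using ws 1 by (auto simp: butlast_append)
    moreover have "sum G ({(U, [], hd W, tl W)} \<union> {(butlast U, last U, [], W)}) = sum G {(U, [], hd W, tl W)} + sum G {(butlast U, last U, [], W)}"
    proof (rule sum.union_disjoint)
     have "last U \<noteq> []" using 1 ws(2) last_in_set by metis
     then show "{(U, [], hd W, tl W)} \<inter> {(butlast U, last U, [], W)} = {}" by simp
    qed auto
    then have "sum G (pairs ws) = 0" unfolding sums using 1 g1 g2 by (simp only: if_False sum.insert finite.emptyI empty_iff not_False_eq_True sum.empty) (simp add: smul_minus_left)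
    ultimately show ?thesis unfolding eq by (simp add: mT_unit)
   next
    case 2
    have "[] \<in> set (butlast ws)" using ws 2 by (auto simp: butlast_append)
    moreover have "hd ws = []" "tl ws = W" using ws 2 by auto
    moreover have "lin (\<lambda>x. m2 [[], x]) (mT W) = lin (\<lambda>x. smul (sg (wdeg W)) (bvec x)) (mT W)"
     by (rule lin_cong) (use mT_keys_nzl[OF _ nzW] in \<open>simp add: mT_parity\<close>)
    ultimately show ?thesis unfolding eq sums using 2 g1 by (simp add: mT_unit smul_minus_left lin_fun_smul del: m2_simps)
   next
    case 3
    have "[] \<in> set (tl ws)" using ws 3 by (cases U) auto
    moreover have "last ws = []" "butlast ws = U" using ws 3 by auto
    moreover have "lin (\<lambda>x. m2 [x, []]) (mT U) = lin bvec (mT U)"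
     by (rule lin_cong) (use mT_keys_nzl[OF _ nzU] in simp)
    ultimately show ?thesis unfolding eq sums using 3 g2 by (simp add: mT_unit smul_minus_left del: m2_simps)
   qed
  qed
 qed
qed

theorem mm_mm:
 assumes "\<forall>a\<in>set ws. nzl a" "[] \<notin> set ws \<Longrightarrow> successively (\<lambda>a b. cmp (last a) (hd b)) ws"
 shows "lin mm (hat 1 mm ws) = 0"
proof (cases "[] \<in> set ws")
 case True
 then show ?thesis using mm_mm_unit assms by blast
next
 case False
 then have "word ws" unfolding word_def using assms by metis
 then show ?thesis by (rule mm_mm_word)
qed

end

section \<open>Quivers whose faces satisfy the gentle condition\<close>

context graded_face_structure begin

lemma inL_unique: "x \<in> inL w \<Longrightarrow> x' \<in> inL w \<Longrightarrow> x = x'"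
proof -
 assume "x \<in> inL w" "x' \<in> inL w"
 then obtain z z' zs where e: "x @ z = x' @ z'" "tg (z # zs)" "tg (z' # zs)" by (auto simp: inL_def)
 then obtain us where "(x = x' @ us \<and> z' = us @ z) \<or> (x' = x @ us \<and> z = us @ z')"
  by (auto simp: append_eq_append_conv2)
 then show ?thesis using e tg_suffix_free[OF e(2) refl, of "[]" us] tg_suffix_free[OF e(3) refl, of "[]" us] by auto
qed

lemma inR_unique: "x \<in> inR w \<Longrightarrow> x' \<in> inR w \<Longrightarrow> x = x'"
proof -
 assume "x \<in> inR w" "x' \<in> inR w"
 then obtain z z' zs where e: "z @ x = z' @ x'" "tg (zs @ [z])" "tg (zs @ [z'])" by (auto simp: inR_def)
 then obtain us where "(z = z' @ us \<and> x' = us @ x) \<or> (z' = z @ us \<and> x = us @ x')"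
  by (auto simp: append_eq_append_conv2)
 then show ?thesis using e tg_prefix_free[OF e(2) refl, of us "[]"] tg_prefix_free[OF e(3) refl, of us "[]"] by auto
qed

lemma inL_inR_disjoint: "x \<in> inL w \<Longrightarrow> y \<in> inR w \<Longrightarrow> False"
proof -
 assume x: "x \<in> inL w" and y: "y \<in> inR w"
 obtain a A c where a: "w = (x @ a) # A @ [c]" "tg (a # A @ [c])" "a \<noteq> []" using inL_D[OF x] by blast
 obtain d B b where d: "w = d # B @ [b @ y]" "tg (d # B @ [b])" "b \<noteq> []" "y \<noteq> []" using inR_D[OF y] by blast
 have e: "d = x @ a" "A = B" "c = b @ y" using a d by auto
 show False
 proof (cases "x = []")
  case True
  then show False using tg_prefix_free[OF d(2), of "d # B" b y "[]"] a d e by simp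
 next
  case False
  have "tg ([] @ (x @ a) # B @ [b])" using d e by simp
  from tg_cut[OF this refl False a(3)] obtain B1 b' a' B2 where "right_cut [] x a (B @ [b]) B1 b' a' B2" by (auto simp: left_cut_def)
  then have r: "B @ [b] = B1 @ (b' @ a') # B2" "a' \<noteq> []" "tg (a # B1 @ [b'])" by (auto simp: right_cut_def)
  show False
  proof (cases B2 rule: rev_cases)
   case Nil
   with r have "B = B1" "b = b' @ a'" by auto
   then show False using tg_prefix_free[OF r(3), of "a # B1" b' "a' @ y" "[]"] a r e by simp
  next
   case (snoc B2' f)
   with r(1) have "B @ [b] = (B1 @ (b' @ a') # B2') @ [f]" by simp
   then have "B = B1 @ (b' @ a') # B2'" by (simp only: append1_eq_conv)
   then show False using tg_prefix_free[OF r(3), of "a # B1" b' a' "B2' @ [c]"] a r e by simp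
  qed
 qed
qed

end

text \<open>
 The combinatorial data are attached to a quiver.  The function \<open>rd\<close> numbers the corners of each face and thereby marks one of
 them, the corner with number zero, as root; the root breaks the cyclic symmetry of closed walks along a face.
\<close>

locale gentle_quiver = graded_face_structure "q_arrows Q" nx pv per
  "\<lambda>a b. a \<in> q_arrows Q \<and> b \<in> q_arrows Q \<and> q_tail Q a = q_head Q b" "q_deg Q"
 for Q :: "('v, 'e) angle_quiver" and nx pv :: "'e \<Rightarrow> 'e" and per :: "'e \<Rightarrow> nat" +
 fixes rd :: "'e \<Rightarrow> nat"
 assumes tail_in [simp]: "x \<in> q_arrows Q \<Longrightarrow> q_tail Q x \<in> q_verts Q"
  and head_in [simp]: "x \<in> q_arrows Q \<Longrightarrow> q_head Q x \<in> q_verts Q"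
  and consecutive_iff: "consecutive Q a b \<longleftrightarrow> a \<in> q_arrows Q \<and> b = nx a"
  and face_word_fw: "w \<in> q_face_words Q \<Longrightarrow> \<exists>x\<in>q_arrows Q. w = fw x"
  and fw_face_word: "x \<in> q_arrows Q \<Longrightarrow> \<exists>w\<in>q_face_words Q. \<exists>i. fw x = rotate i w"
  and rd_nx: "x \<in> q_arrows Q \<Longrightarrow> rd (nx x) = (if Suc (rd x) = per x then 0 else Suc (rd x))"
begin

declare cmp_nx [simp del]

abbreviation "Ar \<equiv> q_arrows Q"
abbreviation "nz \<equiv> nz_paths Q"

lemma head_nx [simp]: "x \<in> Ar \<Longrightarrow> q_head Q (nx x) = q_tail Q x"
 using cmp_nx[of x] by simp

lemma nzc_iff: "nzc a b \<longleftrightarrow> a \<in> Ar \<and> b \<in> Ar \<and> q_tail Q a = q_head Q b \<and> \<not> consecutive Q a b"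
 unfolding nzc_def consecutive_iff by auto

lemma nz_iff: "(v, as) \<in> nz \<longleftrightarrow> v \<in> q_verts Q \<and> nzl as \<and> (as \<noteq> [] \<longrightarrow> q_tail Q (last as) = v)"
proof -
 have "set as \<subseteq> Ar \<and> successively (\<lambda>\<alpha> \<beta>. q_tail Q \<alpha> = q_head Q \<beta>) as \<and> successively (\<lambda>\<alpha> \<beta>. \<not> consecutive Q \<alpha> \<beta>) as \<longleftrightarrow> nzl as"
  unfolding nzl_def by (induction as rule: induct_list012) (auto simp: nzc_iff)
 moreover have "(v, as) \<in> nz \<longleftrightarrow> v \<in> q_verts Q \<and> (as \<noteq> [] \<longrightarrow> q_tail Q (last as) = v) \<and>
  set as \<subseteq> Ar \<and> successively (\<lambda>\<alpha> \<beta>. q_tail Q \<alpha> = q_head Q \<beta>) as \<and> successively (\<lambda>\<alpha> \<beta>. \<not> consecutive Q \<alpha> \<beta>) as"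
  unfolding nz_paths_def q_paths_def by simp blast
 ultimately show ?thesis by blast
qed

lemma fst_nz: "p \<in> nz \<Longrightarrow> fst p \<in> q_verts Q" by (cases p) (simp add: nz_iff)
lemma snd_nz: "p \<in> nz \<Longrightarrow> nzl (snd p)" by (cases p) (simp add: nz_iff)
lemma tail_nz: "p \<in> nz \<Longrightarrow> snd p \<noteq> [] \<Longrightarrow> q_tail Q (last (snd p)) = fst p" by (cases p) (simp add: nz_iff)

lemma head_in_verts: "p \<in> nz \<Longrightarrow> path_head Q p \<in> q_verts Q"
 by (cases p) (auto simp: nz_iff path_head_def nzl_def hd_in_set subset_iff)

lemma comp_nz_iff: "comp_nz Q p q \<longleftrightarrow> p \<in> nz \<and> q \<in> nz \<and> fst p = path_head Q q \<and> nzl (snd p @ snd q)"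
 by (cases p; cases q) (auto simp: comp_nz_def path_comp_def nz_iff path_head_def)

lemma comp_nz_in: "comp_nz Q p q \<Longrightarrow> path_comp p q \<in> nz" by (simp add: comp_nz_def)

lemma path_head_comp: "fst p = path_head Q q \<Longrightarrow> path_head Q (path_comp p q) = path_head Q p"
 by (auto simp: path_head_def path_comp_def)

lemma path_deg_ldeg: "path_deg Q p = ldeg (snd p)"
 by (simp add: path_deg_def ldeg_def)

text \<open>
 The path with a given non-empty list of arrows.
\<close>

definition mk :: "'e list \<Rightarrow> ('v, 'e) qpath" where "mk s = (q_tail Q (last s), s)"

lemma snd_mk [simp]: "snd (mk s) = s" by (simp add: mk_def)

lemma mk_snd: "p \<in> nz \<Longrightarrow> snd p \<noteq> [] \<Longrightarrow> mk (snd p) = p"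
 by (cases p) (auto simp: mk_def nz_iff)

lemma mk_nz: "nzl s \<Longrightarrow> s \<noteq> [] \<Longrightarrow> mk s \<in> nz"
 using last_in[of s] by (simp add: mk_def nz_iff)

lemma map_mk_snd: "\<forall>p\<in>set ps. p = mk (snd p) \<Longrightarrow> map mk (map snd ps) = ps"
 by (induction ps) auto

text \<open>
 Gluing two tree-gons is an instance of \<open>tg_glue\<close> after a rotation.
\<close>

lemma treegon_imp: "treegon_word Q ps \<Longrightarrow> (\<forall>p\<in>set ps. p = mk (snd p)) \<and> tg (map snd ps)"
proof (induction rule: treegon_word.induct)
 case (face w)
 then obtain x where "x \<in> Ar" "w = fw x" using face_word_fw by blast
 moreover have "map snd (map (arrow_path Q) w) = sing w" by (simp add: arrow_path_def)
 moreover have "\<forall>p\<in>set (map (arrow_path Q) w). p = mk (snd p)" by (auto simp: arrow_path_def mk_def)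
 ultimately show ?case using tg.face[of x] by (simp only:)
next
 case (cyclic x xs)
 then show ?case using tg_rotate by auto
next
 case (glue ak as a1 bl bs b1)
 have tA: "tg (snd ak # map snd as @ [snd a1])" and tB: "tg (snd bl # map snd bs @ [snd b1])"
  using glue by simp_all
 have ne: "snd ak \<noteq> []" "snd a1 \<noteq> []" "snd bl \<noteq> []" "snd b1 \<noteq> []" using tg_ne[OF tA] tg_ne[OF tB] by auto
 have c: "nzc (last (snd a1)) (hd (snd bl))" "nzc (last (snd b1)) (hd (snd ak))"
  using glue.hyps(3,4) ne by (auto simp: comp_nz_iff nzl_append)
 have "tg ([] @ [snd b1, snd bl] @ map snd bs)"
  using tg_rotate_append[of "snd bl # map snd bs" "[snd b1]"] tB by simp
 from tg_glue[OF this tA c(2,1)] have "tg (map snd (path_comp b1 ak # as @ path_comp a1 bl # bs))"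
  by (simp add: path_comp_def)
 moreover have "\<forall>p\<in>set (path_comp b1 ak # as @ path_comp a1 bl # bs). p = mk (snd p)"
 proof -
  have "ak = mk (snd ak)" "bl = mk (snd bl)" "\<forall>p\<in>set as \<union> set bs. p = mk (snd p)" using glue.IH by auto
  moreover from this(1,2) have "fst ak = q_tail Q (last (snd ak))" "fst bl = q_tail Q (last (snd bl))"
   by (metis fst_conv mk_def)+
  ultimately show ?thesis using ne by (auto simp: path_comp_def mk_def)
 qed
 ultimately show ?case by blast
qed

lemma treegon_rotate: "treegon_word Q (u @ v) \<Longrightarrow> treegon_word Q (v @ u)"
proof (induction u arbitrary: v)
 case (Cons a u)
 from treegon_word.cyclic[of Q a "u @ v"] Cons.prems Cons.IH[of "v @ [a]"] show ?case by simp
qed simp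

lemma treegon_rotate': "treegon_word Q w \<Longrightarrow> treegon_word Q (rotate i w)"
 using treegon_rotate[of "take (i mod length w) w" "drop (i mod length w) w"] by (simp add: rotate_drop_take)

lemma comp_nz_mk:
 assumes "nzl a" "nzl b" "a \<noteq> []" "b \<noteq> []" "nzc (last a) (hd b)"
 shows "comp_nz Q (mk a) (mk b)" "path_comp (mk a) (mk b) = mk (a @ b)"
proof -
 have "nzl (a @ b)" using assms by (simp add: nzl_append)
 moreover have "q_tail Q (last a) = q_head Q (hd b)" using assms(5) by (simp add: nzc_iff)
 ultimately show "comp_nz Q (mk a) (mk b)"
  using mk_nz[of a] mk_nz[of b] assms by (simp add: comp_nz_iff path_head_def mk_def)
 show "path_comp (mk a) (mk b) = mk (a @ b)" using assms by (simp add: mk_def path_comp_def)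
qed

text \<open>
 Gluing an ear is gluing the tree-gon of a single face.
\<close>

lemma tg_imp_treegon: "tg w \<Longrightarrow> treegon_word Q (map mk w)"
proof (induction rule: tg.induct)
 case (face x)
 then obtain w i where w: "w \<in> q_face_words Q" "fw x = rotate i w" using fw_face_word by blast
 have "treegon_word Q (rotate i (map (arrow_path Q) w))" using treegon_rotate'[OF treegon_word.face[OF w(1)]] .
 moreover have "rotate i (map (arrow_path Q) w) = map mk (sing (fw x))" unfolding w(2)
  by (simp add: rotate_map arrow_path_def mk_def)
 ultimately show ?case by simp
next
 case (ear L b c R x)
 have x: "x \<in> Ar" using ear nzc_in by blast
 have b: "nzl b" "b \<noteq> []" using tg_entry[OF ear.hyps(1), of b] by auto
 have c: "nzl c" "c \<noteq> []" using tg_entry[OF ear.hyps(1), of c] by auto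
 have sx: "nzl [x]" "nzl [pv x]" using x by (auto simp: nzl_def)
 have A: "treegon_word Q (mk [x] # map mk (sing (mid x)) @ [mk [pv x]])"
 proof -
  obtain w i where w: "w \<in> q_face_words Q" "fw x = rotate i w" using fw_face_word x by blast
  have "treegon_word Q (rotate i (map (arrow_path Q) w))" using treegon_rotate'[OF treegon_word.face[OF w(1)]] .
  moreover have "rotate i (map (arrow_path Q) w) = map mk (sing (fw x))" unfolding w(2)
   by (simp add: rotate_map arrow_path_def mk_def)
  ultimately show ?thesis using x by (simp add: fw_eq)
 qed
 have B: "treegon_word Q (mk c # map mk (R @ L) @ [mk b])"
  using treegon_rotate[of "map mk (L @ [b])" "map mk (c # R)"] ear.IH by simp
 have 1: "comp_nz Q (mk [pv x]) (mk c)" "path_comp (mk [pv x]) (mk c) = mk ([pv x] @ c)"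
  using comp_nz_mk[of "[pv x]" c] sx c ear.hyps by auto
 have 2: "comp_nz Q (mk b) (mk [x])" "path_comp (mk b) (mk [x]) = mk (b @ [x])"
  using comp_nz_mk[of b "[x]"] sx b ear.hyps by auto
 from treegon_word.glue[OF A B 1(1) 2(1)]
 have "treegon_word Q (map mk ([b @ [x]] @ sing (mid x) @ [pv x # c] @ R) @ map mk L)" unfolding 1(2) 2(2) by simp
 from treegon_rotate[OF this] show ?case by simp
qed

lemma treegons_member: "\<psi> \<in> treegons Q \<Longrightarrow> w \<in> \<psi> \<Longrightarrow> treegon_word Q w \<and> \<psi> = {rotate i w | i. True}"
proof -
 assume "\<psi> \<in> treegons Q" "w \<in> \<psi>"
 then obtain u i where u: "treegon_word Q u" "\<psi> = {rotate i u | i. True}" "w = rotate i u" by (auto simp: treegons_def)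
 have "rotate j u \<in> {rotate i w | i. True}" for j
 proof -
  have ne: "length u > 0" using tg_length treegon_imp[OF u(1)] by fastforce
  have "rotate (j + length u * i - i) w = rotate (j + length u * i - i + i) u" by (simp add: u(3) rotate_rotate)
  also have "j + length u * i - i + i = j + length u * i" using ne by (cases "length u") simp_all
  also have "rotate (j + length u * i) u = rotate j u" by (subst rotate_conv_mod) (simp add: rotate_conv_mod[symmetric])
  finally have "rotate j u = rotate (j + length u * i - i) w" by (rule sym)
  then show ?thesis by blast
 qed
 moreover have "rotate j w \<in> {rotate i u | i. True}" for j by (auto simp: u(3) rotate_rotate)
 ultimately show ?thesis using u treegon_rotate' by auto
qed

lemma treegons_I: "treegon_word Q w \<Longrightarrow> {rotate i w | i. True} \<in> treegons Q \<and> w \<in> {rotate i w | i. True}"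
proof -
 assume "treegon_word Q w"
 moreover have "w = rotate 0 w" by simp
 ultimately show ?thesis unfolding treegons_def by blast
qed

definition chain :: "('v, 'e) qpath list \<Rightarrow> bool" where
 "chain ps \<longleftrightarrow> set ps \<subseteq> nz \<and> successively (\<lambda>p q. fst p = path_head Q q) ps"

lemma chain_simps [simp]: "chain []" "chain [p] \<longleftrightarrow> p \<in> nz"
 "chain (p # q # ps) \<longleftrightarrow> p \<in> nz \<and> fst p = path_head Q q \<and> chain (q # ps)"
 by (auto simp: chain_def)

lemma chain_append: "chain (u @ v) \<longleftrightarrow> chain u \<and> chain v \<and> (u = [] \<or> v = [] \<or> fst (last u) = path_head Q (hd v))"
 by (auto simp: chain_def successively_append_iff)

definition wordL :: "('v, 'e) qpath list \<Rightarrow> 'e list \<Rightarrow> ('v, 'e) qpath list" where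
 "wordL ps x = mk (drop (length x) (snd (hd ps))) # tl ps"
definition wordR :: "('v, 'e) qpath list \<Rightarrow> 'e list \<Rightarrow> ('v, 'e) qpath list" where
 "wordR ps x = butlast ps @ [mk (take (length (snd (last ps)) - length x) (snd (last ps)))]"

text \<open>
 The rules that prescribe values of \<open>\<mu>\<close> have an end in common with a tree-gon, and consecutive entries of
 a tree-gon share their arc, so the arguments are composable and the value is determined by its arrows.
\<close>

lemma mu_value_D:
 assumes psi: "\<psi> \<in> treegons Q" and v: "mu_value Q \<psi> ps y"
 shows "chain ps \<and> ((\<exists>x\<in>inL (map snd ps). y = bvec (fst (last ps), x) \<and> wordL ps x \<in> \<psi>) \<or>
  (\<exists>x\<in>inR (map snd ps). y = smul (sg (ldeg x)) (bvec (fst (last ps), x)) \<and> wordR ps x \<in> \<psi>))"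
 using v
proof cases
 case (left \<alpha> as \<beta>)
 have t: "treegon_word Q (\<alpha> # as)" using treegons_member[OF psi left(3)] by simp
 have tg: "tg (snd \<alpha> # map snd as)" and mk: "\<alpha> = mk (snd \<alpha>)" "\<forall>p\<in>set as. p = mk (snd p)"
  using treegon_imp[OF t] by auto
 have ne: "as \<noteq> []" using tg_length[OF tg] by auto
 have nz: "\<forall>p\<in>set (\<alpha> # as). p \<in> nz \<and> snd p \<noteq> []"
 proof
  fix p assume p: "p \<in> set (\<alpha> # as)"
  then have "snd p \<in> set (snd \<alpha> # map snd as)" by auto
  from tg_entry[OF tg this] have "mk (snd p) \<in> nz" "snd p \<noteq> []" using mk_nz by auto
  then show "p \<in> nz \<and> snd p \<noteq> []" using p mk by auto
 qed
 have adj: "successively (\<lambda>p q. fst p = path_head Q q) (\<alpha> # as)"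
 proof -
  have "successively (\<lambda>a b. hd b = nx (last a)) (map snd (\<alpha> # as))" using tg_adj[OF tg] by simp
  then show ?thesis unfolding successively_map
  proof (rule successively_mono)
   fix p q assume p: "p \<in> set (\<alpha> # as)" "q \<in> set (\<alpha> # as)" "hd (snd q) = nx (last (snd p))"
   then have "p \<in> nz" "snd p \<noteq> []" "snd q \<noteq> []" using nz by blast+
   then show "fst p = path_head Q q"
    using p(3) tail_nz[of p] last_in[OF snd_nz, of p] by (simp add: path_head_def)
  qed
 qed
 have "hd (snd \<alpha>) = nx (last (snd (last as)))" using tg_adj[OF tg] ne by (simp add: last_map)
 moreover have "last (snd (last as)) \<in> Ar" using nz ne last_in[OF snd_nz, of "last as"] by simp
 ultimately have hd: "path_head Q \<alpha> = fst (last as)" using nz ne tail_nz[of "last as"] by (simp add: path_head_def)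
 have b: "\<beta> \<in> nz" "fst \<beta> = path_head Q \<alpha>" "path_comp \<beta> \<alpha> \<in> nz" using left(4) by (auto simp: comp_nz_iff comp_nz_def)
 have "chain ps"
  using nz adj b left(1) ne by (cases as) (auto simp: chain_def path_comp_def)
 moreover have "snd \<beta> \<in> inL (map snd ps)" using tg left(1) by (auto simp: in_inL path_comp_def)
 moreover have "y = bvec (fst (last ps), snd \<beta>)" using left b hd ne by (cases \<beta>) simp
 moreover have "wordL ps (snd \<beta>) = \<alpha> # as" using left(1) mk(1) by (simp add: wordL_def path_comp_def)
 ultimately show ?thesis using left(3) by (intro conjI disjI1 bexI[of _ "snd \<beta>"]) simp_all
next
 case (right as \<alpha> \<gamma>)
 have t: "treegon_word Q (as @ [\<alpha>])" using treegons_member[OF psi right(3)] by simp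
 have tg: "tg (map snd as @ [snd \<alpha>])" and mk: "\<alpha> = mk (snd \<alpha>)" "\<forall>p\<in>set as. p = mk (snd p)"
  using treegon_imp[OF t] by auto
 have ne: "as \<noteq> []" using tg_length[OF tg] by auto
 have nz: "\<forall>p\<in>set (as @ [\<alpha>]). p \<in> nz \<and> snd p \<noteq> []"
 proof
  fix p assume p: "p \<in> set (as @ [\<alpha>])"
  then have "snd p \<in> set (map snd as @ [snd \<alpha>])" by auto
  from tg_entry[OF tg this] have "mk (snd p) \<in> nz" "snd p \<noteq> []" using mk_nz by auto
  then show "p \<in> nz \<and> snd p \<noteq> []" using p mk by auto
 qed
 have adj: "successively (\<lambda>p q. fst p = path_head Q q) (as @ [\<alpha>])"
 proof -
  have "successively (\<lambda>a b. hd b = nx (last a)) (map snd (as @ [\<alpha>]))" using tg_adj[OF tg] by simp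
  then show ?thesis unfolding successively_map
  proof (rule successively_mono)
   fix p q assume p: "p \<in> set (as @ [\<alpha>])" "q \<in> set (as @ [\<alpha>])" "hd (snd q) = nx (last (snd p))"
   then have "p \<in> nz" "snd p \<noteq> []" "snd q \<noteq> []" using nz by blast+
   then show "fst p = path_head Q q"
    using p(3) tail_nz[of p] last_in[OF snd_nz, of p] by (simp add: path_head_def)
  qed
 qed
 have g: "\<gamma> \<in> nz" "fst \<alpha> = path_head Q \<gamma>" "path_comp \<alpha> \<gamma> \<in> nz" using right(4) by (auto simp: comp_nz_iff comp_nz_def)
 have \<alpha>: "snd \<alpha> \<noteq> []" using nz by simp
 have ch: "chain ps"
  using nz adj g right(1) ne \<alpha> by (auto simp: chain_def successively_append_iff path_comp_def path_head_def)
 have ps: "ps = as @ [path_comp \<alpha> \<gamma>]" "fst (last ps) = fst \<gamma>" using right(1) by (simp_all add: path_comp_def)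
 show ?thesis
 proof (cases "snd \<gamma> = []")
  case True
  then have "path_comp \<alpha> \<gamma> = \<alpha>" using g by (simp add: path_comp_def path_head_def prod_eqI)
  then have ps': "ps = as @ [\<alpha>]" using ps by simp
  have "wordL ps [] = ps"
   using ps' ne mk(2) by (cases as) (auto simp: wordL_def)
  moreover have "[] \<in> inL (map snd ps)" using tg ps' ne by (cases as) (auto simp: in_inL)
  moreover have "y = bvec (fst (last ps), [])" using right(2) True ps(2) by (cases \<gamma>) (simp add: path_deg_ldeg)
  ultimately show ?thesis using ch right(3) ps' by (intro conjI disjI1 bexI[of _ "[]"]) simp_all
 next
  case False
  then have "snd \<gamma> \<in> inR (map snd ps)" using tg ps in_inR[of "snd \<gamma>" "map snd as" "snd \<alpha> @ snd \<gamma>"] by (auto simp: path_comp_def)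
  moreover have "y = smul (sg (ldeg (snd \<gamma>))) (bvec (fst (last ps), snd \<gamma>))" using right(2) ps(2) by (simp add: path_deg_ldeg)
  moreover have "wordR ps (snd \<gamma>) = as @ [\<alpha>]" using ps mk(1) by (simp add: wordR_def path_comp_def)
  ultimately show ?thesis using ch right(3) by (intro conjI disjI2 bexI[of _ "snd \<gamma>"]) simp_all
 qed
qed

lemma mu_value_inL:
 assumes ch: "chain ps" and x: "x \<in> inL (map snd ps)"
 shows "\<exists>\<psi>\<in>treegons Q. mu_value Q \<psi> ps (bvec (fst (last ps), x))"
proof -
 obtain p ps' where ps: "ps = p # ps'" using x by (cases ps) (auto simp: inL_def)
 obtain z where z: "snd p = x @ z" "tg (z # map snd ps')" using x ps by (auto simp: in_inL)
 have ne: "ps' \<noteq> []" using tg_length[OF z(2)] by auto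
 have zn: "nzl z" "z \<noteq> []" using tg_entry[OF z(2), of z] by auto
 have e: "\<forall>q\<in>set ps'. q = mk (snd q)"
 proof
  fix q assume "q \<in> set ps'"
  then have "q \<in> nz" "snd q \<noteq> []" using ch ps tg_entry[OF z(2), of "snd q"] by (auto simp: chain_def)
  then show "q = mk (snd q)" using mk_snd by simp
 qed
 have "treegon_word Q (map mk (z # map snd ps'))" by (rule tg_imp_treegon[OF z(2)])
 then have t: "treegon_word Q (mk z # ps')" using map_mk_snd[OF e] by simp
 let ?\<psi> = "{rotate i (mk z # ps') | i. True}"
 have psi: "?\<psi> \<in> treegons Q" "mk z # ps' \<in> ?\<psi>" using treegons_I[OF t] by auto
 have p: "p \<in> nz" using ch ps by (auto simp: chain_def)
 have hz: "q_head Q (hd z) = fst (last ps')"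
 proof -
  have "hd z = nx (last (snd (last ps')))" using tg_adj[OF z(2)] ne by (simp add: last_map)
  moreover have l: "last ps' \<in> nz" "snd (last ps') \<noteq> []"
   using ch ps ne tg_entry[OF z(2), of "snd (last ps')"] by (auto simp: chain_def)
  moreover have "last (snd (last ps')) \<in> Ar" using l last_in snd_nz by blast
  ultimately show ?thesis using tail_nz[of "last ps'"] by simp
 qed
 let ?\<beta> = "(fst (last ps'), x)"
 have xn: "nzl x" "nzl (x @ z)" using z snd_nz[OF p] by (auto simp: nzl_append)
 have "last ps' \<in> set ps'" using ne by simp
 then have "fst (last ps') \<in> q_verts Q" using ch ps fst_nz[of "last ps'"] by (auto simp: chain_def)
 moreover have "x \<noteq> [] \<Longrightarrow> q_tail Q (last x) = fst (last ps')"
  using xn zn hz by (auto simp: nzl_append nzc_iff)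
 ultimately have b: "?\<beta> \<in> nz" using xn by (simp add: nz_iff)
 have c: "comp_nz Q ?\<beta> (mk z)" using b mk_nz[OF zn] xn zn hz by (simp add: comp_nz_iff path_head_def)
 have "path_comp ?\<beta> (mk z) = p" using z zn tail_nz[OF p] by (simp add: path_comp_def mk_def prod_eqI)
 with mu_value.left[OF psi(2) c] have "mu_value Q ?\<psi> ps (bvec ?\<beta>)" using ps by simp
 then show ?thesis using psi ps ne by auto
qed

lemma mu_value_inR:
 assumes ch: "chain ps" and x: "x \<in> inR (map snd ps)"
 shows "\<exists>\<psi>\<in>treegons Q. mu_value Q \<psi> ps (smul (sg (ldeg x)) (bvec (fst (last ps), x)))"
proof -
 obtain p ps' where ps: "ps = ps' @ [p]" using x by (cases ps rule: rev_cases) (auto simp: inR_def)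
 obtain z where z: "snd p = z @ x" "tg (map snd ps' @ [z])" "x \<noteq> []" using x ps in_inR[of x "map snd ps'" "snd p"] by auto
 have zn: "nzl z" "z \<noteq> []" using tg_entry[OF z(2), of z] by auto
 have e: "\<forall>q\<in>set ps'. q = mk (snd q)"
 proof
  fix q assume "q \<in> set ps'"
  then have "q \<in> nz" "snd q \<noteq> []" using ch ps tg_entry[OF z(2), of "snd q"] by (auto simp: chain_def)
  then show "q = mk (snd q)" using mk_snd by simp
 qed
 have "treegon_word Q (map mk (map snd ps' @ [z]))" by (rule tg_imp_treegon[OF z(2)])
 then have t: "treegon_word Q (ps' @ [mk z])" using map_mk_snd[OF e] by simp
 let ?\<psi> = "{rotate i (ps' @ [mk z]) | i. True}"
 have psi: "?\<psi> \<in> treegons Q" "ps' @ [mk z] \<in> ?\<psi>" using treegons_I[OF t] by auto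
 have p: "p \<in> nz" using ch ps by (auto simp: chain_def)
 let ?\<gamma> = "(fst p, x)"
 have xn: "nzl x" "nzl (z @ x)" using z snd_nz[OF p] by (auto simp: nzl_append)
 have g: "?\<gamma> \<in> nz" using xn p fst_nz[OF p] tail_nz[OF p] z by (simp add: nz_iff)
 have c: "comp_nz Q (mk z) ?\<gamma>" using g mk_nz[OF zn] xn zn z(3) by (auto simp: comp_nz_iff path_head_def mk_def nzl_append nzc_iff)
 have "path_comp (mk z) ?\<gamma> = p" using z by (simp add: path_comp_def prod_eqI)
 with mu_value.right[OF psi(2) c] have "mu_value Q ?\<psi> ps (smul (sg (path_deg Q ?\<gamma>)) (bvec ?\<gamma>))" using ps by simp
 then show ?thesis using psi ps by (auto simp: path_deg_ldeg)
qed

lemma bvec_ne_0 [simp]: "bvec p \<noteq> 0"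
 using keys_bvec[of p] by (metis empty_not_insert keys_eq_empty)

lemma mu_sum_unique:
 assumes psi: "\<psi> \<in> treegons Q" "mu_value Q \<psi> ps y" "y \<noteq> 0"
  and uniq: "\<And>\<psi>' y'. \<psi>' \<in> treegons Q \<Longrightarrow> mu_value Q \<psi>' ps y' \<Longrightarrow> \<psi>' = \<psi> \<and> y' = y"
 shows "(\<Sum>\<psi> \<in> {\<psi> \<in> treegons Q. mu_treegon Q \<psi> ps \<noteq> 0}. mu_treegon Q \<psi> ps) = y"
proof -
 have m: "mu_treegon Q \<psi> ps = y"
 proof -
  have "{y. mu_value Q \<psi> ps y} = {y}" using psi uniq by blast
  then show ?thesis by (simp add: mu_treegon_def)
 qed
 have "mu_treegon Q \<psi>' ps = 0" if "\<psi>' \<in> treegons Q" "\<psi>' \<noteq> \<psi>" for \<psi>'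
 proof -
  have "{y. mu_value Q \<psi>' ps y} = {}" using that uniq by blast
  then show ?thesis by (simp add: mu_treegon_def)
 qed
 then have "{\<psi> \<in> treegons Q. mu_treegon Q \<psi> ps \<noteq> 0} = {\<psi>}" using psi m by blast
 then show ?thesis by (simp add: m)
qed

lemma mu_treegons_mT:
 assumes ch: "chain ps"
 shows "(\<Sum>\<psi> \<in> {\<psi> \<in> treegons Q. mu_treegon Q \<psi> ps \<noteq> 0}. mu_treegon Q \<psi> ps) = lin (\<lambda>s. bvec (fst (last ps), s)) (mT (map snd ps))"
proof -
 let ?w = "map snd ps" and ?v = "fst (last ps)"
 consider x where "x \<in> inL ?w" | x where "x \<in> inR ?w" | "inL ?w = {}" "inR ?w = {}" by blast
 then show ?thesis
 proof cases
  case 1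
  have L: "inL ?w = {x}" "inR ?w = {}" using 1 inL_unique inL_inR_disjoint by blast+
  obtain \<psi> where psi: "\<psi> \<in> treegons Q" "mu_value Q \<psi> ps (bvec (?v, x))" using mu_value_inL[OF ch 1] by blast
  have "\<psi>' = \<psi> \<and> y' = bvec (?v, x)" if p: "\<psi>' \<in> treegons Q" "mu_value Q \<psi>' ps y'" for \<psi>' y'
  proof -
   have "wordL ps x \<in> \<psi>'" "y' = bvec (?v, x)" using mu_value_D[OF p] L by auto
   moreover have "wordL ps x \<in> \<psi>" using mu_value_D[OF psi] L by auto
   ultimately show ?thesis using treegons_member p(1) psi(1) by blast
  qed
  from mu_sum_unique[OF psi _ this] show ?thesis unfolding lin_mT L by simp
 next
  case 2
  have L: "inR ?w = {x}" "inL ?w = {}" using 2 inR_unique inL_inR_disjoint by blast+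
  obtain \<psi> where psi: "\<psi> \<in> treegons Q" "mu_value Q \<psi> ps (smul (sg (ldeg x)) (bvec (?v, x)))" using mu_value_inR[OF ch 2] by blast
  have "\<psi>' = \<psi> \<and> y' = smul (sg (ldeg x)) (bvec (?v, x))" if p: "\<psi>' \<in> treegons Q" "mu_value Q \<psi>' ps y'" for \<psi>' y'
  proof -
   have "wordR ps x \<in> \<psi>'" "y' = smul (sg (ldeg x)) (bvec (?v, x))" using mu_value_D[OF p] L by auto
   moreover have "wordR ps x \<in> \<psi>" using mu_value_D[OF psi] L by auto
   ultimately show ?thesis using treegons_member p(1) psi(1) by blast
  qed
  from mu_sum_unique[OF psi _ this] show ?thesis unfolding lin_mT L by simp
 next
  case 3
  have "mu_treegon Q \<psi> ps = 0" if "\<psi> \<in> treegons Q" for \<psi>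
  proof -
   have "{y. mu_value Q \<psi> ps y} = {}" using mu_value_D[OF that] 3 by auto
   then show ?thesis by (simp add: mu_treegon_def)
  qed
  then have "{\<psi> \<in> treegons Q. mu_treegon Q \<psi> ps \<noteq> 0} = {}" by blast
  then show ?thesis unfolding lin_mT 3 by simp
 qed
qed

text \<open>
 On composable sequences there is at most one tree-gon and at most one value (by \<open>inL_unique\<close> and its companions), so
 the sum over tree-gons has at most one term.
\<close>

lemma mu_basis_mm:
 assumes ch: "chain ps"
 shows "mu_basis Q ps = lin (\<lambda>s. bvec (fst (last ps), s)) (mm (map snd ps))"
proof -
 consider "length ps < 2" | "length ps = 2" | "2 < length ps" by linarith
 then show ?thesis
 proof cases
  case 1
  then show ?thesis by (simp add: mu_basis_def mm_def mT_short m2_length)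
 next
  case 2
  then obtain p q where ps: "ps = [p, q]" by (auto simp: length_Suc_conv numeral_2_eq_2)
  have "path_mul Q p q = (if nzl (snd p @ snd q) then bvec (fst q, snd p @ snd q) else 0)"
   using ch by (auto simp: ps path_mul_def comp_nz_iff path_comp_def)
  then show ?thesis by (simp add: ps mu_basis_def mm_def mT_short path_deg_ldeg lin_smul)
 next
  case 3
  then show ?thesis using mu_treegons_mT[OF ch] by (simp add: mu_basis_def mm_def m2_length)
 qed
qed

lemma mu_basis_chain: "mu_basis Q ps \<noteq> 0 \<Longrightarrow> chain ps \<and> ps \<noteq> []"
proof -
 assume n: "mu_basis Q ps \<noteq> 0"
 then consider "length ps = 2" | "2 < length ps" by (auto simp: mu_basis_def split: if_splits)
 then show ?thesis
 proof cases
  case 1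
  then obtain p q where ps: "ps = [p, q]" by (auto simp: length_Suc_conv numeral_2_eq_2)
  with n have "path_mul Q p q \<noteq> 0" by (auto simp: mu_basis_def)
  then show ?thesis by (auto simp: ps path_mul_def comp_nz_iff split: if_splits)
 next
  case 2
  let ?S = "{\<psi> \<in> treegons Q. mu_treegon Q \<psi> ps \<noteq> 0}"
  have "?S \<noteq> {}"
  proof
   assume "?S = {}"
   then have "(\<Sum>\<psi>\<in>?S. mu_treegon Q \<psi> ps) = 0" by (simp only: sum.empty)
   then show False using n 2 by (simp add: mu_basis_def)
  qed
  then obtain \<psi> where psi: "\<psi> \<in> treegons Q" "mu_treegon Q \<psi> ps \<noteq> 0" by blast
  have "{y. mu_value Q \<psi> ps y} \<noteq> {}"
  proof
   assume "{y. mu_value Q \<psi> ps y} = {}"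
   then have "mu_treegon Q \<psi> ps = 0" by (simp only: mu_treegon_def sum.empty)
   then show False using psi by simp
  qed
  then show ?thesis using mu_value_D[OF psi(1)] 2 by auto
 qed
qed

end

section \<open>The Hochschild differential on basis sequences\<close>

context gentle_quiver begin

text \<open>
 The shifted degree.
\<close>

definition pdeg :: "('v, 'e) qpath \<Rightarrow> int" where "pdeg p = ldeg (snd p) - 1"

lemma pdeg_pair [simp]: "pdeg (v, s) = ldeg s - 1" by (simp add: pdeg_def)

sublocale pb: graded_basis pdeg .

abbreviation "M \<equiv> mu_basis Q"

text \<open>
 The value \<open>q\<close> starts and ends at the same vertices as the whole sequence.
\<close>

definition par :: "('v, 'e) qpath list \<Rightarrow> ('v, 'e) qpath \<Rightarrow> bool" where
 "par ps q \<longleftrightarrow> q \<in> nz \<and> path_head Q q = path_head Q (hd ps) \<and> fst q = fst (last ps)"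

lemma wdeg_snd: "wdeg (map snd ps) = pb.wdeg ps"
 by (induction ps) auto

lemma keys_mT: "x \<in> keys (mT w) \<longleftrightarrow> x \<in> inL w \<or> x \<in> inR w"
 using inL_inR_disjoint[of x w x] by (auto simp: in_keys_iff lookup_mT)

lemma inL_par:
 assumes ch: "chain ps" and x: "x \<in> inL (map snd ps)"
 shows "par ps (fst (last ps), x)"
proof -
 obtain p ps' where ps: "ps = p # ps'" using x by (cases ps) (auto simp: inL_def)
 obtain z where z: "snd p = x @ z" "tg (z # map snd ps')" using x ps by (auto simp: in_inL)
 have ne: "ps' \<noteq> []" using tg_length[OF z(2)] by auto
 have zn: "nzl z" "z \<noteq> []" using tg_entry[OF z(2), of z] by auto
 have p: "p \<in> nz" using ch ps by (auto simp: chain_def)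
 have l: "last ps' \<in> nz" "snd (last ps') \<noteq> []"
  using ch ps ne tg_entry[OF z(2), of "snd (last ps')"] by (auto simp: chain_def)
 have "hd z = nx (last (snd (last ps')))" using tg_adj[OF z(2)] ne by (simp add: last_map)
 moreover have "last (snd (last ps')) \<in> Ar" using last_in[OF snd_nz[OF l(1)] l(2)] .
 ultimately have hz: "q_head Q (hd z) = fst (last ps')" using tail_nz[OF l] by simp
 have xn: "nzl (x @ z)" using z snd_nz[OF p] by simp
 have "x \<noteq> [] \<Longrightarrow> q_tail Q (last x) = fst (last ps')"
  using xn zn hz by (auto simp: nzl_append nzc_iff)
 then have "(fst (last ps'), x) \<in> nz" using xn fst_nz[OF l(1)] by (simp add: nz_iff nzl_append)
 moreover have "path_head Q (fst (last ps'), x) = path_head Q p"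
  using z zn hz by (auto simp: path_head_def)
 ultimately show ?thesis using ps ne by (simp add: par_def)
qed

lemma inR_par:
 assumes ch: "chain ps" and x: "x \<in> inR (map snd ps)"
 shows "par ps (fst (last ps), x)"
proof -
 obtain p ps' where ps: "ps = ps' @ [p]" using x by (cases ps rule: rev_cases) (auto simp: inR_def)
 obtain z where z: "snd p = z @ x" "tg (map snd ps' @ [z])" "x \<noteq> []" using x ps in_inR[of x "map snd ps'" "snd p"] by auto
 have ne: "ps' \<noteq> []" using tg_length[OF z(2)] by auto
 have zn: "nzl z" "z \<noteq> []" using tg_entry[OF z(2), of z] by auto
 have p: "p \<in> nz" using ch ps by (auto simp: chain_def)
 have h: "hd ps' \<in> nz" "snd (hd ps') \<noteq> []"
  using ch ps ne tg_entry[OF z(2), of "snd (hd ps')"] by (auto simp: chain_def)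
 have "hd (snd (hd ps')) = nx (last z)" using tg_adj[OF z(2)] ne by (simp add: hd_map)
 then have hz: "path_head Q (hd ps') = q_tail Q (last z)" using h last_in[OF zn] by (simp add: path_head_def)
 have xn: "nzl (z @ x)" using z snd_nz[OF p] by simp
 have "(fst p, x) \<in> nz" using xn fst_nz[OF p] tail_nz[OF p] z by (simp add: nz_iff nzl_append)
 moreover have "path_head Q (fst p, x) = path_head Q (hd ps')"
  using xn zn hz z(3) by (auto simp: path_head_def nzl_append nzc_iff)
 ultimately show ?thesis using ps ne by (simp add: par_def)
qed

lemma mm_par:
 assumes ch: "chain ps" and x: "x \<in> keys (mm (map snd ps))"
 shows "par ps (fst (last ps), x)"
proof -
 have "x \<in> keys (mT (map snd ps)) \<or> x \<in> keys (m2 (map snd ps))"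
  using x keys_add[of "mT (map snd ps)" "m2 (map snd ps)"] unfolding mm_def by blast
 then show ?thesis
 proof
  assume "x \<in> keys (mT (map snd ps))"
  then show ?thesis using inL_par[OF ch] inR_par[OF ch] by (auto simp: keys_mT)
 next
  assume x: "x \<in> keys (m2 (map snd ps))"
  have "length ps = 2"
  proof (rule ccontr)
   assume "length ps \<noteq> 2"
   then have "m2 (map snd ps) = 0" by (intro m2_length) simp
   then show False using x by simp
  qed
  then obtain p q where ps: "ps = [p, q]" by (auto simp: length_Suc_conv numeral_2_eq_2)
  have "x = snd p @ snd q" "nzl (snd p @ snd q)" using x ps by (auto simp: in_keys_iff lookup_bvec split: if_splits)
  moreover then have "comp_nz Q p q" using ch ps by (auto simp: comp_nz_iff)
  ultimately show ?thesis using comp_nz_in[of p q] path_head_comp[of p q] ps ch by (auto simp: par_def path_comp_def)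
 qed
qed

lemma M_eq: "chain ps \<Longrightarrow> M ps = lin (\<lambda>s. bvec (fst (last ps), s)) (mm (map snd ps))"
 by (rule mu_basis_mm)

lemma M_par: "q \<in> keys (M ps) \<Longrightarrow> chain ps \<and> ps \<noteq> [] \<and> par ps q \<and> snd q \<in> keys (mm (map snd ps)) \<and> q = (fst (last ps), snd q)"
proof -
 assume q: "q \<in> keys (M ps)"
 then have "M ps \<noteq> 0" by (metis empty_iff keys_zero)
 then have ch: "chain ps" "ps \<noteq> []" using mu_basis_chain[of ps] by auto
 obtain s where "s \<in> keys (mm (map snd ps))" "q = (fst (last ps), s)"
  using q keys_lin[of "\<lambda>s. bvec (fst (last ps), s)" "mm (map snd ps)"] unfolding M_eq[OF ch(1)] by auto
 then show ?thesis using ch mm_par[OF ch(1)] by simp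
qed

lemma homog_M: "pb.homog 1 M"
 unfolding pb.homog_def
proof (intro allI ballI)
 fix ps q assume "q \<in> keys (M ps)"
 from M_par[OF this] have "even (ldeg (snd q) - 1 - wdeg (map snd ps) - 1)" using homog_mm unfolding homog_def by blast
 then show "even (pdeg q - pb.wdeg ps - 1)" unfolding wdeg_snd pdeg_def[of q] .
qed

lemma chain_insert:
 assumes "chain X" "X \<noteq> []" "par X x"
 shows "chain (L @ x # R) \<longleftrightarrow> chain (L @ X @ R)" "par (L @ x # R) q \<longleftrightarrow> par (L @ X @ R) q"
 using assms by (auto simp: chain_append par_def chain_def[of "_ # _"] successively_Cons hd_append last_append chain_def[of R])

text \<open>
 The A-infinity relation, transported from lists of arrows to paths: on composable sequences the source of the value
 is that of the last entry, so paths and their lists of arrows carry the same information.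
\<close>

lemma M_M: "lin M (pb.hat 1 M ps) = 0"
proof (cases "chain ps")
 case False
 have "M w = 0" if w: "w \<in> keys (pb.hat 1 M ps)" for w
 proof (rule ccontr)
  assume "M w \<noteq> 0"
  then have cw: "chain w" using mu_basis_chain by blast
  obtain L X R x where e: "ps = L @ X @ R" "X \<noteq> []" "x \<in> keys (M X)" "w = L @ x # R" using pb.keys_hat[OF w] by blast
  from M_par[OF e(3)] chain_insert(1)[of X x L R] cw e False show False by simp
 qed
 then have "lin M (pb.hat 1 M ps) = lin (\<lambda>w. 0) (pb.hat 1 M ps)" by (intro lin_cong) auto
 then show ?thesis by simp
next
 case True
 define v where "v = fst (last ps)"
 define F where "F = (\<lambda>L X R. smul (sg (wdeg R)) (lin (\<lambda>s. mm (L @ s # R)) (mm X)))"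
 have step: "lin (\<lambda>x. M (L @ x # R)) (M X) = lin (\<lambda>s. bvec (v, s)) (lin (\<lambda>s. mm (map snd L @ s # map snd R)) (mm (map snd X)))"
  if "(L, X, R) \<in> splits ps" for L X R
 proof -
  have e: "ps = L @ X @ R" "X \<noteq> []" using that by (auto simp: splits_def)
  have cX: "chain X" using True e by (auto simp: chain_append)
  have "lin (\<lambda>x. M (L @ x # R)) (M X) = lin (\<lambda>s. M (L @ (fst (last X), s) # R)) (mm (map snd X))"
   unfolding M_eq[OF cX] lin_lin by simp
  also have "\<dots> = lin (\<lambda>s. lin (\<lambda>s. bvec (v, s)) (mm (map snd L @ s # map snd R))) (mm (map snd X))"
  proof (rule lin_cong)
   fix s assume s: "s \<in> keys (mm (map snd X))"
   have p: "par X (fst (last X), s)" using mm_par[OF cX s] .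
   have "chain (L @ (fst (last X), s) # R)" using chain_insert(1)[OF cX e(2) p, of L R] True e by simp
   moreover have "fst (last (L @ (fst (last X), s) # R)) = v" using e by (auto simp: v_def last_append)
   ultimately show "M (L @ (fst (last X), s) # R) = lin (\<lambda>s. bvec (v, s)) (mm (map snd L @ s # map snd R))"
    using M_eq by simp
  qed
  finally show ?thesis by (simp add: lin_lin)
 qed
 have "lin M (pb.hat 1 M ps) = (\<Sum>(L, X, R)\<in>splits ps. smul (sg (pb.wdeg R)) (lin (\<lambda>x. M (L @ x # R)) (M X)))"
  unfolding pb.hat_def lin_sum case_prod_beta lin_smul lin_lin lin_bvec by simp
 also have "\<dots> = (\<Sum>(L, X, R)\<in>splits ps. lin (\<lambda>s. bvec (v, s)) (F (map snd L) (map snd X) (map snd R)))"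
  by (rule sum.cong[OF refl]) (auto simp: step F_def lin_smul wdeg_snd)
 also have "\<dots> = (\<Sum>(L, X, R)\<in>splits (map snd ps). lin (\<lambda>s. bvec (v, s)) (F L X R))"
 proof -
  have inj: "inj_on (\<lambda>(L, X, R). (map snd L, map snd X, map snd R)) (splits ps)"
   by (auto simp: inj_on_def splits_def append_eq_append_conv dest: map_eq_imp_length_eq)
    (metis append_eq_append_conv length_map)+
  have im: "splits (map snd ps) = (\<lambda>(L, X, R). (map snd L, map snd X, map snd R)) ` splits ps"
  proof (intro equalityI subsetI)
   fix t assume "t \<in> splits (map snd ps)"
   then obtain L X R where t: "t = (L, X, R)" "map snd ps = L @ X @ R" "X \<noteq> []" by (auto simp: splits_def)
   from t(2) obtain L' Y where 1: "ps = L' @ Y" "L = map snd L'" "X @ R = map snd Y"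
    unfolding map_eq_append_conv by blast
   from 1(3)[symmetric] obtain X' R' where 2: "Y = X' @ R'" "X = map snd X'" "R = map snd R'"
    unfolding map_eq_append_conv by blast
   have "(L', X', R') \<in> splits ps" "t = (\<lambda>(L, X, R). (map snd L, map snd X, map snd R)) (L', X', R')"
    using t 1 2 by (auto simp: splits_def)
   then show "t \<in> (\<lambda>(L, X, R). (map snd L, map snd X, map snd R)) ` splits ps" by (rule rev_image_eqI)
  qed (auto simp: splits_def)
  show ?thesis unfolding im sum.reindex[OF inj] by (rule sum.cong) auto
 qed
 also have "\<dots> = lin (\<lambda>s. bvec (v, s)) (lin mm (hat 1 mm (map snd ps)))"
  unfolding hat_def lin_sum case_prod_beta lin_smul lin_lin lin_bvec F_def by simp
 also have "lin mm (hat 1 mm (map snd ps)) = 0"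
 proof (rule mm_mm)
  show "\<forall>a\<in>set (map snd ps). nzl a" using True snd_nz by (auto simp: chain_def)
  assume ne: "[] \<notin> set (map snd ps)"
  have "successively (\<lambda>p q. fst p = path_head Q q) ps" using True by (simp add: chain_def)
  then show "successively (\<lambda>a b. last a \<in> Ar \<and> hd b \<in> Ar \<and> q_tail Q (last a) = q_head Q (hd b)) (map snd ps)"
   unfolding successively_map
  proof (rule successively_mono)
   fix p q assume p: "p \<in> set ps" "q \<in> set ps" "fst p = path_head Q q"
   then have "p \<in> nz" "q \<in> nz" "snd p \<noteq> []" "snd q \<noteq> []" using True ne by (auto simp: chain_def image_iff)
   moreover from this have "last (snd p) \<in> Ar" "hd (snd q) \<in> Ar" using last_in snd_nz by (auto simp: nzl_def subset_iff dest: snd_nz)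
   ultimately show "last (snd p) \<in> Ar \<and> hd (snd q) \<in> Ar \<and> q_tail Q (last (snd p)) = q_head Q (hd (snd q))"
    using p(3) tail_nz[of p] by (simp add: path_head_def)
  qed
 qed
 finally show ?thesis by simp
qed

text \<open>Maps of bimodules, given by their values on basis sequences and without constant term.\<close>

text \<open>
 Maps of bimodules, given by their values on basis sequences and without constant term.
\<close>

definition BC :: "(('v, 'e) qpath list \<Rightarrow> ('v, 'e) qvec) \<Rightarrow> bool" where
 "BC f \<longleftrightarrow> (\<forall>ps. f ps \<noteq> 0 \<longrightarrow> chain ps \<and> ps \<noteq> []) \<and> (\<forall>ps. \<forall>q\<in>keys (f ps). par ps q)"

lemma BC_I:
 assumes k: "\<And>ps q. q \<in> keys (f ps) \<Longrightarrow> chain ps \<and> ps \<noteq> [] \<and> par ps q"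
 shows "BC f"
proof -
 have "chain ps \<and> ps \<noteq> []" if n: "f ps \<noteq> 0" for ps
 proof -
  obtain q where "q \<in> keys (f ps)" using n by (metis all_not_in_conv keys_eq_empty)
  from k[OF this] show ?thesis by simp
 qed
 with k show ?thesis unfolding BC_def by blast
qed

lemma BC_M: "BC M"
 using M_par mu_basis_chain by (auto simp: BC_def)

lemma BC_key: "BC f \<Longrightarrow> q \<in> keys (f ps) \<Longrightarrow> chain ps \<and> ps \<noteq> [] \<and> par ps q"
 unfolding BC_def by (metis empty_iff keys_zero)

lemma BC_dif_aux:
 assumes f: "BC f" and g: "BC g" and q: "q \<in> keys (lin f (pb.hat j g ps))"
 shows "chain ps \<and> ps \<noteq> [] \<and> par ps q"
proof -
 obtain w where w: "w \<in> keys (pb.hat j g ps)" "q \<in> keys (f w)" using keys_linD[OF q] by blast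
 obtain L X R x where e: "ps = L @ X @ R" "X \<noteq> []" "x \<in> keys (g X)" "w = L @ x # R" using pb.keys_hat[OF w(1)] by blast
 from BC_key[OF f w(2)] BC_key[OF g e(3)] chain_insert[of X x L R] e show ?thesis by simp
qed

lemma BC_dif:
 assumes f: "BC f" shows "BC (pb.dif M j f)"
proof -
 have k: "chain ps \<and> ps \<noteq> [] \<and> par ps q" if q: "q \<in> keys (pb.dif M j f ps)" for ps q
 proof -
  have "keys (pb.dif M j f ps) \<subseteq> keys (lin M (pb.hat j f ps)) \<union> keys (smul (sg j) (lin f (pb.hat 1 M ps)))"
   unfolding pb.dif_def by (rule keys_diff)
  then have "q \<in> keys (lin M (pb.hat j f ps)) \<or> q \<in> keys (lin f (pb.hat 1 M ps))"
   using q keys_smul_subset[of "sg j" "lin f (pb.hat 1 M ps)"] by auto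
  then show ?thesis
  proof
   assume "q \<in> keys (lin M (pb.hat j f ps))"
   then show ?thesis by (rule BC_dif_aux[OF BC_M f])
  next
   assume "q \<in> keys (lin f (pb.hat 1 M ps))"
   then show ?thesis by (rule BC_dif_aux[OF f BC_M])
  qed
 qed
 then show ?thesis by (rule BC_I)
qed

theorem dif_M_dif_M: "pb.homog j f \<Longrightarrow> pb.dif M (j + 1) (pb.dif M j f) ps = 0"
 by (rule pb.dif_dif[OF homog_M M_M])

end

section \<open>Pairing the basis sequences that contain a product\<close>

context gentle_quiver begin

definition run :: "('v, 'e) qpath list \<Rightarrow> nat" where
 "run ps = length (takeWhile (\<lambda>p. snd p = []) ps)"

text \<open>
 The first place of a sequence at which it can be changed: a path of at least two arrows is split after its first
 arrow, a single arrow is merged into a successor with non-zero product, a run of idempotents of odd length is lengthened and one of even length shortened.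
 The flag is \<open>True\<close> if the sequence is the source of its pair, that is, the shorter one of the two.
\<close>

fun partner :: "('v, 'e) qpath list \<Rightarrow> (bool \<times> ('v, 'e) qpath list) option" where
 "partner [] = None"
| "partner (p # ps) =
  (if snd p = [] then (if odd (run (p # ps)) then Some (True, p # p # ps) else Some (False, ps))
   else if tl (snd p) \<noteq> [] then Some (True, mk [hd (snd p)] # (fst p, tl (snd p)) # ps)
   else if ps \<noteq> [] \<and> snd (hd ps) \<noteq> [] \<and> hd (snd (hd ps)) \<noteq> nx (hd (snd p)) then Some (False, path_comp p (hd ps) # tl ps)
   else map_option (map_prod id ((#) p)) (partner ps))"

definition arrows :: "('v, 'e) qpath list \<Rightarrow> nat" where "arrows ps = (\<Sum>p\<leftarrow>ps. length (snd p))"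

lemma arrows_simps [simp]: "arrows [] = 0" "arrows (p # ps) = length (snd p) + arrows ps" "arrows (ps @ qs) = arrows ps + arrows qs"
 by (simp_all add: arrows_def)

definition front_arrow :: "('v, 'e) qpath list \<Rightarrow> 'e option" where
 "front_arrow ps = (if snd (hd ps) = [] then None else Some (hd (snd (hd ps))))"

lemma run_Cons: "run (p # ps) = (if snd p = [] then Suc (run ps) else 0)"
 by (simp add: run_def)

lemma chain_Cons: "chain (p # ps) \<longleftrightarrow> p \<in> nz \<and> chain ps \<and> (ps = [] \<or> fst p = path_head Q (hd ps))"
 by (cases ps) auto

lemma path_head_idem [simp]: "snd p = [] \<Longrightarrow> path_head Q p = fst p"
 by (simp add: path_head_def)

lemma nzl_Cons: "nzl (a # as) \<longleftrightarrow> a \<in> Ar \<and> nzl as \<and> (as = [] \<or> nzc a (hd as))"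
 by (auto simp: nzl_def successively_Cons)

lemma nz_Cons_split:
 assumes p: "p \<in> nz" "snd p = a # b # as"
 shows "mk [a] \<in> nz" "(fst p, b # as) \<in> nz" "fst (mk [a]) = q_head Q b" "b \<noteq> nx a" "a \<in> Ar"
  "path_head Q (mk [a]) = path_head Q p" "path_comp (mk [a]) (fst p, b # as) = p"
proof -
 have n: "nzl (a # b # as)" using snd_nz[OF p(1)] p(2) by simp
 then show "a \<in> Ar" by (simp add: nzl_Cons)
 then show "mk [a] \<in> nz" by (intro mk_nz) (simp_all add: nzl_Cons)
 show "(fst p, b # as) \<in> nz" using n p fst_nz[OF p(1)] tail_nz[OF p(1)] by (auto simp: nz_iff nzl_Cons)
 show "fst (mk [a]) = q_head Q b" "b \<noteq> nx a" using n by (auto simp: nzl_Cons nzc_def mk_def)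
 show "path_head Q (mk [a]) = path_head Q p" "path_comp (mk [a]) (fst p, b # as) = p"
  using p by (auto simp: path_head_def path_comp_def prod_eqI)
qed

text \<open>
 The first arrow does not change, so that nothing happens to the left of the place that is modified; this makes
 \<open>partner\<close> an involution.
\<close>

lemma partner_of_source:
 "partner ps = Some (True, u) \<Longrightarrow> chain ps \<Longrightarrow>
  chain u \<and> u \<noteq> [] \<and> path_head Q (hd u) = path_head Q (hd ps) \<and> fst (last u) = fst (last ps) \<and>
  length u = Suc (length ps) \<and> arrows u = arrows ps \<and> front_arrow u = front_arrow ps \<and> partner u = Some (False, ps)"
proof (induction ps arbitrary: u rule: partner.induct)
 case (2 p ps)
 have p: "p \<in> nz" "chain ps" "ps = [] \<or> fst p = path_head Q (hd ps)" using 2(3) by (auto simp: chain_Cons)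
 consider "snd p = []" | a b as where "snd p = a # b # as" | a where "snd p = [a]"
  by (metis list.exhaust)
 then show ?case
 proof cases
  case 1
  then have "odd (run (p # ps))" "u = p # p # ps" using 2(2) by (auto split: if_splits)
  then show ?thesis using 1 p by (auto simp: run_Cons front_arrow_def chain_Cons)
 next
  case (2 a b as)
  then have u: "u = mk [a] # (fst p, b # as) # ps" using "2.prems" by simp
  show ?thesis using nz_Cons_split[OF p(1) 2] p 2 unfolding u
   by (auto simp: chain_Cons front_arrow_def path_head_def)
 next
  case (3 a)
  then have l: "\<not> (ps \<noteq> [] \<and> snd (hd ps) \<noteq> [] \<and> hd (snd (hd ps)) \<noteq> nx a)"
   using "2.prems" by (auto split: if_splits)
  then obtain u' where u': "partner ps = Some (True, u')" "u = p # u'"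
   using "2.prems" 3 by (auto split: if_splits)
  then have ne: "ps \<noteq> []" by auto
  have IH: "chain u'" "u' \<noteq> []" "path_head Q (hd u') = path_head Q (hd ps)" "fst (last u') = fst (last ps)"
   "length u' = Suc (length ps)" "arrows u' = arrows ps" "front_arrow u' = front_arrow ps" "partner u' = Some (False, ps)"
   using "2.IH"[OF _ _ _ u'(1)] 3 l p by auto
  have l': "\<not> (u' \<noteq> [] \<and> snd (hd u') \<noteq> [] \<and> hd (snd (hd u')) \<noteq> nx a)"
   using IH(7) l ne by (auto simp: front_arrow_def split: if_splits)
  show ?thesis using IH l' 3 u' p ne by (auto simp: chain_Cons front_arrow_def)
 qed
qed simp

lemma partner_of_target:
 "partner u = Some (False, v) \<Longrightarrow> chain u \<Longrightarrow>
  chain v \<and> v \<noteq> [] \<and> path_head Q (hd v) = path_head Q (hd u) \<and> fst (last v) = fst (last u) \<and>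
  front_arrow v = front_arrow u \<and> partner v = Some (True, u)"
proof (induction u arbitrary: v rule: partner.induct)
 case (2 p ps)
 have p: "p \<in> nz" "chain ps" "ps = [] \<or> fst p = path_head Q (hd ps)" using 2(3) by (auto simp: chain_Cons)
 consider "snd p = []" | a b as where "snd p = a # b # as" | a where "snd p = [a]"
  by (metis list.exhaust)
 then show ?case
 proof cases
  case 1
  then have e: "even (run (p # ps))" "v = ps" using 2(2) by (auto split: if_splits)
  then have "run ps \<noteq> 0" using 1 by (cases "run ps") (auto simp: run_Cons)
  then obtain p' ps' where ps: "ps = p' # ps'" "snd p' = []" by (cases ps) (auto simp: run_def split: if_splits)
  then have "p' = p" using p 1 by (auto simp: prod_eqI)
  then show ?thesis using e p ps 1 by (auto simp: run_Cons front_arrow_def)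
 next
  case (2 a b as)
  then show ?thesis using "2.prems" by simp
 next
  case (3 a)
  show ?thesis
  proof (cases "ps \<noteq> [] \<and> snd (hd ps) \<noteq> [] \<and> hd (snd (hd ps)) \<noteq> nx a")
   case True
   then obtain q qs where ps: "ps = q # qs" "snd q \<noteq> []" "hd (snd q) \<noteq> nx a" by (cases ps) auto
   have v: "v = path_comp p q # qs" using "2.prems" 3 ps by simp
   have q: "q \<in> nz" using p ps by (simp add: chain_Cons)
   have a: "a \<in> Ar" "q_tail Q a = fst p" using snd_nz[OF p(1)] tail_nz[OF p(1)] 3 by (auto simp: nzl_Cons)
   have "hd (snd q) \<in> Ar" using snd_nz[OF q] ps(2) by (auto simp: nzl_def)
   then have "nzc a (hd (snd q))" using a p ps by (auto simp: nzc_def path_head_def)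
   then have c: "comp_nz Q p q" using p q ps snd_nz[OF q] a 3 by (auto simp: comp_nz_iff nzl_Cons)
   have pm: "mk [a] = p" using mk_snd[OF p(1)] 3 by simp
   have "partner v = Some (True, p # ps)"
    using v 3 ps pm by (cases q; cases "snd q") (auto simp: path_comp_def)
   moreover have "chain v" using c comp_nz_in[OF c] p ps unfolding v by (auto simp: chain_Cons path_comp_def)
   ultimately show ?thesis using v c ps 3 by (auto simp: front_arrow_def path_head_comp comp_nz_iff path_comp_def path_head_def)
  next
   case False
   then obtain v' where v': "partner ps = Some (False, v')" "v = p # v'"
    using "2.prems" 3 by (auto split: if_splits)
   then have ne: "ps \<noteq> []" by auto
   have IH: "chain v'" "v' \<noteq> []" "path_head Q (hd v') = path_head Q (hd ps)" "fst (last v') = fst (last ps)"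
    "front_arrow v' = front_arrow ps" "partner v' = Some (True, ps)"
    using "2.IH"[OF _ _ _ v'(1)] 3 False p by auto
   have l': "\<not> (v' \<noteq> [] \<and> snd (hd v') \<noteq> [] \<and> hd (snd (hd v')) \<noteq> nx a)"
    using IH(5) False ne by (auto simp: front_arrow_def split: if_splits)
   show ?thesis using IH l' 3 v' p ne by (auto simp: chain_Cons front_arrow_def)
  qed
 qed
qed simp

text \<open>The words of single arrows that walk around a face.\<close>

text \<open>
 The walks along a face: the products of neighbours all vanish.
\<close>

definition walk :: "('v, 'e) qpath list \<Rightarrow> bool" where
 "walk w \<longleftrightarrow> (\<forall>p\<in>set w. length (snd p) = 1) \<and> successively (\<lambda>p q. hd (snd q) = nx (hd (snd p))) w"

lemma walk_Cons: "walk (p # w) \<longleftrightarrow> length (snd p) = 1 \<and> walk w \<and> (w = [] \<or> hd (snd (hd w)) = nx (hd (snd p)))"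
 by (cases w) (auto simp: walk_def)

lemma partner_None: "partner w = None \<longleftrightarrow> walk w"
proof (induction w rule: partner.induct)
 case (2 p ps)
 consider "snd p = []" | a b as where "snd p = a # b # as" | a where "snd p = [a]"
  by (metis list.exhaust)
 then show ?case
 proof cases
  case (3 a)
  show ?thesis
  proof (cases "ps \<noteq> [] \<and> snd (hd ps) \<noteq> [] \<and> hd (snd (hd ps)) \<noteq> nx a")
   case True
   then show ?thesis using 3 by (auto simp: walk_Cons)
  next
   case False
   then have "partner ps = None \<longleftrightarrow> walk ps" using "2.IH" 3 by auto
   moreover have "walk ps \<Longrightarrow> ps \<noteq> [] \<Longrightarrow> snd (hd ps) \<noteq> []" by (cases ps) (auto simp: walk_Cons)
   ultimately show ?thesis using 3 False by (auto simp: walk_Cons)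
  qed
 qed (auto simp: walk_Cons)
qed (simp add: walk_def)

text \<open>Merging neighbours: the part of the Hochschild differential inside the sequence.\<close>

text \<open>
 The part of the differential that multiplies two neighbours before \<open>f\<close> is applied, and the sequences that
 arise in this way.
\<close>

fun merge :: "(('v, 'e) qpath list \<Rightarrow> ('v, 'e) qvec) \<Rightarrow> ('v, 'e) qpath list \<Rightarrow> ('v, 'e) qvec" where
 "merge f (a # b # ws) = (if comp_nz Q a b then smul (sg (pb.wdeg ws + ldeg (snd b))) (f (path_comp a b # ws)) else 0)
   + merge (\<lambda>z. f (a # z)) (b # ws)"
| "merge f _ = 0"

fun merges :: "('v, 'e) qpath list \<Rightarrow> ('v, 'e) qpath list set" where
 "merges (a # b # ws) = (if comp_nz Q a b then {path_comp a b # ws} else {}) \<union> (#) a ` merges (b # ws)"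
| "merges _ = {}"

lemma merge_0: "\<forall>z\<in>merges u. f z = 0 \<Longrightarrow> merge f u = 0"
 by (induction f u rule: merge.induct) auto

lemma merges_hd: "z \<in> merges (a # ws) \<Longrightarrow> snd a \<noteq> [] \<Longrightarrow> z \<noteq> [] \<and> snd (hd z) \<noteq> [] \<and> hd (snd (hd z)) = hd (snd a)"
 by (cases ws) (auto simp: path_comp_def split: if_splits)

lemma M_2: "M [a, b] = (if comp_nz Q a b then smul (sg (ldeg (snd b))) (bvec (path_comp a b)) else 0)"
 by (simp add: mu_basis_def path_mul_def path_deg_ldeg)

lemma M_short: "length ps < 2 \<Longrightarrow> M ps = 0"
 by (simp add: mu_basis_def)

lemma merge_pairs: "(\<Sum>(A, c, d, B)\<in>pairs u. smul (sg (pb.wdeg B)) (lin (\<lambda>x. f (A @ x # B)) (M [c, d]))) = merge f u"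
proof (induction f u rule: merge.induct)
 case (1 f a b ws)
 let ?F = "\<lambda>f (A, c, d, B). smul (sg (pb.wdeg B)) (lin (\<lambda>x. f (A @ x # B)) (M [c, d]))"
 have p: "pairs (a # b # ws) = insert ([], a, b, ws) ((\<lambda>(A, c, d, B). (a # A, c, d, B)) ` pairs (b # ws))"
  by (auto simp: pairs_def Cons_eq_append_conv image_iff)
 have inj: "inj_on (\<lambda>(A, c, d, B). (a # A, c, d, B)) (pairs (b # ws))" by (auto simp: inj_on_def)
 have "sum (?F f) (pairs (a # b # ws)) = ?F f ([], a, b, ws) + sum (?F f) ((\<lambda>(A, c, d, B). (a # A, c, d, B)) ` pairs (b # ws))"
  unfolding p by (rule sum.insert) auto
 also have "sum (?F f) ((\<lambda>(A, c, d, B). (a # A, c, d, B)) ` pairs (b # ws)) = sum (?F (\<lambda>z. f (a # z))) (pairs (b # ws))"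
  unfolding sum.reindex[OF inj] by (rule sum.cong) auto
 finally show ?case using 1 by (simp add: M_2 lin_smul sg_mult)
next
 case ("2_1" f)
 have "pairs [] = ({} :: (('v, 'e) qpath list \<times> _ \<times> _ \<times> _) set)" by (auto simp: pairs_def)
 then show ?case by simp
next
 case ("2_2" f v)
 have "pairs [v] = {}" by (auto simp: pairs_def Cons_eq_append_conv)
 then show ?case by simp
qed

text \<open>
 The number of merges of a run of \<open>Suc k\<close> idempotents that give back the run of length \<open>k\<close>, with signs: they alternate, and the last
 one multiplies the run into \<open>rr\<close>.
\<close>

definition kap :: "('v, 'e) qpath list \<Rightarrow> nat \<Rightarrow> complex" where
 "kap rr k = (if odd k then sg (pb.wdeg rr) else 0) - (if rr = [] then 0 else sg (pb.wdeg rr))"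

lemma comp_idem_left: "p \<in> nz \<Longrightarrow> snd p = [] \<Longrightarrow> r \<in> nz \<Longrightarrow> fst p = path_head Q r \<Longrightarrow> comp_nz Q p r \<and> path_comp p r = r"
 using snd_nz[of r] by (simp add: comp_nz_iff path_comp_def prod_eqI)

lemma comp_idem_right: "p \<in> nz \<Longrightarrow> snd p = [] \<Longrightarrow> r \<in> nz \<Longrightarrow> fst r = fst p \<Longrightarrow> comp_nz Q r p \<and> path_comp r p = r"
 using snd_nz[of r] by (simp add: comp_nz_iff path_comp_def prod_eqI)

lemma wdeg_replicate: "snd p = [] \<Longrightarrow> pb.wdeg (replicate k p @ rr) = pb.wdeg rr - int k"
 by (induction k) (auto simp: pdeg_def[of p])

lemma merge_replicate:
 assumes p: "p \<in> nz" "snd p = []" and r: "chain (p # rr)" "rr = [] \<or> snd (hd rr) \<noteq> []"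
  and f: "\<And>z. z \<noteq> [] \<Longrightarrow> snd (hd z) \<noteq> [] \<Longrightarrow> f (replicate (Suc k) p @ z) = 0"
 shows "merge f (replicate (Suc k) p @ rr) = smul (kap rr k) (f (replicate k p @ rr))"
 using f
proof (induction k arbitrary: f)
 case 0
 show ?case
 proof (cases rr)
  case Nil
  then show ?thesis by (simp add: kap_def)
 next
  case (Cons q qs)
  have c: "comp_nz Q p q" "path_comp p q = q" using comp_idem_left[of p q] p r Cons by (auto simp: chain_Cons)
  have "merge (\<lambda>z. f (p # z)) rr = 0"
   using 0 merges_hd[of _ q qs] r(2) Cons by (intro merge_0) auto
  moreover have "sg (pb.wdeg qs + ldeg (snd q)) = - sg (pb.wdeg rr)"
   using Cons by (auto simp: sg_def pdeg_def[of q])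
  ultimately show ?thesis using Cons c by (simp add: kap_def)
 qed
next
 case (Suc k)
 have c: "comp_nz Q p p" "path_comp p p = p" using comp_idem_left[of p p] p by auto
 have IH: "merge (\<lambda>z. f (p # z)) (replicate (Suc k) p @ rr) = smul (kap rr k) (f (p # replicate k p @ rr))"
  using Suc.IH[of "\<lambda>z. f (p # z)"] Suc.prems by simp
 have "sg (pb.wdeg (replicate k p @ rr) + ldeg (snd p)) + kap rr k = kap rr (Suc k)"
  using p by (simp add: wdeg_replicate kap_def del: pb.wdeg_simps) (auto simp: sg_def)
 then show ?case using IH c by (simp add: smul_add_left[symmetric] del: pb.wdeg_simps)
qed

lemma run_decomp: "chain (p # ps) \<Longrightarrow> snd p = [] \<Longrightarrow>
 \<exists>rr. p # ps = replicate (run (p # ps)) p @ rr \<and> (rr = [] \<or> snd (hd rr) \<noteq> []) \<and> chain (p # rr)"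
proof (induction ps)
 case Nil
 then show ?case by (intro exI[of _ "[]"]) (simp add: run_def)
next
 case (Cons q qs)
 show ?case
 proof (cases "snd q = []")
  case True
  then have "q = p" using Cons.prems by (auto simp: prod_eqI)
  with Cons True obtain rr where "p # qs = replicate (run (p # qs)) p @ rr" "rr = [] \<or> snd (hd rr) \<noteq> []" "chain (p # rr)" by auto
  then show ?thesis using \<open>q = p\<close> Cons.prems by (intro exI[of _ rr]) (simp add: run_Cons)
 next
  case False
  then show ?thesis using Cons.prems by (intro exI[of _ "q # qs"]) (simp add: run_Cons)
 qed
qed

lemma run_replicate: "snd p = [] \<Longrightarrow> z = [] \<or> snd (hd z) \<noteq> [] \<Longrightarrow> run (replicate k p @ z) = k"
 by (induction k) (cases z; auto simp: run_Cons run_def)+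

lemma butlast_replicate_Suc: "butlast (replicate (Suc k) p) = replicate k p"
 by (induction k) auto

lemma butlast_Cons_eq: "butlast (q # w) = w \<Longrightarrow> w = replicate (length w) q"
proof (induction w)
 case (Cons a w)
 then have "a = q" "butlast (a # w) = w" by (auto split: if_splits)
 then show ?case using Cons.IH by simp
qed simp

lemma partner_Cons_target:
 assumes p: "snd p = [a]" and z: "partner z = Some (False, v)" and l: "front_arrow z = None \<or> front_arrow z = Some (nx a)"
 shows "partner (p # z) = Some (False, p # v)"
proof -
 have "\<not> (z \<noteq> [] \<and> snd (hd z) \<noteq> [] \<and> hd (snd (hd z)) \<noteq> nx a)" using l by (auto simp: front_arrow_def split: if_splits)
 then have "partner (p # z) = map_option (map_prod id ((#) p)) (partner z)"
  by (subst partner.simps(2)) (simp only: p list.sel if_False list.distinct not_False_eq_True simp_thms if_cancel)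
 then show ?thesis using z by simp
qed

text \<open>
 Merging at places other than the one given by \<open>partner\<close> leads to targets, where \<open>f\<close> vanishes.  The coefficient can be zero
 only if the sequence ends in idempotents; then the missing contribution is the one that
 multiplies with the last entry from outside.
\<close>

lemma merge_partner:
 "partner ps = Some (True, u) \<Longrightarrow> chain ps \<Longrightarrow>
  \<exists>c :: complex. (\<forall>f. (\<forall>z. (\<exists>v. partner z = Some (False, v)) \<and> front_arrow z = front_arrow ps \<longrightarrow> f z = 0) \<longrightarrow> merge f u = smul c (f ps)) \<and>
   (if snd (hd ps) = [] then c = of_bool (butlast u = ps) else if butlast u = ps then c = 0 else c \<noteq> 0)"
proof (induction ps arbitrary: u rule: partner.induct)
 case (2 p ps)
 have p: "p \<in> nz" "chain ps" "ps = [] \<or> fst p = path_head Q (hd ps)" using 2(3) by (auto simp: chain_Cons)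
 consider "snd p = []" | a b as where "snd p = a # b # as" | a where "snd p = [a]"
  by (metis list.exhaust)
 then show ?case
 proof cases
  case 1
  then have odd: "odd (run (p # ps))" and u: "u = p # p # ps" using 2(2) by (auto split: if_splits)
  obtain rr where rr: "p # ps = replicate (run (p # ps)) p @ rr" "rr = [] \<or> snd (hd rr) \<noteq> []" "chain (p # rr)"
   using run_decomp[OF "2.prems"(2) 1] by blast
  define m where "m = run (p # ps)"
  have u': "u = replicate (Suc m) p @ rr" and ps: "p # ps = replicate m p @ rr" using u rr(1) m_def by auto
  have bl: "butlast u = p # ps \<longleftrightarrow> rr = []"
  proof
   assume "butlast u = p # ps"
   show "rr = []"
   proof (rule ccontr)
    assume r: "rr \<noteq> []"
    then have "(replicate (Suc m) p @ butlast rr) ! m = (replicate m p @ rr) ! m"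
     using \<open>butlast u = p # ps\<close> u' ps by (simp add: butlast_append)
    moreover have "(replicate (Suc m) p @ butlast rr) ! m = p" by (subst nth_append) (simp del: replicate_Suc)
    moreover have "(replicate m p @ rr) ! m = hd rr" using r by (simp add: nth_append hd_conv_nth)
    ultimately have "p = hd rr" by simp
    then show False using rr(2) r 1 by simp
   qed
  next
   assume "rr = []"
   then show "butlast u = p # ps" using u' ps by (simp only: append_Nil2 butlast_replicate_Suc)
  qed
  show ?thesis
  proof (intro exI[of _ "kap rr m"] conjI allI impI)
   fix f :: "('v, 'e) qpath list \<Rightarrow> ('v, 'e) qvec" assume f: "\<forall>z. (\<exists>v. partner z = Some (False, v)) \<and> front_arrow z = front_arrow (p # ps) \<longrightarrow> f z = 0"
   have "f (replicate (Suc m) p @ z) = 0" if z: "z \<noteq> []" "snd (hd z) \<noteq> []" for z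
   proof -
    have "run (replicate (Suc m) p @ z) = Suc m" using run_replicate[of p z "Suc m"] 1 z by simp
    then have "partner (replicate (Suc m) p @ z) = Some (False, replicate m p @ z)" using odd 1 m_def by simp
    moreover have "front_arrow (replicate (Suc m) p @ z) = front_arrow (p # ps)" by (simp add: front_arrow_def)
    ultimately show ?thesis using f by blast
   qed
   from merge_replicate[where f = f and k = m, OF p(1) 1 rr(3,2) this] show "merge f u = smul (kap rr m) (f (p # ps))" unfolding u' ps by simp
  next
   show "if snd (hd (p # ps)) = [] then kap rr m = of_bool (butlast u = p # ps) else if butlast u = p # ps then kap rr m = 0 else kap rr m \<noteq> 0"
    unfolding bl using 1 odd m_def by (simp add: kap_def)
  qed
 next
  case (2 a b as)
  then have u: "u = mk [a] # (fst p, b # as) # ps" using "2.prems" by simp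
  note n = nz_Cons_split[OF p(1) 2]
  have c: "comp_nz Q (mk [a]) (fst p, b # as)"
   using n p(1) snd_nz[OF p(1)] 2 by (simp add: comp_nz_iff path_head_def)
  let ?c = "sg (pb.wdeg ps + ldeg (b # as))"
  show ?thesis
  proof (intro exI[of _ ?c] conjI allI impI)
   fix f :: "('v, 'e) qpath list \<Rightarrow> ('v, 'e) qvec" assume f: "\<forall>z. (\<exists>v. partner z = Some (False, v)) \<and> front_arrow z = front_arrow (p # ps) \<longrightarrow> f z = 0"
   have "f (mk [a] # z) = 0" if z: "z \<in> merges ((fst p, b # as) # ps)" for z
   proof -
    have "z \<noteq> []" "snd (hd z) \<noteq> []" "hd (snd (hd z)) = b" using merges_hd[OF z] by auto
    then have "partner (mk [a] # z) = Some (False, path_comp (mk [a]) (hd z) # tl z)" using n by simp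
    moreover have "front_arrow (mk [a] # z) = front_arrow (p # ps)" using 2 by (simp add: front_arrow_def)
    ultimately show ?thesis using f by blast
   qed
   then have "merge (\<lambda>z. f (mk [a] # z)) ((fst p, b # as) # ps) = 0" by (intro merge_0) simp
   then show "merge f u = smul ?c (f (p # ps))" unfolding u using c n(7) by simp
  next
   have "butlast u \<noteq> p # ps" using u 2 by (cases "butlast u") (auto simp: mk_def split: if_splits)
   then show "if snd (hd (p # ps)) = [] then ?c = of_bool (butlast u = p # ps) else if butlast u = p # ps then ?c = 0 else ?c \<noteq> 0"
    using 2 by simp
  qed
 next
  case (3 a)
  then have l: "\<not> (ps \<noteq> [] \<and> snd (hd ps) \<noteq> [] \<and> hd (snd (hd ps)) \<noteq> nx a)"
   using "2.prems" by (auto split: if_splits)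
  then obtain u' where u': "partner ps = Some (True, u')" "u = p # u'"
   using "2.prems" 3 by (auto split: if_splits)
  then have ne: "ps \<noteq> []" by auto
  obtain c' where c': "\<And>f. (\<forall>z. (\<exists>v. partner z = Some (False, v)) \<and> front_arrow z = front_arrow ps \<longrightarrow> f z = 0) \<Longrightarrow> merge f u' = smul c' (f ps)"
   "if snd (hd ps) = [] then c' = of_bool (butlast u' = ps) else if butlast u' = ps then c' = 0 else c' \<noteq> 0"
   using "2.IH"[OF _ _ _ u'(1)] 3 l p by auto
  have V: "u' \<noteq> []" "front_arrow u' = front_arrow ps" using partner_of_source[OF u'(1) p(2)] by auto
  then obtain h t where ht: "u' = h # t" by (cases u') auto
  have fps: "front_arrow ps = None \<or> front_arrow ps = Some (nx a)" using l ne by (auto simp: front_arrow_def)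
  have bl: "butlast u = p # ps \<longleftrightarrow> butlast u' = ps" using u' V by simp
  have tail: "merge (\<lambda>z. f (p # z)) u' = smul c' (f (p # ps))"
   if f: "\<forall>z. (\<exists>v. partner z = Some (False, v)) \<and> front_arrow z = front_arrow (p # ps) \<longrightarrow> f z = 0" for f
  proof (rule c'(1), intro allI impI, elim conjE exE)
   fix z v assume z: "partner z = Some (False, v)" "front_arrow z = front_arrow ps"
   have "partner (p # z) = Some (False, p # v)" using partner_Cons_target[OF 3 z(1)] z(2) fps by simp
   moreover have "front_arrow (p # z) = front_arrow (p # ps)" by (simp add: front_arrow_def)
   ultimately show "f (p # z) = 0" using f by blast
  qed
  show ?thesis
  proof (cases "snd (hd ps) = []")
   case False
   then have "hd (snd h) = nx a" "snd h \<noteq> []" using V(2) l ne ht by (auto simp: front_arrow_def split: if_splits)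
   then have "\<not> comp_nz Q p h" using 3 by (auto simp: comp_nz_iff nzl_Cons nzc_def hd_append)
   then show ?thesis using tail c'(2) False bl 3 u'(2) ht by (intro exI[of _ c']) auto
  next
   case True
   obtain q qs where ps: "ps = q # qs" using ne by (cases ps) auto
   have q: "snd q = []" "q \<in> nz" "odd (run ps)" "u' = q # ps" using True ps u'(1) p by (auto simp: chain_Cons split: if_splits)
   have c: "comp_nz Q p q \<and> path_comp p q = p" using comp_idem_right[of q p] q p ps by simp
   let ?s = "sg (pb.wdeg ps + ldeg (snd q))"
   have merge: "merge f u = smul (?s + c') (f (p # ps))"
    if f: "\<forall>z. (\<exists>v. partner z = Some (False, v)) \<and> front_arrow z = front_arrow (p # ps) \<longrightarrow> f z = 0" for f
    using tail[OF f] c unfolding u'(2) q(4) by (simp add: smul_add_left)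
   have "if butlast u = p # ps then ?s + c' = 0 else ?s + c' \<noteq> 0"
   proof (cases "butlast u' = ps")
    case True
    then have r: "ps = replicate (length ps) q" using butlast_Cons_eq q(4) by metis
    then have "run ps = length ps" using run_replicate[of q "[]" "length ps"] q by simp
    then have "odd (length ps)" using q by simp
    moreover have "pb.wdeg ps = - int (length ps)" using wdeg_replicate[of q "length ps" "[]"] q r by simp
    ultimately have "?s = -1" using q by (simp add: sg_def)
    then show ?thesis using True bl c'(2) \<open>snd (hd ps) = []\<close> by simp
   next
    case False
    then show ?thesis using bl c'(2) \<open>snd (hd ps) = []\<close> by simp
   qed
   then show ?thesis using merge 3 by (intro exI[of _ "?s + c'"]) auto
  qed
 qed
qed simp

lemma partner_butlast:
 "partner u = Some (False, v) \<Longrightarrow> chain u \<Longrightarrow> snd (last u) = [] \<Longrightarrow> butlast u = v \<or> (\<exists>v'. partner (butlast u) = Some (False, v'))"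
proof (induction u arbitrary: v rule: partner.induct)
 case (2 p ps)
 have p: "p \<in> nz" "chain ps" "ps = [] \<or> fst p = path_head Q (hd ps)" using 2(3) by (auto simp: chain_Cons)
 consider "snd p = []" | a b as where "snd p = a # b # as" | a where "snd p = [a]"
  by (metis list.exhaust)
 then show ?case
 proof cases
  case 1
  then have e: "even (run (p # ps))" "v = ps" using 2(2) by (auto split: if_splits)
  obtain rr where rr: "p # ps = replicate (run (p # ps)) p @ rr" "rr = [] \<or> snd (hd rr) \<noteq> []" "chain (p # rr)"
   using run_decomp[OF "2.prems"(2) 1] by blast
  define m where "m = run (p # ps)"
  have m: "m \<noteq> 0" using 1 by (simp add: m_def run_Cons)
  then obtain k where k: "m = Suc k" by (cases m) auto
  have ps: "p # ps = replicate m p @ rr" using rr(1) m_def by simp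
  show ?thesis
  proof (cases "rr = []")
   case True
   then have "ps = replicate k p" using ps k by simp
   then have "butlast (p # ps) = ps" using butlast_replicate_Suc[of k p] by simp
   then show ?thesis using e by simp
  next
   case False
   obtain r rs where r: "rr = r # rs" using False by (cases rr) auto
   have "rs \<noteq> []"
   proof
    assume "rs = []"
    then have "last (p # ps) = r" unfolding ps r by simp
    then show False using "2.prems"(3) rr(2) r by simp
   qed
   then have bl: "butlast (p # ps) = p # (replicate k p @ butlast rr)" unfolding ps k using False by (simp add: butlast_append)
   have "run (butlast (p # ps)) = m"
    using run_replicate[of p "butlast rr" m] 1 rr(2) r \<open>rs \<noteq> []\<close> unfolding bl k by simp
   then have "partner (butlast (p # ps)) = Some (False, replicate k p @ butlast rr)" using e(1) 1 m_def unfolding bl by simp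
   then show ?thesis by blast
  qed
 next
  case (2 a b as)
  then show ?thesis using "2.prems" by simp
 next
  case (3 a)
  show ?thesis
  proof (cases "ps \<noteq> [] \<and> snd (hd ps) \<noteq> [] \<and> hd (snd (hd ps)) \<noteq> nx a")
   case True
   then obtain q qs where ps: "ps = q # qs" "snd q \<noteq> []" "hd (snd q) \<noteq> nx a" by (cases ps) auto
   have "qs \<noteq> []" using "2.prems"(3) ps by auto
   then have "butlast (p # ps) = p # q # butlast qs" using ps by simp
   then have "partner (butlast (p # ps)) = Some (False, path_comp p q # butlast qs)" using 3 ps by simp
   then show ?thesis by blast
  next
   case False
   then obtain v' where v': "partner ps = Some (False, v')" "v = p # v'"
    using "2.prems" 3 by (auto split: if_splits)
   then have ne: "ps \<noteq> []" by auto
   have "butlast ps = v' \<or> (\<exists>v''. partner (butlast ps) = Some (False, v''))"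
    using "2.IH"[OF _ _ _ v'(1)] 3 False p "2.prems"(3) ne by auto
   then show ?thesis
   proof
    assume "butlast ps = v'"
    then show ?thesis using v' ne by simp
   next
    assume "\<exists>v''. partner (butlast ps) = Some (False, v'')"
    then obtain v'' where v'': "partner (butlast ps) = Some (False, v'')" by blast
    then have "butlast ps \<noteq> []" by auto
    then have "front_arrow (butlast ps) = front_arrow ps" by (cases ps) (auto simp: front_arrow_def)
    moreover have "front_arrow ps = None \<or> front_arrow ps = Some (nx a)" using False ne by (auto simp: front_arrow_def)
    ultimately have "partner (p # butlast ps) = Some (False, p # v'')" using partner_Cons_target[OF 3 v''] by simp
    then show ?thesis using ne by auto
   qed
  qed
 qed
qed simp

end

section \<open>Pairing all basis sequences\<close>

context gentle_quiver begin

abbreviation x0 where "x0 w \<equiv> hd (snd (hd w))"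
abbreviation xl where "xl w \<equiv> hd (snd (last w))"

definition walk_from :: "'e \<Rightarrow> nat \<Rightarrow> ('v, 'e) qpath list" where
 "walk_from r n = map (\<lambda>i. mk [(nx ^^ i) r]) [0..<n]"

lemma length_walk_from [simp]: "length (walk_from r n) = n" by (simp add: walk_from_def)
lemma nth_walk_from [simp]: "i < n \<Longrightarrow> walk_from r n ! i = mk [(nx ^^ i) r]" by (simp add: walk_from_def)

lemma walk_eq:
 assumes "walk w" "chain w"
 shows "w = walk_from (x0 w) (length w)"
proof (rule nth_equalityI)
 fix i assume "i < length w"
 then show "w ! i = walk_from (x0 w) (length w) ! i"
 proof (induction i)
  case 0
  then have "w ! 0 \<in> nz" "length (snd (w ! 0)) = 1" using assms by (auto simp: walk_def chain_def)
  moreover have "w ! 0 = hd w" using 0 by (cases w) auto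
  ultimately show ?case using 0 mk_snd[of "hd w"] by (cases "snd (hd w)") auto
 next
  case (Suc i)
  then have "w ! Suc i \<in> nz" "length (snd (w ! Suc i)) = 1" using assms by (auto simp: walk_def chain_def)
  moreover have "hd (snd (w ! Suc i)) = nx (hd (snd (w ! i)))"
   using assms(1) Suc.prems by (simp add: walk_def successively_conv_nth)
  moreover have "w ! i = mk [(nx ^^ i) (x0 w)]" using Suc by simp
  ultimately have "snd (w ! Suc i) = [(nx ^^ Suc i) (x0 w)]" "mk (snd (w ! Suc i)) = w ! Suc i"
   using mk_snd[of "w ! Suc i"] by (cases "snd (w ! Suc i)"; auto)+
  then show ?case using Suc.prems by simp
 qed
qed simp

lemma walk_ends: "walk w \<Longrightarrow> chain w \<Longrightarrow> w \<noteq> [] \<Longrightarrow> x0 w \<in> Ar \<and> hd w = mk [x0 w] \<and> xl w = (nx ^^ (length w - 1)) (x0 w)"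
proof -
 assume a: "walk w" "chain w" "w \<noteq> []"
 have h: "hd w \<in> nz" "length (snd (hd w)) = 1" using a by (cases w; auto simp: walk_Cons chain_Cons)+
 then obtain x where x: "snd (hd w) = [x]" by (cases "snd (hd w)") auto
 then have "x0 w \<in> Ar" using snd_nz[OF h(1)] by (simp add: nzl_Cons)
 moreover have "hd w = mk [x0 w]" using mk_snd[OF h(1)] x by simp
 moreover have "last w = mk [(nx ^^ (length w - 1)) (x0 w)]"
  using walk_eq[OF a(1,2)] a(3) by (metis diff_less last_conv_nth length_greater_0_conv nth_walk_from zero_less_one)
 ultimately show ?thesis by simp
qed

lemma walk_append: "walk (u @ v) \<Longrightarrow> walk u \<and> walk v"
 by (auto simp: walk_def successively_append_iff)

lemma per_funpow [simp]: "x \<in> Ar \<Longrightarrow> per ((nx ^^ i) x) = per x"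
 by (induction i) auto

lemma rd_funpow: "r \<in> Ar \<Longrightarrow> rd r = 0 \<Longrightarrow> i < per r \<Longrightarrow> rd ((nx ^^ i) r) = i"
 by (induction i) (auto simp: rd_nx)

lemma rd_pv: "x \<in> Ar \<Longrightarrow> rd x \<noteq> 0 \<Longrightarrow> rd (pv x) < rd x"
 using rd_nx[of "pv x"] by (auto split: if_splits)

lemma walk_from_append: "walk_from r n @ walk_from ((nx ^^ n) r) m = walk_from r (n + m)"
 by (rule nth_equalityI) (auto simp: nth_append funpow_add[symmetric, unfolded comp_def fun_eq_iff, rule_format])

lemma map_mk_fw: "map mk (sing (fw r)) = walk_from r (per r)"
 by (simp add: fw_def walk_from_def)

lemma drop_walk_from: "drop i (walk_from r n) = walk_from ((nx ^^ i) r) (n - i)"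
proof (cases "i \<le> n")
 case True
 then show ?thesis using walk_from_append[of r i "n - i"] by (metis append_eq_conv_conj le_add_diff_inverse length_walk_from)
qed (simp add: walk_from_def)

text \<open>
 A closed walk along a face with one corner as value.  It is the source for the walk that is longer by a full turn less one corner and takes
 an idempotent as value.
\<close>

definition theta :: "('v, 'e) qpath list \<Rightarrow> ('v, 'e) qpath \<Rightarrow> bool" where
 "theta w q \<longleftrightarrow> walk w \<and> w \<noteq> [] \<and> snd q = [x0 w] \<and> xl w = x0 w \<and> rd (nx (x0 w)) = 0"

text \<open>
 A full walk around a face, possibly several times, that begins at the root.
\<close>

definition loop :: "('v, 'e) qpath list \<Rightarrow> ('v, 'e) qpath \<Rightarrow> bool" where
 "loop w q \<longleftrightarrow> walk w \<and> w \<noteq> [] \<and> snd q = [] \<and> rd (x0 w) = 0 \<and> xl w = pv (x0 w)"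

text \<open>
 The larger members of the matched pairs: the differential can be solved for the coefficients at these.
\<close>

definition target :: "('v, 'e) qpath list \<Rightarrow> ('v, 'e) qpath \<Rightarrow> bool" where
 "target w q \<longleftrightarrow> (\<exists>v. partner w = Some (False, v)) \<or> loop w q \<or> (walk w \<and> w \<noteq> [] \<and> snd q \<noteq> [] \<and> hd (snd q) = x0 w \<and> \<not> theta w q)"

text \<open>
 The partner of a source \<open>(w; q)\<close> is \<open>(mate w q; mate_out w q)\<close>.  A walk along a face gains the preceding corner, and so does its
 value, unless \<open>theta w q\<close> holds.
\<close>

definition mate :: "('v, 'e) qpath list \<Rightarrow> ('v, 'e) qpath \<Rightarrow> ('v, 'e) qpath list" where
 "mate w q = (if partner w \<noteq> None then snd (the (partner w)) else if theta w q then tl w @ map mk (sing (fw (nx (x0 w)))) else mk [pv (x0 w)] # w)"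

definition mate_out :: "('v, 'e) qpath list \<Rightarrow> ('v, 'e) qpath \<Rightarrow> ('v, 'e) qpath" where
 "mate_out w q = (if partner w \<noteq> None then q else if theta w q then (fst q, []) else path_comp (mk [pv (x0 w)]) q)"

text \<open>
 The order along which the differential is triangular.  The number of arrows decreases when the outer
 multiplications strip off a non-trivial end of the sequence; the last component is used only for closed
 walks, which can be rotated until they start at the root.
\<close>

definition smaller :: "(('v, 'e) qpath list \<times> ('v, 'e) qpath list) set" where
 "smaller = measures [length, arrows, \<lambda>w. rd (x0 w)]"

lemma wf_smaller: "wf smaller" by (simp add: smaller_def)
lemma smaller_iff: "(u, w) \<in> smaller \<longleftrightarrow> length u < length w \<or> length u = length w \<and> (arrows u < arrows w \<or> arrows u = arrows w \<and> rd (x0 u) < rd (x0 w))"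
 by (auto simp: smaller_def)

text \<open>
 If \<open>f\<close> vanishes on sequences that are shorter than \<open>n\<close>, only products of length two contribute at length \<open>Suc n\<close>.
\<close>

lemma dif_lowest:
 assumes f: "\<And>X. length X < n \<Longrightarrow> f X = 0" and n: "length u = Suc n" "n \<noteq> 0"
 shows "pb.dif M j f u = lin (\<lambda>x. M [hd u, x]) (f (tl u)) + smul (sg (pdeg (last u) * j)) (lin (\<lambda>x. M [x, last u]) (f (butlast u)))
  - smul (sg j) (merge f u)"
proof -
 let ?F = "\<lambda>L X R. if length L + length R = 1 then smul (sg (pb.wdeg R * j)) (lin (\<lambda>x. M (L @ x # R)) (f X)) else 0"
 have z: "smul (sg (pb.wdeg R * j)) (lin (\<lambda>x. M (L @ x # R)) (f X)) = 0" if "(L, X, R) \<in> splits u" "length L + length R \<noteq> 1" for L X R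
 proof (cases "length L + length R = 0")
  case True
  then have "M (L @ x # R) = 0" for x by (intro M_short) simp
  then show ?thesis by simp
 next
  case False
  moreover have "length L + length X + length R = Suc n" using that(1) n(1) by (auto simp: splits_def)
  ultimately have "length X < n" using that(2) by linarith
  then show ?thesis using f by simp
 qed
 have "lin M (pb.hat j f u) = (\<Sum>(L, X, R)\<in>splits u. smul (sg (pb.wdeg R * j)) (lin (\<lambda>x. M (L @ x # R)) (f X)))"
  unfolding pb.hat_def lin_sum case_prod_beta lin_smul lin_lin lin_bvec by simp
 also have "\<dots> = (\<Sum>(L, X, R)\<in>splits u. ?F L X R)" by (rule sum.cong[OF refl]) (auto simp: z)
 also have "\<dots> = ?F [hd u] (tl u) [] + ?F [] (butlast u) [last u]"
  by (rule sum_splits_outer2) (use n in auto)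
 also have "\<dots> = lin (\<lambda>x. M [hd u, x]) (f (tl u)) + smul (sg (pdeg (last u) * j)) (lin (\<lambda>x. M [x, last u]) (f (butlast u)))"
  by simp
 finally have 1: "lin M (pb.hat j f u) = \<dots>" .
 let ?G = "\<lambda>L X R. if length X = 2 then smul (sg (pb.wdeg R)) (lin (\<lambda>x. f (L @ x # R)) (M X)) else 0"
 have z: "smul (sg (pb.wdeg R)) (lin (\<lambda>x. f (L @ x # R)) (M X)) = 0" if "(L, X, R) \<in> splits u" "length X \<noteq> 2" for L X R
 proof (cases "length X < 2")
  case True
  then show ?thesis by (simp add: M_short)
 next
  case False
  then have "f (L @ x # R) = 0" for x by (intro f) (use that n in \<open>auto simp: splits_def\<close>)
  then show ?thesis by simp
 qed
 have "lin f (pb.hat 1 M u) = (\<Sum>(L, X, R)\<in>splits u. smul (sg (pb.wdeg R)) (lin (\<lambda>x. f (L @ x # R)) (M X)))"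
  unfolding pb.hat_def lin_sum case_prod_beta lin_smul lin_lin lin_bvec by simp
 also have "\<dots> = (\<Sum>(L, X, R)\<in>splits u. ?G L X R)" by (rule sum.cong[OF refl]) (auto simp: z)
 also have "\<dots> = (\<Sum>(A, c, d, B)\<in>pairs u. ?G A [c, d] B)"
  by (rule sum_splits_inner2) simp
 also have "\<dots> = merge f u" unfolding merge_pairs[symmetric] by simp
 finally show ?thesis unfolding pb.dif_def 1 by simp
qed

lemma lookup_M_left:
 "lookup (lin (\<lambda>x. M [p, x]) v) q = (\<Sum>x\<in>keys v. lookup v x * (if comp_nz Q p x \<and> path_comp p x = q then sg (ldeg (snd x)) else 0))"
 unfolding lookup_lin by (intro sum.cong refl) (simp add: M_2 lookup_bvec)

lemma lookup_M_right:
 "lookup (lin (\<lambda>x. M [x, p]) v) q = (\<Sum>x\<in>keys v. lookup v x * (if comp_nz Q x p \<and> path_comp x p = q then sg (ldeg (snd p)) else 0))"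
 unfolding lookup_lin by (intro sum.cong refl) (simp add: M_2 lookup_bvec)

lemma sum_keys_single:
 assumes "\<And>x. x \<in> keys v \<Longrightarrow> h x = (if x = q then c else (0 :: complex))"
 shows "(\<Sum>x\<in>keys v. lookup v x * h x) = c * lookup v q"
proof -
 have "(\<Sum>x\<in>keys v. lookup v x * h x) = (\<Sum>x\<in>keys v. if x = q then c * lookup v q else 0)"
  by (rule sum.cong) (auto simp: assms)
 also have "\<dots> = c * lookup v q" by (simp add: in_keys_iff)
 finally show ?thesis .
qed

lemma sum_keys_neq_0:
 assumes "(\<Sum>x\<in>keys v. lookup v x * (if P x then c x else (0 :: complex))) \<noteq> 0"
 shows "\<exists>x\<in>keys v. P x"
proof (rule ccontr)
 assume "\<not> ?thesis"
 then have "(\<Sum>x\<in>keys v. lookup v x * (if P x then c x else 0)) = 0" by (intro sum.neutral) auto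
 with assms show False by simp
qed

text \<open>
 The contribution of the inner merges is given by \<open>merge_partner\<close>.  The two outer multiplications contribute only with an idempotent,
 since otherwise the remaining sequence has fewer arrows.
\<close>

lemma dif_match_partner:
 assumes w: "chain w" "partner w = Some (True, u)" "par w q"
 shows "\<exists>c. c \<noteq> 0 \<and> (\<forall>f. BC f \<longrightarrow> (\<forall>v p. target v p \<longrightarrow> lookup (f v) p = 0) \<longrightarrow> (\<forall>v. (v, w) \<in> smaller \<longrightarrow> f v = 0) \<longrightarrow>
  lookup (pb.dif M j f u) q = c * lookup (f w) q)"
proof -
 note V = partner_of_source[OF w(2,1)]
 have wn: "w \<noteq> []" using w(2) by auto
 have qn: "q \<in> nz" "path_head Q q = path_head Q (hd w)" "fst q = fst (last w)" using w(3) by (auto simp: par_def)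
 obtain c where c: "\<And>f. (\<forall>z. (\<exists>v. partner z = Some (False, v)) \<and> front_arrow z = front_arrow w \<longrightarrow> f z = 0) \<Longrightarrow> merge f u = smul c (f w)"
   "if snd (hd w) = [] then c = of_bool (butlast u = w) else if butlast u = w then c = 0 else c \<noteq> 0"
  using merge_partner[OF w(2,1)] by blast
 define c1 where "c1 = (if snd (hd w) = [] then sg (ldeg (snd q)) else 0)"
 define c2 where "c2 = (if butlast u = w then sg j else 0)"
 show ?thesis
 proof (intro exI[of _ "c1 + c2 - sg j * c"] conjI allI impI)
  have "c1 = 0 \<longleftrightarrow> snd (hd w) \<noteq> []" by (simp add: c1_def)
  then show "c1 + c2 - sg j * c \<noteq> 0" using c(2) by (auto simp: c2_def c1_def split: if_splits)
 next
  fix f assume f: "BC f" "\<forall>v p. target v p \<longrightarrow> lookup (f v) p = 0" "\<forall>v. (v, w) \<in> smaller \<longrightarrow> f v = 0"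
  have U: "f z = 0" if "partner z = Some (False, v)" for z v
   using f(2) that by (intro poly_mapping_eqI) (auto simp: target_def)
  have merge: "merge f u = smul c (f w)" using c(1) U by blast
  have red: "pb.dif M j f u = lin (\<lambda>x. M [hd u, x]) (f (tl u)) + smul (sg (pdeg (last u) * j)) (lin (\<lambda>x. M [x, last u]) (f (butlast u)))
   - smul (sg j) (merge f u)"
   by (rule dif_lowest[of "length w"]) (use f(3) V wn in \<open>auto simp: smaller_iff\<close>)
  have arr_u: "arrows u = length (snd (hd u)) + arrows (tl u)" "arrows u = arrows (butlast u) + length (snd (last u))"
   using V arrows_simps(2)[of "hd u" "tl u"] arrows_simps(3)[of "butlast u" "[last u]"] by simp_all
  have hdu: "snd (hd u) = [] \<longleftrightarrow> snd (hd w) = []" using V by (auto simp: front_arrow_def split: if_splits)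
  have 1: "lookup (lin (\<lambda>x. M [hd u, x]) (f (tl u))) q = c1 * lookup (f w) q"
  proof (cases "snd (hd w) = []")
   case False
   then have "(tl u, w) \<in> smaller" using hdu arr_u V by (auto simp: smaller_iff)
   then show ?thesis using f(3) False by (simp add: c1_def)
  next
   case True
   then obtain p ps where ps: "w = p # ps" "u = p # w" using w(2) by (cases w) (auto split: if_splits)
   have p: "p \<in> nz" "snd p = []" using ps w True by (auto simp: chain_Cons)
   have *: "comp_nz Q p x \<and> path_comp p x = x" if "x \<in> keys (f w)" for x
    using BC_key[OF f(1) that] comp_idem_left[OF p, of x] ps p by (auto simp: par_def)
   have "hd u = p" "tl u = w" using ps by simp_all
   then show ?thesis unfolding lookup_M_left using * True by (simp add: c1_def) (rule sum_keys_single, auto)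
  qed
  have 2: "sg (pdeg (last u) * j) * lookup (lin (\<lambda>x. M [x, last u]) (f (butlast u))) q = c2 * lookup (f w) q"
  proof (cases "snd (last u) = []")
   case False
   then have "arrows (butlast u) < arrows w" using arr_u(2) V by (cases "snd (last u)") auto
   then have "(butlast u, w) \<in> smaller" using V by (auto simp: smaller_iff)
   moreover have "butlast u \<noteq> w" using False arr_u V by auto
   ultimately show ?thesis using f(3) by (simp add: c2_def)
  next
   case True
   show ?thesis
   proof (cases "butlast u = w")
    case False
    then obtain v' where "partner (butlast u) = Some (False, v')" using partner_butlast[of u w] V True by auto
    then show ?thesis using U False by (simp add: c2_def)
   next
    case b: True
    have p: "last u \<in> nz" "fst (last w) = fst (last u)" using V by (auto simp: chain_def)
    have *: "comp_nz Q x (last u) \<and> path_comp x (last u) = x" if "x \<in> keys (f w)" for x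
     using BC_key[OF f(1) that] comp_idem_right[OF p(1) True, of x] p by (auto simp: par_def)
    have "sg (pdeg (last u) * j) = sg j" using True by (simp add: pdeg_def)
    moreover have "lookup (lin (\<lambda>x. M [x, last u]) (f (butlast u))) q = 1 * lookup (f w) q"
     unfolding lookup_M_right b by (rule sum_keys_single) (use * True in auto)
    ultimately show ?thesis using b by (simp add: c2_def)
   qed
  qed
  show "lookup (pb.dif M j f u) q = (c1 + c2 - sg j * c) * lookup (f w) q"
   unfolding red lookup_minus lookup_add lookup_smul 1 2 merge by (simp add: algebra_simps)
 qed
qed

lemma merges_walk: "walk u \<Longrightarrow> merges u = {}"
proof (induction u rule: merges.induct)
 case (1 a b ws)
 then have "hd (snd b) = nx (hd (snd a))" "length (snd a) = 1" "length (snd b) = 1" by (auto simp: walk_Cons)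
 then have "\<not> comp_nz Q a b" by (cases "snd a"; cases "snd b") (auto simp: comp_nz_iff nzl_Cons nzc_def)
 moreover have "walk (b # ws)" using 1(2) unfolding walk_Cons[of a] by blast
 ultimately show ?case using 1(1) by simp
qed auto

text \<open>
 No inner merges exist.  Multiplying with the new first entry gives the coefficient.  Multiplying with the last entry could only
 contribute for closed walks, and then rotates the walk closer to the root or leads to a target.
\<close>

lemma dif_match_walk:
 assumes w: "chain w" "walk w" "w \<noteq> []" "par w q" and V: "\<not> target w q" "\<not> theta w q"
  and u: "u = mk [pv (x0 w)] # w" and q': "q' = path_comp (mk [pv (x0 w)]) q"
  and f: "BC f" "\<forall>v p. target v p \<longrightarrow> lookup (f v) p = 0" "\<forall>v. (v, w) \<in> smaller \<longrightarrow> f v = 0"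
 shows "lookup (pb.dif M j f u) q' = sg (ldeg (snd q)) * lookup (f w) q"
proof -
 let ?y = "pv (x0 w)"
 have x0: "x0 w \<in> Ar" "hd w = mk [x0 w]" using walk_ends[OF w(2,1,3)] by auto
 have y: "?y \<in> Ar" "nx ?y = x0 w" using x0 by auto
 have Q: "q \<in> nz" "path_head Q q = path_head Q (hd w)" "fst q = fst (last w)" using w(4) by (auto simp: par_def)
 have "snd (hd w) \<noteq> []" using arg_cong[OF x0(2), of snd] by (metis list.distinct(1) snd_mk)
 then have hw: "path_head Q (hd w) = q_tail Q ?y" using y head_nx[OF y(1)] by (simp add: path_head_def)
 have hq: "snd q = [] \<or> hd (snd q) \<noteq> x0 w" using V w by (auto simp: target_def)
 have red: "pb.dif M j f u = lin (\<lambda>x. M [hd u, x]) (f (tl u)) + smul (sg (pdeg (last u) * j)) (lin (\<lambda>x. M [x, last u]) (f (butlast u)))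
   - smul (sg j) (merge f u)"
  by (rule dif_lowest[of "length w"]) (use f(3) w u in \<open>auto simp: smaller_iff\<close>)
 have au: "walk u" using w x0 y by (simp add: u walk_Cons)
 then have merge: "merge f u = 0" using merges_walk by (intro merge_0) simp
 have my: "mk [?y] \<in> nz" using y by (intro mk_nz) (auto simp: nzl_Cons)
 have cu: "chain u" using my w hw x0 by (auto simp: u chain_Cons mk_def)
 have cq: "comp_nz Q (mk [?y]) q"
 proof -
  have "nzc ?y (hd (snd q))" if "snd q \<noteq> []"
   using that Q hw hq y snd_nz[OF Q(1)] by (cases "snd q") (auto simp: nzc_iff consecutive_iff path_head_def nzl_Cons)
  then show ?thesis using my Q hw snd_nz[OF Q(1)] y by (auto simp: comp_nz_iff nzl_Cons mk_def)
 qed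
 have 1: "lookup (lin (\<lambda>x. M [hd u, x]) (f (tl u))) q' = sg (ldeg (snd q)) * lookup (f w) q"
 proof -
  have hu: "hd u = mk [?y]" "tl u = w" by (simp_all add: u)
  have eq: "(comp_nz Q (mk [?y]) x \<and> path_comp (mk [?y]) x = q') = (x = q)" for x
  proof -
   have "path_comp (mk [?y]) x = q' \<longleftrightarrow> x = q" unfolding q' path_comp_def prod_eq_iff[of x q] by simp
   then show ?thesis using cq by auto
  qed
  show ?thesis unfolding lookup_M_left hu eq
   by (rule sum_keys_single) (rule if_cong; simp)
 qed
 have 2: "lookup (lin (\<lambda>x. M [x, last u]) (f (butlast u))) q' = 0"
 proof (rule ccontr)
  assume n: "lookup (lin (\<lambda>x. M [x, last u]) (f (butlast u))) q' \<noteq> 0"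
  then obtain x where x: "x \<in> keys (f (butlast u))" "comp_nz Q x (last u)" "path_comp x (last u) = q'"
   using sum_keys_neq_0[OF n[unfolded lookup_M_right]] by blast
  have ll: "snd (last u) = [xl w]"
  proof -
   have "last w \<in> set w" using w by simp
   then have "length (snd (last w)) = 1" using w by (simp add: walk_def)
   then show ?thesis using w by (cases "snd (last w)") (auto simp: u)
  qed
  have e: "snd x @ [xl w] = ?y # snd q" using x(3) ll by (auto simp: q' path_comp_def)
  have b: "butlast u = mk [?y] # butlast w" "walk (butlast u)" "x0 (butlast u) = ?y"
   using w walk_append[of "butlast u" "[last u]"] au by (auto simp: u)
  have nU: "\<not> target (butlast u) x" using f(2) x(1) unfolding in_keys_iff by blast
  show False
  proof (cases "snd x = []")
   case False
   then have "hd (snd x) = ?y" using e by (cases "snd x") auto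
   then have t: "theta (butlast u) x" using nU b False by (auto simp: target_def)
   then have t': "snd x = [?y]" "xl (butlast u) = ?y" using b by (auto simp: theta_def)
   have "xl w = x0 w"
   proof (cases "butlast w = []")
    case True
    then show ?thesis using w by (cases w) (auto split: if_splits)
   next
    case False
    have "walk (butlast w @ [last w])" using w by simp
    then have "xl w = nx (xl (butlast w))" using False by (auto simp: walk_def successively_append_iff)
    then show ?thesis using t'(2) False b y by simp
   qed
   then have "snd q = [x0 w]" using e t' by simp
   then show False using hq by (metis list.distinct(1) list.sel(1))
  next
   case True
   then have "snd q = []" "xl w = ?y" using e by auto
   then have "rd (x0 w) \<noteq> 0" using V(1) w by (auto simp: target_def loop_def)
   then have "rd ?y < rd (x0 w)" using rd_pv x0 by simp
   moreover have "arrows (butlast u) = arrows w"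
   proof -
    have "arrows w = arrows (butlast w) + length (snd (last w))" using w arrows_simps(3)[of "butlast w" "[last w]"] by simp
    moreover have "last u = last w" using w by (simp add: u)
    then have "length (snd (last w)) = 1" using ll by (metis length_Cons list.size(3) One_nat_def)
    moreover have "arrows (butlast u) = 1 + arrows (butlast w)" unfolding b(1) by simp
    ultimately show ?thesis by simp
   qed
   ultimately have "(butlast u, w) \<in> smaller" using b w by (simp add: smaller_iff u)
   then show False using f(3) x(1) by simp
  qed
 qed
 show ?thesis unfolding red lookup_minus lookup_add lookup_smul 1 2 merge by simp
qed

lemma walk_walk_from: "r \<in> Ar \<Longrightarrow> walk (walk_from r n)"
 unfolding walk_def by (intro conjI) (simp add: walk_from_def, simp add: successively_conv_nth)

lemma chain_walk_from: "r \<in> Ar \<Longrightarrow> chain (walk_from r n)"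
proof -
 assume r: "r \<in> Ar"
 have "mk [(nx ^^ i) r] \<in> nz" for i using r by (intro mk_nz) (auto simp: nzl_Cons)
 moreover have "fst (mk [(nx ^^ i) r]) = path_head Q (mk [(nx ^^ Suc i) r])" for i using r by (simp add: path_head_def) (simp add: mk_def)
 ultimately show ?thesis unfolding chain_def by (intro conjI) (auto simp: walk_from_def, simp add: successively_conv_nth)
qed

lemma arrows_walk: "walk w \<Longrightarrow> arrows w = length w"
 by (induction w) (auto simp: walk_Cons)

text \<open>
 Every ear produces two entries with more than one arrow.
\<close>

lemma tg_single:
 assumes "tg v" "v = L @ [s] @ R" "\<forall>a\<in>set L \<union> set R. length a = 1"
 shows "\<exists>z\<in>Ar. v = sing (fw z)"
 using assms(1)
proof cases
 case (ear L' b c R' x)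
 have "filter (\<lambda>a. length a \<noteq> 1) L = []" "filter (\<lambda>a. length a \<noteq> 1) R = []" using assms(3) by (auto simp: filter_empty_conv)
 then have "length (filter (\<lambda>a. length a \<noteq> 1) v) \<le> 1" unfolding assms(2) by simp
 moreover have "b \<noteq> []" "c \<noteq> []" using tg_ne[OF ear(2)] by auto
 then have "length (filter (\<lambda>a. length a \<noteq> 1) v) \<ge> 2" unfolding ear(1) by simp
 ultimately show ?thesis by simp
qed blast

lemma lookup_M: "chain v \<Longrightarrow> fst (last v) = a \<Longrightarrow> lookup (M v) (a, s) = lookup (mm (map snd v)) s"
proof -
 assume v: "chain v" "fst (last v) = a"
 have "lookup (M v) (a, s) = (\<Sum>t\<in>keys (mm (map snd v)). lookup (mm (map snd v)) t * (if t = s then 1 else 0))"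
  unfolding M_eq[OF v(1)] v(2) lookup_lin by (intro sum.cong refl) (auto simp: lookup_bvec)
 also have "\<dots> = 1 * lookup (mm (map snd v)) s"
  by (rule sum_keys_single) simp
 finally show ?thesis by simp
qed

lemma list_length_2: "length l = 2 \<Longrightarrow> \<exists>c d. l = [c, d]"
 by (auto simp: length_Suc_conv numeral_2_eq_2)

lemma inL_Nil: "[] \<in> inL v \<Longrightarrow> tg v"
 by (auto simp: inL_def)

text \<open>
 The partner walk contains one corner more than full turns.  The only products with idempotent value on words all of whose entries but one
 are single arrows are those of the face itself.  Replacing a subword by one corner in such a product leaves as many possible
 subwords as the face has corners; all but the last of them are targets, since they do not end at the root.
 Applying the product inside the walk leads to sequences with fewer arrows.
\<close>

lemma dif_match_theta:
 assumes w: "chain w" "w \<noteq> []" "par w q" and t: "theta w q"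
  and u: "u = tl w @ map mk (sing (fw (nx (x0 w))))" and q': "q' = (fst q, [])"
  and f: "BC f" "\<forall>v p. target v p \<longrightarrow> lookup (f v) p = 0" "\<forall>v. (v, w) \<in> smaller \<longrightarrow> f v = 0"
 shows "lookup (pb.dif M j f u) q' = lookup (f w) q"
proof -
 define y where "y = x0 w"
 define r where "r = nx y"
 define n where "n = length w"
 define k where "k = per y"
 have walk_from: "walk w" and th: "snd q = [y]" "xl w = y" "rd r = 0" using t by (auto simp: theta_def y_def r_def)
 have yA: "y \<in> Ar" "xl w = (nx ^^ (n - 1)) y" using walk_ends[OF walk_from w(1,2)] by (auto simp: y_def n_def)
 then have rA: "r \<in> Ar" and pr: "per r = k" "pv r = y" by (auto simp: r_def k_def)
 have k3: "3 \<le> k" using per_ge yA by (simp add: k_def)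
 have n0: "n \<noteq> 0" using w by (simp add: n_def)
 have "k dvd n - 1" using funpow_nx_eq[OF yA(1), of "n - 1"] yA th by (simp add: k_def)
 then have nr: "(nx ^^ (n - 1)) r = r" using funpow_nx_eq[OF rA, of "n - 1"] pr by simp
 have wa: "w = walk_from y n" using walk_eq[OF walk_from w(1)] by (simp add: y_def n_def)
 have "tl w = walk_from r (n - 1)" using drop_walk_from[of 1 y n] wa by (simp add: r_def drop_Suc)
 then have ua: "u = walk_from r (n - 1 + k)" using walk_from_append[of r "n - 1" k] nr u map_mk_fw[of r] pr by (simp add: r_def y_def)
 have lu: "length u = n - 1 + k" by (simp add: ua)
 have au: "walk u" "chain u" using walk_walk_from chain_walk_from rA ua by auto
 have un: "u ! i = mk [(nx ^^ i) r]" if "i < length u" for i using that by (simp add: ua)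
 have single: "\<forall>a\<in>set (map snd L) \<union> set (map snd R). length a = 1" if "u = L @ X @ R" for L X R
  using au(1) that by (auto simp: walk_def)
 have wd: "w = drop (k - 1) u"
  using drop_walk_from[of "k - 1" r "n - 1 + k"] funpow_pred_per[OF rA] pr wa n0 k3 ua by simp
 have key: "R = [] \<and> X = w \<and> x = q"
  if e: "u = L @ X @ R" "X \<noteq> []" and x: "x \<in> keys (f X)" and m: "lookup (M (L @ x # R)) q' \<noteq> 0" for L X R x
 proof -
  have q'k: "q' \<in> keys (M (L @ x # R))" using m by (simp add: in_keys_iff)
  have ch: "chain (L @ x # R)" and "[] \<in> keys (mm (map snd (L @ x # R)))" using M_par[OF q'k] by (auto simp: q')
  then have "[] \<in> keys (mT (map snd (L @ x # R))) \<or> [] \<in> keys (m2 (map snd (L @ x # R)))"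
   using keys_add[of "mT (map snd (L @ x # R))" "m2 (map snd (L @ x # R))"] unfolding mm_def by blast
  moreover have "[] \<notin> keys (m2 (map snd (L @ x # R)))"
  proof
   assume a: "[] \<in> keys (m2 (map snd (L @ x # R)))"
   have "length (L @ x # R) = 2"
   proof (rule ccontr)
    assume "length (L @ x # R) \<noteq> 2"
    then have "m2 (map snd (L @ x # R)) = 0" by (intro m2_length) (simp only: length_map not_False_eq_True)
    then show False using a by (simp only: keys_zero empty_iff)
   qed
   then obtain c d where cd: "L @ x # R = [c, d]" using list_length_2 by blast
   have "[] \<in> keys (m2 [snd c, snd d])" using a unfolding cd by simp
   then have "snd c = [] \<and> snd d = []" by (auto simp: in_keys_iff lookup_bvec split: if_splits)
   moreover have "(\<exists>a\<in>set L \<union> set R. a = c \<or> a = d)" using cd by (auto simp: append_eq_Cons_conv)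
   ultimately show False using single[OF e(1)] by force
  qed
  moreover have "[] \<notin> inR (map snd (L @ x # R))" unfolding inR_def by blast
  ultimately have "[] \<in> inL (map snd (L @ x # R))" unfolding keys_mT by blast
  then have "tg (map snd (L @ x # R))" by (rule inL_Nil)
  from tg_single[OF this, of "map snd L" "snd x" "map snd R"] single[OF e(1)]
  obtain z where z: "z \<in> Ar" "map snd (L @ x # R) = sing (fw z)" by auto
  have lz: "length L + 1 + length R = per z" using arg_cong[OF z(2), of length] by simp
  have zn: "snd ((L @ x # R) ! i) = [(nx ^^ i) z]" if "i < per z" for i
  proof -
   have "snd ((L @ x # R) ! i) = map snd (L @ x # R) ! i" using that lz by (subst nth_map) auto
   also have "\<dots> = [(nx ^^ i) z]" unfolding z(2) using that by (simp add: fw_def)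
   finally show ?thesis .
  qed
  have lX: "length L + length X + length R = n - 1 + k" using arg_cong[OF e(1), of length] lu by simp
  have "z = r \<and> per z = k"
  proof (cases "L = []")
   case False
   then have "(L @ x # R) ! 0 = u ! 0" "0 < length u" unfolding e(1) by (auto simp: nth_append)
   then have "[z] = [r]" using zn[of 0] lz un[of 0] by simp
   then show ?thesis using pr by simp
  next
   case True
   have R: "R \<noteq> []" using lz True per_ge[OF z(1)] by auto
   then have "(L @ x # R) ! 1 = u ! length X" "length X < length u" unfolding e(1) using True by (auto simp: nth_append)
   moreover have "1 < per z" using per_ge[OF z(1)] by simp
   ultimately have "[(nx ^^ 1) z] = [(nx ^^ length X) r]" using zn[of 1] un[of "length X"] by (metis snd_mk)
   then have nz: "nx z = (nx ^^ length X) r" by simp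
   have "per z = per (nx z)" using z(1) by simp
   also have "\<dots> = per ((nx ^^ length X) r)" by (simp only: nz)
   also have "\<dots> = k" using rA pr by simp
   finally have "per z = k" .
   moreover from this have "length X = Suc (n - 1)" using lX lz True by simp
   then have "nx z = nx r" using nz nr by simp
   ultimately show ?thesis using nx_inj[OF z(1) rA] by simp
  qed
  then have zr: "z = r" "per z = k" by auto
  have x1: "snd x = [(nx ^^ length L) r]" using zn[of "length L"] lz zr by simp
  have "u ! length L = hd X" using e by (simp add: nth_append hd_conv_nth)
  moreover have "length L < length u" using e by simp
  ultimately have X0: "x0 X = (nx ^^ length L) r" using un[of "length L"] by (metis list.sel(1) snd_mk)
  have aX: "walk X" using au(1) e(1) walk_append by metis
  have "\<not> target X x" using f(2) x unfolding in_keys_iff by blast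
  then have "theta X x" using aX e(2) x1 X0 by (simp add: target_def)
  then have rd: "rd ((nx ^^ Suc (length L)) r) = 0" using X0 by (simp add: theta_def)
  have "Suc (length L) = k"
  proof (rule ccontr)
   assume "Suc (length L) \<noteq> k"
   then have "Suc (length L) < per r" using lz zr pr by simp
   from rd_funpow[OF rA th(3) this] rd show False by simp
  qed
  then have R: "R = []" "length L = k - 1" using lz zr by auto
  then have X: "X = w" using e wd by simp
  have "par X x" using BC_key[OF f(1) x] by simp
  then have "fst x = fst q" using w(3) X by (simp add: par_def)
  moreover have "snd x = snd q" using x1 X0 X th by (simp add: y_def)
  ultimately show ?thesis using R X by (simp add: prod_eqI)
 qed
 have val: "lookup (M (take (k - 1) u @ [q])) q' = 1"
 proof -
  have uw: "u = take (k - 1) u @ w @ []" using wd by simp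
  have qp: "par w q" using w by simp
  have ch: "chain (take (k - 1) u @ q # [])" using chain_insert(1)[OF w(1,2) qp, of "take (k - 1) u" "[]"] uw au by simp
  have "map snd (take (k - 1) u) @ [snd q] = sing (fw r)"
  proof (rule nth_equalityI)
   show "length (map snd (take (k - 1) u) @ [snd q]) = length (sing (fw r))" using lu pr k3 n0 by simp
   fix i assume "i < length (map snd (take (k - 1) u) @ [snd q])"
   then have i: "i < k" using lu k3 n0 by simp
   show "(map snd (take (k - 1) u) @ [snd q]) ! i = sing (fw r) ! i"
   proof (cases "i = k - 1")
    case True
    then show ?thesis using funpow_pred_per[OF rA] pr th i lu n0 k3 by (simp add: nth_append fw_def min_def)
   next
    case False
    then have "i < k - 1" using i by simp
    then show ?thesis using lu un[of i] pr by (simp add: nth_append fw_def)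
   qed
  qed
  then have e: "map snd (take (k - 1) u @ [q]) = sing (fw r)" by simp
  have "tg (sing (fw r))" using tg.face[OF rA] .
  then have "[] \<in> inL (sing (fw r))" using fw_ne[OF rA] by (cases "fw r") (auto simp: inL_def)
  moreover have "[] \<notin> inR (sing (fw r))" by (simp add: inR_def)
  moreover have "m2 (sing (fw r)) = 0" by (intro m2_length) (use pr k3 in simp)
  ultimately have "lookup (mm (sing (fw r))) [] = 1" by (simp add: mm_def lookup_add lookup_mT)
  moreover have "lookup (M (take (k - 1) u @ [q])) (fst q, []) = lookup (mm (map snd (take (k - 1) u @ [q]))) []"
   by (rule lookup_M) (use ch in simp_all)
  ultimately show ?thesis unfolding e q' by simp
 qed
 let ?t = "(take (k - 1) u, w, [])"
 have "lookup (lin M (pb.hat j f u)) q' = (\<Sum>(L, X, R)\<in>splits u. sg (pb.wdeg R * j) * (\<Sum>x\<in>keys (f X). lookup (f X) x * lookup (M (L @ x # R)) q'))"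
  unfolding pb.hat_def lin_sum case_prod_beta lin_smul lin_lin lin_bvec lookup_sum lookup_smul lookup_lin ..
 also have "\<dots> = (\<Sum>T\<in>splits u. if T = ?t then lookup (f w) q else 0)"
 proof (rule sum.cong[OF refl], clarify)
  fix L X R assume "(L, X, R) \<in> splits u"
  then have e: "u = L @ X @ R" "X \<noteq> []" by (auto simp: splits_def)
  let ?S = "\<Sum>x\<in>keys (f X). lookup (f X) x * lookup (M (L @ x # R)) q'"
  show "sg (pb.wdeg R * j) * ?S = (if (L, X, R) = ?t then lookup (f w) q else 0)"
  proof (cases "(L, X, R) = ?t")
   case True
   then have T: "L = take (k - 1) u" "X = w" "R = []" by simp_all
   have "lookup (M (L @ x # R)) q' = (if x = q then 1 else 0)" if x: "x \<in> keys (f X)" for x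
   proof (cases "x = q")
    case True
    then show ?thesis using val T by simp
   next
    case False
    then show ?thesis using key[OF e x] by fastforce
   qed
   then have "?S = 1 * lookup (f X) q" by (rule sum_keys_single)
   then show ?thesis using T by simp
  next
   case False
   have "lookup (M (L @ x # R)) q' = 0" if x: "x \<in> keys (f X)" for x
   proof (rule ccontr)
    assume "lookup (M (L @ x # R)) q' \<noteq> 0"
    from key[OF e x this] have "R = []" "X = w" by auto
    moreover from this have "L = take (length u - n) u" using e by (simp add: n_def)
    moreover have "length u - n = k - 1" using lu n0 by simp
    ultimately show False using False by simp
   qed
   then have "?S = 0" by (intro sum.neutral) auto
   then show ?thesis by (simp only: False if_False mult_zero_right)
  qed
 qed
 also have "\<dots> = lookup (f w) q"
 proof -
  have "u = take (k - 1) u @ w @ []" unfolding wd append_Nil2 by (rule append_take_drop_id[symmetric])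
  then have "?t \<in> splits u" using w(2) unfolding splits_def by blast
  then show ?thesis by (simp only: sum.delta finite_splits if_True)
 qed
 finally have 1: "lookup (lin M (pb.hat j f u)) q' = lookup (f w) q" .
 have "f w' = 0" if w': "w' \<in> keys (pb.hat 1 M u)" for w'
 proof -
  obtain L X R s where e: "u = L @ X @ R" "X \<noteq> []" "s \<in> keys (M X)" "w' = L @ s # R" using pb.keys_hat[OF w'] by blast
  have aX: "walk X" using au(1) e(1) walk_append by metis
  have X2: "length X \<noteq> 2"
  proof
   assume "length X = 2"
   then obtain a b where X: "X = [a, b]" by (auto simp: length_Suc_conv numeral_2_eq_2)
   then have "\<not> comp_nz Q a b" using merges_walk[OF aX] by (auto split: if_splits)
   then show False using e(3) X by (simp add: M_2)
  qed
  then have "snd s \<in> keys (mT (map snd X))" using M_par[OF e(3)] by (simp add: mm_def m2_length)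
  then have "snd s = [] \<and> tg (map snd X)"
   unfolding keys_mT
  proof
   assume "snd s \<in> inL (map snd X)"
   then obtain z zs where z: "map snd X = (snd s @ z) # zs" "tg (z # zs)" by (auto simp: inL_def)
   then have "length (snd s @ z) = 1" using aX by (cases X) (auto simp: walk_Cons)
   then have "snd s = []" using tg_ne[OF z(2)] by (cases "snd s") auto
   then show ?thesis using z by simp
  next
   assume "snd s \<in> inR (map snd X)"
   then obtain z zs where z: "map snd X = zs @ [z @ snd s]" "tg (zs @ [z])" "snd s \<noteq> []" by (auto simp: inR_def)
   then have "z @ snd s \<in> set (map snd X)" by simp
   then have "length (z @ snd s) = 1" using aX unfolding walk_def by auto
   moreover have "z \<noteq> []" using tg_ne[OF z(2)] by auto
   ultimately show ?thesis using z(3) by (cases z; cases "snd s") auto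
  qed
  then have s: "snd s = []" and tX: "tg (map snd X)" by auto
  have "map snd X = [] @ [snd (hd X)] @ map snd (tl X)" using e(2) by (cases X) auto
  moreover have "\<forall>a\<in>set [] \<union> set (map snd (tl X)). length a = 1"
   using aX by (cases X) (auto simp: walk_def)
  ultimately obtain z where z: "z \<in> Ar" "map snd X = sing (fw z)" using tg_single[OF tX] by blast
  have lX: "length X = per z" using arg_cong[OF z(2), of length] by simp
  have "hd X = u ! length L" "length L < length u" using e by (auto simp: nth_append hd_conv_nth)
  then have "snd (hd X) = [(nx ^^ length L) r]" using un by simp
  moreover have "snd (hd X) = [z]" using z e(2) by (cases X) (auto simp: fw_eq)
  ultimately have "per z = k" using rA pr by simp
  then have l: "length L + k + length R = n - 1 + k" using lX arg_cong[OF e(1), of length] lu by simp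
  have "arrows L = length L" "arrows R = length R" using arrows_walk au(1) e(1) walk_append by metis+
  then have "length w' = n" "arrows w' = n - 1" using l e(4) s n0 by auto
  moreover have "arrows w = n" using arrows_walk[OF walk_from] n_def by simp
  ultimately have "(w', w) \<in> smaller" using n0 by (simp add: smaller_iff n_def)
  then show ?thesis using f(3) by simp
 qed
 then have "lin f (pb.hat 1 M u) = lin (\<lambda>v. 0) (pb.hat 1 M u)" by (intro lin_cong) auto
 then show ?thesis unfolding pb.dif_def by (simp add: lookup_minus 1)
qed

text \<open>
 The three kinds of sources taken together.
\<close>

lemma dif_match:
 assumes w: "chain w" "w \<noteq> []" "par w q" "\<not> target w q"
 shows "\<exists>c. c \<noteq> 0 \<and> (\<forall>f. BC f \<longrightarrow> (\<forall>v p. target v p \<longrightarrow> lookup (f v) p = 0) \<longrightarrow> (\<forall>v. (v, w) \<in> smaller \<longrightarrow> f v = 0) \<longrightarrow>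
  lookup (pb.dif M j f (mate w q)) (mate_out w q) = c * lookup (f w) q)"
proof (cases "partner w")
 case (Some bu)
 then obtain u where u: "partner w = Some (True, u)" using w(4) by (cases bu; cases "fst bu") (auto simp: target_def)
 from dif_match_partner[OF w(1) u w(3), of j] u show ?thesis by (simp add: mate_def mate_out_def)
next
 case None
 then have a: "walk w" by (simp add: partner_None)
 show ?thesis
 proof (cases "theta w q")
  case True
  then show ?thesis using dif_match_theta[OF w(1-3) True refl refl] None
   by (intro exI[of _ 1]) (simp add: mate_def mate_out_def)
 next
  case False
  then show ?thesis using dif_match_walk[OF w(1) a w(2-4) False refl refl] None
   by (intro exI[of _ "sg (ldeg (snd q))"]) (simp add: mate_def mate_out_def)
 qed
qed

text \<open>
 The matching is surjective onto the targets.
\<close>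

lemma matched:
 assumes u: "chain u" "2 \<le> length u" "target u q'" "par u q'"
 shows "\<exists>w q. chain w \<and> w \<noteq> [] \<and> par w q \<and> \<not> target w q \<and> mate w q = u \<and> mate_out w q = q'"
proof -
 consider v where "partner u = Some (False, v)" | "loop u q'" | "walk u" "snd q' \<noteq> []" "hd (snd q') = x0 u" "\<not> theta u q'"
  using u(3) by (auto simp: target_def)
 then show ?thesis
 proof cases
  case 1
  note V = partner_of_target[OF 1 u(1)]
  then have "\<not> walk v" using partner_None[of v] by auto
  then have "\<not> target v q'" using V by (auto simp: target_def loop_def)
  then show ?thesis using V u(4) by (intro exI[of _ v] exI[of _ q']) (auto simp: par_def mate_def mate_out_def)
 next
  case 2
  define r where "r = x0 u"
  define k where "k = per r"
  define n where "n = length u"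
  have L: "walk u" "u \<noteq> []" "snd q' = []" "rd r = 0" "xl u = pv r" using 2 by (auto simp: loop_def r_def)
  have r: "r \<in> Ar" "xl u = (nx ^^ (n - 1)) r" using walk_ends[OF L(1) u(1) L(2)] by (auto simp: r_def n_def)
  have ua: "u = walk_from r n" using walk_eq[OF L(1) u(1)] by (simp add: r_def n_def)
  have n0: "n \<noteq> 0" using L by (simp add: n_def)
  have "(nx ^^ n) r = nx ((nx ^^ (n - 1)) r)" using n0 by (cases n) auto
  also have "\<dots> = r" using r L nx_pv[OF r(1)] by metis
  finally have "k dvd n" using funpow_nx_eq[OF r(1)] by (simp add: k_def)
  then have kn: "k \<le> n" using n0 dvd_imp_le by blast
  have k3: "3 \<le> k" using per_ge[OF r(1)] by (simp add: k_def)
  define y where "y = pv r"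
  have y: "y \<in> Ar" "nx y = r" "(nx ^^ (k - 1)) r = y" using r funpow_pred_per[OF r(1)] by (auto simp: y_def k_def)
  define w where "w = drop (k - 1) u"
  have wa: "w = walk_from y (n - k + 1)" using drop_walk_from[of "k - 1" r n] y ua kn k3 Suc_diff_le[OF kn] by (simp add: w_def)
  define q where "q = (fst q', [y])"
  have wn: "w \<noteq> []" using arg_cong[OF wa, of length] by auto
  have lw: "last w = last u" using wn by (simp add: w_def last_drop)
  have hw: "hd w = mk [y]" using wa wn by (simp add: hd_conv_nth)
  have uw: "u = take (k - 1) u @ w" by (simp add: w_def)
  have cw: "chain w" using u(1) uw chain_append by metis
  have aw': "walk w" using L(1) uw walk_append by metis
  have x0w: "x0 w = y" using hw by simp
  have th: "theta w q" using aw' wn x0w lw L y by (auto simp: theta_def q_def y_def)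
  have "last u \<in> nz" using u(1) L by (auto simp: chain_def)
  moreover have "snd (last u) = [y]"
  proof -
   have "last u \<in> set u" using L by simp
   then have "length (snd (last u)) = 1" using L(1) by (simp add: walk_def)
   then show ?thesis using L(5) by (cases "snd (last u)") (auto simp: y_def)
  qed
  ultimately have "last u = mk [y]" using mk_snd[of "last u"] by simp
  then have fq: "fst q' = q_tail Q y" using u(4) by (simp add: par_def mk_def)
  have "q = mk [y]" using fq by (simp add: q_def mk_def)
  then have pq: "par w q" using \<open>last u = mk [y]\<close> hw lw mk_nz[of "[y]"] y(1) by (simp add: par_def nzl_Cons)
  have "partner w = None" using aw' partner_None by simp
  then have nU: "\<not> target w q" using th by (auto simp: target_def loop_def q_def)
  have "tl w = walk_from r (n - k)" using drop_walk_from[of 1 y "n - k + 1"] wa y by (simp add: drop_Suc)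
  moreover have "(nx ^^ (n - k)) r = r" using \<open>k dvd n\<close> funpow_nx_eq[OF r(1), of "n - k"] by (simp add: k_def)
  ultimately have "tl w @ map mk (sing (fw r)) = u" using walk_from_append[of r "n - k" k] ua kn map_mk_fw[of r] by (simp add: k_def)
  then have "mate w q = u" using \<open>partner w = None\<close> th x0w y by (simp add: mate_def)
  moreover have "mate_out w q = q'" using \<open>partner w = None\<close> th L by (simp add: mate_out_def q_def prod_eqI)
  ultimately show ?thesis using cw wn pq nU by blast
 next
  case 3
  define y where "y = x0 u"
  define w where "w = tl u"
  define q where "q = (fst q', tl (snd q'))"
  have un: "u \<noteq> []" using u(2) by auto
  have y: "y \<in> Ar" "hd u = mk [y]" using walk_ends[OF 3(1) u(1) un] by (auto simp: y_def)
  have uw: "u = mk [y] # w" using y un by (cases u) (auto simp: w_def)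
  have wn: "w \<noteq> []" using u(2) uw by auto
  have a: "walk w" "x0 w = nx y" "chain w" "path_head Q (hd w) = q_tail Q y"
   using 3(1) u(1) wn by (auto simp: uw walk_Cons chain_Cons mk_def)
  have sq: "snd q' = y # snd q" using 3 by (cases "snd q'") (auto simp: q_def y_def)
  have Q': "q' \<in> nz" "fst q' = fst (last u)" using u(4) by (auto simp: par_def)
  have nq: "nzl (y # snd q)" using snd_nz[OF Q'(1)] sq by simp
  have tq: "snd q \<noteq> [] \<Longrightarrow> q_tail Q (last (snd q)) = fst q'" "snd q = [] \<Longrightarrow> fst q' = q_tail Q y"
   using tail_nz[OF Q'(1)] sq by auto
  have qnz: "q \<in> nz" using nq tq fst_nz[OF Q'(1)] by (auto simp: q_def nz_iff nzl_Cons)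
  have hq: "snd q \<noteq> [] \<Longrightarrow> hd (snd q) \<noteq> nx y \<and> q_head Q (hd (snd q)) = q_tail Q y" using nq by (auto simp: nzl_Cons nzc_def)
  have "path_head Q q = q_tail Q y" using hq tq(2) by (auto simp: path_head_def) (auto simp: q_def)
  then have pq: "par w q" using qnz a Q' wn uw by (simp add: par_def q_def)
  have "\<not> loop w q"
  proof
   assume l: "loop w q"
   then have "snd q' = [y]" "rd (nx y) = 0" "xl w = y" using a y sq by (auto simp: loop_def)
   then have "theta u q'" using 3(1) un wn by (simp add: theta_def y_def[symmetric] uw)
    (simp add: mk_def)?
   then show False using 3(4) by simp
  qed
  moreover have aN: "partner w = None" using a partner_None by simp
  moreover have nt: "\<not> theta w q" using hq a by (auto simp: theta_def)
  ultimately have nU: "\<not> target w q" using hq a by (auto simp: target_def)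
  have "pv (x0 w) = y" using a y by simp
  then have "mate w q = u" "mate_out w q = path_comp (mk [y]) q" using aN nt uw by (simp_all add: mate_def mate_out_def)
  moreover have "path_comp (mk [y]) q = q'" using sq by (simp add: path_comp_def prod_eq_iff[of _ q'] q_def)
  ultimately show ?thesis using a wn pq nU by blast
 qed
qed

end

section \<open>Acyclicity\<close>

context graded_basis begin

lemma hat_add: "hat j (\<lambda>w. f w + g w) ws = hat j f ws + hat j g ws"
 by (simp add: hat_def lin_add smul_add_right sum.distrib case_prod_beta)

lemma hat_smul: "hat j (\<lambda>w. smul c (f w)) ws = smul c (hat j f ws)"
 by (simp add: hat_def lin_smul smul_sum_right case_prod_beta mult.commute)

lemma dif_add: "dif m j (\<lambda>w. f w + g w) ws = dif m j f ws + dif m j g ws"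
 by (simp add: dif_def hat_add lin_add lin_fun_add smul_add_right)

lemma dif_smul: "dif m j (\<lambda>w. smul c (f w)) ws = smul c (dif m j f ws)"
 by (simp add: dif_def hat_smul lin_smul lin_fun_smul smul_diff_right mult.commute)

lemma dif_diff: "dif m j (\<lambda>w. f w - g w) ws = dif m j f ws - dif m j g ws"
proof -
 have "dif m j (\<lambda>w. f w + smul (- 1) (g w)) ws = dif m j f ws + smul (- 1) (dif m j g ws)"
  unfolding dif_add dif_smul ..
 then show ?thesis by (simp add: smul_minus_left)
qed

lemma dif_parity: "even (i - j) \<Longrightarrow> dif m i f ws = dif m j f ws"
proof -
 assume e: "even (i - j)"
 then have "sg (k * i) = sg (k * j)" for k by (intro sg_cong) (simp add: right_diff_distrib[symmetric])
 moreover from e have "sg i = sg j" by (rule sg_cong)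
 ultimately show ?thesis by (simp add: dif_def hat_def)
qed

lemma homog_parity: "even (i - j) \<Longrightarrow> homog i f \<Longrightarrow> homog j f"
 unfolding homog_def
proof (intro allI ballI)
 fix ws x assume e: "even (i - j)" and h: "\<forall>ws. \<forall>x\<in>keys (f ws). even (dg x - wdeg ws - i)" and x: "x \<in> keys (f ws)"
 have "even (dg x - wdeg ws - i)" using h x by blast
 then have "even ((dg x - wdeg ws - i) + (i - j))" using e by (rule dvd_add)
 then show "even (dg x - wdeg ws - j)" by (subst (asm) add_diff_eq) simp
qed

definition part :: "int \<Rightarrow> ('p list \<Rightarrow> ('p \<Rightarrow>\<^sub>0 complex)) \<Rightarrow> 'p list \<Rightarrow> ('p \<Rightarrow>\<^sub>0 complex)" where
 "part j f ws = lin (\<lambda>q. if even (dg q - wdeg ws - j) then bvec q else 0) (f ws)"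

lemma lookup_part: "lookup (part j f ws) q = (if even (dg q - wdeg ws - j) then lookup (f ws) q else 0)"
proof -
 have "lookup (part j f ws) q = (\<Sum>p\<in>keys (f ws). if p = q then (if even (dg q - wdeg ws - j) then lookup (f ws) q else 0) else 0)"
  unfolding part_def lookup_lin by (rule sum.cong) (auto simp: lookup_bvec)
 then show ?thesis by (simp add: in_keys_iff)
qed

lemma homog_part: "homog j (part j f)"
 unfolding homog_def
proof (intro allI ballI)
 fix ws x assume "x \<in> keys (part j f ws)"
 then have "lookup (part j f ws) x \<noteq> 0" by (simp add: in_keys_iff)
 then show "even (dg x - wdeg ws - j)" unfolding lookup_part by presburger
qed

lemma part_add: "part j f ws + part (j + 1) f ws = f ws"
 by (rule poly_mapping_eqI) (simp add: lookup_add lookup_part)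

lemma homogD: "homog j f \<Longrightarrow> odd (dg q - wdeg ws - j) \<Longrightarrow> lookup (f ws) q = 0"
proof (rule ccontr)
 assume h: "homog j f" and o: "odd (dg q - wdeg ws - j)" and "lookup (f ws) q \<noteq> 0"
 then have "q \<in> keys (f ws)" by (simp add: in_keys_iff)
 with h have "even (dg q - wdeg ws - j)" unfolding homog_def by blast
 with o show False by blast
qed

end

context gentle_quiver begin

lemma finite_targets:
 fixes d :: "('v, 'e) qpath list \<Rightarrow> ('v, 'e) qvec"
 shows "finite {q. par w q \<and> lookup (d (mate w q)) (mate_out w q) \<noteq> 0}"
proof (cases "partner w")
 case (Some a)
 then have "{q. par w q \<and> lookup (d (mate w q)) (mate_out w q) \<noteq> 0} \<subseteq> keys (d (snd a))"
  by (auto simp: mate_def mate_out_def in_keys_iff)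
 then show ?thesis by (rule finite_subset) simp
next
 case None
 let ?p = "mk [pv (x0 w)]"
 have sub: "q \<in> insert (fst (last w), [x0 w]) (path_comp ?p -` keys (d (?p # w)))"
  if q: "par w q" "lookup (d (mate w q)) (mate_out w q) \<noteq> 0" for q
 proof (cases "theta w q")
  case True
  then have "q = (fst (last w), [x0 w])" using q(1) unfolding prod_eq_iff par_def theta_def by simp
  then show ?thesis by simp
 next
  case False
  then show ?thesis using q(2) None by (simp add: mate_def mate_out_def in_keys_iff)
 qed
 have "inj (path_comp ?p)"
 proof (rule injI)
  fix q q' assume "path_comp ?p q = path_comp ?p q'"
  then show "q = q'" by (cases q; cases q') (simp add: path_comp_def)
 qed
 then have "finite (insert (fst (last w), [x0 w]) (path_comp ?p -` keys (d (?p # w))))"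
  by (intro finite.insertI finite_vimageI finite_keys)
 moreover have "{q. par w q \<and> lookup (d (mate w q)) (mate_out w q) \<noteq> 0} \<subseteq> insert (fst (last w), [x0 w]) (path_comp ?p -` keys (d (?p # w)))"
  using sub by blast
 ultimately show ?thesis using finite_subset by blast
qed

text \<open>
 The non-zero factor in \<open>dif_match\<close>.
\<close>

definition match_coeff :: "int \<Rightarrow> ('v, 'e) qpath list \<Rightarrow> ('v, 'e) qpath \<Rightarrow> complex" where
 "match_coeff j w q = (SOME c. c \<noteq> 0 \<and> (\<forall>f. BC f \<longrightarrow> (\<forall>v p. target v p \<longrightarrow> lookup (f v) p = 0) \<longrightarrow> (\<forall>v. (v, w) \<in> smaller \<longrightarrow> f v = 0) \<longrightarrow>
  lookup (pb.dif M j f (mate w q)) (mate_out w q) = c * lookup (f w) q))"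

lemma match_coeff:
 assumes "chain w" "w \<noteq> []" "par w q" "\<not> target w q"
 shows "match_coeff j w q \<noteq> 0"
  "BC f \<Longrightarrow> \<forall>v p. target v p \<longrightarrow> lookup (f v) p = 0 \<Longrightarrow> \<forall>v. (v, w) \<in> smaller \<longrightarrow> f v = 0 \<Longrightarrow>
   lookup (pb.dif M j f (mate w q)) (mate_out w q) = match_coeff j w q * lookup (f w) q"
 using someI_ex[OF dif_match[OF assms, of j]] unfolding match_coeff_def[symmetric] by blast+

text \<open>
 The truncation of a cochain to the sequences below \<open>w\<close>.
\<close>

definition below :: "('v, 'e) qpath list \<Rightarrow> (('v, 'e) qpath list \<Rightarrow> ('v, 'e) qvec) \<Rightarrow> ('v, 'e) qpath list \<Rightarrow> ('v, 'e) qvec" where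
 "below w f v = (if (v, w) \<in> smaller then f v else 0)"

definition gap where
 "gap j \<nu> g w q = lookup (\<nu> (mate w q) - pb.dif M j (below w g) (mate w q)) (mate_out w q)"

definition prim_step :: "int \<Rightarrow> (('v, 'e) qpath list \<Rightarrow> ('v, 'e) qvec) \<Rightarrow> (('v, 'e) qpath list \<Rightarrow> ('v, 'e) qvec) \<Rightarrow> ('v, 'e) qpath list \<Rightarrow> ('v, 'e) qvec" where
 "prim_step j \<nu> g w = (if chain w \<and> w \<noteq> [] then
   (\<Sum>q\<in>{q. par w q \<and> gap j \<nu> g w q \<noteq> 0}. smul (if target w q then 0 else gap j \<nu> g w q / match_coeff j w q) (bvec q)) else 0)"

text \<open>
 A primitive of \<open>\<nu>\<close> on the targets.  By triangularity, its coefficient at a source is determined by the coefficients at smaller sequences.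
\<close>

definition prim where "prim j \<nu> = wfrec smaller (prim_step j \<nu>)"

lemma prim_eq: "prim j \<nu> w = prim_step j \<nu> (prim j \<nu>) w"
proof -
 have "below w (cut (prim j \<nu>) smaller w) = below w (prim j \<nu>)"
  by (auto simp: below_def cut_def fun_eq_iff)
 then have "gap j \<nu> (cut (prim j \<nu>) smaller w) w = gap j \<nu> (prim j \<nu>) w" by (intro HOL.ext) (simp only: gap_def)
 then have "prim_step j \<nu> (cut (prim j \<nu>) smaller w) w = prim_step j \<nu> (prim j \<nu>) w" unfolding prim_step_def by (simp only:)
 then show ?thesis unfolding prim_def by (subst wfrec[OF wf_smaller]) simp
qed

lemma lookup_sum_bvec: "finite S \<Longrightarrow> lookup (\<Sum>q\<in>S. smul (a q) (bvec q)) p = (if p \<in> S then a p else 0)"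
proof -
 assume S: "finite S"
 have "lookup (\<Sum>q\<in>S. smul (a q) (bvec q)) p = (\<Sum>q\<in>S. if q = p then a p else 0)"
  unfolding lookup_sum by (rule sum.cong) (auto simp: lookup_bvec)
 then show ?thesis using S by simp
qed

lemma lookup_prim:
 "lookup (prim j \<nu> w) q = (if chain w \<and> w \<noteq> [] \<and> par w q \<and> \<not> target w q then gap j \<nu> (prim j \<nu>) w q / match_coeff j w q else 0)"
proof -
 define S where "S = {q. par w q \<and> gap j \<nu> (prim j \<nu>) w q \<noteq> 0}"
 define a where "a q = (if target w q then 0 else gap j \<nu> (prim j \<nu>) w q / match_coeff j w q)" for q
 have S: "finite S" unfolding S_def gap_def by (rule finite_targets)
 have e: "prim j \<nu> w = (if chain w \<and> w \<noteq> [] then (\<Sum>q\<in>S. smul (a q) (bvec q)) else 0)"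
  unfolding S_def a_def by (subst prim_eq) (simp only: prim_step_def)
 show ?thesis
 proof (cases "chain w \<and> w \<noteq> []")
  case True
  have "lookup (prim j \<nu> w) q = (if q \<in> S then a q else 0)"
   unfolding e if_P[OF True] by (rule lookup_sum_bvec[OF S])
  also have "\<dots> = (if par w q \<and> \<not> target w q then gap j \<nu> (prim j \<nu>) w q / match_coeff j w q else 0)"
   by (cases "gap j \<nu> (prim j \<nu>) w q = 0") (simp_all add: S_def a_def)
  finally show ?thesis using True by simp
 next
  case False
  then show ?thesis unfolding e if_not_P[OF False] by auto
 qed
qed

lemma lookup_prim_target: "target w q \<Longrightarrow> lookup (prim j \<nu> w) q = 0"
 unfolding lookup_prim by (simp only: simp_thms if_False)

lemma BC_prim: "BC (prim j \<nu>)"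
proof -
 have k: "chain w \<and> w \<noteq> [] \<and> par w q" if "q \<in> keys (prim j \<nu> w)" for w q
  using that unfolding in_keys_iff lookup_prim by (auto split: if_splits)
 then show ?thesis by (rule BC_I)
qed

lemma BC_sub: "BC f \<Longrightarrow> (\<And>w q. lookup (g w) q = 0 \<or> lookup (g w) q = lookup (f w) q) \<Longrightarrow> BC g"
proof -
 assume f: "BC f" and g: "\<And>w q. lookup (g w) q = 0 \<or> lookup (g w) q = lookup (f w) q"
 have k: "chain w \<and> w \<noteq> [] \<and> par w q" if "q \<in> keys (g w)" for w q
 proof -
  have "lookup (g w) q \<noteq> 0" using that by (simp add: in_keys_iff)
  then have "lookup (f w) q \<noteq> 0" using g[of w q] by simp
  then have "q \<in> keys (f w)" by (simp add: in_keys_iff)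
  then show ?thesis using BC_key[OF f] by blast
 qed
 then show ?thesis by (rule BC_I)
qed

text \<open>
 Write the primitive as its part below \<open>w\<close> and a part to which \<open>dif_match\<close> applies.
\<close>

lemma prim_solves:
 assumes "chain w" "w \<noteq> []" "par w q" "\<not> target w q"
 shows "lookup (pb.dif M j (prim j \<nu>) (mate w q)) (mate_out w q) = lookup (\<nu> (mate w q)) (mate_out w q)"
proof -
 define f where "f = prim j \<nu>"
 define g where "g v = (if (v, w) \<in> smaller then 0 else f v)" for v
 have fg: "(\<lambda>v. below w f v + g v) = f" by (auto simp: below_def g_def)
 have "lookup (pb.dif M j g (mate w q)) (mate_out w q) = match_coeff j w q * lookup (g w) q"
 proof (rule match_coeff(2)[OF assms])
  show "BC g" by (rule BC_sub[OF BC_prim[of j \<nu>]]) (simp add: g_def f_def)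
  show "\<forall>v p. target v p \<longrightarrow> lookup (g v) p = 0" unfolding g_def f_def by (simp add: lookup_prim_target)
  show "\<forall>v. (v, w) \<in> smaller \<longrightarrow> g v = 0" by (simp add: g_def)
 qed
 also have "g w = f w" by (simp add: g_def smaller_iff)
 also have "match_coeff j w q * lookup (f w) q = gap j \<nu> f w q"
 proof -
  have "lookup (prim j \<nu> w) q = gap j \<nu> (prim j \<nu>) w q / match_coeff j w q"
   unfolding lookup_prim using assms by (simp only: simp_thms if_True not_False_eq_True)
  then show ?thesis using match_coeff(1)[OF assms, of j] unfolding f_def by simp
 qed
 finally have c: "lookup (pb.dif M j g (mate w q)) (mate_out w q) = lookup (\<nu> (mate w q)) (mate_out w q) - lookup (pb.dif M j (below w f) (mate w q)) (mate_out w q)"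
  unfolding gap_def lookup_minus .
 have "lookup (pb.dif M j (\<lambda>v. below w f v + g v) (mate w q)) (mate_out w q) =
   lookup (pb.dif M j (below w f) (mate w q)) (mate_out w q) + lookup (pb.dif M j g (mate w q)) (mate_out w q)"
  by (simp only: pb.dif_add lookup_add)
 with fg have "lookup (pb.dif M j f (mate w q)) (mate_out w q) =
   lookup (pb.dif M j (below w f) (mate w q)) (mate_out w q) + lookup (pb.dif M j g (mate w q)) (mate_out w q)" by (simp only:)
 moreover have "a = b + c \<Longrightarrow> c = n - b \<Longrightarrow> a = n" for a b c n :: complex by simp
 ultimately have "lookup (pb.dif M j f (mate w q)) (mate_out w q) = lookup (\<nu> (mate w q)) (mate_out w q)" using c by blast
 then show ?thesis by (simp only: f_def)
qed

lemma dif_short: "length w \<le> 1 \<Longrightarrow> pb.dif M j f w = 0"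
proof -
 assume w: "length w \<le> 1"
 have "lin M (pb.hat j f w) = lin (\<lambda>v. 0) (pb.hat j f w)"
 proof (rule lin_cong)
  fix v assume v: "v \<in> keys (pb.hat j f w)"
  obtain L X R x where "w = L @ X @ R" "X \<noteq> []" "v = L @ x # R" using pb.keys_hat[OF v] by blast
  then have "length v < 2" using w by (cases X) auto
  then show "M v = 0" by (rule M_short)
 qed
 moreover have "lin f (pb.hat 1 M w) = lin (\<lambda>v. 0) (pb.hat 1 M w)"
 proof (rule lin_cong)
  fix v assume v: "v \<in> keys (pb.hat 1 M w)"
  obtain L X R x where "w = L @ X @ R" "x \<in> keys (M X)" using pb.keys_hat[OF v] by blast
  moreover from this have "M X = 0" using w by (intro M_short) auto
  ultimately show "f v = 0" by simp
 qed
 ultimately show ?thesis by (simp add: pb.dif_def)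
qed

text \<open>
 The primitive has to be replaced by its homogeneous part to get \<open>d d = 0\<close>; this does not affect the equation on targets since \<open>\<nu>\<close> is
 homogeneous.  The difference of \<open>\<nu>\<close> and the differential is closed and vanishes on targets, so the smallest source at
 which it is non-zero contradicts \<open>dif_match\<close>.
\<close>

theorem basis_acyclic:
 assumes \<nu>: "BC \<nu>" "pb.homog (j + 1) \<nu>" "\<And>w. length w \<le> 1 \<Longrightarrow> \<nu> w = 0" and closed: "\<And>w. pb.dif M (j + 1) \<nu> w = 0"
 shows "\<exists>E. BC E \<and> pb.homog j E \<and> (\<forall>w. pb.dif M j E w = \<nu> w)"
proof -
 define E where "E = pb.part j (prim j \<nu>)"
 have hE: "pb.homog j E" unfolding E_def by (rule pb.homog_part)
 have bE: "BC E" unfolding E_def by (rule BC_sub[OF BC_prim[of j \<nu>]]) (simp add: pb.lookup_part)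
 have hdE: "pb.homog (j + 1) (pb.dif M j E)" by (rule pb.homog_dif[OF homog_M hE])
 define Oj where "Oj = pb.part (j + 1) (prim j \<nu>)"
 have hdO: "pb.homog (j + 1 + 1) (pb.dif M j Oj)" unfolding Oj_def by (rule pb.homog_dif[OF homog_M pb.homog_part])
 have EO: "(\<lambda>w. E w + Oj w) = prim j \<nu>" unfolding E_def Oj_def pb.part_add ..
 have solve: "lookup (pb.dif M j E u) q' = lookup (\<nu> u) q'" if u: "chain u" "2 \<le> length u" "target u q'" "par u q'" for u q'
 proof (cases "even (pdeg q' - pb.wdeg u - (j + 1))")
  case True
  then have "lookup (pb.dif M j Oj u) q' = 0" by (intro pb.homogD[OF hdO]) simp
  moreover obtain w q where "chain w" "w \<noteq> []" "par w q" "\<not> target w q" "mate w q = u" "mate_out w q = q'" using matched[OF u] by blast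
  then have "lookup (pb.dif M j (\<lambda>w. E w + Oj w) u) q' = lookup (\<nu> u) q'" using prim_solves[of w q j \<nu>] unfolding EO by simp
  ultimately show ?thesis unfolding pb.dif_add by (simp add: lookup_add)
 next
  case False
  then show ?thesis using pb.homogD[OF hdE, of q' u] pb.homogD[OF \<nu>(2), of q' u] by simp
 qed
 define R where "R w = \<nu> w - pb.dif M j E w" for w
 have bR: "BC R"
 proof -
  have k: "chain w \<and> w \<noteq> [] \<and> par w q" if "q \<in> keys (R w)" for w q
  proof -
   have "q \<in> keys (\<nu> w) \<or> q \<in> keys (pb.dif M j E w)" using that keys_diff[of "\<nu> w" "pb.dif M j E w"] unfolding R_def by blast
   then show ?thesis
   proof
    assume "q \<in> keys (\<nu> w)" then show ?thesis by (rule BC_key[OF \<nu>(1)])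
   next
    assume "q \<in> keys (pb.dif M j E w)" then show ?thesis by (rule BC_key[OF BC_dif[OF bE]])
   qed
  qed
  then show ?thesis by (rule BC_I)
 qed
 have R0: "R w = 0" if "length w \<le> 1" for w using \<nu>(3) dif_short that by (simp add: R_def)
 have RU: "lookup (R u) q' = 0" if "target u q'" for u q'
 proof (rule ccontr)
  assume n: "lookup (R u) q' \<noteq> 0"
  then have "q' \<in> keys (R u)" by (simp add: in_keys_iff)
  then have "chain u" "par u q'" using BC_key[OF bR] by blast+
  moreover have "2 \<le> length u" using R0[of u] n by (cases "length u \<le> 1") auto
  ultimately show False using solve[of u q'] n that by (simp add: R_def lookup_minus)
 qed
 have dR: "pb.dif M (j + 1) R w = 0" for w
  unfolding R_def[abs_def] pb.dif_diff closed dif_M_dif_M[OF hE] by simp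
 have "R w = 0" for w
 proof (induction w rule: wf_induct_rule[OF wf_smaller])
  case (1 w)
  show ?case
  proof (rule poly_mapping_eqI)
   fix q
   show "lookup (R w) q = lookup 0 q"
   proof (rule ccontr)
    assume n: "lookup (R w) q \<noteq> lookup 0 q"
    then have "q \<in> keys (R w)" by (simp add: in_keys_iff)
    then have w: "chain w" "w \<noteq> []" "par w q" using BC_key[OF bR] by blast+
    have nU: "\<not> target w q"
    proof
     assume "target w q"
     from RU[OF this] n show False by simp
    qed
    have "lookup (pb.dif M (j + 1) R (mate w q)) (mate_out w q) = match_coeff (j + 1) w q * lookup (R w) q"
     by (rule match_coeff(2)[OF w nU bR]) (use RU 1 in blast)+
    then show False using dR n match_coeff(1)[OF w nU, of "j + 1"] by simp
   qed
  qed
 qed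
 then have "pb.dif M j E w = \<nu> w" for w by (simp add: R_def)
 then show ?thesis using bE hE by blast
qed

end

section \<open>Cochains and their values on basis sequences\<close>

lemma mlin_Nil [simp]: "mlin f [] = f []"
 by (simp add: mlin_def)

lemma finite_listset: "\<forall>A\<in>set As. finite A \<Longrightarrow> finite (listset As)"
proof (induction As)
 case (Cons A As)
 have "set_Cons A (listset As) = (\<lambda>(x, xs). x # xs) ` (A \<times> listset As)" by (auto simp: set_Cons_def)
 with Cons show ?case by simp
qed simp

text \<open>
 The multilinear extension is an iterated linear extension.
\<close>

lemma mlin_Cons: "mlin f (x # xs) = lin (\<lambda>p. mlin (\<lambda>ps. f (p # ps)) xs) x"
proof -
 let ?L = "listset (map keys xs)"
 have fin: "finite ?L" by (rule finite_listset) auto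
 have "listset (map keys (x # xs)) = (\<lambda>(p, ps). p # ps) ` (keys x \<times> ?L)" by (auto simp: set_Cons_def)
 moreover have "inj_on (\<lambda>(p, ps). p # ps) (keys x \<times> ?L)" by (auto simp: inj_on_def)
 ultimately have "mlin f (x # xs) = (\<Sum>(p, ps)\<in>keys x \<times> ?L. smul (\<Prod>i<length (x # xs). lookup ((x # xs) ! i) ((p # ps) ! i)) (f (p # ps)))"
  unfolding mlin_def by (simp only: sum.reindex o_def case_prod_unfold)
 also have "\<dots> = (\<Sum>(p, ps)\<in>keys x \<times> ?L. smul (lookup x p) (smul (\<Prod>i<length xs. lookup (xs ! i) (ps ! i)) (f (p # ps))))"
  by (simp only: length_Cons prod.lessThan_Suc_shift nth_Cons_0 nth_Cons_Suc smul_smul)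
 also have "\<dots> = (\<Sum>p\<in>keys x. \<Sum>ps\<in>?L. smul (lookup x p) (smul (\<Prod>i<length xs. lookup (xs ! i) (ps ! i)) (f (p # ps))))"
  by (rule sum.cartesian_product[symmetric])
 finally show ?thesis unfolding lin_def mlin_def smul_sum_right .
qed

lemma mlin_bvec: "mlin f (map bvec ps) = f ps"
 by (induction ps arbitrary: f) (simp_all add: mlin_Cons)

lemma mlin_append: "mlin f (us @ vs) = mlin (\<lambda>ps. mlin (\<lambda>qs. f (ps @ qs)) vs) us"
 by (induction us arbitrary: f) (simp_all add: mlin_Cons)

lemma lin_mlin: "lin g (mlin f xs) = mlin (\<lambda>ps. lin g (f ps)) xs"
 by (induction xs arbitrary: f) (simp_all add: mlin_Cons lin_lin)

lemma mlin_fun_add: "mlin (\<lambda>ps. f ps + g ps) xs = mlin f xs + mlin g xs"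
 by (induction xs arbitrary: f g) (simp_all add: mlin_Cons lin_fun_add)

lemma mlin_fun_smul: "mlin (\<lambda>ps. smul c (f ps)) xs = smul c (mlin f xs)"
 by (induction xs arbitrary: f) (simp_all add: mlin_Cons lin_fun_smul)

lemma mlin_fun_0 [simp]: "mlin (\<lambda>ps. 0) xs = 0"
 by (induction xs) (simp_all add: mlin_Cons)

lemma mlin_cong:
 "(\<And>ps. length ps = length xs \<Longrightarrow> set ps \<subseteq> K \<Longrightarrow> f ps = g ps) \<Longrightarrow> (\<forall>x\<in>set xs. keys x \<subseteq> K) \<Longrightarrow> mlin f xs = mlin g xs"
proof (induction xs arbitrary: f g)
 case (Cons x xs)
 show ?case unfolding mlin_Cons
 proof (rule lin_cong)
  fix p assume "p \<in> keys x"
  then have "p \<in> K" using Cons.prems by auto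
  then show "mlin (\<lambda>ps. f (p # ps)) xs = mlin (\<lambda>ps. g (p # ps)) xs"
   using Cons.prems by (intro Cons.IH) auto
 qed
qed simp

lemma keys_mlin: "(\<And>ps. keys (f ps) \<subseteq> K) \<Longrightarrow> keys (mlin f xs) \<subseteq> K"
proof (induction xs arbitrary: f)
 case (Cons x xs)
 show ?case unfolding mlin_Cons
 proof
  fix q assume "q \<in> keys (lin (\<lambda>p. mlin (\<lambda>ps. f (p # ps)) xs) x)"
  from keys_linD[OF this] obtain p where "q \<in> keys (mlin (\<lambda>ps. f (p # ps)) xs)" by blast
  then show "q \<in> K" using Cons.IH[of "\<lambda>ps. f (p # ps)"] Cons.prems by blast
 qed
qed simp

lemma Gtl_D: "x \<in> Gtl Q \<Longrightarrow> p \<in> keys x \<Longrightarrow> p \<in> nz_paths Q" by (auto simp: Gtl_def)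

lemma Gtl_bvec [simp]: "bvec p \<in> Gtl Q \<longleftrightarrow> p \<in> nz_paths Q" by (simp add: Gtl_def)

lemma Gtl_0 [simp]: "0 \<in> Gtl Q" by (simp add: Gtl_def)

lemma Gtl_add: "x \<in> Gtl Q \<Longrightarrow> y \<in> Gtl Q \<Longrightarrow> x + y \<in> Gtl Q"
 using keys_add[of x y] unfolding Gtl_def by blast

lemma Gtl_smul: "x \<in> Gtl Q \<Longrightarrow> smul c x \<in> Gtl Q"
 using keys_smul_subset[of c x] unfolding Gtl_def by blast

lemma gmul_lin: "gmul Q x y = lin (\<lambda>p. lin (path_mul Q p) y) x"
 unfolding gmul_def lin_def smul_sum_right smul_smul ..

lemma gmul_add_right: "gmul Q x (y + z) = gmul Q x y + gmul Q x z"
 unfolding gmul_lin lin_add lin_fun_add ..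

lemma gmul_add_left: "gmul Q (x + y) z = gmul Q x z + gmul Q y z"
 unfolding gmul_lin lin_add ..

context gentle_quiver begin

abbreviation "G \<equiv> Gtl Q"

lemma idem_nz: "v \<in> q_verts Q \<Longrightarrow> (v, []) \<in> nz" by (simp add: nz_iff)

text \<open>
 An idempotent element acts on each path by a scalar that depends on its source only.
\<close>

lemma gmul_idem_right: "x \<in> G \<Longrightarrow> e \<in> Gtl0 Q \<Longrightarrow> gmul Q x e = lin (\<lambda>p. smul (lookup e (fst p, [])) (bvec p)) x"
 unfolding gmul_lin
proof (rule lin_cong)
 fix p assume e: "e \<in> Gtl0 Q" and "x \<in> G" "p \<in> keys x"
 then have p: "p \<in> nz" by (simp add: Gtl_D)
 have "lin (path_mul Q p) e = lin (\<lambda>q. if q = (fst p, []) then bvec p else 0) e"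
 proof (rule lin_cong)
  fix q assume "q \<in> keys e"
  then obtain v where q: "q = (v, [])" "v \<in> q_verts Q" using e by (auto simp: Gtl0_def)
  show "path_mul Q p q = (if q = (fst p, []) then bvec p else 0)"
  proof (cases "fst p = v")
   case True
   then show ?thesis using comp_idem_right[of q p] idem_nz q p by (simp add: path_mul_def)
  next
   case False
   then show ?thesis using q by (auto simp: path_mul_def comp_nz_iff path_head_def)
  qed
 qed
 also have "\<dots> = (\<Sum>q\<in>keys e. if q = (fst p, []) then smul (lookup e (fst p, [])) (bvec p) else 0)"
  unfolding lin_def by (rule sum.cong) auto
 also have "\<dots> = smul (lookup e (fst p, [])) (bvec p)" by (simp add: in_keys_iff)
 finally show "lin (path_mul Q p) e = smul (lookup e (fst p, [])) (bvec p)" .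
qed

lemma gmul_idem_left: "y \<in> G \<Longrightarrow> e \<in> Gtl0 Q \<Longrightarrow> gmul Q e y = lin (\<lambda>q. smul (lookup e (path_head Q q, [])) (bvec q)) y"
proof -
 assume y: "y \<in> G" and e: "e \<in> Gtl0 Q"
 have "gmul Q e y = lin (\<lambda>q. lin (\<lambda>p. path_mul Q p q) e) y" unfolding gmul_lin by (rule lin_swap)
 also have "\<dots> = lin (\<lambda>q. smul (lookup e (path_head Q q, [])) (bvec q)) y"
 proof (rule lin_cong)
  fix q assume "q \<in> keys y"
  then have q: "q \<in> nz" using y by (simp add: Gtl_D)
  have "lin (\<lambda>p. path_mul Q p q) e = lin (\<lambda>p. if p = (path_head Q q, []) then bvec q else 0) e"
  proof (rule lin_cong)
   fix p assume "p \<in> keys e"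
   then obtain v where p: "p = (v, [])" "v \<in> q_verts Q" using e by (auto simp: Gtl0_def)
   show "path_mul Q p q = (if p = (path_head Q q, []) then bvec q else 0)"
   proof (cases "path_head Q q = v")
    case True
    then show ?thesis using comp_idem_left[of p q] idem_nz q p by (simp add: path_mul_def)
   next
    case False
    then show ?thesis using p by (auto simp: path_mul_def comp_nz_iff)
   qed
  qed
  also have "\<dots> = (\<Sum>p\<in>keys e. if p = (path_head Q q, []) then smul (lookup e (path_head Q q, [])) (bvec q) else 0)"
   unfolding lin_def by (rule sum.cong) auto
  also have "\<dots> = smul (lookup e (path_head Q q, [])) (bvec q)" by (simp add: in_keys_iff)
  finally show "lin (\<lambda>p. path_mul Q p q) e = smul (lookup e (path_head Q q, [])) (bvec q)" .
 qed
 finally show ?thesis .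
qed

text \<open>
 The passage from values on basis sequences to cochains; \<open>ev\<close> is the passage back.
\<close>

definition ext :: "(('v, 'e) qpath list \<Rightarrow> ('v, 'e) qvec) \<Rightarrow> ('v, 'e) cochain" where
 "ext f xs = (if set xs \<subseteq> G then mlin f xs else 0)"

definition ev :: "('v, 'e) cochain \<Rightarrow> ('v, 'e) qpath list \<Rightarrow> ('v, 'e) qvec" where
 "ev \<nu> ps = \<nu> (map bvec ps)"

lemma set_bvec: "set (map bvec ps) \<subseteq> G \<longleftrightarrow> set ps \<subseteq> nz" by auto

lemma ext_bvec: "ext f (map bvec ps) = (if set ps \<subseteq> nz then f ps else 0)"
 unfolding ext_def set_bvec mlin_bvec ..

lemma BC_ext_bvec: "BC f \<Longrightarrow> ext f (map bvec ps) = f ps"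
proof (cases "set ps \<subseteq> nz")
 case True
 then show ?thesis by (simp only: ext_bvec if_True)
next
 case False
 assume "BC f"
 then have "f ps = 0" using False unfolding BC_def chain_def by blast
 then show ?thesis by (simp only: ext_bvec False if_False)
qed

lemma BC_nz: "BC f \<Longrightarrow> keys (f ps) \<subseteq> nz"
proof
 fix q assume "BC f" "q \<in> keys (f ps)"
 then have "par ps q" using BC_key[of f q ps] by blast
 then show "q \<in> nz" by (simp add: par_def)
qed

lemma ext_G: "(\<And>ps. keys (f ps) \<subseteq> nz) \<Longrightarrow> ext f xs \<in> G"
 using keys_mlin[of f nz xs] by (simp add: ext_def Gtl_def)

lemma ext_add_slot: "x \<in> G \<Longrightarrow> y \<in> G \<Longrightarrow> ext f (us @ (x + y) # vs) = ext f (us @ x # vs) + ext f (us @ y # vs)"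
 by (simp add: ext_def Gtl_add mlin_append mlin_Cons lin_add mlin_fun_add)

lemma ext_smul_slot: "x \<in> G \<Longrightarrow> ext f (us @ smul c x # vs) = smul c (ext f (us @ x # vs))"
 by (simp add: ext_def Gtl_smul mlin_append mlin_Cons lin_smul mlin_fun_smul)

lemma keys_lin_scale: "keys (lin (\<lambda>p. smul (c p) (bvec p)) x) \<subseteq> keys x"
proof
 fix q assume "q \<in> keys (lin (\<lambda>p. smul (c p) (bvec p)) x)"
 from keys_linD[OF this] obtain p where p: "p \<in> keys x" "q \<in> keys (smul (c p) (bvec p))" by blast
 then show "q \<in> keys x" using keys_smul_subset[of "c p" "bvec p"] by auto
qed

lemma Gtl_gmul_right: "gmul Q x e \<in> G" if "x \<in> G" "e \<in> Gtl0 Q"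
proof -
 have "keys (gmul Q x e) \<subseteq> keys x" unfolding gmul_idem_right[OF that] by (rule keys_lin_scale)
 then show ?thesis using that(1) unfolding Gtl_def by blast
qed

lemma Gtl_gmul_left: "gmul Q e x \<in> G" if "x \<in> G" "e \<in> Gtl0 Q"
proof -
 have "keys (gmul Q e x) \<subseteq> keys x" unfolding gmul_idem_left[OF that] by (rule keys_lin_scale)
 then show ?thesis using that(1) unfolding Gtl_def by blast
qed

lemma ext_in_CC:
 assumes f: "BC f"
 shows "ext f \<in> CC Q"
proof -
 have fz: "f ps = 0" if "\<not> chain ps" for ps using f that by (auto simp: BC_def)
 have 0: "ext f [] = 0" using f by (auto simp: ext_def BC_def)
 have mid: "ext f (us @ gmul Q x e # y # vs) = ext f (us @ x # gmul Q e y # vs)"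
  if "x \<in> G" "y \<in> G" "e \<in> Gtl0 Q" for us vs x y e
 proof -
  have "smul (lookup e (fst p, [])) (mlin (\<lambda>qs. f (us' @ p # q # qs)) vs)
   = smul (lookup e (path_head Q q, [])) (mlin (\<lambda>qs. f (us' @ p # q # qs)) vs)" for us' p q
  proof (cases "fst p = path_head Q q")
   case False
   then have "f (us' @ p # q # qs) = 0" for qs by (intro fz) (auto simp: chain_append)
   then show ?thesis by simp
  qed simp
  note eq = this
  have "mlin f (us @ gmul Q x e # y # vs) = mlin f (us @ x # gmul Q e y # vs)"
   unfolding gmul_idem_left[OF that(2,3)] gmul_idem_right[OF that(1,3)] mlin_append mlin_Cons lin_lin lin_smul lin_bvec
    lin_fun_smul[symmetric] eq ..
  then show ?thesis using Gtl_gmul_left[OF that(2,3)] Gtl_gmul_right[OF that(1,3)] that(1,2) unfolding ext_def by simp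
 qed
 have left: "ext f (gmul Q e x # xs) = gmul Q e (ext f (x # xs))" if "x \<in> G" "e \<in> Gtl0 Q" for x xs e
 proof (cases "set xs \<subseteq> G")
  case True
  have "lin (\<lambda>q. smul (lookup e (path_head Q q, [])) (bvec q)) (f (p # ps)) = smul (lookup e (path_head Q p, [])) (f (p # ps))" for p ps
  proof -
   have "lin (\<lambda>q. smul (lookup e (path_head Q q, [])) (bvec q)) (f (p # ps)) = lin (\<lambda>q. smul (lookup e (path_head Q p, [])) (bvec q)) (f (p # ps))"
    by (rule lin_cong) (use BC_key[OF f] in \<open>auto simp: par_def\<close>)
   then show ?thesis by (simp add: lin_fun_smul)
  qed
  note * = this
  have G: "ext f (x # xs) \<in> G" by (rule ext_G[OF BC_nz[OF f]])
  have "gmul Q e (ext f (x # xs)) = lin (\<lambda>q. smul (lookup e (path_head Q q, [])) (bvec q)) (lin (\<lambda>p. mlin (\<lambda>ps. f (p # ps)) xs) x)"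
   unfolding gmul_idem_left[OF G that(2)] using that True by (simp add: ext_def mlin_Cons)
  also have "\<dots> = lin (\<lambda>p. smul (lookup e (path_head Q p, [])) (mlin (\<lambda>ps. f (p # ps)) xs)) x"
   unfolding lin_lin lin_mlin * mlin_fun_smul ..
  also have "\<dots> = mlin f (gmul Q e x # xs)"
   unfolding gmul_idem_left[OF that] mlin_Cons lin_lin lin_smul lin_bvec ..
  also have "\<dots> = ext f (gmul Q e x # xs)"
   using Gtl_gmul_left[OF that] True by (simp add: ext_def)
  finally show ?thesis by simp
 next
  case False
  then show ?thesis by (simp add: ext_def gmul_lin)
 qed
 have right: "ext f (xs @ [gmul Q x e]) = gmul Q (ext f (xs @ [x])) e" if "x \<in> G" "e \<in> Gtl0 Q" for x xs e
 proof (cases "set xs \<subseteq> G")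
  case True
  have "lin (\<lambda>q. smul (lookup e (fst q, [])) (bvec q)) (f (ps @ [p])) = smul (lookup e (fst p, [])) (f (ps @ [p]))" for p ps
  proof -
   have "lin (\<lambda>q. smul (lookup e (fst q, [])) (bvec q)) (f (ps @ [p])) = lin (\<lambda>q. smul (lookup e (fst p, [])) (bvec q)) (f (ps @ [p]))"
    by (rule lin_cong) (use BC_key[OF f] in \<open>fastforce simp: par_def\<close>)
   then show ?thesis by (simp add: lin_fun_smul)
  qed
  note * = this
  have G: "ext f (xs @ [x]) \<in> G" by (rule ext_G[OF BC_nz[OF f]])
  have "gmul Q (ext f (xs @ [x])) e = lin (\<lambda>q. smul (lookup e (fst q, [])) (bvec q)) (mlin (\<lambda>ps. lin (\<lambda>p. f (ps @ [p])) x) xs)"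
   unfolding gmul_idem_right[OF G that(2)] using that True by (simp add: ext_def mlin_append mlin_Cons)
  also have "\<dots> = mlin (\<lambda>ps. lin (\<lambda>p. smul (lookup e (fst p, [])) (f (ps @ [p]))) x) xs"
   unfolding lin_mlin lin_lin * ..
  also have "\<dots> = mlin f (xs @ [gmul Q x e])"
   unfolding gmul_idem_right[OF that] mlin_append mlin_Cons mlin_Nil lin_lin lin_smul lin_bvec ..
  also have "\<dots> = ext f (xs @ [gmul Q x e])"
   using Gtl_gmul_right[OF that] True by (simp add: ext_def)
  finally show ?thesis by simp
 next
  case False
  then show ?thesis by (simp add: ext_def gmul_lin)
 qed
 show ?thesis
  unfolding CC_def mem_Collect_eq
 proof (intro conjI allI ballI impI; (elim conjE)?)
  fix xs :: "('v, 'e) qvec list" assume "\<not> set xs \<subseteq> G"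
  then show "ext f xs = 0" by (simp add: ext_def)
 qed (use ext_G[OF BC_nz[OF f]] mid left right ext_add_slot ext_smul_slot in \<open>auto simp: 0 gmul_lin\<close>)
qed

lemma CC_D:
 assumes "\<nu> \<in> CC Q"
 shows "\<not> set xs \<subseteq> G \<Longrightarrow> \<nu> xs = 0" "set xs \<subseteq> G \<Longrightarrow> \<nu> xs \<in> G"
  "set us \<subseteq> G \<Longrightarrow> set vs \<subseteq> G \<Longrightarrow> x \<in> G \<Longrightarrow> y \<in> G \<Longrightarrow> \<nu> (us @ (x + y) # vs) = \<nu> (us @ x # vs) + \<nu> (us @ y # vs)"
  "set us \<subseteq> G \<Longrightarrow> set vs \<subseteq> G \<Longrightarrow> x \<in> G \<Longrightarrow> \<nu> (us @ smul c x # vs) = smul c (\<nu> (us @ x # vs))"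
  "set us \<subseteq> G \<Longrightarrow> set vs \<subseteq> G \<Longrightarrow> x \<in> G \<Longrightarrow> y \<in> G \<Longrightarrow> e \<in> Gtl0 Q \<Longrightarrow>
    \<nu> (us @ gmul Q x e # y # vs) = \<nu> (us @ x # gmul Q e y # vs)"
  "set xs \<subseteq> G \<Longrightarrow> x \<in> G \<Longrightarrow> e \<in> Gtl0 Q \<Longrightarrow> \<nu> (gmul Q e x # xs) = gmul Q e (\<nu> (x # xs))"
  "set xs \<subseteq> G \<Longrightarrow> x \<in> G \<Longrightarrow> e \<in> Gtl0 Q \<Longrightarrow> \<nu> (xs @ [gmul Q x e]) = gmul Q (\<nu> (xs @ [x])) e"
  "e \<in> Gtl0 Q \<Longrightarrow> gmul Q e (\<nu> []) = gmul Q (\<nu> []) e"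
 using assms unfolding CC_def by blast+

lemma CC_G: "\<nu> \<in> CC Q \<Longrightarrow> \<nu> xs \<in> G"
 using CC_D(1,2)[of \<nu> xs] by (cases "set xs \<subseteq> G") auto

lemma CC_lin:
 assumes \<nu>: "\<nu> \<in> CC Q" and x: "x \<in> G" "set us \<subseteq> G" "set vs \<subseteq> G"
 shows "\<nu> (us @ x # vs) = lin (\<lambda>p. \<nu> (us @ bvec p # vs)) x"
proof -
 have "(\<Sum>p\<in>K. smul (lookup x p) (bvec p)) \<in> G \<and>
  \<nu> (us @ (\<Sum>p\<in>K. smul (lookup x p) (bvec p)) # vs) = (\<Sum>p\<in>K. smul (lookup x p) (\<nu> (us @ bvec p # vs)))"
  if "finite K" "K \<subseteq> keys x" for K
  using that
 proof (induction K)
  case empty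
  have "\<nu> (us @ smul 0 0 # vs) = smul 0 (\<nu> (us @ 0 # vs))" by (rule CC_D(4)[OF \<nu>]) (use x in auto)
  then show ?case by simp
 next
  case (insert p K)
  then have p: "bvec p \<in> G" using Gtl_D[OF x(1)] by auto
  then have "smul (lookup x p) (bvec p) \<in> G" by (rule Gtl_smul)
  then show ?case using insert x CC_D(3)[OF \<nu>] CC_D(4)[OF \<nu>] p by (simp add: Gtl_add)
 qed
 from this[OF finite_keys order_refl] show ?thesis
  using lin_id[of x] by (simp add: lin_def)
qed

lemma CC_mlin:
 assumes \<nu>: "\<nu> \<in> CC Q"
 shows "set ps \<subseteq> nz \<Longrightarrow> set xs \<subseteq> G \<Longrightarrow> \<nu> (map bvec ps @ xs) = mlin (\<lambda>qs. ev \<nu> (ps @ qs)) xs"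
proof (induction xs arbitrary: ps)
 case (Cons x xs)
 have "\<nu> (map bvec ps @ x # xs) = lin (\<lambda>p. \<nu> (map bvec ps @ bvec p # xs)) x"
  by (rule CC_lin[OF \<nu>]) (use Cons.prems in auto)
 also have "\<dots> = lin (\<lambda>p. mlin (\<lambda>qs. ev \<nu> (ps @ p # qs)) xs) x"
 proof (rule lin_cong)
  fix p assume "p \<in> keys x"
  then have "p \<in> nz" using Cons.prems(2) Gtl_D[of x Q p] by simp
  then show "\<nu> (map bvec ps @ bvec p # xs) = mlin (\<lambda>qs. ev \<nu> (ps @ p # qs)) xs"
   using Cons.IH[of "ps @ [p]"] Cons.prems by simp
 qed
 finally show ?case by (simp add: mlin_Cons)
qed (simp add: ev_def)

lemma CC_ext: "\<nu> \<in> CC Q \<Longrightarrow> \<nu> = ext (ev \<nu>)"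
 using CC_mlin[of \<nu> "[]"] CC_D(1)[of \<nu>] by (auto simp: ext_def fun_eq_iff)

lemma idem_Gtl0: "v \<in> q_verts Q \<Longrightarrow> bvec (v, []) \<in> Gtl0 Q" by (simp add: Gtl0_def)

lemma CC_zero: "\<nu> \<in> CC Q \<Longrightarrow> \<nu> (us @ 0 # vs) = 0"
 using CC_D(1)[of \<nu> "us @ 0 # vs"] CC_D(4)[of \<nu> us vs 0 0] by (cases "set us \<subseteq> G \<and> set vs \<subseteq> G") auto

text \<open>
 Moving the idempotent of a vertex between neighbouring arguments, or out of the cochain at either end, shows that the value is zero
 unless the vertices agree.
\<close>

lemma BC_ev:
 assumes \<nu>: "\<nu> \<in> CC Q" and 0: "\<nu> [] = 0"
 shows "BC (ev \<nu>)"
proof -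
 have nz: "set ps \<subseteq> nz \<and> ps \<noteq> []" if "ev \<nu> ps \<noteq> 0" for ps
 proof
  have "set (map bvec ps) \<subseteq> G" using that CC_D(1)[OF \<nu>, of "map bvec ps"] unfolding ev_def by blast
  then show "set ps \<subseteq> nz" by (simp only: set_bvec)
  show "ps \<noteq> []" using that 0 by (auto simp: ev_def)
 qed
 have adj: "fst p = path_head Q q" if n: "ev \<nu> (us @ p # q # vs) \<noteq> 0" for us p q vs
 proof (rule ccontr)
  assume ne: "fst p \<noteq> path_head Q q"
  have s: "set (us @ p # q # vs) \<subseteq> nz" using nz[OF n] by blast
  then have pq: "p \<in> nz" "q \<in> nz" by auto
  let ?e = "bvec (fst p, []) :: ('v, 'e) qvec"
  have e: "?e \<in> Gtl0 Q" using idem_Gtl0 fst_nz[OF pq(1)] by blast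
  have "gmul Q (bvec p) ?e = bvec p" using gmul_idem_right[of "bvec p" ?e] e pq by (simp add: lookup_bvec)
  moreover have "gmul Q ?e (bvec q) = 0" using gmul_idem_left[of "bvec q" ?e] e pq ne by (simp add: lookup_bvec)
  moreover have "\<nu> (map bvec us @ gmul Q (bvec p) ?e # bvec q # map bvec vs) = \<nu> (map bvec us @ bvec p # gmul Q ?e (bvec q) # map bvec vs)"
   by (rule CC_D(5)[OF \<nu> _ _ _ _ e]) (use s in auto)
  ultimately have "ev \<nu> (us @ p # q # vs) = \<nu> ((map bvec us @ [bvec p]) @ 0 # map bvec vs)" by (simp add: ev_def)
  also have "\<dots> = 0" by (rule CC_zero[OF \<nu>])
  finally show False using n by simp
 qed
 have ch: "chain ps \<and> ps \<noteq> []" if n: "ev \<nu> ps \<noteq> 0" for ps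
 proof -
  have "successively (\<lambda>p q. fst p = path_head Q q) ps"
   unfolding successively_conv_nth
  proof (intro allI impI)
   fix i assume i: "Suc i < length ps"
   then have "ps = take i ps @ ps ! i # ps ! Suc i # drop (Suc (Suc i)) ps"
    by (metis Cons_nth_drop_Suc Suc_lessD append_take_drop_id)
   then show "fst (ps ! i) = path_head Q (ps ! Suc i)" using adj n by metis
  qed
  then show ?thesis using nz[OF n] by (simp add: chain_def)
 qed
 have "par ps q" if q: "q \<in> keys (ev \<nu> ps)" for ps q
 proof -
  have n: "ev \<nu> ps \<noteq> 0" using q by auto
  then have s: "set ps \<subseteq> nz" "ps \<noteq> []" using nz by blast+
  have G: "ev \<nu> ps \<in> G" unfolding ev_def by (rule CC_G[OF \<nu>])
  have qn: "q \<in> nz" using Gtl_D[OF G q] .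
  have "path_head Q q = path_head Q (hd ps)"
  proof (rule ccontr)
   assume ne: "path_head Q q \<noteq> path_head Q (hd ps)"
   obtain p ps' where ps: "ps = p # ps'" using s by (cases ps) auto
   let ?e = "bvec (path_head Q p, []) :: ('v, 'e) qvec"
   have e: "?e \<in> Gtl0 Q" using idem_Gtl0 head_in_verts[of p] s ps by auto
   have "gmul Q ?e (bvec p) = bvec p" using gmul_idem_left[of "bvec p" ?e] e ps s by (simp add: lookup_bvec)
   moreover have "\<nu> (gmul Q ?e (bvec p) # map bvec ps') = gmul Q ?e (\<nu> (bvec p # map bvec ps'))"
    by (rule CC_D(6)[OF \<nu> _ _ e]) (use s ps in auto)
   ultimately have "ev \<nu> ps = gmul Q ?e (ev \<nu> ps)" by (simp add: ev_def ps)
   then have eq: "ev \<nu> ps = lin (\<lambda>q. smul (lookup ?e (path_head Q q, [])) (bvec q)) (ev \<nu> ps)" using gmul_idem_left[OF G e] by simp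
   have "q \<in> keys (lin (\<lambda>q. smul (lookup ?e (path_head Q q, [])) (bvec q)) (ev \<nu> ps))" using q eq by simp
   from keys_linD[OF this] obtain q' where q': "q \<in> keys (smul (lookup ?e (path_head Q q', [])) (bvec q'))" by blast
   then have "q' = q" using keys_smul_subset[of "lookup ?e (path_head Q q', [])" "bvec q'"] by auto
   then show False using q' ne ps by (simp add: lookup_bvec)
  qed
  moreover have "fst q = fst (last ps)"
  proof (rule ccontr)
   assume ne: "fst q \<noteq> fst (last ps)"
   obtain p ps' where ps: "ps = ps' @ [p]" using s by (cases ps rule: rev_cases) auto
   let ?e = "bvec (fst p, []) :: ('v, 'e) qvec"
   have e: "?e \<in> Gtl0 Q" using idem_Gtl0 fst_nz[of p] s ps by auto
   have "gmul Q (bvec p) ?e = bvec p" using gmul_idem_right[of "bvec p" ?e] e ps s by (simp add: lookup_bvec)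
   moreover have "\<nu> (map bvec ps' @ [gmul Q (bvec p) ?e]) = gmul Q (\<nu> (map bvec ps' @ [bvec p])) ?e"
    by (rule CC_D(7)[OF \<nu> _ _ e]) (use s ps in auto)
   ultimately have "ev \<nu> ps = gmul Q (ev \<nu> ps) ?e" by (simp add: ev_def ps)
   then have eq: "ev \<nu> ps = lin (\<lambda>q. smul (lookup ?e (fst q, [])) (bvec q)) (ev \<nu> ps)" using gmul_idem_right[OF G e] by simp
   have "q \<in> keys (lin (\<lambda>q. smul (lookup ?e (fst q, [])) (bvec q)) (ev \<nu> ps))" using q eq by simp
   from keys_linD[OF this] obtain q' where q': "q \<in> keys (smul (lookup ?e (fst q', [])) (bvec q'))" by blast
   then have "q' = q" using keys_smul_subset[of "lookup ?e (fst q', [])" "bvec q'"] by auto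
   then show False using q' ne ps by (simp add: lookup_bvec)
  qed
  ultimately show ?thesis using qn by (simp add: par_def)
 qed
 with ch show ?thesis unfolding BC_def by blast
qed

end

section \<open>The differential and the cohomology class of a cochain\<close>

context graded_basis begin

lemma part_homog: "homog j f \<Longrightarrow> part j f = f"
proof (rule HOL.ext, rule poly_mapping_eqI)
 fix ws q assume "homog j f"
 then show "lookup (part j f ws) q = lookup (f ws) q"
  unfolding lookup_part using homogD[of j f q ws] by simp
qed

lemma part_homog_0: "homog i f \<Longrightarrow> odd (i - j) \<Longrightarrow> part j f = (\<lambda>ws. 0)"
proof (rule HOL.ext, rule poly_mapping_eqI)
 fix ws q assume f: "homog i f" and o: "odd (i - j)"
 have "lookup (f ws) q = 0" if e: "even (dg q - wdeg ws - j)"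
 proof (rule homogD[OF f])
  show "odd (dg q - wdeg ws - i)" using e o by presburger
 qed
 then show "lookup (part j f ws) q = lookup 0 q"
  unfolding lookup_part by simp
qed

lemma part_fun_add: "part j (\<lambda>w. f w + g w) ws = part j f ws + part j g ws"
 by (simp add: part_def lin_add)

lemma part_fun_smul: "part j (\<lambda>w. smul c (f w)) ws = smul c (part j f ws)"
 by (simp add: part_def lin_smul)

end

lemma lookup_degree_part: "lookup (degree_part Q m x) q = (if even (path_deg Q q - m) then lookup x q else 0)"
proof -
 let ?S = "{q \<in> keys x. even (path_deg Q q - m)}"
 have S: "finite ?S" by simp
 have "lookup (degree_part Q m x) q = (\<Sum>p\<in>?S. if p = q then lookup x q else 0)"
  unfolding degree_part_def lookup_sum by (rule sum.cong) (auto simp: lookup_single when_def)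
 also have "\<dots> = (if q \<in> ?S then lookup x q else 0)" by (rule sum.delta[OF S])
 also have "\<dots> = (if even (path_deg Q q - m) then lookup x q else 0)"
  by (cases "q \<in> keys x") (simp_all add: in_keys_iff)
 finally show ?thesis .
qed

text \<open>
 The positions of an insertion correspond to the decompositions of the sequence.
\<close>

lemma sum_insertions:
 fixes F :: "'p list \<Rightarrow> 'p list \<Rightarrow> 'p list \<Rightarrow> 'b :: comm_monoid_add"
 assumes F: "\<And>L R. F L [] R = 0"
 shows "(\<Sum>l\<le>length ps. \<Sum>i\<le>l. F (take (length ps - l) ps) (take (l - i) (drop (length ps - l) ps)) (drop (length ps - i) ps))
  = (\<Sum>(L, X, R)\<in>splits ps. F L X R)"
proof -
 let ?r = "length ps"
 let ?t = "\<lambda>(l, i). (take (?r - l) ps, take (l - i) (drop (?r - l) ps), drop (?r - i) ps)"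
 let ?S = "Sigma {..?r} (\<lambda>l. {..l})"
 let ?F = "\<lambda>(L, X, R). F L X R"
 have "(\<Sum>l\<le>?r. \<Sum>i\<le>l. F (take (?r - l) ps) (take (l - i) (drop (?r - l) ps)) (drop (?r - i) ps)) = (\<Sum>t\<in>?S. ?F (?t t))"
  by (subst sum.Sigma) (auto simp: case_prod_unfold)
 also have "\<dots> = (\<Sum>t\<in>{(l, i). i < l \<and> l \<le> ?r}. ?F (?t t))"
 proof (rule sum.mono_neutral_right)
  show "finite ?S" by simp
  show "{(l, i). i < l \<and> l \<le> ?r} \<subseteq> ?S" by auto
  show "\<forall>t\<in>?S - {(l, i). i < l \<and> l \<le> ?r}. ?F (?t t) = 0"
  proof
   fix t assume t: "t \<in> ?S - {(l, i). i < l \<and> l \<le> ?r}"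
   obtain l i where "t = (l, i)" by (cases t)
   moreover from this t have "i = l" by auto
   ultimately show "?F (?t t) = 0" using F by simp
  qed
 qed
 also have "\<dots> = (\<Sum>t\<in>splits ps. ?F t)"
 proof (rule sum.reindex_bij_witness[of _ "\<lambda>(L, X, R). (length X + length R, length R)" ?t])
  fix a assume a: "a \<in> {(l, i). i < l \<and> l \<le> ?r}"
  then obtain l i where li: "a = (l, i)" "i < l" "l \<le> ?r" by auto
  have d: "drop (?r - i) ps = drop (l - i) (drop (?r - l) ps)" using li by simp
  have "take (?r - l) ps @ take (l - i) (drop (?r - l) ps) @ drop (?r - i) ps = ps" unfolding d by (simp only: append_take_drop_id)
  moreover have "take (l - i) (drop (?r - l) ps) \<noteq> []" using li by simp
  ultimately show "?t a \<in> splits ps" unfolding splits_def li by simp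
  show "(case ?t a of (L, X, R) \<Rightarrow> (length X + length R, length R)) = a" using li by simp
  show "?F (?t a) = ?F (?t a)" ..
 next
  fix b assume "b \<in> splits ps"
  then obtain L X R where b: "b = (L, X, R)" "ps = L @ X @ R" "X \<noteq> []" by (auto simp: splits_def)
  then show "?t (case b of (L, X, R) \<Rightarrow> (length X + length R, length R)) = b"
   "(case b of (L, X, R) \<Rightarrow> (length X + length R, length R)) \<in> {(l, i). i < l \<and> l \<le> ?r}" by auto
 qed
 finally show ?thesis by (simp add: case_prod_unfold)
qed

context gentle_quiver begin

lemma wdeg_path_deg: "pb.wdeg ps = (\<Sum>p\<leftarrow>ps. path_deg Q p - 1)" "pb.wdeg ps = (\<Sum>p\<leftarrow>ps. path_deg Q p) - int (length ps)"
proof -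
 show "pb.wdeg ps = (\<Sum>p\<leftarrow>ps. path_deg Q p - 1)"
 proof (induction ps)
  case (Cons p ps)
  then show ?case using pdeg_def[of p] by (simp add: path_deg_ldeg)
 qed simp
 show "pb.wdeg ps = (\<Sum>p\<leftarrow>ps. path_deg Q p) - int (length ps)"
 proof (induction ps)
  case (Cons p ps)
  then show ?case using pdeg_def[of p] by (simp add: path_deg_ldeg)
 qed simp
qed

lemma hom_part_ext: "hom_part Q j \<nu> = ext (pb.part j (ev \<nu>))"
proof -
 have "degree_part Q ((\<Sum>p\<leftarrow>ps. path_deg Q p) + 1 + j - int (length ps)) (\<nu> (map bvec ps)) = pb.part j (ev \<nu>) ps" for ps
 proof (rule poly_mapping_eqI)
  fix q
  have eq: "path_deg Q q - ((\<Sum>p\<leftarrow>ps. path_deg Q p) + 1 + j - int (length ps)) = pdeg q - pb.wdeg ps - j"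
   unfolding wdeg_path_deg(2) pdeg_def[of q] path_deg_ldeg[of q] by simp
  show "lookup (degree_part Q ((\<Sum>p\<leftarrow>ps. path_deg Q p) + 1 + j - int (length ps)) (\<nu> (map bvec ps))) q = lookup (pb.part j (ev \<nu>) ps) q"
   unfolding lookup_degree_part pb.lookup_part ev_def eq ..
 qed
 then show ?thesis by (intro HOL.ext) (simp only: hom_part_def ext_def)
qed

lemma mu_ext: "mu Q = ext M"
 by (intro HOL.ext) (simp only: mu_def ext_def)

lemma ev_ext: "BC f \<Longrightarrow> ev (ext f) = f"
 by (intro HOL.ext) (simp only: ev_def BC_ext_bvec)

lemma ext_zero_slot: "ext f (us @ 0 # vs) = 0"
 using ext_smul_slot[of 0 f us 0 vs] by simp

lemma BC_Nil: "BC f \<Longrightarrow> f [] = 0"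
 unfolding BC_def by blast

lemma insertion_ext:
 assumes g: "BC g" and ps: "set ps \<subseteq> nz"
 shows "insertion Q (ext f) j (ext g) ps = lin f (pb.hat j g ps)"
proof -
 define F where "F L X R = smul (sg (pb.wdeg R * j)) (ext f (map bvec L @ ext g (map bvec X) # map bvec R))" for L X R
 have "insertion Q (ext f) j (ext g) ps = (\<Sum>l\<le>length ps. \<Sum>i\<le>l. F (take (length ps - l) ps) (take (l - i) (drop (length ps - l) ps)) (drop (length ps - i) ps))"
  unfolding insertion_def Let_def F_def wdeg_path_deg(1) take_map drop_map ..
 also have "\<dots> = (\<Sum>(L, X, R)\<in>splits ps. F L X R)"
 proof (rule sum_insertions)
  fix L R
  have "ext g (map bvec []) = 0" using BC_ext_bvec[OF g, of "[]"] BC_Nil[OF g] by simp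
  then show "F L [] R = 0" unfolding F_def by (simp only: ext_zero_slot smul_eq_0 simp_thms)
 qed
 also have "\<dots> = (\<Sum>(L, X, R)\<in>splits ps. smul (sg (pb.wdeg R * j)) (lin (\<lambda>x. f (L @ x # R)) (g X)))"
 proof (rule sum.cong[OF refl], clarify)
  fix L X R assume "(L, X, R) \<in> splits ps"
  then have "ps = L @ X @ R" by (simp add: splits_def)
  then have "set (map bvec L) \<subseteq> G" "set (map bvec R) \<subseteq> G" unfolding set_bvec using ps by auto
  moreover have "g X \<in> G" using BC_nz[OF g] by (simp add: Gtl_def)
  ultimately have "ext f (map bvec L @ g X # map bvec R) = mlin f (map bvec L @ g X # map bvec R)"
   unfolding ext_def by simp
  then show "F L X R = smul (sg (pb.wdeg R * j)) (lin (\<lambda>x. f (L @ x # R)) (g X))"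
   unfolding F_def BC_ext_bvec[OF g] by (simp add: mlin_append mlin_Cons mlin_bvec)
 qed
 also have "\<dots> = lin f (pb.hat j g ps)"
  unfolding pb.hat_def lin_sum case_prod_beta lin_smul lin_lin lin_bvec ..
 finally show ?thesis .
qed

lemma BC_part: "BC f \<Longrightarrow> BC (pb.part j f)"
 by (erule BC_sub) (simp add: pb.lookup_part)

lemma ev_mu: "ev (mu Q) = M"
 unfolding mu_ext by (rule ev_ext[OF BC_M])

lemma BC_0: "BC (\<lambda>w. 0)" by (simp add: BC_def)

text \<open>
 Only the odd part of \<open>\<mu>\<close> is non-zero, so the bracket has one term for each parity of \<open>\<nu>\<close>.
\<close>

lemma hoch_diff_eq:
 assumes B: "BC (ev \<nu>)"
 shows "hoch_diff Q \<nu> = ext (\<lambda>ps. pb.dif M 0 (pb.part 0 (ev \<nu>)) ps + pb.dif M 1 (pb.part 1 (ev \<nu>)) ps)"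
proof -
 let ?\<nu> = "\<lambda>j. pb.part j (ev \<nu>)"
 have h0: "hom_part Q 0 (mu Q) = ext (\<lambda>w. 0)"
  unfolding hom_part_ext ev_mu by (simp add: pb.part_homog_0[OF homog_M])
 have h1: "hom_part Q 1 (mu Q) = ext M"
  unfolding hom_part_ext ev_mu by (simp add: pb.part_homog[OF homog_M])
 have b0: "hom_bracket Q 0 (hom_part Q 0 (mu Q)) j (hom_part Q j \<nu>) ps = 0" if "set ps \<subseteq> nz" for j ps
  unfolding h0 unfolding hom_part_ext hom_bracket_def insertion_ext[OF BC_part[OF B] that] insertion_ext[OF BC_0 that]
  by (simp add: pb.hat_eq_0)
 have b1: "hom_bracket Q 1 (hom_part Q 1 (mu Q)) j (hom_part Q j \<nu>) ps = pb.dif M j (?\<nu> j) ps" if "set ps \<subseteq> nz" for j ps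
  unfolding h1 unfolding hom_part_ext hom_bracket_def insertion_ext[OF BC_part[OF B] that] insertion_ext[OF BC_M that] pb.dif_def by simp
 show ?thesis
 proof (rule HOL.ext)
  fix xs :: "('v, 'e) qvec list"
  show "hoch_diff Q \<nu> xs = ext (\<lambda>ps. pb.dif M 0 (?\<nu> 0) ps + pb.dif M 1 (?\<nu> 1) ps) xs"
  proof (cases "set xs \<subseteq> G")
   case True
   then have k: "\<forall>x\<in>set xs. keys x \<subseteq> nz" by (auto simp: Gtl_def)
   have m0: "mlin (hom_bracket Q 0 (hom_part Q 0 (mu Q)) j (hom_part Q j \<nu>)) xs = 0" for j
   proof -
    have "mlin (hom_bracket Q 0 (hom_part Q 0 (mu Q)) j (hom_part Q j \<nu>)) xs = mlin (\<lambda>ps. 0) xs"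
     by (rule mlin_cong[OF b0 k])
    then show ?thesis by simp
   qed
   have m1: "mlin (hom_bracket Q 1 (hom_part Q 1 (mu Q)) j (hom_part Q j \<nu>)) xs = mlin (pb.dif M j (?\<nu> j)) xs" for j
    by (rule mlin_cong[OF b1 k])
   have "hoch_diff Q \<nu> xs = mlin (pb.dif M 0 (?\<nu> 0)) xs + mlin (pb.dif M 1 (?\<nu> 1)) xs"
    unfolding hoch_diff_def bracket_def if_P[OF True] by (simp add: m0 m1 del: One_nat_def)
   then show ?thesis using True by (simp add: ext_def mlin_fun_add)
  next
   case False
   then show ?thesis by (simp add: hoch_diff_def bracket_def ext_def)
  qed
 qed
qed

lemma ext_fun_add: "ext (\<lambda>ps. f ps + g ps) xs = ext f xs + ext g xs"
 by (simp add: ext_def mlin_fun_add)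

lemma ext_fun_smul: "ext (\<lambda>ps. smul c (f ps)) xs = smul c (ext f xs)"
 by (simp add: ext_def mlin_fun_smul)

lemma insertion_add_right:
 assumes "\<And>xs. a xs \<in> G" "\<And>xs. b xs \<in> G"
 shows "insertion Q (ext f) j (\<lambda>xs. a xs + b xs) ps = insertion Q (ext f) j a ps + insertion Q (ext f) j b ps"
 unfolding insertion_def Let_def ext_add_slot[OF assms] smul_add_right sum.distrib ..

lemma insertion_add_left:
 "insertion Q (\<lambda>xs. a xs + b xs) j \<kappa> ps = insertion Q a j \<kappa> ps + insertion Q b j \<kappa> ps"
 unfolding insertion_def Let_def smul_add_right sum.distrib ..

lemma hoch_diff_add:
 assumes "\<nu> \<in> CC Q" "\<nu>' \<in> CC Q"
 shows "hoch_diff Q (\<lambda>xs. \<nu> xs + \<nu>' xs) xs = hoch_diff Q \<nu> xs + hoch_diff Q \<nu>' xs"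
proof -
 have h: "hom_part Q j (\<lambda>xs. \<nu> xs + \<nu>' xs) = (\<lambda>xs. hom_part Q j \<nu> xs + hom_part Q j \<nu>' xs)" for j
 proof -
  have "ev (\<lambda>xs. \<nu> xs + \<nu>' xs) = (\<lambda>ps. ev \<nu> ps + ev \<nu>' ps)" by (intro HOL.ext) (simp only: ev_def)
  then have "pb.part j (ev (\<lambda>xs. \<nu> xs + \<nu>' xs)) = (\<lambda>ps. pb.part j (ev \<nu>) ps + pb.part j (ev \<nu>') ps)"
   by (intro HOL.ext) (simp only: pb.part_fun_add)
  then show ?thesis unfolding hom_part_ext by (intro HOL.ext) (simp only: ext_fun_add)
 qed
 have G: "hom_part Q j \<kappa> xs \<in> G" if \<kappa>: "\<kappa> \<in> CC Q" for j \<kappa> xs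
  unfolding hom_part_ext
 proof (rule ext_G)
  fix ps
  have "ev \<kappa> ps \<in> G" unfolding ev_def by (rule CC_G[OF \<kappa>])
  then have "keys (ev \<kappa> ps) \<subseteq> nz" by (simp add: Gtl_def)
  moreover have "keys (pb.part j (ev \<kappa>) ps) \<subseteq> keys (ev \<kappa> ps)"
  proof
   fix q assume "q \<in> keys (pb.part j (ev \<kappa>) ps)"
   then have "lookup (pb.part j (ev \<kappa>) ps) q \<noteq> 0" by (simp add: in_keys_iff)
   then have "lookup (ev \<kappa> ps) q \<noteq> 0" unfolding pb.lookup_part by presburger
   then show "q \<in> keys (ev \<kappa> ps)" by (simp add: in_keys_iff)
  qed
  ultimately show "keys (pb.part j (ev \<kappa>) ps) \<subseteq> nz" by blast
 qed
 have i: "insertion Q (hom_part Q k (mu Q)) j (\<lambda>xs. hom_part Q j \<nu> xs + hom_part Q j \<nu>' xs) ps =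
  insertion Q (hom_part Q k (mu Q)) j (hom_part Q j \<nu>) ps + insertion Q (hom_part Q k (mu Q)) j (hom_part Q j \<nu>') ps" for k j ps
  unfolding hom_part_ext[of k "mu Q"] by (rule insertion_add_right) (rule G[OF assms(1)], rule G[OF assms(2)])
 have b: "hom_bracket Q k (hom_part Q k (mu Q)) j (hom_part Q j (\<lambda>xs. \<nu> xs + \<nu>' xs)) =
  (\<lambda>ps. hom_bracket Q k (hom_part Q k (mu Q)) j (hom_part Q j \<nu>) ps + hom_bracket Q k (hom_part Q k (mu Q)) j (hom_part Q j \<nu>') ps)" for k j
  unfolding hom_bracket_def h i insertion_add_left smul_add_right by (intro HOL.ext) (simp add: algebra_simps)
 show ?thesis unfolding hoch_diff_def bracket_def b mlin_fun_add sum.distrib by simp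
qed

lemma CC_add:
 assumes a: "\<nu> \<in> CC Q" and b: "\<nu>' \<in> CC Q"
 shows "(\<lambda>xs. \<nu> xs + \<nu>' xs) \<in> CC Q"
 unfolding CC_def mem_Collect_eq
 by (intro conjI allI impI ballI; (elim conjE)?)
  (simp_all only: CC_D(1)[OF a] CC_D(1)[OF b] CC_G[OF a] CC_G[OF b] Gtl_add CC_D(3-7)[OF a] CC_D(3-7)[OF b] CC_D(8)[OF a] CC_D(8)[OF b]
   smul_add_right gmul_add_right gmul_add_left add_0_left add.assoc add.commute add.left_commute simp_thms not_False_eq_True add_0_right)

lemma BC_add:
 assumes f: "BC f" and g: "BC g"
 shows "BC (\<lambda>w. f w + g w)"
proof -
 have k: "chain w \<and> w \<noteq> [] \<and> par w q" if "q \<in> keys (f w + g w)" for w q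
 proof -
  have "q \<in> keys (f w) \<or> q \<in> keys (g w)" using that keys_add[of "f w" "g w"] by blast
  then show ?thesis
  proof
   assume "q \<in> keys (f w)" then show ?thesis by (rule BC_key[OF f])
  next
   assume "q \<in> keys (g w)" then show ?thesis by (rule BC_key[OF g])
  qed
 qed
 then show ?thesis by (rule BC_I)
qed

lemma BC_smul: "BC f \<Longrightarrow> BC (\<lambda>w. smul c (f w))"
 unfolding BC_def using keys_smul_subset by (metis (no_types, lifting) smul_eq_0 subset_iff)

text \<open>
 The even and the odd part of a cocycle are cocycles, because their differentials have different parity.  The
 factor \<open>c\<close> serves to get a primitive of \<open>- \<nu>\<close> too.
\<close>

theorem closed_exact:
 assumes \<nu>: "\<nu> \<in> CC Q" and d: "hoch_diff Q \<nu> = (\<lambda>xs. 0)" and 0: "\<nu> [] = 0" and 1: "\<And>x. \<nu> [x] = 0"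
 shows "\<exists>\<epsilon>\<in>CC Q. hoch_diff Q \<epsilon> = (\<lambda>xs. smul c (\<nu> xs))"
proof -
 have B: "BC (ev \<nu>)" by (rule BC_ev[OF \<nu> 0])
 define n0 where "n0 = pb.part 0 (ev \<nu>)"
 define n1 where "n1 = pb.part 1 (ev \<nu>)"
 have B0: "BC n0" and B1: "BC n1" unfolding n0_def n1_def by (rule BC_part[OF B])+
 have h: "pb.homog 0 n0" "pb.homog 1 n1" unfolding n0_def n1_def by (rule pb.homog_part)+
 have n: "n0 ps + n1 ps = ev \<nu> ps" for ps using pb.part_add[of 0 "ev \<nu>" ps] by (simp add: n0_def n1_def)
 have D: "pb.dif M 0 n0 ps + pb.dif M 1 n1 ps = 0" for ps
 proof (cases "set ps \<subseteq> nz")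
  case True
  have "ext (\<lambda>ps. pb.dif M 0 n0 ps + pb.dif M 1 n1 ps) (map bvec ps) = 0"
   using d unfolding hoch_diff_eq[OF B] n0_def n1_def by metis
  then show ?thesis using True by (simp add: ext_bvec)
 next
  case False
  then have "\<not> chain ps" by (auto simp: chain_def)
  then have "pb.dif M 0 n0 ps = 0" "pb.dif M 1 n1 ps = 0"
   using BC_dif[OF B0, of 0] BC_dif[OF B1, of 1] unfolding BC_def by blast+
  then show ?thesis by simp
 qed
 have hd: "pb.homog (0 + 1) (pb.dif M 0 n0)" "pb.homog (1 + 1) (pb.dif M 1 n1)"
  by (rule pb.homog_dif[OF homog_M h(1)], rule pb.homog_dif[OF homog_M h(2)])
 have s: "lookup (pb.dif M 0 n0 ps) q + lookup (pb.dif M 1 n1 ps) q = 0" for ps q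
  using arg_cong[OF D[of ps], of "\<lambda>x. lookup x q"] by (simp add: lookup_add)
 have D0: "pb.dif M 0 n0 ps = 0" for ps
 proof (rule poly_mapping_eqI)
  fix q show "lookup (pb.dif M 0 n0 ps) q = lookup 0 q"
  proof (cases "odd (pdeg q - pb.wdeg ps - (0 + 1))")
   case True
   then show ?thesis using pb.homogD[OF hd(1) True] by simp
  next
   case False
   then have "odd (pdeg q - pb.wdeg ps - (1 + 1))" by simp
   then show ?thesis using pb.homogD[OF hd(2), of q ps] s[of ps q] by simp
  qed
 qed
 then have D1: "pb.dif M 1 n1 ps = 0" for ps using D[of ps] by simp
 have short: "n0 w = 0" "n1 w = 0" if "length w \<le> 1" for w
 proof -
  have "ev \<nu> w = 0" using that 0 1 by (cases w) (simp_all add: ev_def)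
  then show "n0 w = 0" "n1 w = 0" by (simp_all add: n0_def n1_def pb.part_def)
 qed
 have "\<exists>E. BC E \<and> pb.homog 1 E \<and> (\<forall>w. pb.dif M 1 E w = n0 w)"
 proof (rule basis_acyclic[OF B0])
  show "pb.homog (1 + 1) n0" by (rule pb.homog_parity[OF _ h(1)]) simp
  show "pb.dif M (1 + 1) n0 w = 0" for w using pb.dif_parity[of "1 + 1" 0 M n0 w] D0 by simp
 qed (rule short(1))
 then obtain E1 where E1: "BC E1" "pb.homog 1 E1" "\<And>w. pb.dif M 1 E1 w = n0 w" by blast
 have "\<exists>E. BC E \<and> pb.homog 0 E \<and> (\<forall>w. pb.dif M 0 E w = n1 w)"
 proof (rule basis_acyclic[OF B1])
  show "pb.homog (0 + 1) n1" using h by simp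
  show "pb.dif M (0 + 1) n1 w = 0" for w using D1 by simp
 qed (rule short(2))
 then obtain E0 where E0: "BC E0" "pb.homog 0 E0" "\<And>w. pb.dif M 0 E0 w = n1 w" by blast
 define E where "E w = smul c (E0 w + E1 w)" for w
 have BE: "BC E" unfolding E_def by (rule BC_smul[OF BC_add[OF E0(1) E1(1)]])
 have pE: "pb.part j E = (\<lambda>w. smul c (pb.part j E0 w + pb.part j E1 w))" for j
  unfolding E_def by (rule HOL.ext) (simp only: pb.part_fun_smul pb.part_fun_add)
 have p: "pb.part 0 E = (\<lambda>w. smul c (E0 w))" "pb.part 1 E = (\<lambda>w. smul c (E1 w))"
  unfolding pE pb.part_homog[OF E0(2)] pb.part_homog[OF E1(2)]
  using pb.part_homog_0[OF E0(2), of 1] pb.part_homog_0[OF E1(2), of 0] by simp_all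
 have e: "ev (ext E) = E" by (rule ev_ext[OF BE])
 have "hoch_diff Q (ext E) = ext (\<lambda>ps. smul c (ev \<nu> ps))"
 proof -
  have "hoch_diff Q (ext E) = ext (\<lambda>ps. smul c (n1 ps) + smul c (n0 ps))"
   using hoch_diff_eq[of "ext E"] BE unfolding e p pb.dif_smul E0(3) E1(3) by simp
  also have "(\<lambda>ps. smul c (n1 ps) + smul c (n0 ps)) = (\<lambda>ps. smul c (ev \<nu> ps))"
   unfolding smul_add_right[symmetric] by (intro HOL.ext) (simp only: n[symmetric] add.commute)
  finally show ?thesis .
 qed
 also have "\<dots> = (\<lambda>xs. smul c (\<nu> xs))"
  by (rule HOL.ext) (simp only: ext_fun_smul CC_ext[OF \<nu>, symmetric])
 finally show ?thesis using ext_in_CC[OF BE] by blast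
qed

text \<open>
 The classes are cosets, and both \<open>\<nu>\<close> and \<open>- \<nu>\<close> are differentials of cochains.
\<close>

theorem HH_class_zero:
 assumes \<nu>: "\<nu> \<in> CC Q" "hoch_diff Q \<nu> = (\<lambda>xs. 0)" "\<nu> [] = 0" "\<And>x. \<nu> [x] = 0"
 shows "HH_class Q \<nu> = HH_class Q (\<lambda>xs. 0)"
proof (intro equalityI subsetI)
 fix \<kappa> assume "\<kappa> \<in> HH_class Q \<nu>"
 then obtain \<epsilon> where \<epsilon>: "\<epsilon> \<in> CC Q" "\<kappa> = (\<lambda>xs. \<nu> xs + hoch_diff Q \<epsilon> xs)" by (auto simp: HH_class_def)
 obtain \<delta> where \<delta>: "\<delta> \<in> CC Q" "hoch_diff Q \<delta> = (\<lambda>xs. smul 1 (\<nu> xs))" using closed_exact[OF \<nu>] by blast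
 have "\<kappa> = (\<lambda>xs. 0 + hoch_diff Q (\<lambda>xs. \<delta> xs + \<epsilon> xs) xs)"
  unfolding hoch_diff_add[OF \<delta>(1) \<epsilon>(1)] \<delta>(2) \<epsilon>(2) by simp
 then show "\<kappa> \<in> HH_class Q (\<lambda>xs. 0)" unfolding HH_class_def using CC_add[OF \<delta>(1) \<epsilon>(1)] by blast
next
 fix \<kappa> assume "\<kappa> \<in> HH_class Q (\<lambda>xs. 0)"
 then obtain \<epsilon> where \<epsilon>: "\<epsilon> \<in> CC Q" "\<kappa> = (\<lambda>xs. 0 + hoch_diff Q \<epsilon> xs)" by (auto simp: HH_class_def)
 obtain \<delta> where \<delta>: "\<delta> \<in> CC Q" "hoch_diff Q \<delta> = (\<lambda>xs. smul (- 1) (\<nu> xs))" using closed_exact[OF \<nu>] by blast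
 have "\<kappa> = (\<lambda>xs. \<nu> xs + hoch_diff Q (\<lambda>xs. \<delta> xs + \<epsilon> xs) xs)"
  unfolding hoch_diff_add[OF \<delta>(1) \<epsilon>(1)] \<delta>(2) \<epsilon>(2) by (simp add: smul_minus_left)
 then show "\<kappa> \<in> HH_class Q \<nu>" unfolding HH_class_def using CC_add[OF \<delta>(1) \<epsilon>(1)] by blast
qed

end

section \<open>The quiver of an arc collection\<close>

text \<open>
 The combinatorial data of the surface quiver: the next and the previous corner of a polygon, and the number of its sides.
\<close>

definition snx :: "('s set \<Rightarrow> 's polygon) \<Rightarrow> 's set \<times> nat \<Rightarrow> 's set \<times> nat" where
 "snx P = (\<lambda>(F, i). (F, Suc i mod poly_sides (P F)))"
definition spv :: "('s set \<Rightarrow> 's polygon) \<Rightarrow> 's set \<times> nat \<Rightarrow> 's set \<times> nat" where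
 "spv P = (\<lambda>(F, i). (F, (i + poly_sides (P F) - 1) mod poly_sides (P F)))"
definition sper :: "('s set \<Rightarrow> 's polygon) \<Rightarrow> 's set \<times> nat \<Rightarrow> nat" where
 "sper P = (\<lambda>(F, i). poly_sides (P F))"

lemma mod_pred: "i < k \<Longrightarrow> (i + k - Suc 0) mod k = (if i = 0 then k - Suc 0 else i - Suc 0)"
proof (cases i)
 case (Suc j)
 assume "i < k"
 then show ?thesis using Suc by (simp add: mod_if)
qed simp

lemma funpow_snx: "j < poly_sides (P F) \<Longrightarrow> (snx P ^^ n) (F, j) = (F, (j + n) mod poly_sides (P F))"
 by (induction n) (simp_all add: snx_def mod_Suc_eq)

text \<open>
 An arrow \<open>(F, i)\<close> starts at side \<open>i\<close> of the polygon \<open>F\<close> and ends at side \<open>i - 1\<close>, so composable arrows, together with the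
 arrow that precedes the second one in its face, give several sides on the same arc; \<open>at_most_two_sides\<close>
 then yields the gentle condition.  The degree of a corner is even iff the direction of the arcs changes with respect to the polygon
 there, and the number of changes around a polygon is even.
\<close>

lemma surface_gentle_quiver:
 fixes S :: "'s::t2_space set"
 assumes ms: "marked_surface S At M" and ac: "arc_collection S M A" and sp: "splits_surface S At A P" and nmd: "NMD S A P"
 shows "gentle_quiver (surface_quiver S A P) (snx P) (spv P) (sper P) snd"
proof -
 let ?Q = "surface_quiver S A P"
 let ?Ar = "q_arrows ?Q"
 let ?k = "\<lambda>F. poly_sides (P F)"
 let ?cmp = "\<lambda>a b. a \<in> ?Ar \<and> b \<in> ?Ar \<and> q_tail ?Q a = q_head ?Q b"
 have Ar: "(F, i) \<in> ?Ar \<longleftrightarrow> F \<in> faces S A \<and> i < ?k F" for F i by (simp add: surface_quiver_def)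
 have k3: "3 \<le> ?k F" if "F \<in> faces S A" for F using nmd that by (simp add: NMD_def)
 have head: "q_head ?Q x = q_tail ?Q (spv P x)" for x
  by (cases x) (simp add: surface_quiver_def spv_def prev_side_def)
 have nx_in: "snx P x \<in> ?Ar" and pv_in: "spv P x \<in> ?Ar" and pv_nx: "spv P (snx P x) = x" and nx_pv: "snx P (spv P x) = x"
  and per: "3 \<le> sper P x" "sper P (snx P x) = sper P x" if x: "x \<in> ?Ar" for x
 proof -
  obtain F i where xe: "x = (F, i)" by (cases x)
  have F: "F \<in> faces S A" "i < ?k F" using x Ar xe by auto
  show "snx P x \<in> ?Ar" "spv P x \<in> ?Ar" using F k3[OF F(1)] by (auto simp: xe snx_def spv_def Ar)
  show "spv P (snx P x) = x" "snx P (spv P x) = x"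
   using F k3[OF F(1)] by (auto simp: xe snx_def spv_def mod_pred mod_Suc)
  show "3 \<le> sper P x" "sper P (snx P x) = sper P x" using F k3[OF F(1)] by (auto simp: xe snx_def sper_def)
 qed
 have two: False
  if s: "x \<in> ?Ar" "y \<in> ?Ar" "z \<in> ?Ar" "q_tail ?Q x = a" "q_tail ?Q y = a" "q_tail ?Q z = a" "x \<noteq> y" "x \<noteq> z" "y \<noteq> z" for x y z a
 proof -
  define t where "t j = (if j = 0 then x else if j = 1 then y else z)" for j :: nat
  show False
  proof (rule at_most_two_sides[OF ms ac sp, where F = "\<lambda>j. fst (t j)" and n = "\<lambda>j. snd (t j)" and a = a])
   fix j :: nat
   have t: "t j \<in> ?Ar" "q_tail ?Q (t j) = a" using s by (simp_all add: t_def)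
   then show "fst (t j) \<in> faces S A \<and> snd (t j) < ?k (fst (t j)) \<and> fst (poly_side (P (fst (t j))) (snd (t j))) = a"
    using Ar[of "fst (t j)" "snd (t j)"] by (cases "t j") (simp add: surface_quiver_def)
  next
   fix i j :: nat assume ij: "i < 3" "j < 3" "i \<noteq> j" "fst (t i) = fst (t j)"
   have "i = 0 \<or> i = 1 \<or> i = 2" "j = 0 \<or> j = 1 \<or> j = 2" using ij by linarith+
   then have "t i \<noteq> t j" using ij(3) s(7-9) by (auto simp: t_def)
   then show "snd (t i) \<noteq> snd (t j)" using ij(4) by (simp add: prod_eq_iff)
  qed
 qed
 have fs: "face_structure ?Ar (snx P) (spv P) (sper P) ?cmp"
 proof
  fix x assume x: "x \<in> ?Ar"
  show "snx P x \<in> ?Ar" "spv P x \<in> ?Ar" "spv P (snx P x) = x" "snx P (spv P x) = x" "3 \<le> sper P x" "sper P (snx P x) = sper P x"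
   using nx_in pv_in pv_nx nx_pv per x by blast+
  show "?cmp x (snx P x)" using x nx_in[OF x] head[of "snx P x"] pv_nx[OF x] by simp
  fix i
  obtain F j where xe: "x = (F, j)" by (cases x)
  have F: "j < ?k F" using x Ar xe by auto
  have "(j + i) mod ?k F = j \<longleftrightarrow> ?k F dvd i"
   using mod_eq_dvd_iff_nat[of j "j + i" "?k F"] F by auto
  then show "(snx P ^^ i) x = x \<longleftrightarrow> sper P x dvd i" using funpow_snx[of j P F i] F by (simp add: xe sper_def)
 next
  fix a b b' assume h: "?cmp a b" "b \<noteq> snx P a" "?cmp a b'" "b' \<noteq> snx P a"
  show "b = b'"
  proof (rule ccontr)
   assume "b \<noteq> b'"
   have A: "a \<in> ?Ar" "b \<in> ?Ar" "b' \<in> ?Ar" using h by blast+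
   have n: "snx P (spv P b) = b" "snx P (spv P b') = b'" using nx_pv A by blast+
   have t: "q_tail ?Q (spv P b) = q_tail ?Q a" "q_tail ?Q (spv P b') = q_tail ?Q a"
    using h(1,3) head[of b] head[of b'] by presburger+
   have ne: "a \<noteq> spv P b" "a \<noteq> spv P b'" "spv P b \<noteq> spv P b'"
    using n h(2,4) \<open>b \<noteq> b'\<close> by force+
   show False by (rule two[OF A(1) pv_in[OF A(2)] pv_in[OF A(3)] refl t ne])
  qed
 next
  fix a a' b assume h: "?cmp a b" "b \<noteq> snx P a" "?cmp a' b" "b \<noteq> snx P a'"
  show "a = a'"
  proof (rule ccontr)
   assume "a \<noteq> a'"
   have A: "a \<in> ?Ar" "a' \<in> ?Ar" "b \<in> ?Ar" using h by blast+
   have n: "snx P (spv P b) = b" using nx_pv A by blast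
   have t: "q_tail ?Q a' = q_tail ?Q a" "q_tail ?Q (spv P b) = q_tail ?Q a"
    using h(1,3) head[of b] by presburger+
   have ne: "a \<noteq> spv P b" "a' \<noteq> spv P b" using n h(2,4) by force+
   show False by (rule two[OF A(1,2) pv_in[OF A(3)] refl t \<open>a \<noteq> a'\<close> ne])
  qed
 qed auto
 have fw: "face_structure.fw (snx P) (sper P) (F, j) = map (\<lambda>i. (F, (j + i) mod ?k F)) [0..<?k F]" if "j < ?k F" for F j
  unfolding face_structure.fw_def[OF fs] using funpow_snx[of j P F] that by (simp add: sper_def)
 have par: "even ((\<Sum>y\<leftarrow>face_structure.fw (snx P) (sper P) x. q_deg ?Q y) - int (sper P x))" if x: "x \<in> ?Ar" for x
 proof -
  obtain F j where xe: "x = (F, j)" by (cases x)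
  have F: "j < ?k F" using x Ar xe by auto
  define e where "e m = (of_bool (snd (prev_side (P F) (m mod ?k F))) :: int)" for m
  have step: "even (q_deg ?Q (F, m mod ?k F) - 1 - (e (Suc m) - e m))" for m
  proof -
   have k0: "Suc m mod ?k F < ?k F" "m mod ?k F < ?k F" using F by simp_all
   have "(Suc m mod ?k F + ?k F - Suc 0) mod ?k F = m mod ?k F"
    unfolding mod_pred[OF k0(1)] using k0 by (auto simp: mod_Suc split: if_splits)
   then have "prev_side (P F) (Suc m mod ?k F) = poly_side (P F) (m mod ?k F)" unfolding prev_side_def One_nat_def by simp
   then have 1: "e (Suc m) = of_bool (snd (poly_side (P F) (m mod ?k F)))" unfolding e_def by simp
   have 2: "q_deg ?Q (F, m mod ?k F) = (if snd (poly_side (P F) (m mod ?k F)) \<noteq> snd (prev_side (P F) (m mod ?k F)) then 0 else 1)"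
    by (simp add: surface_quiver_def)
   show ?thesis unfolding 1 2 unfolding e_def
    by (cases "snd (poly_side (P F) (m mod ?k F))"; cases "snd (prev_side (P F) (m mod ?k F))") simp_all
  qed
  define c where "c i = q_deg ?Q (F, i mod ?k F)" for i
  have gen: "even ((\<Sum>i\<leftarrow>[0..<n]. c (j + i)) - int n - (e (j + n) - e j))" for n
  proof (induction n)
   case (Suc n)
   have s: "even (c (j + n) - 1 - (e (Suc (j + n)) - e (j + n)))" using step[of "j + n"] unfolding c_def .
   have "(\<Sum>i\<leftarrow>[0..<n]. c (j + i)) - int n - (e (j + n) - e j) + (c (j + n) - 1 - (e (Suc (j + n)) - e (j + n)))
    = (\<Sum>i\<leftarrow>[0..<Suc n]. c (j + i)) - int (Suc n) - (e (j + Suc n) - e j)"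
    by simp
   then show ?case using dvd_add[OF Suc s] by (simp only:)
  qed simp
  have ej: "e (j + ?k F) = e j" by (simp add: e_def)
  have ev: "even ((\<Sum>i\<leftarrow>[0..<?k F]. q_deg ?Q (F, (j + i) mod ?k F)) - int (?k F))"
   using gen[of "?k F"] unfolding ej diff_self diff_0_right c_def .
  have s: "(\<Sum>y\<leftarrow>face_structure.fw (snx P) (sper P) x. q_deg ?Q y) = (\<Sum>i\<leftarrow>[0..<?k F]. q_deg ?Q (F, (j + i) mod ?k F))"
   unfolding xe fw[OF F] map_map o_def ..
  have p: "sper P x = ?k F" by (simp add: xe sper_def)
  show ?thesis unfolding s p by (rule ev)
 qed
 have gs: "graded_face_structure ?Ar (snx P) (spv P) (sper P) ?cmp (q_deg ?Q)"
  by (intro graded_face_structure.intro[OF fs] graded_face_structure_axioms.intro par)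
 have words: "q_face_words ?Q = {map (Pair F) [0..<?k F] | F. F \<in> faces S A}" by (simp add: surface_quiver_def)
 have sides: "fst (poly_side (P F) i) \<in> A" if "F \<in> faces S A" "i < ?k F" for F i
  using polygon_face_side(1)[of At A F "P F" i "fst (poly_side (P F) i)" "snd (poly_side (P F) i)"] sp that by (simp add: splits_surface_def)
 have tail: "q_tail ?Q x \<in> q_verts ?Q" if "x \<in> ?Ar" for x
  using that sides by (cases x) (simp add: surface_quiver_def)
 show ?thesis
 proof (intro gentle_quiver.intro[OF gs] gentle_quiver_axioms.intro)
  fix x assume x: "x \<in> ?Ar"
  obtain F j where xe: "x = (F, j)" by (cases x)
  have F: "F \<in> faces S A" "j < ?k F" using x Ar xe by auto
  show "q_tail ?Q x \<in> q_verts ?Q" using tail x .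
  show "q_head ?Q x \<in> q_verts ?Q" unfolding head using tail pv_in x by blast
  have "face_structure.fw (snx P) (sper P) x = rotate j (map (Pair F) [0..<?k F])"
   unfolding xe fw[OF F(2)] by (rule nth_equalityI) (auto simp: nth_rotate)
  then show "\<exists>w\<in>q_face_words ?Q. \<exists>i. face_structure.fw (snx P) (sper P) x = rotate i w" using F words by blast
  show "snd (snx P x) = (if Suc (snd x) = sper P x then 0 else Suc (snd x))"
   using F by (simp add: xe snx_def sper_def mod_Suc)
 next
  fix w assume "w \<in> q_face_words ?Q"
  then obtain F where F: "F \<in> faces S A" "w = map (Pair F) [0..<?k F]" using words by blast
  then have "(F, 0) \<in> ?Ar" "0 < ?k F" using k3[OF F(1)] by (auto simp: Ar)
  moreover from this have "face_structure.fw (snx P) (sper P) (F, 0) = w" unfolding F(2) by (subst fw) auto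
  ultimately show "\<exists>x\<in>?Ar. w = face_structure.fw (snx P) (sper P) x" by blast
 next
  fix a b
  show "consecutive ?Q a b \<longleftrightarrow> a \<in> ?Ar \<and> b = snx P a"
  proof
   assume "consecutive ?Q a b"
   then obtain F i where "F \<in> faces S A" "i < ?k F" "a = (F, i)" "b = (F, Suc i mod ?k F)"
    unfolding consecutive_def words by auto
   then show "a \<in> ?Ar \<and> b = snx P a" by (simp add: Ar snx_def)
  next
   assume h: "a \<in> ?Ar \<and> b = snx P a"
   obtain F i where ae: "a = (F, i)" by (cases a)
   then have F: "F \<in> faces S A" "i < ?k F" "b = (F, Suc i mod ?k F)" using h Ar by (auto simp: snx_def)
   then show "consecutive ?Q a b"
    unfolding consecutive_def words ae by (intro bexI[of _ "map (Pair F) [0..<?k F]"] exI[of _ i]) auto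
  qed
 qed
qed

theorem theorem3p11:
 fixes S M :: "'s::t2_space set"
  and At :: "('s set \<times> ('s \<Rightarrow> complex)) set"
  and A :: "(real \<Rightarrow> 's) set"
  and P :: "'s set \<Rightarrow> 's polygon"
  and \<nu> :: "(real \<Rightarrow> 's, 's set \<times> nat) cochain"
 assumes "marked_surface S At M"
  and "arc_collection S M A"
  and "splits_surface S At A P"
  and "NMD S A P"
  and "\<nu> \<in> CC (surface_quiver S A P)"
  and "hoch_diff (surface_quiver S A P) \<nu> = (\<lambda>xs. 0)"
  and "\<nu> [] = 0"
  and "\<And>x. \<nu> [x] = 0"
 shows "HH_class (surface_quiver S A P) \<nu> = HH_class (surface_quiver S A P) (\<lambda>xs. 0)"
proof -
 interpret gentle_quiver "surface_quiver S A P" "snx P" "spv P" "sper P" snd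
  by (rule surface_gentle_quiver) fact+
 show ?thesis by (rule HH_class_zero) fact+
qed

end
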